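(* Let $T\colon R^{p,0}_\omega\to R^{p,0}_\omega$ be a bounded linear operator. For every $\epsilon>0$ there exists $\lambda_0$ in the convex hull of $\mathcal D(T)$ such that $T$ is an orthogonal factor of $\lambda_0I\colon R^{p,0}_\omega\to R^{p,0}_\omega$ with error $\epsilon$, where $I$ is the identity on $R^{p,0}_\omega$.
   Context: Fix $1<p<\infty$, $q=p/(p-1)$, $p^*=\max\{p,q\}$. All $L_r$ spaces are over $[0,1]$ with Lebesgue measure and $\langle g,f\rangle=\int_0^1gf$. A dyadic interval is $[(i-1)2^{-n},i2^{-n})$, $n\ge0$, $1\le i\le2^n$; $\mathcal D^n$ is the set of those of length $2^{-n}$ and $\mathcal D_n=\bigcup_{k=0}^n\mathcal D^k$. For a dyadic interval $I$, $I^+,I^-$ are its left and right halves and $h_I=\chi_{I^+}-\chi_{I^-}$. For each $n\in\mathbb N$ a family $(h^n_I)_{I\in\mathcal D_{n-1}}$ in $L_p$ is fixed with the same joint distribution as $(h_I)_{I\in\mathcal D_{n-1}}$, such that the $\sigma$-algebras $\sigma(h^n_I:I\in\mathcal D_{n-1})$, $n\in\mathbb N$, are independent. Let $\mathcal D_\omega=\{(n,I):n\in\mathbb N,I\in\mathcal D_{n-1}\}$. $R^{p,0}_\omega$ is the closed linear span of $\{h^n_I:(n,I)\in\mathcal D_\omega\}$ in $L_p$ (a distributional copy of the mean-zero hyperplane of the Bourgain–Rosenthal–Schechtman space $R^p_\omega$); $(h^n_I)$ is an unconditional basis of it. For an operator $T$ on $R^{p,0}_\omega$, $\mathcal D(T)=\{|I|^{-1}\langle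 h^n_I,Th^n_I\rangle:(n,I)\in\mathcal D_\omega\}$. Orthogonal factors: an orthogonal projection $P$ on $L_2(\Omega)$ (probability space $\Omega$) is $p$-$C$-bounded if $\|Pf\|_p\le C\|f\|_p$ for $f\in L_2\cap L_p$; a subspace $X\subseteq L_p(\Omega)$ is $C$-orthogonally complemented if it is the $\|\cdot\|_p$-closure of $P(L_2\cap L_p)$ for such a $P$, and $P_X$ denotes the extension of $P|_{L_2\cap L_p}$ to $L_p(\Omega)$. $R^{p,0}_\omega$ is $C$-orthogonally complemented in $L_p$ for some $C$. A distributional embedding $j\colon Y\to X$ is a linear map with $j(y)$ and $y$ equidistributed for all $y$; distributional images of $C$-orthogonally complemented spaces are $C$-orthogonally complemented. $T\colon X\to X$ is an orthogonal factor of $S\colon Y\to Y$ with error $\epsilon$ if there is a distributional embedding $j\colon Y\to X$ with $\|j^{-1}P_{j(Y)}Tj-S\|<\epsilon$. *)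

theory Defs
  imports "HOL-Analysis.Analysis" "HOL-Probability.Probability"
begin

definition M01 :: "real measure" where
  "M01 = lebesgue_on {0..1}"

definition eqae :: "(real \<Rightarrow> real) \<Rightarrow> (real \<Rightarrow> real) \<Rightarrow> bool" where
  "eqae f g \<longleftrightarrow> (AE x in M01. f x = g x)"

definition Lp :: "real \<Rightarrow> (real \<Rightarrow> real) set" where
  "Lp p = {f. f \<in> borel_measurable M01 \<and> integrable M01 (\<lambda>x. \<bar>f x\<bar> powr p)}"

definition lpnorm :: "real \<Rightarrow> (real \<Rightarrow> real) \<Rightarrow> real" where
  "lpnorm p f = (LINT x|M01. \<bar>f x\<bar> powr p) powr (1 / p)"

definition pair :: "(real \<Rightarrow> real) \<Rightarrow> (real \<Rightarrow> real) \<Rightarrow> real" where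
  "pair g f = (LINT x|M01. g x * f x)"

text \<open>Closure of a set of functions in the L_p norm (automatically saturated under a.e. equality).\<close>
definition lp_closure :: "real \<Rightarrow> (real \<Rightarrow> real) set \<Rightarrow> (real \<Rightarrow> real) set" where
  "lp_closure p S = {f \<in> Lp p. \<forall>e>0. \<exists>g\<in>S. lpnorm p (\<lambda>x. f x - g x) < e}"

definition lin_on :: "(real \<Rightarrow> real) set \<Rightarrow> ((real \<Rightarrow> real) \<Rightarrow> (real \<Rightarrow> real)) \<Rightarrow> bool" where
  "lin_on S F \<longleftrightarrow> (\<forall>f\<in>S. \<forall>g\<in>S. \<forall>a b::real.
      eqae (F (\<lambda>x. a * f x + b * g x)) (\<lambda>x. a * F f x + b * F g x))"

text \<open>The dyadic interval indexed by (k,i), i < 2^k, is [i 2^-k, (i+1) 2^-k).\<close>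
definition dyadic :: "nat \<Rightarrow> (nat \<times> nat) set" where
  "dyadic n = {(k, i). k \<le> n \<and> i < 2 ^ k}"

definition haar :: "nat \<times> nat \<Rightarrow> real \<Rightarrow> real" where
  "haar I x = (let k = fst I; i = snd I in
     indicator {real i / 2 ^ k ..< (real i + 1/2) / 2 ^ k} x
   - indicator {(real i + 1/2) / 2 ^ k ..< (real i + 1) / 2 ^ k} x)"

definition Domega :: "(nat \<times> (nat \<times> nat)) set" where
  "Domega = {(n, I). n \<ge> 1 \<and> I \<in> dyadic (n - 1)}"

definition admissible_family :: "(nat \<Rightarrow> nat \<times> nat \<Rightarrow> real \<Rightarrow> real) \<Rightarrow> bool" where
  "admissible_family h \<longleftrightarrow>
     prob_space.indep_vars M01 (\<lambda>n. PiM (dyadic (n - 1)) (\<lambda>_. borel))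
        (\<lambda>n x. \<lambda>I\<in>dyadic (n - 1). h n I x) {1..}
   \<and> (\<forall>n\<ge>1. distr M01 (PiM (dyadic (n - 1)) (\<lambda>_. borel)) (\<lambda>x. \<lambda>I\<in>dyadic (n - 1). h n I x)
            = distr M01 (PiM (dyadic (n - 1)) (\<lambda>_. borel)) (\<lambda>x. \<lambda>I\<in>dyadic (n - 1). haar I x))"

definition Rspace :: "real \<Rightarrow> (nat \<Rightarrow> nat \<times> nat \<Rightarrow> real \<Rightarrow> real) \<Rightarrow> (real \<Rightarrow> real) set" where
  "Rspace p h = lp_closure p
     {(\<lambda>x. \<Sum>\<iota>\<in>F. c \<iota> * h (fst \<iota>) (snd \<iota>) x) | F c. finite F \<and> F \<subseteq> Domega}"

definition bounded_op_on :: "real \<Rightarrow> (real \<Rightarrow> real) set \<Rightarrow> ((real \<Rightarrow> real) \<Rightarrow> (real \<Rightarrow> real)) \<Rightarrow> bool" where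
  "bounded_op_on p X T \<longleftrightarrow> (\<forall>f\<in>X. T f \<in> X) \<and> lin_on X T
     \<and> (\<exists>C. \<forall>f\<in>X. lpnorm p (T f) \<le> C * lpnorm p f)"

text \<open>D(T) = { |I|^{-1} <h^n_I, T h^n_I> : (n,I) \<in> D_omega }, with |I| = 2^{-k}.\<close>
definition diag_set :: "(nat \<Rightarrow> nat \<times> nat \<Rightarrow> real \<Rightarrow> real) \<Rightarrow> ((real \<Rightarrow> real) \<Rightarrow> (real \<Rightarrow> real)) \<Rightarrow> real set" where
  "diag_set h T = {2 ^ fst I * pair (h n I) (T (h n I)) | n I. (n, I) \<in> Domega}"

definition orth_proj :: "((real \<Rightarrow> real) \<Rightarrow> (real \<Rightarrow> real)) \<Rightarrow> bool" where
  "orth_proj P \<longleftrightarrow> (\<forall>f\<in>Lp 2. P f \<in> Lp 2)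
     \<and> (\<forall>f\<in>Lp 2. \<forall>g\<in>Lp 2. eqae f g \<longrightarrow> eqae (P f) (P g))
     \<and> lin_on (Lp 2) P
     \<and> (\<forall>f\<in>Lp 2. eqae (P (P f)) (P f))
     \<and> (\<forall>f\<in>Lp 2. \<forall>g\<in>Lp 2. pair (P f) g = pair f (P g))"

definition p_C_bounded :: "real \<Rightarrow> real \<Rightarrow> ((real \<Rightarrow> real) \<Rightarrow> (real \<Rightarrow> real)) \<Rightarrow> bool" where
  "p_C_bounded p C P \<longleftrightarrow>
     (\<forall>f\<in>Lp 2 \<inter> Lp p. P f \<in> Lp p \<and> lpnorm p (P f) \<le> C * lpnorm p f)"

definition lp_extension :: "real \<Rightarrow> ((real \<Rightarrow> real) \<Rightarrow> (real \<Rightarrow> real)) \<Rightarrow> ((real \<Rightarrow> real) \<Rightarrow> (real \<Rightarrow> real)) \<Rightarrow> bool" where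
  "lp_extension p P Q \<longleftrightarrow> (\<forall>f\<in>Lp p. Q f \<in> Lp p) \<and> lin_on (Lp p) Q
     \<and> (\<exists>K. \<forall>f\<in>Lp p. lpnorm p (Q f) \<le> K * lpnorm p f)
     \<and> (\<forall>f\<in>Lp 2 \<inter> Lp p. eqae (Q f) (P f))"

definition dist_embedding :: "(real \<Rightarrow> real) set \<Rightarrow> (real \<Rightarrow> real) set \<Rightarrow> ((real \<Rightarrow> real) \<Rightarrow> (real \<Rightarrow> real)) \<Rightarrow> bool" where
  "dist_embedding Y X j \<longleftrightarrow> (\<forall>y\<in>Y. j y \<in> X) \<and> lin_on Y j
     \<and> (\<forall>y\<in>Y. distr M01 borel (j y) = distr M01 borel y)"

text \<open>T : X \<rightarrow> X is an orthogonal factor of S : Y \<rightarrow> Y with error \<epsilon>: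
  there is a distributional embedding j with j(Y) = closure of P(L_2 \<inter> L_p) for a
  p-C-bounded orthogonal projection P (P_{j(Y)} = its extension Q), and
  \<parallel>j^{-1} Q T j - S\<parallel> < \<epsilon>.\<close>
definition orth_factor :: "real \<Rightarrow> (real \<Rightarrow> real) set \<Rightarrow> (real \<Rightarrow> real) set
    \<Rightarrow> ((real \<Rightarrow> real) \<Rightarrow> (real \<Rightarrow> real)) \<Rightarrow> ((real \<Rightarrow> real) \<Rightarrow> (real \<Rightarrow> real)) \<Rightarrow> real \<Rightarrow> bool" where
  "orth_factor p X Y T S \<epsilon> \<longleftrightarrow>
    (\<exists>j P Q C c. dist_embedding Y X j \<and> orth_proj P \<and> p_C_bounded p C P
       \<and> {f \<in> Lp p. \<exists>y\<in>Y. eqae f (j y)} = lp_closure p (P ` (Lp 2 \<inter> Lp p))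
       \<and> lp_extension p P Q \<and> c < \<epsilon>
       \<and> (\<forall>y\<in>Y. \<exists>z\<in>Y. eqae (j z) (Q (T (j y)))
                      \<and> lpnorm p (\<lambda>x. z x - S y x) \<le> c * lpnorm p y))"

end

theory Submission
  imports Defs
begin

text \<open>
  Up to null sets, the functions \<open>h n I\<close> are the Haar functions of a variable \<open>U n\<close> that is uniform on
  \<open>2 ^ n\<close> atoms, and the \<open>U n\<close> are independent. The orthogonal projection onto the closed span sends \<open>f\<close>
  to the sum over \<open>n\<close> of the centred conditional expectations given \<open>U n\<close>. It is bounded in \<open>L_p\<close>: for
  \<open>p \<ge> 2\<close> by Rosenthal's inequality, where the sum of the \<open>p\<close>-th moments is controlled by duality and the
  von Bahr--Esseen inequality, and for \<open>p < 2\<close> by duality.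

  Inside a late copy \<open>U N\<close> one finds, by choosing random signs level by level as in the Gamlen--Gaudet
  construction, a block Haar system on which the matrix of \<open>T\<close> is almost diagonal with almost constant
  diagonal, the constant being an average of diagonal entries of \<open>T\<close> over one level. The constants have
  a cluster point \<open>\<mu>\<close>, and entries between different copies are small since bounded independent
  sequences are weakly null. Choosing the copies inductively, the matrix of \<open>T\<close> with respect to the
  block systems differs from \<open>\<mu>\<close> times the identity by entries so small that the difference is
  absolutely summable, and no unconditionality is needed.
\<close>

section \<open>The spaces \<open>L_p\<close> on the unit interval\<close>

text \<open>Three choices shape the argument. The diagonal of a block system must be constant, while
  the diagonal entries of T may vary within a level. Pigeonholing the level averages gives as many
  levels as needed with nearly one common average, and the signs are kept almost orthogonal to all
  diagonal functions in play, so that every block sees this one average. Next, \<mu> has to be fixed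
  before any copy is selected: copy n has its own size and tolerance, but all copies share \<mu>. A
  block system with many atoms contains the coarser ones, so a cluster point along growing sizes
  serves every n. It is only a limit of points of the convex hull, and \<open>lam0\<close> is a
  nearby point of the hull. Finally, the tolerance 64^-n: copy n has fewer than 2^n Haar functions,
  with normalising weights below 2^n, so entries of size 8^-(n+n') leave a factor 2^-n in each
  index, and the error is summed pointwise. Operators act on functions, and their identities hold
  almost everywhere only; hence the care with \<open>eqae\<close> in every passage to a
  limit.\<close>

interpretation M01: prob_space M01
proof
  show "emeasure M01 (space M01) = 1"
    by (simp add: M01_def emeasure_restrict_space space_restrict_space)
qed

lemma powr_add_le_real:
  fixes x y r :: real
  assumes "0 \<le> x" "0 \<le> y" "0 \<le> r"
  shows "(x + y) powr r \<le> 2 powr r * (x powr r + y powr r)"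
proof -
  have "(x + y) powr r \<le> (2 * max x y) powr r"
    using assms by (intro powr_mono2) auto
  also have "\<dots> = 2 powr r * (max x y) powr r"
    using assms by (simp add: powr_mult)
  also have "\<dots> \<le> 2 powr r * (x powr r + y powr r)"
    by (intro mult_left_mono) (auto simp: max_def)
  finally show ?thesis .
qed

lemma LpD [dest]:
  assumes "f \<in> Lp p"
  shows "f \<in> borel_measurable M01" "integrable M01 (\<lambda>x. \<bar>f x\<bar> powr p)"
  using assms by (auto simp: Lp_def)

lemma Lp_lincomb:
  assumes "0 < p" "f \<in> Lp p" "g \<in> Lp p"
  shows "(\<lambda>x. a * f x + b * g x) \<in> Lp p"
proof -
  note [measurable] = LpD(1)[OF assms(2)] LpD(1)[OF assms(3)]
  have i: "integrable M01 (\<lambda>x. 2 powr p * (\<bar>a\<bar> powr p * \<bar>f x\<bar> powr p + \<bar>b\<bar> powr p * \<bar>g x\<bar> powr p))"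
    using LpD(2)[OF assms(2)] LpD(2)[OF assms(3)] by auto
  have "integrable M01 (\<lambda>x. \<bar>a * f x + b * g x\<bar> powr p)"
  proof (rule Bochner_Integration.integrable_bound[OF i])
    show "AE x in M01. norm (\<bar>a * f x + b * g x\<bar> powr p)
        \<le> norm (2 powr p * (\<bar>a\<bar> powr p * \<bar>f x\<bar> powr p + \<bar>b\<bar> powr p * \<bar>g x\<bar> powr p))"
    proof (intro AE_I2)
      fix x
      have "\<bar>a * f x + b * g x\<bar> powr p \<le> (\<bar>a * f x\<bar> + \<bar>b * g x\<bar>) powr p"
        using assms by (intro powr_mono2) auto
      also have "\<dots> \<le> 2 powr p * (\<bar>a * f x\<bar> powr p + \<bar>b * g x\<bar> powr p)"
        using assms by (intro powr_add_le_real) auto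
      finally show "norm (\<bar>a * f x + b * g x\<bar> powr p)
        \<le> norm (2 powr p * (\<bar>a\<bar> powr p * \<bar>f x\<bar> powr p + \<bar>b\<bar> powr p * \<bar>g x\<bar> powr p))"
        by (simp add: abs_mult powr_mult)
    qed
  qed auto
  then show ?thesis by (auto simp: Lp_def)
qed

lemma Lp_zero: "0 < p \<Longrightarrow> (\<lambda>x. 0) \<in> Lp p"
  by (auto simp: Lp_def)

lemma Lp_add: "0 < p \<Longrightarrow> f \<in> Lp p \<Longrightarrow> g \<in> Lp p \<Longrightarrow> (\<lambda>x. f x + g x) \<in> Lp p"
  using Lp_lincomb[of p f g 1 1] by simp

lemma Lp_diff: "0 < p \<Longrightarrow> f \<in> Lp p \<Longrightarrow> g \<in> Lp p \<Longrightarrow> (\<lambda>x. f x - g x) \<in> Lp p"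
  using Lp_lincomb[of p f g 1 "-1"] by simp

lemma Lp_cmult: "0 < p \<Longrightarrow> f \<in> Lp p \<Longrightarrow> (\<lambda>x. c * f x) \<in> Lp p"
  using Lp_lincomb[of p f f c 0] by simp

lemma Lp_bounded:
  assumes "f \<in> borel_measurable M01" "\<And>x. \<bar>f x\<bar> \<le> B" "0 < p"
  shows "f \<in> Lp p"
proof -
  note [measurable] = assms(1)
  have "integrable M01 (\<lambda>x. \<bar>f x\<bar> powr p)"
    by (rule M01.integrable_const_bound[where B = "B powr p"])
      (use assms in \<open>auto intro!: powr_mono2 AE_I2\<close>)
  then show ?thesis by (auto simp: Lp_def)
qed

lemma tendsto_0_le:
  fixes u v :: "nat \<Rightarrow> real"
  assumes "v \<longlonglongrightarrow> 0" "\<And>n. 0 \<le> u n" "\<And>n. u n \<le> v n"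
  shows "u \<longlonglongrightarrow> 0"
  by (rule tendsto_sandwich[of "\<lambda>_. 0" u _ v]) (use assms in auto)

lemma lpnorm_nonneg [simp]: "0 \<le> lpnorm p f"
  by (simp add: lpnorm_def)

lemma lpnorm_powr:
  assumes "0 < p"
  shows "lpnorm p f powr p = (LINT x|M01. \<bar>f x\<bar> powr p)"
  using assms by (simp add: lpnorm_def powr_powr)

lemma lpnorm_le_iff:
  assumes "0 < p" "0 \<le> a"
  shows "lpnorm p f \<le> a \<longleftrightarrow> (LINT x|M01. \<bar>f x\<bar> powr p) \<le> a powr p"
  unfolding lpnorm_powr[OF assms(1), symmetric]
  using assms powr_mono2[of p "lpnorm p f" a] powr_less_mono2[of p a "lpnorm p f"] lpnorm_nonneg[of p f]
  by linarith

lemma lpnorm_less_powr: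
  assumes "0 < p" "lpnorm p f < a"
  shows "(LINT x|M01. \<bar>f x / a\<bar> powr p) \<le> 1"
proof -
  have a: "0 < a" using assms(2) lpnorm_nonneg[of p f] by linarith
  have "(LINT x|M01. \<bar>f x / a\<bar> powr p) = (LINT x|M01. \<bar>f x\<bar> powr p) / a powr p"
    using a by (simp add: abs_divide powr_divide)
  also have "\<dots> \<le> 1"
    using lpnorm_le_iff[OF assms(1), of a f] a assms by (simp add: divide_le_eq)
  finally show ?thesis .
qed

lemma Lp_cdivide: "0 < p \<Longrightarrow> f \<in> Lp p \<Longrightarrow> (\<lambda>x. f x / c) \<in> Lp p"
  using Lp_cmult[of p f "1/c"] by simp

section \<open>Hoelder, Minkowski and comparison of exponents\<close>

lemma Holder:
  assumes "1 < p" "1 < q" "1/p + 1/q = 1" "f \<in> Lp p" "g \<in> Lp q"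
  shows "integrable M01 (\<lambda>x. f x * g x)"
    and "(LINT x|M01. \<bar>f x * g x\<bar>) \<le> lpnorm p f * lpnorm q g"
proof -
  note [measurable] = LpD(1)[OF assms(4)] LpD(1)[OF assms(5)]
  have Y: "\<bar>x * y\<bar> \<le> \<bar>x\<bar> powr p / p + \<bar>y\<bar> powr q / q" for x y
    using Youngs_inequality[of p q "\<bar>x\<bar>" "\<bar>y\<bar>"] assms by (simp add: abs_mult)
  show int: "integrable M01 (\<lambda>x. f x * g x)"
  proof (rule Bochner_Integration.integrable_bound)
    show "integrable M01 (\<lambda>x. \<bar>f x\<bar> powr p / p + \<bar>g x\<bar> powr q / q)"
      using LpD(2)[OF assms(4)] LpD(2)[OF assms(5)] by auto
    show "AE x in M01. norm (f x * g x) \<le> norm (\<bar>f x\<bar> powr p / p + \<bar>g x\<bar> powr q / q)"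
      using Y by (intro AE_I2) (smt (verit) real_norm_def)
  qed auto
  \<comment> \<open>Scaling by strict upper bounds a, b of the norms instead of the norms themselves
    avoids the case of norm 0. Letting a and b decrease to the norms gives the claim.\<close>
  have main: "(LINT x|M01. \<bar>f x * g x\<bar>) \<le> a * b" if a: "lpnorm p f < a" and b: "lpnorm q g < b" for a b
  proof -
    have pos: "0 < a" "0 < b" using a b lpnorm_nonneg[of p f] lpnorm_nonneg[of q g] by linarith+
    have fa: "(\<lambda>x. f x / a) \<in> Lp p" and gb: "(\<lambda>x. g x / b) \<in> Lp q"
      using assms by (auto intro: Lp_cdivide)
    have "(LINT x|M01. \<bar>f x * g x\<bar>) = a * b * (LINT x|M01. \<bar>(f x / a) * (g x / b)\<bar>)"
      using pos by (simp add: abs_mult)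
    also have "(LINT x|M01. \<bar>(f x / a) * (g x / b)\<bar>)
        \<le> (LINT x|M01. \<bar>f x / a\<bar> powr p / p + \<bar>g x / b\<bar> powr q / q)"
    proof (rule integral_mono)
      show "integrable M01 (\<lambda>x. \<bar>f x / a * (g x / b)\<bar>)"
        using integrable_abs[OF int] by (simp add: abs_mult)
      show "integrable M01 (\<lambda>x. \<bar>f x / a\<bar> powr p / p + \<bar>g x / b\<bar> powr q / q)"
        using LpD(2)[OF fa] LpD(2)[OF gb] by auto
    qed (rule Y)
    also have "\<dots> = (LINT x|M01. \<bar>f x / a\<bar> powr p) / p + (LINT x|M01. \<bar>g x / b\<bar> powr q) / q"
      using LpD(2)[OF fa] LpD(2)[OF gb] by simp
    also have "\<dots> \<le> 1 / p + 1 / q"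
      using lpnorm_less_powr[OF _ a] lpnorm_less_powr[OF _ b] assms
      by (intro add_mono divide_right_mono) auto
    finally show ?thesis using pos assms by simp
  qed
  show "(LINT x|M01. \<bar>f x * g x\<bar>) \<le> lpnorm p f * lpnorm q g"
  proof -
    have "((\<lambda>n. (lpnorm p f + 1 / real (Suc n)) * (lpnorm q g + 1 / real (Suc n)))
       \<longlonglongrightarrow> (lpnorm p f + 0) * (lpnorm q g + 0))"
      by (intro tendsto_intros LIMSEQ_Suc lim_1_over_n)
    moreover have "(LINT x|M01. \<bar>f x * g x\<bar>)
       \<le> (lpnorm p f + 1 / real (Suc n)) * (lpnorm q g + 1 / real (Suc n))" for n
      by (rule main) auto
    ultimately show ?thesis
      by (intro LIMSEQ_le_const[where X = "\<lambda>n. (lpnorm p f + 1 / real (Suc n)) * (lpnorm q g + 1 / real (Suc n))"]) auto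
  qed
qed

lemma pair_le_lpnorm:
  assumes "1 < p" "1 < q" "1/p + 1/q = 1" "g \<in> Lp q" "f \<in> Lp p"
  shows "\<bar>pair g f\<bar> \<le> lpnorm q g * lpnorm p f"
proof -
  have "\<bar>pair g f\<bar> \<le> (LINT x|M01. \<bar>g x * f x\<bar>)"
    unfolding pair_def by (rule integral_abs_bound)
  also have "\<dots> \<le> lpnorm q g * lpnorm p f"
    using assms by (intro Holder) auto
  finally show ?thesis .
qed

text \<open>Convexity of t^r in tangent form, without derivatives: Young's inequality for the
  product of x^(r-1) and y, with exponents r/(r-1) and r.\<close>

lemma powr_tangent:
  fixes x y r :: real
  assumes "1 \<le> r" "0 \<le> x" "0 \<le> y"
  shows "x powr r + r * x powr (r - 1) * (y - x) \<le> y powr r"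
proof (cases "r = 1 \<or> x = 0")
  case True
  then show ?thesis using assms by (auto simp: powr_def)
next
  case False
  then have r: "1 < r" and x: "0 < x" using assms by auto
  have "x powr (r - 1) * y \<le> (x powr (r - 1)) powr (r / (r - 1)) / (r / (r - 1)) + y powr r / r"
    using r assms by (intro Youngs_inequality) (auto simp: field_simps)
  also have "(x powr (r - 1)) powr (r / (r - 1)) = x powr r"
    using r by (simp add: powr_powr)
  finally have "r * (x powr (r - 1) * y) \<le> (r - 1) * x powr r + y powr r"
    using r by (simp add: field_simps)
  moreover have "x powr (r - 1) * x = x powr r"
    using x by (simp add: powr_diff)
  ultimately show ?thesis by (simp add: algebra_simps)
qed

text \<open>Tangents at the mean point m: in the weighted sum of the two tangent inequalities the
  linear terms cancel.\<close>

lemma powr_convex2: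
  fixes x y r t :: real
  assumes "1 \<le> r" "0 \<le> x" "0 \<le> y" "0 \<le> t" "t \<le> 1"
  shows "(t * x + (1 - t) * y) powr r \<le> t * x powr r + (1 - t) * y powr r"
proof -
  define m where "m = t * x + (1 - t) * y"
  have m: "0 \<le> m" using assms by (simp add: m_def)
  have "t * (m powr r + r * m powr (r - 1) * (x - m)) \<le> t * x powr r"
    using powr_tangent[OF assms(1) m assms(2)] assms by (intro mult_left_mono)
  moreover have "(1 - t) * (m powr r + r * m powr (r - 1) * (y - m)) \<le> (1 - t) * y powr r"
    using powr_tangent[OF assms(1) m assms(3)] assms by (intro mult_left_mono) auto
  moreover have "t * (m powr r + r * m powr (r - 1) * (x - m))
     + (1 - t) * (m powr r + r * m powr (r - 1) * (y - m))
     = m powr r + r * m powr (r - 1) * (t * x + (1 - t) * y - m)"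
    by (simp add: algebra_simps)
  ultimately show ?thesis by (simp add: m_def)
qed

lemma Minkowski:
  assumes "1 \<le> p" "f \<in> Lp p" "g \<in> Lp p"
  shows "lpnorm p (\<lambda>x. f x + g x) \<le> lpnorm p f + lpnorm p g"
proof -
  have p: "0 < p" using assms by simp
  have main: "lpnorm p (\<lambda>x. f x + g x) \<le> a + b" if a: "lpnorm p f < a" and b: "lpnorm p g < b" for a b
  proof -
    have pos: "0 < a" "0 < b" using a b lpnorm_nonneg[of p f] lpnorm_nonneg[of p g] by linarith+
    have fa: "(\<lambda>x. f x / a) \<in> Lp p" and gb: "(\<lambda>x. g x / b) \<in> Lp p"
      using assms p by (auto intro: Lp_cdivide)
    \<comment> \<open>With this weight |f| + |g| is a + b times a convex combination of |f/a| and
      |g/b|, so convexity of the p-th power applies.\<close>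
    define t where "t = a / (a + b)"
    have t: "0 \<le> t" "t \<le> 1" "1 - t = b / (a + b)" using pos by (auto simp: t_def field_simps)
    have tab: "(a + b) * t = a" "(a + b) * (1 - t) = b"
      unfolding t(3) using pos by (auto simp: t_def)
    have "(LINT x|M01. \<bar>f x + g x\<bar> powr p)
       \<le> (LINT x|M01. (a + b) powr p * (t * \<bar>f x / a\<bar> powr p + (1 - t) * \<bar>g x / b\<bar> powr p))"
    proof (rule integral_mono)
      show "integrable M01 (\<lambda>x. \<bar>f x + g x\<bar> powr p)"
        using Lp_add[OF p assms(2,3)] by auto
      show "integrable M01 (\<lambda>x. (a + b) powr p * (t * \<bar>f x / a\<bar> powr p + (1 - t) * \<bar>g x / b\<bar> powr p))"
        using LpD(2)[OF fa] LpD(2)[OF gb] by auto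
      fix x
      have "\<bar>f x + g x\<bar> \<le> (a + b) * (t * \<bar>f x / a\<bar> + (1 - t) * \<bar>g x / b\<bar>)"
      proof -
        have "(a + b) * (t * \<bar>f x / a\<bar> + (1 - t) * \<bar>g x / b\<bar>)
          = ((a + b) * t) * \<bar>f x / a\<bar> + ((a + b) * (1 - t)) * \<bar>g x / b\<bar>"
          by (simp only: distrib_left mult.assoc)
        also have "\<dots> = \<bar>f x\<bar> + \<bar>g x\<bar>" unfolding tab using pos by simp
        finally show ?thesis by simp
      qed
      then have "\<bar>f x + g x\<bar> powr p \<le> ((a + b) * (t * \<bar>f x / a\<bar> + (1 - t) * \<bar>g x / b\<bar>)) powr p"
        using p by (intro powr_mono2) auto
      also have "\<dots> = (a + b) powr p * (t * \<bar>f x / a\<bar> + (1 - t) * \<bar>g x / b\<bar>) powr p"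
        by (rule powr_mult)
      also have "\<dots> \<le> (a + b) powr p * (t * \<bar>f x / a\<bar> powr p + (1 - t) * \<bar>g x / b\<bar> powr p)"
        using t assms(1) by (intro mult_left_mono powr_convex2) auto
      finally show "\<bar>f x + g x\<bar> powr p
        \<le> (a + b) powr p * (t * \<bar>f x / a\<bar> powr p + (1 - t) * \<bar>g x / b\<bar> powr p)" .
    qed
    also have "\<dots> = (a + b) powr p * (t * (LINT x|M01. \<bar>f x / a\<bar> powr p) + (1 - t) * (LINT x|M01. \<bar>g x / b\<bar> powr p))"
      using LpD(2)[OF fa] LpD(2)[OF gb] by simp
    also have "\<dots> \<le> (a + b) powr p * (t * 1 + (1 - t) * 1)"
      using lpnorm_less_powr[OF p a] lpnorm_less_powr[OF p b] t
      by (intro mult_left_mono add_mono) auto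
    finally show ?thesis
      using pos by (subst lpnorm_le_iff[OF p]) auto
  qed
  have "lpnorm p (\<lambda>x. f x + g x) \<le> lpnorm p f + lpnorm p g + e" if "0 < e" for e
    using main[of "lpnorm p f + e / 2" "lpnorm p g + e / 2"] that by simp
  then show ?thesis by (rule field_le_epsilon)
qed

lemma lpnorm_cmult: "0 < p \<Longrightarrow> lpnorm p (\<lambda>x. c * f x) = \<bar>c\<bar> * lpnorm p f"
  by (simp add: lpnorm_def abs_mult powr_mult powr_powr)

lemma lpnorm_minus_commute: "lpnorm p (\<lambda>x. f x - g x) = lpnorm p (\<lambda>x. g x - f x)"
  by (simp add: lpnorm_def abs_minus_commute)

lemma lpnorm_triangle_diff:
  assumes "1 \<le> p" "f \<in> Lp p" "g \<in> Lp p" "k \<in> Lp p"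
  shows "lpnorm p (\<lambda>x. f x - k x) \<le> lpnorm p (\<lambda>x. f x - g x) + lpnorm p (\<lambda>x. g x - k x)"
  using Minkowski[OF assms(1), of "\<lambda>x. f x - g x" "\<lambda>x. g x - k x"] assms
    Lp_diff[of p f g] Lp_diff[of p g k] by simp

lemma lpnorm_diff_le:
  assumes "1 \<le> p" "f \<in> Lp p" "g \<in> Lp p"
  shows "lpnorm p (\<lambda>x. f x - g x) \<le> lpnorm p f + lpnorm p g"
  using Minkowski[OF assms(1), of f "\<lambda>x. (-1) * g x"] Lp_cmult[of p g "-1"] lpnorm_cmult[of p "-1" g] assms
  by auto

lemma lpnorm_le_bound:
  assumes "0 < p" "\<And>x. \<bar>f x\<bar> \<le> B" "f \<in> borel_measurable M01" "0 \<le> B"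
  shows "lpnorm p f \<le> B"
proof -
  have "(LINT x|M01. \<bar>f x\<bar> powr p) \<le> (LINT x|M01. B powr p)"
    using Lp_bounded[OF assms(3,2,1)] assms by (intro integral_mono) (auto intro!: powr_mono2)
  also have "\<dots> = B powr p" by (simp add: M01.prob_space)
  finally show ?thesis using assms by (subst lpnorm_le_iff) auto
qed

text \<open>Weighted Young gives |x|^r \<le> (r/p) |x|^p + (1 - r/p). After scaling f by some a
  above its p-norm this integrates to a bound by 1, because the total mass is 1.\<close>

lemma Lp_mono_exponent:
  assumes "0 < r" "r \<le> p" "f \<in> Lp p"
  shows "f \<in> Lp r" and "lpnorm r f \<le> lpnorm p f"
proof -
  note [measurable] = LpD(1)[OF assms(3)]
  have p: "0 < p" using assms by simp
  have Y: "\<bar>x\<bar> powr r \<le> r / p * \<bar>x\<bar> powr p + (1 - r / p)" for x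
  proof (cases "x = 0")
    case False
    have "(\<bar>x\<bar> powr p) powr (r / p) * 1 powr (1 - r / p) \<le> r / p * \<bar>x\<bar> powr p + (1 - r / p) * 1"
      using assms p False by (intro Youngs_inequality_0) auto
    then show ?thesis using p by (simp add: powr_powr)
  qed (use assms p in auto)
  have int: "integrable M01 (\<lambda>x. \<bar>g x\<bar> powr r)"
    if [measurable]: "g \<in> borel_measurable M01" and "integrable M01 (\<lambda>x. \<bar>g x\<bar> powr p)" for g
  proof (rule Bochner_Integration.integrable_bound)
    show "integrable M01 (\<lambda>x. r / p * \<bar>g x\<bar> powr p + (1 - r / p))"
      using that by auto
    show "AE x in M01. norm (\<bar>g x\<bar> powr r) \<le> norm (r / p * \<bar>g x\<bar> powr p + (1 - r / p))"
      using Y by (intro AE_I2) (smt (verit) real_norm_def powr_ge_zero)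
  qed auto
  show fr: "f \<in> Lp r" using int[of f] assms(3) by (auto simp: Lp_def)
  show "lpnorm r f \<le> lpnorm p f"
  proof (rule dense_ge)
    fix a assume a: "lpnorm p f < a"
    have pos: "0 < a" using a lpnorm_nonneg[of p f] by linarith
    have fa: "(\<lambda>x. f x / a) \<in> Lp p" using Lp_cdivide[OF p assms(3)] .
    have "(LINT x|M01. \<bar>f x / a\<bar> powr r) \<le> (LINT x|M01. r / p * \<bar>f x / a\<bar> powr p + (1 - r / p))"
      using LpD[OF fa] by (intro integral_mono int Y) auto
    also have "\<dots> = r / p * (LINT x|M01. \<bar>f x / a\<bar> powr p) + (1 - r / p)"
      using LpD(2)[OF fa] by (simp add: M01.prob_space)
    also have "\<dots> \<le> r / p * 1 + (1 - r / p)"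
      using lpnorm_less_powr[OF p a] assms p by (intro add_mono mult_left_mono) auto
    finally have "(LINT x|M01. \<bar>f x\<bar> powr r) / a powr r \<le> 1"
      using pos by (simp add: abs_divide powr_divide)
    then show "lpnorm r f \<le> a"
      using pos assms by (subst lpnorm_le_iff) (auto simp: divide_le_eq)
  qed
qed

lemma lpnorm_one: "lpnorm 1 f = (LINT x|M01. \<bar>f x\<bar>)"
  by (simp add: lpnorm_def)

lemma Lp_integrable: "1 \<le> p \<Longrightarrow> f \<in> Lp p \<Longrightarrow> integrable M01 f"
  using Lp_mono_exponent(1)[of 1 p f] by (auto simp: Lp_def integrable_abs_iff)

lemma lpnorm_eq_0_iff:
  assumes "0 < p" "f \<in> Lp p"
  shows "lpnorm p f = 0 \<longleftrightarrow> eqae f (\<lambda>x. 0)"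
proof -
  have "lpnorm p f = 0 \<longleftrightarrow> (LINT x|M01. \<bar>f x\<bar> powr p) = 0"
    by (simp add: lpnorm_def)
  also have "\<dots> \<longleftrightarrow> (AE x in M01. \<bar>f x\<bar> powr p = 0)"
    using LpD(2)[OF assms(2)] by (intro integral_nonneg_eq_0_iff_AE) auto
  finally show ?thesis by (simp add: eqae_def)
qed

lemma lpnorm_eqae:
  assumes "eqae f g" "f \<in> borel_measurable M01" "g \<in> borel_measurable M01"
  shows "lpnorm p f = lpnorm p g"
proof -
  have "(LINT x|M01. \<bar>f x\<bar> powr p) = (LINT x|M01. \<bar>g x\<bar> powr p)"
    using assms by (intro integral_cong_AE) (auto simp: eqae_def)
  then show ?thesis by (simp add: lpnorm_def)
qed

lemma pair_eqae:
  assumes "eqae f g" "f \<in> borel_measurable M01" "g \<in> borel_measurable M01" "k \<in> borel_measurable M01"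
  shows "pair k f = pair k g" "pair f k = pair g k"
  using assms unfolding pair_def eqae_def by (auto intro!: integral_cong_AE)

lemma eqae_refl [simp]: "eqae f f" by (simp add: eqae_def)

lemma eqae_sym: "eqae f g \<Longrightarrow> eqae g f" by (auto simp: eqae_def)

lemma eqae_trans [trans]: "eqae f g \<Longrightarrow> eqae g k \<Longrightarrow> eqae f k" by (auto simp: eqae_def)

lemma eqae_iff_lpnorm_diff:
  assumes "0 < p" "f \<in> Lp p" "g \<in> Lp p"
  shows "eqae f g \<longleftrightarrow> lpnorm p (\<lambda>x. f x - g x) = 0"
  using lpnorm_eq_0_iff[OF assms(1) Lp_diff[OF assms]] by (simp add: eqae_def)

lemma Lp_eqae:
  assumes "eqae f g" "f \<in> Lp p" "g \<in> borel_measurable M01"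
  shows "g \<in> Lp p"
proof -
  have "integrable M01 (\<lambda>x. \<bar>f x\<bar> powr p) \<longleftrightarrow> integrable M01 (\<lambda>x. \<bar>g x\<bar> powr p)"
    using assms by (intro integrable_cong_AE) (auto simp: eqae_def)
  then show ?thesis using assms by (auto simp: Lp_def)
qed

section \<open>Convergence, completeness and limits of laws in L_p\<close>

definition lp_lim :: "real \<Rightarrow> (nat \<Rightarrow> real \<Rightarrow> real) \<Rightarrow> (real \<Rightarrow> real) \<Rightarrow> bool" where
  "lp_lim p s f \<longleftrightarrow> f \<in> Lp p \<and> (\<lambda>n. lpnorm p (\<lambda>x. s n x - f x)) \<longlonglongrightarrow> 0"

text \<open>A Cauchy sequence in L_p is Cauchy in L_1, which yields a subsequence converging almost
  everywhere. Fatou's lemma along this subsequence bounds the p-distance from s n to the pointwise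
  limit.\<close>

lemma Lp_complete:
  assumes "1 \<le> p" "\<And>n. s n \<in> Lp p"
    and cau: "\<And>e. 0 < e \<Longrightarrow> \<exists>N. \<forall>i\<ge>N. \<forall>j\<ge>N. lpnorm p (\<lambda>x. s i x - s j x) < e"
  shows "\<exists>f. lp_lim p s f"
proof -
  have p: "0 < p" using assms(1) by simp
  note [measurable] = LpD(1)[OF assms(2)]
  obtain r where r: "strict_mono r" "AE x in M01. Cauchy (\<lambda>i. s (r i) x)"
  proof (rule cauchy_L1_AE_cauchy_subseq[of M01 s])
    show "integrable M01 (s n)" for n using Lp_integrable[OF assms(1,2)] .
    fix e :: real assume "0 < e"
    then obtain N where N: "\<forall>i\<ge>N. \<forall>j\<ge>N. lpnorm p (\<lambda>x. s i x - s j x) < e" using cau by blast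
    have "(LINT x|M01. norm (s i x - s j x)) \<le> lpnorm p (\<lambda>x. s i x - s j x)" for i j
      using Lp_mono_exponent(2)[of 1 p "\<lambda>x. s i x - s j x"] assms p by (simp add: lpnorm_one Lp_diff)
    then show "\<exists>N. \<forall>i\<ge>N. \<forall>j\<ge>N. (LINT x|M01. norm (s i x - s j x)) < e"
      using N by (meson le_less_trans)
  qed
  define f where "f x = lim (\<lambda>i. s (r i) x)" for x
  have f [measurable]: "f \<in> borel_measurable M01" unfolding f_def by measurable
  have conv: "AE x in M01. (\<lambda>i. s (r i) x) \<longlonglongrightarrow> f x"
    using r(2) by eventually_elim (auto simp: f_def Cauchy_convergent_iff convergent_LIMSEQ_iff)
  have bound: "(\<integral>\<^sup>+x. ennreal (\<bar>s n x - f x\<bar> powr p) \<partial>M01) \<le> ennreal (e powr p)"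
    if "0 < e" and N: "\<And>j. N \<le> j \<Longrightarrow> lpnorm p (\<lambda>x. s n x - s j x) < e" for n N e
  proof -
    have "(\<integral>\<^sup>+x. ennreal (\<bar>s n x - f x\<bar> powr p) \<partial>M01)
        = (\<integral>\<^sup>+x. liminf (\<lambda>i. ennreal (\<bar>s n x - s (r i) x\<bar> powr p)) \<partial>M01)"
    proof (rule nn_integral_cong_AE)
      show "AE x in M01. ennreal (\<bar>s n x - f x\<bar> powr p) = liminf (\<lambda>i. ennreal (\<bar>s n x - s (r i) x\<bar> powr p))"
        using conv
      proof eventually_elim
        case (elim x)
        have "(\<lambda>i. ennreal (\<bar>s n x - s (r i) x\<bar> powr p)) \<longlonglongrightarrow> ennreal (\<bar>s n x - f x\<bar> powr p)"
          using p elim by (intro tendsto_intros tendsto_ennrealI tendsto_powr2) (auto intro!: tendsto_intros)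
        from lim_imp_Liminf[OF sequentially_bot this] show ?case by (rule sym)
      qed
    qed
    also have "\<dots> \<le> liminf (\<lambda>i. \<integral>\<^sup>+x. ennreal (\<bar>s n x - s (r i) x\<bar> powr p) \<partial>M01)"
      by (intro nn_integral_liminf) auto
    also have "\<dots> \<le> ennreal (e powr p)"
    proof (rule Liminf_le)
      show "\<forall>\<^sub>F i in sequentially. (\<integral>\<^sup>+x. ennreal (\<bar>s n x - s (r i) x\<bar> powr p) \<partial>M01) \<le> ennreal (e powr p)"
      proof (rule eventually_sequentiallyI[of N])
        fix i assume "N \<le> i"
        then have "N \<le> r i" using seq_suble[OF r(1), of i] by linarith
        then have "(LINT x|M01. \<bar>s n x - s (r i) x\<bar> powr p) \<le> e powr p"
          using N[of "r i"] lpnorm_le_iff[OF p, of e "\<lambda>x. s n x - s (r i) x"] \<open>0 < e\<close> by simp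
        moreover have "integrable M01 (\<lambda>x. \<bar>s n x - s (r i) x\<bar> powr p)"
          using Lp_diff[OF p assms(2,2)] by auto
        ultimately show "(\<integral>\<^sup>+x. ennreal (\<bar>s n x - s (r i) x\<bar> powr p) \<partial>M01) \<le> ennreal (e powr p)"
          by (subst nn_integral_eq_integral) (auto intro: ennreal_leI)
      qed
    qed auto
    finally show ?thesis .
  qed
  have diffLp: "(\<lambda>x. s n x - f x) \<in> Lp p \<and> lpnorm p (\<lambda>x. s n x - f x) \<le> e"
    if "0 < e" and N: "\<And>j. N \<le> j \<Longrightarrow> lpnorm p (\<lambda>x. s n x - s j x) < e" for n N e
  proof -
    have b: "(\<integral>\<^sup>+x. ennreal (\<bar>s n x - f x\<bar> powr p) \<partial>M01) \<le> ennreal (e powr p)"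
      by (rule bound[OF \<open>0 < e\<close> N])
    then have fin: "(\<integral>\<^sup>+x. ennreal (\<bar>s n x - f x\<bar> powr p) \<partial>M01) < \<infinity>"
      by (rule le_less_trans) simp
    then have int: "integrable M01 (\<lambda>x. \<bar>s n x - f x\<bar> powr p)"
      by (intro integrableI_nonneg) auto
    then have "ennreal (LINT x|M01. \<bar>s n x - f x\<bar> powr p) \<le> ennreal (e powr p)"
      using b by (subst (asm) nn_integral_eq_integral) auto
    then have "(LINT x|M01. \<bar>s n x - f x\<bar> powr p) \<le> e powr p" by simp
    then show ?thesis using int that(1) by (auto simp: Lp_def lpnorm_le_iff[OF p])
  qed
  obtain N1 where N1: "\<forall>i\<ge>N1. \<forall>j\<ge>N1. lpnorm p (\<lambda>x. s i x - s j x) < 1" using cau[of 1] by auto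
  have "(\<lambda>x. s N1 x - f x) \<in> Lp p" using diffLp[of 1 N1 N1] N1 by auto
  from Lp_diff[OF p assms(2)[of N1] this] have fLp: "f \<in> Lp p" by simp
  have "(\<lambda>n. lpnorm p (\<lambda>x. s n x - f x)) \<longlonglongrightarrow> 0"
  proof (rule LIMSEQ_I)
    fix e :: real assume e: "0 < e"
    obtain N where N: "\<forall>i\<ge>N. \<forall>j\<ge>N. lpnorm p (\<lambda>x. s i x - s j x) < e / 2" using cau[of "e/2"] e by auto
    have "norm (lpnorm p (\<lambda>x. s n x - f x) - 0) < e" if "N \<le> n" for n
      using diffLp[of "e/2" N n] N that e by auto
    then show "\<exists>no. \<forall>n\<ge>no. norm (lpnorm p (\<lambda>x. s n x - f x) - 0) < e" by blast
  qed
  with fLp show ?thesis by (auto simp: lp_lim_def)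
qed

lemma lp_lim_unique:
  assumes "1 \<le> p" "\<And>n. s n \<in> Lp p" "lp_lim p s f" "lp_lim p s g"
  shows "eqae f g"
proof -
  have p: "0 < p" using assms(1) by simp
  have fg: "f \<in> Lp p" "g \<in> Lp p" using assms by (auto simp: lp_lim_def)
  have "lpnorm p (\<lambda>x. f x - g x) \<le> lpnorm p (\<lambda>x. s n x - f x) + lpnorm p (\<lambda>x. s n x - g x)" for n
    using lpnorm_triangle_diff[OF assms(1) fg(1) assms(2)[of n] fg(2)] lpnorm_minus_commute[of p f "s n"] by simp
  moreover have "(\<lambda>n. lpnorm p (\<lambda>x. s n x - f x) + lpnorm p (\<lambda>x. s n x - g x)) \<longlonglongrightarrow> 0 + 0"
    using assms(3,4) unfolding lp_lim_def by (intro tendsto_add) auto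
  ultimately have "lpnorm p (\<lambda>x. f x - g x) \<le> 0"
    by (intro LIMSEQ_le_const[where X = "\<lambda>n. lpnorm p (\<lambda>x. s n x - f x) + lpnorm p (\<lambda>x. s n x - g x)"]) auto
  then have "lpnorm p (\<lambda>x. f x - g x) = 0" using lpnorm_nonneg by (intro antisym) auto
  then show ?thesis using eqae_iff_lpnorm_diff[OF p fg] by simp
qed

lemma lp_lim_lincomb:
  assumes "1 \<le> p" "\<And>n. s n \<in> Lp p" "\<And>n. t n \<in> Lp p" "lp_lim p s f" "lp_lim p t g"
  shows "lp_lim p (\<lambda>n x. a * s n x + b * t n x) (\<lambda>x. a * f x + b * g x)"
proof -
  have p: "0 < p" using assms(1) by simp
  have fg: "f \<in> Lp p" "g \<in> Lp p" using assms by (auto simp: lp_lim_def)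
  have le: "lpnorm p (\<lambda>x. (a * s n x + b * t n x) - (a * f x + b * g x))
    \<le> \<bar>a\<bar> * lpnorm p (\<lambda>x. s n x - f x) + \<bar>b\<bar> * lpnorm p (\<lambda>x. t n x - g x)" for n
  proof -
    have "lpnorm p (\<lambda>x. (a * s n x + b * t n x) - (a * f x + b * g x))
      = lpnorm p (\<lambda>x. a * (s n x - f x) + b * (t n x - g x))"
      by (simp add: algebra_simps)
    also have "\<dots> \<le> lpnorm p (\<lambda>x. a * (s n x - f x)) + lpnorm p (\<lambda>x. b * (t n x - g x))"
      using assms p fg by (intro Minkowski Lp_cmult Lp_diff) auto
    finally show ?thesis by (simp add: lpnorm_cmult[OF p])
  qed
  have "(\<lambda>n. \<bar>a\<bar> * lpnorm p (\<lambda>x. s n x - f x) + \<bar>b\<bar> * lpnorm p (\<lambda>x. t n x - g x)) \<longlonglongrightarrow> \<bar>a\<bar> * 0 + \<bar>b\<bar> * 0"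
    using assms(4,5) unfolding lp_lim_def by (intro tendsto_intros) auto
  then have "(\<lambda>n. \<bar>a\<bar> * lpnorm p (\<lambda>x. s n x - f x) + \<bar>b\<bar> * lpnorm p (\<lambda>x. t n x - g x)) \<longlonglongrightarrow> 0" by simp
  from tendsto_0_le[OF this lpnorm_nonneg le]
  have "(\<lambda>n. lpnorm p (\<lambda>x. (a * s n x + b * t n x) - (a * f x + b * g x))) \<longlonglongrightarrow> 0" .
  then show ?thesis using Lp_lincomb[OF p fg] by (simp add: lp_lim_def)
qed

lemma lp_lim_lpnorm:
  assumes "1 \<le> p" "\<And>n. s n \<in> Lp p" "lp_lim p s f"
  shows "(\<lambda>n. lpnorm p (s n)) \<longlonglongrightarrow> lpnorm p f"
proof -
  have p: "0 < p" using assms(1) by simp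
  have f: "f \<in> Lp p" using assms by (auto simp: lp_lim_def)
  have le: "\<bar>lpnorm p (s n) - lpnorm p f\<bar> \<le> lpnorm p (\<lambda>x. s n x - f x)" for n
    using lpnorm_triangle_diff[OF assms(1,2) f Lp_zero[OF p], of n]
      lpnorm_triangle_diff[OF assms(1) f assms(2) Lp_zero[OF p], of n]
      lpnorm_minus_commute[of p f "s n"] by auto
  have "(\<lambda>n. lpnorm p (\<lambda>x. s n x - f x)) \<longlonglongrightarrow> 0" using assms(3) by (simp add: lp_lim_def)
  from tendsto_0_le[OF this abs_ge_zero le]
  have "(\<lambda>n. \<bar>lpnorm p (s n) - lpnorm p f\<bar>) \<longlonglongrightarrow> 0" .
  then show ?thesis using LIM_zero_cancel tendsto_rabs_zero_iff by blast
qed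

lemma lp_lim_lpnorm_le:
  assumes "1 \<le> p" "\<And>n. s n \<in> Lp p" "lp_lim p s f" "\<And>n. lpnorm p (s n) \<le> B"
  shows "lpnorm p f \<le> B"
  using lp_lim_lpnorm[OF assms(1-3)] assms(4) by (intro LIMSEQ_le_const2) auto

lemma lp_lim_mono_exponent:
  assumes "0 < r" "r \<le> p" "\<And>n. s n \<in> Lp p" "lp_lim p s f"
  shows "lp_lim r s f"
proof -
  have f: "f \<in> Lp p" using assms by (auto simp: lp_lim_def)
  have le: "lpnorm r (\<lambda>x. s n x - f x) \<le> lpnorm p (\<lambda>x. s n x - f x)" for n
    using assms f by (intro Lp_mono_exponent(2) Lp_diff) auto
  have "(\<lambda>n. lpnorm p (\<lambda>x. s n x - f x)) \<longlonglongrightarrow> 0" using assms(4) by (simp add: lp_lim_def)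
  from tendsto_0_le[OF this lpnorm_nonneg le]
  have "(\<lambda>n. lpnorm r (\<lambda>x. s n x - f x)) \<longlonglongrightarrow> 0" .
  then show ?thesis using Lp_mono_exponent(1)[OF assms(1,2) f] by (simp add: lp_lim_def)
qed

lemma lp_lim_pair:
  assumes "1 < p" "1 < q" "1/p + 1/q = 1" "\<And>n. s n \<in> Lp p" "lp_lim p s f" "g \<in> Lp q"
  shows "(\<lambda>n. pair g (s n)) \<longlonglongrightarrow> pair g f"
proof -
  have p: "0 < p" using assms(1) by simp
  have f: "f \<in> Lp p" using assms by (auto simp: lp_lim_def)
  have le: "\<bar>pair g (s n) - pair g f\<bar> \<le> lpnorm q g * lpnorm p (\<lambda>x. s n x - f x)" for n
  proof -
    have "pair g (s n) - pair g f = pair g (\<lambda>x. s n x - f x)"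
      unfolding pair_def using Holder(1)[OF assms(2,1) _ assms(6,4), of n] Holder(1)[OF assms(2,1) _ assms(6) f] assms(3)
      by (simp add: right_diff_distrib add.commute)
    then show ?thesis using pair_le_lpnorm[OF assms(1-3,6), of "\<lambda>x. s n x - f x"] Lp_diff[OF p assms(4) f] by simp
  qed
  have "(\<lambda>n. lpnorm q g * lpnorm p (\<lambda>x. s n x - f x)) \<longlonglongrightarrow> lpnorm q g * 0"
    using assms(5) unfolding lp_lim_def by (intro tendsto_intros) auto
  then have "(\<lambda>n. lpnorm q g * lpnorm p (\<lambda>x. s n x - f x)) \<longlonglongrightarrow> 0" by simp
  from tendsto_0_le[OF this abs_ge_zero le]
  have "(\<lambda>n. \<bar>pair g (s n) - pair g f\<bar>) \<longlonglongrightarrow> 0" .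
  then show ?thesis using LIM_zero_cancel tendsto_rabs_zero_iff by blast
qed

text \<open>The characteristic function at \<tau> is |\<tau>|-Lipschitz in the L_1 distance of the
  variables, so equal laws pass to the limits by Levy uniqueness.\<close>

lemma distr_eq_of_lp_lim:
  assumes "1 \<le> p" "\<And>n. s n \<in> Lp p" "\<And>n. t n \<in> Lp p" "lp_lim p s f" "lp_lim p t g"
    and eq: "\<And>n. distr M01 borel (s n) = distr M01 borel (t n)"
  shows "distr M01 borel f = distr M01 borel g"
proof -
  have p: "0 < p" using assms(1) by simp
  have [measurable]: "f \<in> borel_measurable M01" "g \<in> borel_measurable M01"
    "\<And>n. s n \<in> borel_measurable M01" "\<And>n. t n \<in> borel_measurable M01"
    using assms by (auto simp: lp_lim_def)
  have char_conv: "(\<lambda>n. char (distr M01 borel (s n)) \<tau>) \<longlonglongrightarrow> char (distr M01 borel f) \<tau>"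
    if s: "\<And>n. s n \<in> Lp p" "lp_lim p s f" for s f \<tau>
  proof -
    have [measurable]: "f \<in> borel_measurable M01" "\<And>n. s n \<in> borel_measurable M01"
      using s by (auto simp: lp_lim_def)
    have f: "f \<in> Lp p" using s by (auto simp: lp_lim_def)
    have ii: "integrable M01 (\<lambda>x. iexp (\<tau> * k x))" if [measurable]: "k \<in> borel_measurable M01" for k
      by (rule M01.integrable_const_bound[where B = 1]) auto
    have le: "norm (char (distr M01 borel (s n)) \<tau> - char (distr M01 borel f) \<tau>) \<le> \<bar>\<tau>\<bar> * lpnorm p (\<lambda>x. s n x - f x)" for n
    proof -
      have i1: "integrable M01 (\<lambda>x. s n x - f x)"
        using Lp_integrable[OF assms(1) Lp_diff[OF p s(1) f]] .
      have "char (distr M01 borel (s n)) \<tau> - char (distr M01 borel f) \<tau>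
        = (CLINT x|M01. iexp (\<tau> * s n x) - iexp (\<tau> * f x))"
        using ii[of "s n"] ii[of f] by (simp add: char_def integral_distr)
      also have "norm \<dots> \<le> (LINT x|M01. norm (iexp (\<tau> * s n x) - iexp (\<tau> * f x)))"
        by (rule integral_norm_bound)
      also have "\<dots> \<le> (LINT x|M01. \<bar>\<tau>\<bar> * \<bar>s n x - f x\<bar>)"
      proof (rule integral_mono)
        fix x
        have "iexp (\<tau> * s n x) - iexp (\<tau> * f x) = iexp (\<tau> * f x) * (iexp (\<tau> * (s n x - f x)) - 1)"
          by (simp add: algebra_simps exp_add[symmetric] flip: exp_diff)
        then have "norm (iexp (\<tau> * s n x) - iexp (\<tau> * f x)) = norm (iexp (\<tau> * (s n x - f x)) - 1)"
          by (simp add: norm_mult)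
        also have "\<dots> \<le> \<bar>\<tau> * (s n x - f x)\<bar>"
          using iexp_approx1[of "\<tau> * (s n x - f x)" 0] by simp
        finally show "norm (iexp (\<tau> * s n x) - iexp (\<tau> * f x)) \<le> \<bar>\<tau>\<bar> * \<bar>s n x - f x\<bar>"
          by (simp add: abs_mult)
      qed (use ii[of "s n"] ii[of f] i1 in auto)
      also have "\<dots> = \<bar>\<tau>\<bar> * lpnorm 1 (\<lambda>x. s n x - f x)" by (simp add: lpnorm_one)
      also have "\<dots> \<le> \<bar>\<tau>\<bar> * lpnorm p (\<lambda>x. s n x - f x)"
        using assms(1) p s f by (intro mult_left_mono Lp_mono_exponent(2) Lp_diff) auto
      finally show ?thesis .
    qed
    have "(\<lambda>n. \<bar>\<tau>\<bar> * lpnorm p (\<lambda>x. s n x - f x)) \<longlonglongrightarrow> \<bar>\<tau>\<bar> * 0"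
      using s(2) unfolding lp_lim_def by (intro tendsto_intros) auto
    then have "(\<lambda>n. \<bar>\<tau>\<bar> * lpnorm p (\<lambda>x. s n x - f x)) \<longlonglongrightarrow> 0" by simp
    from tendsto_norm_zero_cancel[OF tendsto_0_le[OF this norm_ge_zero le]]
    have "(\<lambda>n. char (distr M01 borel (s n)) \<tau> - char (distr M01 borel f) \<tau>) \<longlonglongrightarrow> 0" .
    then show ?thesis by (rule LIM_zero_cancel)
  qed
  show ?thesis
  proof (rule Levy_uniqueness)
    show "real_distribution (distr M01 borel f)" "real_distribution (distr M01 borel g)"
      by (auto intro!: M01.real_distribution_distr)
    show "char (distr M01 borel f) = char (distr M01 borel g)"
    proof
      fix \<tau>
      show "char (distr M01 borel f) \<tau> = char (distr M01 borel g) \<tau>"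
        using char_conv[OF assms(2,4), of \<tau>] char_conv[OF assms(3,5), of \<tau>] eq
        by (auto intro: LIMSEQ_unique)
    qed
  qed
qed

section \<open>Moments of sums of independent random variables\<close>

text \<open>The signed power. For r = p - 1 it is, up to the factor p, the derivative of |x|^p, and
  it produces the norming functional of an element of L_p.\<close>

definition sgpow :: "real \<Rightarrow> real \<Rightarrow> real" where
  "sgpow r x = sgn x * \<bar>x\<bar> powr r"

lemma sgpow_measurable [measurable]: "sgpow r \<in> borel_measurable borel"
  unfolding sgpow_def[abs_def] by measurable

lemma abs_sgpow: "\<bar>sgpow r x\<bar> = \<bar>x\<bar> powr r"
  by (auto simp: sgpow_def abs_mult abs_sgn_eq)

lemma mult_sgpow: "x * sgpow r x = \<bar>x\<bar> powr (r + 1)"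
  by (cases "x < 0"; cases "x = 0") (auto simp: sgpow_def powr_add sgn_if)

lemma sgpow_tangent:
  assumes "1 \<le> p"
  shows "\<bar>x\<bar> powr p + p * sgpow (p - 1) x * (y - x) \<le> \<bar>y\<bar> powr p"
proof -
  have "sgpow (p - 1) x * (y - x) \<le> \<bar>x\<bar> powr (p - 1) * (\<bar>y\<bar> - \<bar>x\<bar>)"
  proof -
    have "sgn x * (y - x) \<le> \<bar>y\<bar> - \<bar>x\<bar>" by (auto simp: sgn_if)
    then have "\<bar>x\<bar> powr (p - 1) * (sgn x * (y - x)) \<le> \<bar>x\<bar> powr (p - 1) * (\<bar>y\<bar> - \<bar>x\<bar>)"
      by (rule mult_left_mono) simp
    then show ?thesis by (simp add: sgpow_def mult_ac)
  qed
  then have "p * (sgpow (p - 1) x * (y - x)) \<le> p * (\<bar>x\<bar> powr (p - 1) * (\<bar>y\<bar> - \<bar>x\<bar>))"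
    using assms by (intro mult_left_mono) auto
  with powr_tangent[OF assms, of "\<bar>x\<bar>" "\<bar>y\<bar>"] show ?thesis by (simp add: mult_ac)
qed

text \<open>The fractions y/x and (x - y)/x add up to 1 and lie in [0,1], where raising to a power s
  \<le> 1 does not decrease a number.\<close>

lemma powr_diff_le_small:
  fixes x y s :: real
  assumes "0 < s" "s \<le> 1" "0 \<le> y" "y \<le> x"
  shows "x powr s - y powr s \<le> (x - y) powr s"
proof (cases "x = 0 \<or> y = 0 \<or> x = y")
  case False
  then have pos: "0 < y" "0 < x - y" "0 < x" using assms by auto
  have "1 = y / x + (x - y) / x" using pos by (simp add: field_simps)
  also have "\<dots> \<le> (y / x) powr s + ((x - y) / x) powr s"
    using powr_mono'[of s 1 "y / x"] powr_mono'[of s 1 "(x - y) / x"] assms pos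
    by (intro add_mono) auto
  also have "\<dots> = (y powr s + (x - y) powr s) / x powr s"
    using pos by (simp add: powr_divide add_divide_distrib)
  finally show ?thesis using pos by (simp add: field_simps)
qed (use assms in auto)

text \<open>For equal signs this is subadditivity of the power. For opposite signs |x - y| = |x| +
  |y| dominates both terms, which is where the constant 2 is attained.\<close>

lemma sgpow_holder_small:
  assumes "0 < s" "s \<le> 1"
  shows "\<bar>sgpow s x - sgpow s y\<bar> \<le> 2 * \<bar>x - y\<bar> powr s"
proof -
  have same: "\<bar>u powr s - v powr s\<bar> \<le> 2 * \<bar>u - v\<bar> powr s" if "0 \<le> u" "0 \<le> v" for u v :: real
    using powr_diff_le_small[OF assms, of v u] powr_diff_le_small[OF assms, of u v] that
      powr_mono2[of s u v] powr_mono2[of s v u] assms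
    by (cases "u \<le> v") (auto simp: abs_if powr_ge_zero intro: order_trans)
  have opp: "u powr s + v powr s \<le> 2 * (u + v) powr s" if "0 \<le> u" "0 \<le> v" for u v :: real
    using powr_mono2[of s u "u + v"] powr_mono2[of s v "u + v"] that assms by auto
  consider "0 \<le> x" "0 \<le> y" | "x \<le> 0" "y \<le> 0" | "0 \<le> x" "y \<le> 0" | "x \<le> 0" "0 \<le> y" by linarith
  then show ?thesis
  proof cases
    case 1
    then show ?thesis using same[of x y] by (auto simp: sgpow_def sgn_if)
  next
    case 2
    then show ?thesis using same[of "-x" "-y"] by (auto simp: sgpow_def sgn_if abs_minus_commute)
  next
    case 3
    then show ?thesis using opp[of x "-y"] by (auto simp: sgpow_def sgn_if)
  next
    case 4
    then have e: "sgpow s x = - ((-x) powr s)" "sgpow s y = y powr s" "\<bar>x - y\<bar> = -x + y" "\<bar>x\<bar> = -x" "\<bar>y\<bar> = y"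
      by (auto simp: sgpow_def sgn_if)
    show ?thesis unfolding e
      using opp[of "-x" y] powr_ge_zero[of "-x" s] powr_ge_zero[of y s] 4 by linarith
  qed
qed

text \<open>For equal signs the tangent at the point of larger modulus replaces the mean value
  theorem. For opposite signs one power of each modulus is split off and |x| + |y| = |x - y| is
  used.\<close>

lemma sgpow_lipschitz_large:
  assumes "1 \<le> s"
  shows "\<bar>sgpow s x - sgpow s y\<bar> \<le> s * \<bar>x - y\<bar> * (max \<bar>x\<bar> \<bar>y\<bar>) powr (s - 1)"
proof -
  have le: "v powr s - u powr s \<le> s * (v - u) * v powr (s - 1)" if "0 \<le> u" "u \<le> v" for u v :: real
    using powr_tangent[OF assms, of v u] that by (simp add: algebra_simps)
  have same: "\<bar>u powr s - v powr s\<bar> \<le> s * \<bar>u - v\<bar> * (max u v) powr (s - 1)" if "0 \<le> u" "0 \<le> v" for u v :: real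
    using le[of u v] le[of v u] powr_mono2[of s u v] powr_mono2[of s v u] that assms
    by (cases "u \<le> v") (auto simp: max_def)
  have opp: "u powr s + v powr s \<le> s * (u + v) * (max u v) powr (s - 1)" if "0 \<le> u" "0 \<le> v" for u v :: real
  proof -
    have *: "w powr s \<le> w * (max u v) powr (s - 1)" if "w = u \<or> w = v" for w
    proof -
      have "w powr s = w * w powr (s - 1)" using that \<open>0 \<le> u\<close> \<open>0 \<le> v\<close>
        by (cases "w = 0") (auto simp: powr_diff)
      also have "\<dots> \<le> w * (max u v) powr (s - 1)"
        using that \<open>0 \<le> u\<close> \<open>0 \<le> v\<close> assms by (intro mult_left_mono powr_mono2) auto
      finally show ?thesis .
    qed
    have "u powr s + v powr s \<le> 1 * ((u + v) * (max u v) powr (s - 1))"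
      using *[of u] *[of v] by (simp add: algebra_simps)
    also have "\<dots> \<le> s * ((u + v) * (max u v) powr (s - 1))"
      using that assms by (intro mult_right_mono) auto
    finally show ?thesis by (simp add: mult_ac)
  qed
  consider "0 \<le> x" "0 \<le> y" | "x \<le> 0" "y \<le> 0" | "0 \<le> x" "y \<le> 0" | "x \<le> 0" "0 \<le> y" by linarith
  then show ?thesis
  proof cases
    case 1
    then show ?thesis using same[of x y] by (auto simp: sgpow_def sgn_if)
  next
    case 2
    then show ?thesis using same[of "-x" "-y"] by (auto simp: sgpow_def sgn_if abs_minus_commute)
  next
    case 3
    then show ?thesis using opp[of x "-y"] by (auto simp: sgpow_def sgn_if)
  next
    case 4
    then have e: "sgpow s x = - ((-x) powr s)" "sgpow s y = y powr s" "\<bar>x - y\<bar> = -x + y" "\<bar>x\<bar> = -x" "\<bar>y\<bar> = y"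
      by (auto simp: sgpow_def sgn_if)
    show ?thesis unfolding e
      using opp[of "-x" y] powr_ge_zero[of "-x" s] powr_ge_zero[of y s] 4 by linarith
  qed
qed

text \<open>The tangent is taken at a + b and evaluated at a, which bounds |a + b|^p from above.
  Replacing the slope at a + b by the slope at a costs only the Hoelder modulus of
  \<open>sgpow\<close>. The linear term stays explicit because independence and centring make its
  integral vanish.\<close>

lemma powr_expand_small:
  assumes "1 < p" "p \<le> 2"
  shows "\<bar>a + b\<bar> powr p \<le> \<bar>a\<bar> powr p + p * (sgpow (p - 1) a * b) + 2 * p * \<bar>b\<bar> powr p"
proof -
  have "\<bar>a + b\<bar> powr p \<le> \<bar>a\<bar> powr p + p * sgpow (p - 1) (a + b) * b"
    using sgpow_tangent[of p "a + b" a] assms by (simp add: algebra_simps)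
  also have "p * sgpow (p - 1) (a + b) * b
     = p * (sgpow (p - 1) a * b) + p * ((sgpow (p - 1) (a + b) - sgpow (p - 1) a) * b)"
    by (simp add: algebra_simps)
  also have "(sgpow (p - 1) (a + b) - sgpow (p - 1) a) * b \<le> \<bar>sgpow (p - 1) (a + b) - sgpow (p - 1) a\<bar> * \<bar>b\<bar>"
    by (metis abs_ge_self abs_mult)
  also have "\<dots> \<le> (2 * \<bar>b\<bar> powr (p - 1)) * \<bar>b\<bar>"
    using sgpow_holder_small[of "p - 1" "a + b" a] assms by (intro mult_right_mono) auto
  also have "\<dots> = 2 * \<bar>b\<bar> powr p"
    by (cases "b = 0") (auto simp: powr_diff)
  finally show ?thesis using assms by (simp add: mult_ac)
qed

text \<open>p (p - 1) comes from the slope p and the Lipschitz bound for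
  \<open>sgpow (p - 1)\<close>, and 2^(p-2) from splitting (|a| + |b|)^(p-2).\<close>

definition expand_const :: "real \<Rightarrow> real" where
  "expand_const p = p * (p - 1) * 2 powr (p - 2)"

text \<open>Same scheme as for p \<le> 2. The slope is now Lipschitz with a constant growing like
  the (p-2)-th power, so the remainder has a part of order b^2 and a part of order |b|^p, the two
  terms of Rosenthal's inequality.\<close>

lemma powr_expand_large:
  assumes "2 \<le> p"
  shows "\<bar>a + b\<bar> powr p \<le> \<bar>a\<bar> powr p + p * (sgpow (p - 1) a * b)
     + expand_const p * (\<bar>a\<bar> powr (p - 2) * b\<^sup>2 + \<bar>b\<bar> powr p)"
proof -
  have "\<bar>a + b\<bar> powr p \<le> \<bar>a\<bar> powr p + p * sgpow (p - 1) (a + b) * b"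
    using sgpow_tangent[of p "a + b" a] assms by (simp add: algebra_simps)
  also have "p * sgpow (p - 1) (a + b) * b
     = p * (sgpow (p - 1) a * b) + p * ((sgpow (p - 1) (a + b) - sgpow (p - 1) a) * b)"
    by (simp add: algebra_simps)
  also have "(sgpow (p - 1) (a + b) - sgpow (p - 1) a) * b \<le> \<bar>sgpow (p - 1) (a + b) - sgpow (p - 1) a\<bar> * \<bar>b\<bar>"
    by (metis abs_ge_self abs_mult)
  also have "\<dots> \<le> ((p - 1) * \<bar>b\<bar> * (max \<bar>a + b\<bar> \<bar>a\<bar>) powr (p - 2)) * \<bar>b\<bar>"
    using sgpow_lipschitz_large[of "p - 1" "a + b" a] assms by (intro mult_right_mono) auto
  also have "\<dots> = (p - 1) * b\<^sup>2 * (max \<bar>a + b\<bar> \<bar>a\<bar>) powr (p - 2)"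
    by (simp only: power2_eq_square abs_mult_self_eq[of b, symmetric] mult_ac)
  also have "\<dots> \<le> (p - 1) * b\<^sup>2 * (2 powr (p - 2) * (\<bar>a\<bar> powr (p - 2) + \<bar>b\<bar> powr (p - 2)))"
  proof (rule mult_left_mono)
    have "(max \<bar>a + b\<bar> \<bar>a\<bar>) powr (p - 2) \<le> (\<bar>a\<bar> + \<bar>b\<bar>) powr (p - 2)"
      using assms by (intro powr_mono2) auto
    also have "\<dots> \<le> 2 powr (p - 2) * (\<bar>a\<bar> powr (p - 2) + \<bar>b\<bar> powr (p - 2))"
      using assms by (intro powr_add_le_real) auto
    finally show "(max \<bar>a + b\<bar> \<bar>a\<bar>) powr (p - 2) \<le> 2 powr (p - 2) * (\<bar>a\<bar> powr (p - 2) + \<bar>b\<bar> powr (p - 2))" .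
  qed (use assms in auto)
  also have "\<dots> = (p - 1) * 2 powr (p - 2) * (\<bar>a\<bar> powr (p - 2) * b\<^sup>2 + \<bar>b\<bar> powr p)"
  proof -
    have "b\<^sup>2 * \<bar>b\<bar> powr (p - 2) = \<bar>b\<bar> powr p"
      by (cases "b = 0") (auto simp: powr_diff)
    then have "(p - 1) * 2 powr (p - 2) * (\<bar>a\<bar> powr (p - 2) * b\<^sup>2 + b\<^sup>2 * \<bar>b\<bar> powr (p - 2))
      = (p - 1) * 2 powr (p - 2) * (\<bar>a\<bar> powr (p - 2) * b\<^sup>2 + \<bar>b\<bar> powr p)" by simp
    then show ?thesis by (simp only: distrib_left mult_ac)
  qed
  finally show ?thesis using assms by (simp add: expand_const_def mult_ac)
qed

lemma integrable_bounded:
  fixes f :: "real \<Rightarrow> real"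
  assumes "f \<in> borel_measurable M01" "\<And>x. \<bar>f x\<bar> \<le> B"
  shows "integrable M01 f"
  by (rule M01.integrable_const_bound[where B = B]) (use assms in auto)

lemma indep_expectation_mult:
  assumes "M01.indep_var borel X borel S"
    and "\<And>x. \<bar>X x\<bar> \<le> BX" "\<And>x. \<bar>S x\<bar> \<le> BS"
    and [measurable]: "f \<in> borel_measurable borel" "g \<in> borel_measurable borel"
    and "\<And>t. \<bar>t\<bar> \<le> BX \<Longrightarrow> \<bar>f t\<bar> \<le> Bf" "\<And>t. \<bar>t\<bar> \<le> BS \<Longrightarrow> \<bar>g t\<bar> \<le> Bg"
  shows "(LINT x|M01. g (S x) * f (X x)) = (LINT x|M01. g (S x)) * (LINT x|M01. f (X x :: real) :: real)"
proof -
  have [measurable]: "X \<in> borel_measurable M01" "S \<in> borel_measurable M01"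
    using M01.indep_var_rv1[OF assms(1)] M01.indep_var_rv2[OF assms(1)] by auto
  have "M01.indep_var borel (f \<circ> X) borel (g \<circ> S)"
    by (rule M01.indep_var_compose[OF assms(1)]) auto
  moreover have "integrable M01 (f \<circ> X)" "integrable M01 (g \<circ> S)"
    using integrable_bounded[of "f \<circ> X" Bf] integrable_bounded[of "g \<circ> S" Bg] assms by auto
  ultimately show ?thesis
    using M01.indep_var_lebesgue_integral[of "f \<circ> X" "g \<circ> S"] by (simp add: comp_def mult.commute)
qed

text \<open>The bounds \<open>b\<close> serve integrability; the moment estimates below do not
  contain them. All variables to which the locale is applied are functions of finitely many
  values.\<close>

locale indep_centered =
  fixes X :: "nat \<Rightarrow> real \<Rightarrow> real" and F :: "nat set" and b :: "nat \<Rightarrow> real"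
  assumes fin: "finite F"
    and indep: "M01.indep_vars (\<lambda>_. borel) X F"
    and bdd: "\<And>i x. i \<in> F \<Longrightarrow> \<bar>X i x\<bar> \<le> b i"
    and centered: "\<And>i. i \<in> F \<Longrightarrow> (LINT x|M01. X i x) = 0"
begin

lemma meas: "i \<in> F \<Longrightarrow> X i \<in> borel_measurable M01"
  using indep by (auto simp: M01.indep_vars_def)

lemma meas_sum: "G \<subseteq> F \<Longrightarrow> (\<lambda>x. \<Sum>i\<in>G. X i x) \<in> borel_measurable M01"
  by (intro borel_measurable_sum meas) auto

lemma bdd_sum: "G \<subseteq> F \<Longrightarrow> \<bar>\<Sum>i\<in>G. X i x\<bar> \<le> (\<Sum>i\<in>G. b i)"
  by (rule order_trans[OF sum_abs sum_mono]) (use bdd in auto)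

lemma indep_step:
  assumes "i \<in> F" "G \<subseteq> F" "i \<notin> G"
  shows "M01.indep_var borel (X i) borel (\<lambda>x. \<Sum>i\<in>G. X i x)"
proof (rule M01.indep_vars_sum)
  show "finite G" using assms fin finite_subset by blast
  show "M01.indep_vars (\<lambda>_. borel) X (insert i G)"
    by (rule M01.indep_vars_subset[OF indep]) (use assms in auto)
qed (use assms in auto)

lemma cross_zero:
  assumes "i \<in> F" "G \<subseteq> F" "i \<notin> G" "g \<in> borel_measurable borel"
    "\<And>t. \<bar>t\<bar> \<le> (\<Sum>i\<in>G. b i) \<Longrightarrow> \<bar>g t\<bar> \<le> B"
  shows "(LINT x|M01. g (\<Sum>i\<in>G. X i x) * X i x) = 0"
  using indep_expectation_mult[OF indep_step[OF assms(1-3)] bdd[OF assms(1)] bdd_sum[OF assms(2)],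
      of "\<lambda>t. t" g "b i" B] assms centered[OF assms(1)] by auto

lemma powr_bdd: "i \<in> F \<Longrightarrow> 0 \<le> r \<Longrightarrow> integrable M01 (\<lambda>x. \<bar>X i x\<bar> powr r)"
  using meas[of i] bdd[of i]
  by (intro integrable_bounded[where B = "b i powr r"]) (auto intro!: powr_mono2)

lemma powr_sum_bdd: "G \<subseteq> F \<Longrightarrow> 0 \<le> r \<Longrightarrow> integrable M01 (\<lambda>x. \<bar>\<Sum>i\<in>G. X i x\<bar> powr r)"
  using meas_sum[of G] bdd_sum[of G]
  by (intro integrable_bounded[where B = "(\<Sum>i\<in>G. b i) powr r"]) (auto intro!: powr_mono2)

lemma sgpow_cross:
  assumes "i \<in> F" "G \<subseteq> F" "i \<notin> G" "0 \<le> r"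
  shows "(LINT x|M01. sgpow r (\<Sum>i\<in>G. X i x) * X i x) = 0"
    and "integrable M01 (\<lambda>x. sgpow r (\<Sum>i\<in>G. X i x) * X i x)"
proof -
  have B: "\<bar>sgpow r t\<bar> \<le> (\<Sum>i\<in>G. b i) powr r" if "\<bar>t\<bar> \<le> (\<Sum>i\<in>G. b i)" for t
    using that assms by (simp add: abs_sgpow powr_mono2)
  show "(LINT x|M01. sgpow r (\<Sum>i\<in>G. X i x) * X i x) = 0"
    using assms B by (intro cross_zero[where B = "(\<Sum>i\<in>G. b i) powr r"]) auto
  note [measurable] = meas[OF assms(1)] meas_sum[OF assms(2)]
  have "\<bar>sgpow r (\<Sum>i\<in>G. X i x) * X i x\<bar> \<le> (\<Sum>i\<in>G. b i) powr r * b i" for x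
    unfolding abs_mult using B[OF bdd_sum[OF assms(2)]] bdd[OF assms(1)]
    by (intro mult_mono) auto
  then show "integrable M01 (\<lambda>x. sgpow r (\<Sum>i\<in>G. X i x) * X i x)"
    by (intro integrable_bounded) auto
qed

text \<open>One term is added at a time. The linear term of \<open>powr_expand_small\<close>
  integrates to 0, since the new term is centred and independent of the previous sum; 2 p is the
  coefficient of the remainder.\<close>

lemma von_Bahr_Esseen:
  assumes p: "1 < p" "p \<le> 2" and "G \<subseteq> F"
  shows "(LINT x|M01. \<bar>\<Sum>i\<in>G. X i x\<bar> powr p) \<le> 2 * p * (\<Sum>i\<in>G. LINT x|M01. \<bar>X i x\<bar> powr p)"
proof -
  have "finite G" using assms fin finite_subset by blast
  then show ?thesis using \<open>G \<subseteq> F\<close>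
  proof (induction G)
    case (insert i G)
    then have i: "i \<in> F" "G \<subseteq> F" "i \<notin> G" by auto
    let ?S = "\<lambda>x. \<Sum>i\<in>G. X i x"
    have "(LINT x|M01. \<bar>\<Sum>i\<in>insert i G. X i x\<bar> powr p) = (LINT x|M01. \<bar>?S x + X i x\<bar> powr p)"
      using insert by (simp add: add.commute)
    also have "\<dots> \<le> (LINT x|M01. \<bar>?S x\<bar> powr p + p * (sgpow (p - 1) (?S x) * X i x) + 2 * p * \<bar>X i x\<bar> powr p)"
    proof (rule integral_mono)
      show "integrable M01 (\<lambda>x. \<bar>?S x + X i x\<bar> powr p)"
        using powr_sum_bdd[of "insert i G" p] i p insert by (simp add: add.commute)
      show "integrable M01 (\<lambda>x. \<bar>?S x\<bar> powr p + p * (sgpow (p - 1) (?S x) * X i x) + 2 * p * \<bar>X i x\<bar> powr p)"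
        using powr_sum_bdd[of G p] powr_bdd[of i p] sgpow_cross(2)[OF i, of "p - 1"] i p by auto
    qed (rule powr_expand_small[OF p])
    also have "\<dots> = (LINT x|M01. \<bar>?S x\<bar> powr p) + 2 * p * (LINT x|M01. \<bar>X i x\<bar> powr p)"
      using powr_sum_bdd[of G p] powr_bdd[of i p] sgpow_cross[OF i, of "p - 1"] i p by simp
    finally show ?case using insert i p by (simp add: algebra_simps)
  qed simp
qed

text \<open>Jensen's inequality in disguise: the tangent at the old sum has a linear term with
  integral 0.\<close>

lemma sum_powr_mono:
  assumes p: "1 \<le> p" and i: "i \<in> F" "G \<subseteq> F" "i \<notin> G"
  shows "(LINT x|M01. \<bar>\<Sum>i\<in>G. X i x\<bar> powr p) \<le> (LINT x|M01. \<bar>\<Sum>i\<in>insert i G. X i x\<bar> powr p)"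
proof -
  let ?S = "\<lambda>x. \<Sum>i\<in>G. X i x"
  have fG: "finite G" using assms fin finite_subset by blast
  have "(LINT x|M01. \<bar>?S x\<bar> powr p) = (LINT x|M01. \<bar>?S x\<bar> powr p + p * (sgpow (p - 1) (?S x) * X i x))"
    using powr_sum_bdd[of G p] sgpow_cross[OF i, of "p - 1"] i p by simp
  also have "\<dots> \<le> (LINT x|M01. \<bar>?S x + X i x\<bar> powr p)"
  proof (rule integral_mono)
    show "integrable M01 (\<lambda>x. \<bar>?S x + X i x\<bar> powr p)"
      using powr_sum_bdd[of "insert i G" p] i p fG by (simp add: add.commute)
    show "integrable M01 (\<lambda>x. \<bar>?S x\<bar> powr p + p * (sgpow (p - 1) (?S x) * X i x))"
      using powr_sum_bdd[of G p] sgpow_cross(2)[OF i, of "p - 1"] i p by auto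
    show "\<bar>?S x\<bar> powr p + p * (sgpow (p - 1) (?S x) * X i x) \<le> \<bar>?S x + X i x\<bar> powr p" for x
      using sgpow_tangent[OF p, of "?S x" "?S x + X i x"] by (simp add: mult_ac)
  qed
  finally show ?thesis using i fG by (simp add: add.commute)
qed

text \<open>D is an a priori bound for the p-th moment that stays fixed during the induction. By
  \<open>sum_powr_mono\<close> it passes to all shorter sums, and comparison of exponents turns it
  into the bound D^((p-2)/p) for their moments of order p - 2, the factor in front of each
  variance.\<close>

lemma Rosenthal_aux:
  assumes p: "2 < p" and "G \<subseteq> F" "(LINT x|M01. \<bar>\<Sum>i\<in>G. X i x\<bar> powr p) \<le> D"
  shows "(LINT x|M01. \<bar>\<Sum>i\<in>G. X i x\<bar> powr p)
    \<le> expand_const p * ((\<Sum>i\<in>G. LINT x|M01. (X i x)\<^sup>2) * D powr ((p - 2) / p) + (\<Sum>i\<in>G. LINT x|M01. \<bar>X i x\<bar> powr p))"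
proof -
  have "finite G" using assms fin finite_subset by blast
  then show ?thesis using assms(2,3)
  proof (induction G)
    case (insert i G)
    then have i: "i \<in> F" "G \<subseteq> F" "i \<notin> G" by auto
    note [measurable] = meas[OF i(1)] meas_sum[OF i(2)]
    let ?S = "\<lambda>x. \<Sum>i\<in>G. X i x"
    let ?A = "LINT x|M01. \<bar>?S x\<bar> powr p"
    have C: "0 \<le> expand_const p" using p by (simp add: expand_const_def)
    have AD: "?A \<le> D" using sum_powr_mono[OF _ i, of p] p insert by linarith
    have x2: "integrable M01 (\<lambda>x. (X i x)\<^sup>2)"
      using bdd[OF i(1)] by (intro integrable_bounded[where B = "(b i)\<^sup>2"]) (auto simp: abs_le_square_iff[symmetric] intro: order_trans[OF _ abs_ge_self])
    have prod: "(LINT x|M01. \<bar>?S x\<bar> powr (p - 2) * (X i x)\<^sup>2) = (LINT x|M01. \<bar>?S x\<bar> powr (p - 2)) * (LINT x|M01. (X i x)\<^sup>2)"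
      using p bdd[OF i(1)]
      by (intro indep_expectation_mult[OF indep_step[OF i] bdd[OF i(1)] bdd_sum[OF i(2)],
          where Bf = "(b i)\<^sup>2" and Bg = "(\<Sum>i\<in>G. b i) powr (p - 2)"])
        (auto intro!: powr_mono2 simp: abs_le_square_iff[symmetric])
    have iprod: "integrable M01 (\<lambda>x. \<bar>?S x\<bar> powr (p - 2) * (X i x)\<^sup>2)"
    proof (rule integrable_bounded)
      show "\<bar>\<bar>?S x\<bar> powr (p - 2) * (X i x)\<^sup>2\<bar> \<le> (\<Sum>i\<in>G. b i) powr (p - 2) * (b i)\<^sup>2" for x
        unfolding abs_mult using bdd[OF i(1), of x] bdd_sum[OF i(2), of x] p
        by (intro mult_mono) (auto intro!: powr_mono2 simp: abs_le_square_iff[symmetric])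
    qed measurable
    have SL: "?S \<in> Lp p" using meas_sum[OF i(2)] powr_sum_bdd[OF i(2), of p] p by (simp add: Lp_def)
    have "lpnorm (p - 2) ?S powr (p - 2) \<le> lpnorm p ?S powr (p - 2)"
      using Lp_mono_exponent(2)[OF _ _ SL, of "p - 2"] p by (intro powr_mono2) auto
    also have "\<dots> = (lpnorm p ?S powr p) powr ((p - 2) / p)" using p by (simp add: powr_powr)
    also have "\<dots> \<le> D powr ((p - 2) / p)" using AD p lpnorm_powr[of p ?S] by (intro powr_mono2) auto
    finally have SD: "(LINT x|M01. \<bar>?S x\<bar> powr (p - 2)) \<le> D powr ((p - 2) / p)"
      using lpnorm_powr[of "p - 2" ?S] p by simp
    have "(LINT x|M01. \<bar>\<Sum>i\<in>insert i G. X i x\<bar> powr p) = (LINT x|M01. \<bar>?S x + X i x\<bar> powr p)"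
      using insert by (simp add: add.commute)
    also have "\<dots> \<le> (LINT x|M01. \<bar>?S x\<bar> powr p + p * (sgpow (p - 1) (?S x) * X i x)
        + expand_const p * (\<bar>?S x\<bar> powr (p - 2) * (X i x)\<^sup>2 + \<bar>X i x\<bar> powr p))"
    proof (rule integral_mono)
      show "integrable M01 (\<lambda>x. \<bar>?S x + X i x\<bar> powr p)"
        using powr_sum_bdd[of "insert i G" p] i p insert by (simp add: add.commute)
      show "integrable M01 (\<lambda>x. \<bar>?S x\<bar> powr p + p * (sgpow (p - 1) (?S x) * X i x)
        + expand_const p * (\<bar>?S x\<bar> powr (p - 2) * (X i x)\<^sup>2 + \<bar>X i x\<bar> powr p))"
        using powr_sum_bdd[of G p] powr_bdd[of i p] sgpow_cross(2)[OF i, of "p - 1"] i p iprod by auto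
    qed (rule powr_expand_large, use p in simp)
    also have "\<dots> = ?A + expand_const p * ((LINT x|M01. \<bar>?S x\<bar> powr (p - 2)) * (LINT x|M01. (X i x)\<^sup>2) + (LINT x|M01. \<bar>X i x\<bar> powr p))"
      using powr_sum_bdd[of G p] powr_bdd[of i p] sgpow_cross[OF i, of "p - 1"] i p iprod prod by simp
    also have "\<dots> \<le> ?A + expand_const p * (D powr ((p - 2) / p) * (LINT x|M01. (X i x)\<^sup>2) + (LINT x|M01. \<bar>X i x\<bar> powr p))"
      using SD C by (intro add_left_mono mult_left_mono add_right_mono mult_right_mono) auto
    finally show ?case using insert.IH[OF i(2) AD] insert.hyps by (simp add: algebra_simps)
  qed (simp add: expand_const_def)
qed

text \<open>With D equal to the moment A itself, the auxiliary bound reads A \<le> C (s A^(1-2/p) +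
  B). Either C B is at least half of A, or the other term is, and then A^(2/p) \<le> 2 C s. The p-th
  moment is finite from the start, so A may be used in its own estimate.\<close>

lemma Rosenthal:
  assumes p: "2 < p" and G: "G \<subseteq> F"
  shows "(LINT x|M01. \<bar>\<Sum>i\<in>G. X i x\<bar> powr p)
    \<le> (2 * expand_const p * (\<Sum>i\<in>G. LINT x|M01. (X i x)\<^sup>2)) powr (p / 2)
      + 2 * expand_const p * (\<Sum>i\<in>G. LINT x|M01. \<bar>X i x\<bar> powr p)"
proof -
  define A where "A = (LINT x|M01. \<bar>\<Sum>i\<in>G. X i x\<bar> powr p)"
  define s where "s = (\<Sum>i\<in>G. LINT x|M01. (X i x)\<^sup>2)"
  define B where "B = (\<Sum>i\<in>G. LINT x|M01. \<bar>X i x\<bar> powr p)"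
  have C: "0 \<le> expand_const p" using p by (simp add: expand_const_def)
  have nn: "0 \<le> A" "0 \<le> s" "0 \<le> B" by (auto simp: A_def s_def B_def intro!: sum_nonneg)
  have main: "A \<le> expand_const p * (s * A powr ((p - 2) / p) + B)"
    using Rosenthal_aux[OF p G, of A] by (simp add: A_def s_def B_def)
  have "A \<le> (2 * expand_const p * s) powr (p / 2) + 2 * expand_const p * B"
  proof (cases "A \<le> 2 * expand_const p * B")
    case True
    then show ?thesis using powr_ge_zero[of "2 * expand_const p * s" "p / 2"] by linarith
  next
    case False
    then have Apos: "0 < A" using C nn by (smt (verit) mult_nonneg_nonneg)
    have "A < 2 * (expand_const p * s * A powr ((p - 2) / p))"
      using main False by (simp add: algebra_simps)
    also have "A powr ((p - 2) / p) = A / A powr (2 / p)"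
      using Apos p by (simp add: diff_divide_distrib powr_diff)
    finally have "A powr (2 / p) \<le> 2 * expand_const p * s"
      using Apos by (simp add: field_simps)
    then have "(A powr (2 / p)) powr (p / 2) \<le> (2 * expand_const p * s) powr (p / 2)"
      using p by (intro powr_mono2) auto
    then show ?thesis using Apos p C nn by (simp add: powr_powr add_increasing2)
  qed
  then show ?thesis by (simp add: A_def s_def B_def)
qed

end

section \<open>Discrete Haar functions and random signs\<close>

text \<open>The Haar function of the dyadic interval \<open>I\<close> on the \<open>2 ^ N\<close> atoms of level \<open>N\<close>; meaningful for \<open>fst I < N\<close>.\<close>
definition dhaar :: "nat \<Rightarrow> nat \<times> nat \<Rightarrow> nat \<Rightarrow> real" where
  "dhaar N I u = (if u div 2 ^ (N - fst I) = snd I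
     then (if even (u div 2 ^ (N - fst I - 1)) then 1 else -1) else 0)"

lemma dyadic_eq_Sigma: "dyadic n = Sigma {..n} (\<lambda>k. {..<2 ^ k})"
  by (auto simp: dyadic_def)

lemma finite_dyadic [simp]: "finite (dyadic n)"
  by (simp add: dyadic_eq_Sigma)

lemma div_pow2_less:
  fixes u :: nat
  assumes "u < 2 ^ N" "k \<le> N"
  shows "u div 2 ^ (N - k) < 2 ^ k"
proof -
  have "(2::nat) ^ N = 2 ^ k * 2 ^ (N - k)" using assms by (simp flip: power_add)
  then show ?thesis using assms by (intro less_mult_imp_div_less) (simp add: mult.commute)
qed

lemma div_pow2_Suc:
  fixes u :: nat
  assumes "k < N"
  shows "u div 2 ^ (N - k) = (u div 2 ^ (N - Suc k)) div 2"
proof -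
  have "N - k = Suc (N - Suc k)" using assms by simp
  then show ?thesis by (simp only: power_Suc2 div_mult2_eq)
qed

lemma dhaar_abs_le: "\<bar>dhaar N I u\<bar> \<le> 1"
  by (simp add: dhaar_def)

text \<open>Completeness of the Haar system on the atoms. With c k telling whether u and v lie in
  the same interval of level k, the Haar functions of level k contribute 2^(k+1) c (k+1) - 2^k c k,
  the difference of two consecutive conditional expectation kernels, and the sum telescopes.\<close>

lemma dhaar_kernel:
  assumes "0 < N" "u < 2 ^ N" "v < 2 ^ N"
  shows "(\<Sum>I\<in>dyadic (N - 1). 2 ^ fst I * (dhaar N I u * dhaar N I v)) = (if u = v then 2 ^ N else 0) - 1"
proof -
  define c :: "nat \<Rightarrow> real" where "c k = (if u div 2 ^ (N - k) = v div 2 ^ (N - k) then 1 else 0)" for k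
  have level: "(\<Sum>i<2 ^ k. dhaar N (k, i) u * dhaar N (k, i) v) = 2 * c (Suc k) - c k" if "k < N" for k
  proof -
    have "(\<Sum>i<2 ^ k. dhaar N (k, i) u * dhaar N (k, i) v)
      = (\<Sum>i<2 ^ k. if i = u div 2 ^ (N - k) then dhaar N (k, i) u * dhaar N (k, i) v else 0)"
      by (intro sum.cong) (auto simp: dhaar_def)
    also have "\<dots> = dhaar N (k, u div 2 ^ (N - k)) u * dhaar N (k, u div 2 ^ (N - k)) v"
      using div_pow2_less[of u N k] assms that by simp
    also have "\<dots> = 2 * c (Suc k) - c k"
    proof -
      have d: "N - k - 1 = N - Suc k" by simp
      let ?a = "u div 2 ^ (N - Suc k)" and ?b = "v div 2 ^ (N - Suc k)"
      have "(?a = ?b) \<longleftrightarrow> (?a div 2 = ?b div 2 \<and> (even ?a \<longleftrightarrow> even ?b))"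
        by (metis dvd_mult_div_cancel odd_two_times_div_two_succ)
      then show ?thesis
        unfolding dhaar_def c_def d fst_conv snd_conv div_pow2_Suc[OF that] by auto
    qed
    finally show ?thesis .
  qed
  have "(\<Sum>I\<in>dyadic (N - 1). 2 ^ fst I * (dhaar N I u * dhaar N I v))
    = (\<Sum>k\<le>N - 1. \<Sum>i<2 ^ k. 2 ^ k * (dhaar N (k, i) u * dhaar N (k, i) v))"
    unfolding dyadic_eq_Sigma by (subst sum.Sigma) (auto simp: case_prod_beta)
  also have "\<dots> = (\<Sum>k<N. 2 ^ k * (2 * c (Suc k) - c k))"
  proof -
    have "{..N - 1} = {..<N}" using assms by auto
    then show ?thesis by (auto simp: sum_distrib_left[symmetric] level intro!: sum.cong)
  qed
  also have "\<dots> = (\<Sum>k<N. 2 ^ Suc k * c (Suc k) - 2 ^ k * c k)"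
    by (intro sum.cong) (auto simp: algebra_simps)
  also have "\<dots> = 2 ^ N * c N - 2 ^ 0 * c 0"
    by (rule sum_lessThan_telescope)
  also have "\<dots> = (if u = v then 2 ^ N else 0) - 1"
    using assms by (simp add: c_def)
  finally show ?thesis .
qed

text \<open>Summing the kernel identity over both variables gives a vanishing sum of squares.\<close>
lemma dhaar_sum_zero:
  assumes "I \<in> dyadic (N - 1)" "0 < N"
  shows "(\<Sum>u<2 ^ N. dhaar N I u) = 0"
proof -
  define S where "S J = (\<Sum>u<2 ^ N. dhaar N J u)" for J
  have "(\<Sum>J\<in>dyadic (N - 1). 2 ^ fst J * (S J)\<^sup>2)
     = (\<Sum>J\<in>dyadic (N - 1). \<Sum>u<2 ^ N. \<Sum>v<2 ^ N. 2 ^ fst J * (dhaar N J u * dhaar N J v))"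
    unfolding power2_eq_square S_def unfolding sum_product unfolding sum_distrib_left ..
  also have "\<dots> = (\<Sum>u<2 ^ N. \<Sum>v<2 ^ N. \<Sum>J\<in>dyadic (N - 1). 2 ^ fst J * (dhaar N J u * dhaar N J v))"
    by (subst sum.swap, intro sum.cong refl, subst sum.swap) simp
  also have "\<dots> = (\<Sum>u<2 ^ N. \<Sum>v<(2::nat) ^ N. (if u = v then 2 ^ N else 0) - 1)"
    using assms by (intro sum.cong refl dhaar_kernel) auto
  also have "\<dots> = 0"
    by (simp add: sum_subtractf)
  finally have "\<forall>J\<in>dyadic (N - 1). 2 ^ fst J * (S J)\<^sup>2 = 0"
    by (subst (asm) sum_nonneg_eq_0_iff) auto
  then show ?thesis using assms by (auto simp: S_def)
qed

section \<open>Second moments of linear and quadratic forms in random signs\<close>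

lemma sum_Pow_insert:
  fixes g :: "'a set \<Rightarrow> real"
  assumes "finite F" "z \<notin> F"
  shows "(\<Sum>A\<in>Pow (insert z F). g A) = (\<Sum>A\<in>Pow F. g A + g (insert z A))"
proof -
  have "(\<Sum>A\<in>Pow (insert z F). g A) = (\<Sum>A\<in>Pow F. g A) + (\<Sum>A\<in>insert z ` Pow F. g A)"
    unfolding Pow_insert using assms by (intro sum.union_disjoint) auto
  also have "(\<Sum>A\<in>insert z ` Pow F. g A) = (\<Sum>A\<in>Pow F. g (insert z A))"
    using assms by (subst sum.reindex) (auto simp: inj_on_def comp_def dest: insert_ident)
  finally show ?thesis by (simp add: sum.distrib)
qed

text \<open>A sign pattern on F is coded by the set of points with sign +1, so that averaging over
  random signs is a finite sum over \<open>Pow F\<close>.\<close>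

definition sgn_of :: "'a set \<Rightarrow> 'a \<Rightarrow> real" where
  "sgn_of A x = (if x \<in> A then 1 else -1)"

text \<open>Orthogonality of independent signs. The constant c is general because peeling off the
  sign of one point z shifts c by u z or by - u z.\<close>

lemma sign_linear_second_moment:
  assumes "finite F"
  shows "(\<Sum>A\<in>Pow F. (c + (\<Sum>x\<in>F. sgn_of A x * u x))\<^sup>2) = 2 ^ card F * (c\<^sup>2 + (\<Sum>x\<in>F. (u x)\<^sup>2))"
  using assms
proof (induction F arbitrary: c rule: finite_induct)
  case (insert z F)
  have L: "(\<Sum>x\<in>F. sgn_of (insert z A) x * u x) = (\<Sum>x\<in>F. sgn_of A x * u x)" for A
    using insert by (intro sum.cong) (auto simp: sgn_of_def)
  have "(\<Sum>A\<in>Pow (insert z F). (c + (\<Sum>x\<in>insert z F. sgn_of A x * u x))\<^sup>2)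
    = (\<Sum>A\<in>Pow F. ((c - u z) + (\<Sum>x\<in>F. sgn_of A x * u x))\<^sup>2 + ((c + u z) + (\<Sum>x\<in>F. sgn_of A x * u x))\<^sup>2)"
    unfolding sum_Pow_insert[OF insert(1,2)]
  proof (rule sum.cong)
    fix A assume "A \<in> Pow F"
    then have "z \<notin> A" using insert by auto
    then have "sgn_of A z = -1" "sgn_of (insert z A) z = 1" by (auto simp: sgn_of_def)
    then have "(\<Sum>x\<in>insert z F. sgn_of A x * u x) = - u z + (\<Sum>x\<in>F. sgn_of A x * u x)"
      "(\<Sum>x\<in>insert z F. sgn_of (insert z A) x * u x) = u z + (\<Sum>x\<in>F. sgn_of A x * u x)"
      using insert(1,2) L[of A] by auto
    then have e: "c + (\<Sum>x\<in>insert z F. sgn_of A x * u x) = (c - u z) + (\<Sum>x\<in>F. sgn_of A x * u x)"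
      "c + (\<Sum>x\<in>insert z F. sgn_of (insert z A) x * u x) = (c + u z) + (\<Sum>x\<in>F. sgn_of A x * u x)"
      by simp_all
    show "(c + (\<Sum>x\<in>insert z F. sgn_of A x * u x))\<^sup>2 + (c + (\<Sum>x\<in>insert z F. sgn_of (insert z A) x * u x))\<^sup>2
      = ((c - u z) + (\<Sum>x\<in>F. sgn_of A x * u x))\<^sup>2 + ((c + u z) + (\<Sum>x\<in>F. sgn_of A x * u x))\<^sup>2"
      unfolding e ..
  qed simp
  also have "\<dots> = 2 ^ card F * ((c - u z)\<^sup>2 + (\<Sum>x\<in>F. (u x)\<^sup>2)) + 2 ^ card F * ((c + u z)\<^sup>2 + (\<Sum>x\<in>F. (u x)\<^sup>2))"
    unfolding sum.distrib insert.IH ..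
  also have "\<dots> = 2 ^ card (insert z F) * (c\<^sup>2 + (\<Sum>x\<in>insert z F. (u x)\<^sup>2))"
    using insert(1,2) by (simp add: power2_eq_square algebra_simps)
  finally show ?case .
qed simp

text \<open>Peeling off z splits the form into Q + sgn(z) L with Q and L free of the sign of z. The
  mixed term cancels between the two signs, and L is covered by the linear case. The factor 2 pays
  for (v x z + v z x)^2, as v need not be symmetric.\<close>

lemma sign_quadratic_second_moment:
  assumes "finite F"
  shows "(\<Sum>A\<in>Pow F. (\<Sum>x\<in>F. \<Sum>y\<in>F - {x}. sgn_of A x * sgn_of A y * v x y)\<^sup>2)
     \<le> 2 ^ card F * (2 * (\<Sum>x\<in>F. \<Sum>y\<in>F. (v x y)\<^sup>2))"
  using assms
proof (induction F rule: finite_induct)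
  case (insert z F)
  define Q where "Q A = (\<Sum>x\<in>F. \<Sum>y\<in>F - {x}. sgn_of A x * sgn_of A y * v x y)" for A
  define L where "L A = (\<Sum>x\<in>F. sgn_of A x * (v x z + v z x))" for A
  have sg: "sgn_of (insert z A) x = sgn_of A x" if "x \<in> F" for A x
    using that insert(2) by (auto simp: sgn_of_def)
  have Q': "Q (insert z A) = Q A" and L': "L (insert z A) = L A" for A
    unfolding Q_def L_def by (auto intro!: sum.cong simp: sg)
  have expand: "(\<Sum>x\<in>insert z F. \<Sum>y\<in>insert z F - {x}. sgn_of A x * sgn_of A y * v x y) = Q A + sgn_of A z * L A" for A
  proof -
    have 1: "(\<Sum>y\<in>insert z F - {x}. sgn_of A x * sgn_of A y * v x y)
       = sgn_of A z * (sgn_of A x * v x z) + (\<Sum>y\<in>F - {x}. sgn_of A x * sgn_of A y * v x y)" if "x \<in> F" for x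
    proof -
      have "insert z F - {x} = insert z (F - {x})" using that insert by auto
      then show ?thesis using insert by (simp add: mult_ac)
    qed
    have 2: "insert z F - {z} = F" using insert by auto
    have "(\<Sum>x\<in>F. \<Sum>y\<in>insert z F - {x}. sgn_of A x * sgn_of A y * v x y)
       = (\<Sum>x\<in>F. sgn_of A z * (sgn_of A x * v x z) + (\<Sum>y\<in>F - {x}. sgn_of A x * sgn_of A y * v x y))"
      by (intro sum.cong refl 1)
    then have "(\<Sum>x\<in>insert z F. \<Sum>y\<in>insert z F - {x}. sgn_of A x * sgn_of A y * v x y)
       = (\<Sum>y\<in>F. sgn_of A z * sgn_of A y * v z y)
       + (\<Sum>x\<in>F. sgn_of A z * (sgn_of A x * v x z) + (\<Sum>y\<in>F - {x}. sgn_of A x * sgn_of A y * v x y))"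
      using insert(1,2) by (simp add: 2)
    then show ?thesis
      by (simp add: Q_def L_def sum.distrib sum_distrib_left algebra_simps)
  qed
  have "(\<Sum>A\<in>Pow (insert z F). (\<Sum>x\<in>insert z F. \<Sum>y\<in>insert z F - {x}. sgn_of A x * sgn_of A y * v x y)\<^sup>2)
     = (\<Sum>A\<in>Pow F. 2 * (Q A)\<^sup>2 + 2 * (L A)\<^sup>2)"
    unfolding sum_Pow_insert[OF insert(1,2)] expand Q' L'
  proof (rule sum.cong)
    fix A assume "A \<in> Pow F"
    then have "z \<notin> A" using insert by auto
    then show "(Q A + sgn_of A z * L A)\<^sup>2 + (Q A + sgn_of (insert z A) z * L A)\<^sup>2 = 2 * (Q A)\<^sup>2 + 2 * (L A)\<^sup>2"
      by (simp add: sgn_of_def power2_eq_square algebra_simps)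
  qed simp
  also have "\<dots> = 2 * (\<Sum>A\<in>Pow F. (Q A)\<^sup>2) + 2 * (\<Sum>A\<in>Pow F. (0 + L A)\<^sup>2)"
    by (simp add: sum.distrib sum_distrib_left)
  also have "(\<Sum>A\<in>Pow F. (0 + L A)\<^sup>2) = 2 ^ card F * (0\<^sup>2 + (\<Sum>x\<in>F. (v x z + v z x)\<^sup>2))"
    unfolding L_def by (rule sign_linear_second_moment[OF insert(1)])
  also have "(\<Sum>x\<in>F. (v x z + v z x)\<^sup>2) \<le> (\<Sum>x\<in>F. 2 * (v x z)\<^sup>2 + 2 * (v z x)\<^sup>2)"
  proof (rule sum_mono)
    fix x
    have "0 \<le> (v x z - v z x)\<^sup>2" by simp
    then show "(v x z + v z x)\<^sup>2 \<le> 2 * (v x z)\<^sup>2 + 2 * (v z x)\<^sup>2" by (simp add: power2_eq_square algebra_simps)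
  qed
  also have "(\<Sum>A\<in>Pow F. (Q A)\<^sup>2) \<le> 2 ^ card F * (2 * (\<Sum>x\<in>F. \<Sum>y\<in>F. (v x y)\<^sup>2))"
    unfolding Q_def by (rule insert.IH)
  also have "2 * (2 ^ card F * (2 * (\<Sum>x\<in>F. \<Sum>y\<in>F. (v x y)\<^sup>2))) + 2 * (2 ^ card F * (0\<^sup>2 + (\<Sum>x\<in>F. 2 * (v x z)\<^sup>2 + 2 * (v z x)\<^sup>2)))
    \<le> 2 ^ card (insert z F) * (2 * (\<Sum>x\<in>insert z F. \<Sum>y\<in>insert z F. (v x y)\<^sup>2))"
    using insert(1,2) by (simp add: sum.distrib sum_distrib_left algebra_simps)
  finally show ?case by simp
qed simp

text \<open>First moment method: the sum of the squares of all forms has average at most (card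
  \<Lambda> + 2 card \<Gamma>) \<eta> over the patterns. Some pattern does not exceed the average,
  and no single square exceeds the sum.\<close>

lemma exists_signs:
  fixes \<Lambda> :: "('a \<Rightarrow> real) set" and \<Gamma> :: "('a \<Rightarrow> 'a \<Rightarrow> real) set"
  assumes F: "finite F" and fin: "finite \<Lambda>" "finite \<Gamma>"
    and lin: "\<And>u. u \<in> \<Lambda> \<Longrightarrow> (\<Sum>x\<in>F. (u x)\<^sup>2) \<le> \<eta>"
    and quad: "\<And>v. v \<in> \<Gamma> \<Longrightarrow> (\<Sum>x\<in>F. \<Sum>y\<in>F. (v x y)\<^sup>2) \<le> \<eta>"
    and c: "real (card \<Lambda>) + 2 * real (card \<Gamma>) \<le> c" and \<eta>: "0 \<le> \<eta>"
  shows "\<exists>\<epsilon>. (\<forall>x. \<epsilon> x = 1 \<or> \<epsilon> x = -1) \<and>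
     (\<forall>u\<in>\<Lambda>. (\<Sum>x\<in>F. \<epsilon> x * u x)\<^sup>2 \<le> c * \<eta>) \<and>
     (\<forall>v\<in>\<Gamma>. (\<Sum>x\<in>F. \<Sum>y\<in>F - {x}. \<epsilon> x * \<epsilon> y * v x y)\<^sup>2 \<le> c * \<eta>)"
proof -
  define lf where "lf A u = (\<Sum>x\<in>F. sgn_of A x * u x)\<^sup>2" for A u
  define qf where "qf A v = (\<Sum>x\<in>F. \<Sum>y\<in>F - {x}. sgn_of A x * sgn_of A y * v x y)\<^sup>2" for A v
  define G where "G A = (\<Sum>u\<in>\<Lambda>. lf A u) + (\<Sum>v\<in>\<Gamma>. qf A v)" for A
  have "(\<Sum>A\<in>Pow F. G A) = (\<Sum>u\<in>\<Lambda>. \<Sum>A\<in>Pow F. lf A u) + (\<Sum>v\<in>\<Gamma>. \<Sum>A\<in>Pow F. qf A v)"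
    unfolding G_def sum.distrib by (simp add: sum.swap[of _ "Pow F"])
  also have "\<dots> \<le> (\<Sum>u\<in>\<Lambda>. 2 ^ card F * \<eta>) + (\<Sum>v\<in>\<Gamma>. 2 ^ card F * (2 * \<eta>))"
  proof (intro add_mono sum_mono)
    fix u assume "u \<in> \<Lambda>"
    have "(\<Sum>A\<in>Pow F. lf A u) = 2 ^ card F * (\<Sum>x\<in>F. (u x)\<^sup>2)"
      using sign_linear_second_moment[OF F, of 0 u] by (simp add: lf_def)
    also have "\<dots> \<le> 2 ^ card F * \<eta>" using lin[OF \<open>u \<in> \<Lambda>\<close>] by simp
    finally show "(\<Sum>A\<in>Pow F. lf A u) \<le> 2 ^ card F * \<eta>" .
  next
    fix v assume "v \<in> \<Gamma>"
    have "(\<Sum>A\<in>Pow F. qf A v) \<le> 2 ^ card F * (2 * (\<Sum>x\<in>F. \<Sum>y\<in>F. (v x y)\<^sup>2))"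
      unfolding qf_def by (rule sign_quadratic_second_moment[OF F])
    also have "\<dots> \<le> 2 ^ card F * (2 * \<eta>)" using quad[OF \<open>v \<in> \<Gamma>\<close>] by simp
    finally show "(\<Sum>A\<in>Pow F. qf A v) \<le> 2 ^ card F * (2 * \<eta>)" .
  qed
  also have "\<dots> = 2 ^ card F * ((real (card \<Lambda>) + 2 * real (card \<Gamma>)) * \<eta>)"
    by (simp add: algebra_simps)
  also have "\<dots> \<le> 2 ^ card F * (c * \<eta>)"
    using c \<eta> by (intro mult_left_mono mult_right_mono) auto
  also have "\<dots> = (\<Sum>A\<in>Pow F. c * \<eta>)" using F by (simp add: card_Pow)
  finally have "\<exists>A\<in>Pow F. G A \<le> c * \<eta>"
    using F by (metis (no_types, lifting) Pow_not_empty finite_Pow_iff linorder_not_less sum_strict_mono)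
  then obtain A where A: "G A \<le> c * \<eta>" by blast
  have nn: "0 \<le> lf A u" "0 \<le> qf A v" for u v by (auto simp: lf_def qf_def)
  have "lf A u \<le> c * \<eta>" if "u \<in> \<Lambda>" for u
    using member_le_sum[OF that, of "lf A"] nn fin A sum_nonneg[of \<Gamma> "qf A"] by (fastforce simp: G_def)
  moreover have "qf A v \<le> c * \<eta>" if "v \<in> \<Gamma>" for v
    using member_le_sum[OF that, of "qf A"] nn fin A sum_nonneg[of \<Lambda> "lf A"] by (fastforce simp: G_def)
  ultimately show ?thesis
    by (intro exI[of _ "sgn_of A"]) (auto simp: sgn_of_def[abs_def] lf_def qf_def)
qed

section \<open>Almost diagonal Haar systems for a bilinear form\<close>

lemma dhaar_Suc:
  assumes "fst I < k"
  shows "dhaar (Suc k) I w = dhaar k I (w div 2)"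
proof -
  have "Suc k - fst I = Suc (k - fst I)" "Suc k - fst I - 1 = Suc (k - fst I - 1)" using assms by auto
  then have "w div 2 ^ (Suc k - fst I) = w div 2 div 2 ^ (k - fst I)"
    "w div 2 ^ (Suc k - fst I - 1) = w div 2 div 2 ^ (k - fst I - 1)"
    by (simp_all only: power_Suc div_mult2_eq)
  then show ?thesis unfolding dhaar_def by simp
qed

text \<open>The model is the pairing of f with T g, where f and g are functions on the 2^N atoms of
  one copy. The bound is boundedness on L_q times L_p with s = 1/q, tested only on functions
  dominated by indicators.\<close>

locale bilinear_form =
  fixes N :: nat and B :: "(nat \<Rightarrow> real) \<Rightarrow> (nat \<Rightarrow> real) \<Rightarrow> real" and K s :: real
  assumes lin1: "\<And>a b f f' g. B (\<lambda>u. a * f u + b * f' u) g = a * B f g + b * B f' g"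
    and lin2: "\<And>a b f g g'. B f (\<lambda>u. a * g u + b * g' u) = a * B f g + b * B f g'"
    and cong: "\<And>f f' g g'. (\<And>u. u < 2 ^ N \<Longrightarrow> f u = f' u) \<Longrightarrow> (\<And>u. u < 2 ^ N \<Longrightarrow> g u = g' u) \<Longrightarrow> B f g = B f' g'"
    and bound: "\<And>A A' f g. A \<subseteq> {..<2 ^ N} \<Longrightarrow> A' \<subseteq> {..<2 ^ N} \<Longrightarrow>
        (\<And>u. u < 2 ^ N \<Longrightarrow> \<bar>f u\<bar> \<le> indicator A u) \<Longrightarrow> (\<And>u. u < 2 ^ N \<Longrightarrow> \<bar>g u\<bar> \<le> indicator A' u) \<Longrightarrow>
        \<bar>B f g\<bar> \<le> K * (card A / 2 ^ N) powr s * (card A' / 2 ^ N) powr (1 - s)"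
    and K_nonneg: "0 \<le> K" and s01: "0 < s" "s < 1"
begin

lemma B_zero1: "B (\<lambda>u. 0) g = 0"
  using lin1[of 0 "\<lambda>_. 0" 0 "\<lambda>_. 0" g] by simp

lemma B_zero2: "B f (\<lambda>u. 0) = 0"
  using lin2[of f 0 "\<lambda>_. 0" 0 "\<lambda>_. 0"] by simp

lemma B_sum1: "finite F \<Longrightarrow> B (\<lambda>u. \<Sum>x\<in>F. c x * f x u) g = (\<Sum>x\<in>F. c x * B (f x) g)"
proof (induction F rule: finite_induct)
  case (insert x F)
  then show ?case using lin1[of "c x" "f x" 1 "\<lambda>u. \<Sum>x\<in>F. c x * f x u" g] by simp
qed (simp add: B_zero1)

lemma B_sum2: "finite F \<Longrightarrow> B g (\<lambda>u. \<Sum>x\<in>F. c x * f x u) = (\<Sum>x\<in>F. c x * B g (f x))"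
proof (induction F rule: finite_induct)
  case (insert x F)
  then show ?case using lin2[of g "c x" "f x" 1 "\<lambda>u. \<Sum>x\<in>F. c x * f x u"] by simp
qed (simp add: B_zero2)

text \<open>The interval of level m that contains the atom u, obtained by deleting the last N - m
  binary digits. The next digit gives the Rademacher sign \<open>sg m u\<close>, and the Haar
  function of an interval is this sign restricted to it.\<close>

abbreviation pre :: "nat \<Rightarrow> nat \<Rightarrow> nat" where "pre m u \<equiv> u div 2 ^ (N - m)"

definition sg :: "nat \<Rightarrow> nat \<Rightarrow> real" where
  "sg m u = (if even (u div 2 ^ (N - m - 1)) then 1 else -1)"

abbreviation e :: "nat \<Rightarrow> nat \<Rightarrow> nat \<Rightarrow> real" where "e m t \<equiv> dhaar N (m, t)"

definition blk :: "nat \<Rightarrow> nat \<Rightarrow> nat set" where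
  "blk m t = {u. u < 2 ^ N \<and> pre m u = t}"

lemma card_blk:
  assumes "m \<le> N" "t < 2 ^ m"
  shows "card (blk m t) = 2 ^ (N - m)"
proof -
  let ?b = "2 ^ (N - m) :: nat"
  have N: "(2::nat) ^ N = 2 ^ m * ?b" using assms by (simp flip: power_add)
  have "blk m t = {t * ?b..<Suc t * ?b}"
  proof (intro set_eqI iffI)
    fix u assume "u \<in> blk m t"
    then show "u \<in> {t * ?b..<Suc t * ?b}"
      using dividend_less_div_times[of ?b u] div_times_less_eq_dividend[of u ?b] by (auto simp: blk_def)
  next
    fix u assume u: "u \<in> {t * ?b..<Suc t * ?b}"
    have "u < Suc t * ?b" using u by simp
    also have "\<dots> \<le> 2 ^ m * ?b" using assms by (intro mult_right_mono) auto
    finally have "u < 2 ^ N" using N by simp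
    moreover have "u div ?b = t" using u by (intro div_nat_eqI) (auto simp: mult.commute)
    ultimately show "u \<in> blk m t" by (simp add: blk_def)
  qed
  then show ?thesis by simp
qed

lemma e_eq: "e m t u = (if pre m u = t then sg m u else 0)"
  by (simp add: dhaar_def sg_def)

lemma sg_abs [simp]: "\<bar>sg m u\<bar> = 1" by (simp add: sg_def)

lemma e_expand:
  assumes "u < 2 ^ N" "m \<le> N"
  shows "(\<Sum>t<2 ^ m. c t * e m t u) = c (pre m u) * sg m u"
proof -
  have "(\<Sum>t<2 ^ m. c t * e m t u) = (\<Sum>t<2 ^ m. if t = pre m u then c t * sg m u else 0)"
    by (intro sum.cong) (auto simp: e_eq)
  then show ?thesis using div_pow2_less[OF assms] by simp
qed

text \<open>A common majorant of 2^(-ms), 2^(-m(1-s)) and 2^(-m), tending to 0 in m because 0 < s <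
  1. All smallness in the sign choices comes from it; it is not a conjugate exponent.\<close>

definition q :: "nat \<Rightarrow> real" where "q m = (1 / 2 ^ m) powr (min s (1 - s))"

lemma card_blk_ratio: "m \<le> N \<Longrightarrow> t < 2 ^ m \<Longrightarrow> card (blk m t) / 2 ^ N = 1 / (2::real) ^ m"
proof -
  assume m: "m \<le> N" and t: "t < 2 ^ m"
  have "(2::real) ^ N = 2 ^ m * 2 ^ (N - m)" using m by (simp flip: power_add)
  then show ?thesis by (simp add: card_blk[OF m t])
qed

lemma powr_le_q: "r = s \<or> r = 1 - s \<or> r = 1 \<Longrightarrow> (1 / 2 ^ m) powr r \<le> q m"
  unfolding q_def using s01 by (intro powr_mono') (auto simp: divide_le_eq)

lemma e_le_blk: "u < 2 ^ N \<Longrightarrow> \<bar>e m t u\<bar> \<le> indicator (blk m t) u"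
  by (auto simp: e_eq blk_def)

lemma B_e_le1:
  assumes "m \<le> N" "t < 2 ^ m" "\<And>u. u < 2 ^ N \<Longrightarrow> \<bar>g u\<bar> \<le> 1"
  shows "\<bar>B (e m t) g\<bar> \<le> K * (1 / 2 ^ m) powr s"
  using bound[of "blk m t" "{..<2 ^ N}" "e m t" g] e_le_blk assms card_blk_ratio[OF assms(1,2)]
  by (simp add: blk_def subset_iff)

lemma B_e_le2:
  assumes "m \<le> N" "t < 2 ^ m" "\<And>u. u < 2 ^ N \<Longrightarrow> \<bar>g u\<bar> \<le> 1"
  shows "\<bar>B g (e m t)\<bar> \<le> K * (1 / 2 ^ m) powr (1 - s)"
  using bound[of "{..<2 ^ N}" "blk m t" g "e m t"] e_le_blk assms card_blk_ratio[OF assms(1,2)]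
  by (simp add: blk_def subset_iff)

lemma B_ee_le:
  assumes "m \<le> N" "t < 2 ^ m" "t' < 2 ^ m"
  shows "\<bar>B (e m t) (e m t')\<bar> \<le> K / 2 ^ m"
proof -
  have "\<bar>B (e m t) (e m t')\<bar> \<le> K * (1 / 2 ^ m) powr s * (1 / 2 ^ m) powr (1 - s)"
    using bound[of "blk m t" "blk m t'" "e m t" "e m t'"] e_le_blk assms card_blk_ratio[OF assms(1)]
    by (simp add: blk_def subset_iff)
  also have "\<dots> = K * (1 / 2 ^ m) powr (s + (1 - s))" unfolding powr_add by simp
  finally show ?thesis by simp
qed

lemma B_le: "(\<And>u. u < 2 ^ N \<Longrightarrow> \<bar>f u\<bar> \<le> 1) \<Longrightarrow> (\<And>u. u < 2 ^ N \<Longrightarrow> \<bar>g u\<bar> \<le> 1) \<Longrightarrow> \<bar>B f g\<bar> \<le> K"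
  using bound[of "{..<2 ^ N}" "{..<2 ^ N}" f g] by simp

text \<open>Insert the signs of the entries as coefficients: the Haar functions of one level have
  disjoint supports, so the signed sum is still bounded by 1.\<close>

lemma B_e_abs_sum1:
  assumes m: "m \<le> N" and g: "\<And>u. u < 2 ^ N \<Longrightarrow> \<bar>g u\<bar> \<le> 1"
  shows "(\<Sum>t<2 ^ m. \<bar>B (e m t) g\<bar>) \<le> K"
proof -
  define c where "c t = sgn (B (e m t) g)" for t
  have "(\<Sum>t<2 ^ m. \<bar>B (e m t) g\<bar>) = (\<Sum>t<2 ^ m. c t * B (e m t) g)"
    by (simp add: c_def abs_sgn mult.commute)
  also have "\<dots> = B (\<lambda>u. \<Sum>t<2 ^ m. c t * e m t u) g" by (simp add: B_sum1)
  also have "\<dots> \<le> K"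
  proof -
    have "\<bar>\<Sum>t<2 ^ m. c t * e m t u\<bar> \<le> 1" if "u < 2 ^ N" for u
      unfolding e_expand[OF that m] by (simp add: abs_mult c_def abs_sgn_eq)
    then have "\<bar>B (\<lambda>u. \<Sum>t<2 ^ m. c t * e m t u) g\<bar> \<le> K" using g by (intro B_le)
    then show ?thesis by simp
  qed
  finally show ?thesis .
qed

lemma B_e_abs_sum2:
  assumes m: "m \<le> N" and A: "A \<subseteq> {..<2 ^ N}" and g: "\<And>u. u < 2 ^ N \<Longrightarrow> \<bar>g u\<bar> \<le> indicator A u"
  shows "(\<Sum>t<2 ^ m. \<bar>B g (e m t)\<bar>) \<le> K * (card A / 2 ^ N) powr s"
proof -
  define c where "c t = sgn (B g (e m t))" for t
  have "(\<Sum>t<2 ^ m. \<bar>B g (e m t)\<bar>) = (\<Sum>t<2 ^ m. c t * B g (e m t))"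
    by (simp add: c_def abs_sgn mult.commute)
  also have "\<dots> = B g (\<lambda>u. \<Sum>t<2 ^ m. c t * e m t u)" by (simp add: B_sum2)
  also have "\<dots> \<le> K * (card A / 2 ^ N) powr s"
  proof -
    have "\<bar>\<Sum>t<2 ^ m. c t * e m t u\<bar> \<le> indicator {..<2 ^ N} u" if "u < 2 ^ N" for u
      unfolding e_expand[OF that m] using that by (simp add: abs_mult c_def abs_sgn_eq)
    then have "\<bar>B g (\<lambda>u. \<Sum>t<2 ^ m. c t * e m t u)\<bar> \<le> K * (card A / 2 ^ N) powr s * (card {..<(2::nat) ^ N} / 2 ^ N) powr (1 - s)"
      using A g by (intro bound) auto
    then show ?thesis by simp
  qed
  finally show ?thesis .
qed

lemma sum_sq_le_max_times_sum:
  fixes a :: "'a \<Rightarrow> real"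
  assumes "\<And>x. x \<in> F \<Longrightarrow> \<bar>a x\<bar> \<le> M" "(\<Sum>x\<in>F. \<bar>a x\<bar>) \<le> S" "0 \<le> M"
  shows "(\<Sum>x\<in>F. (a x)\<^sup>2) \<le> M * S"
proof -
  have "(\<Sum>x\<in>F. (a x)\<^sup>2) \<le> (\<Sum>x\<in>F. M * \<bar>a x\<bar>)"
  proof (rule sum_mono)
    fix x assume "x \<in> F"
    then have "\<bar>a x\<bar> * \<bar>a x\<bar> \<le> M * \<bar>a x\<bar>" using assms by (intro mult_right_mono) auto
    then show "(a x)\<^sup>2 \<le> M * \<bar>a x\<bar>" by (simp add: power2_eq_square)
  qed
  also have "\<dots> = M * (\<Sum>x\<in>F. \<bar>a x\<bar>)" by (simp add: sum_distrib_left)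
  also have "\<dots> \<le> M * S" using assms by (intro mult_left_mono)
  finally show ?thesis .
qed

lemma q_nonneg: "0 \<le> q m" by (simp add: q_def)

text \<open>The largest entry is at most K q m, while the sum of the absolute values stays below K.
  Hence the square sum tends to 0 with the level, although the sum of moduli need not.\<close>

lemma B_e_sq1:
  assumes m: "m \<le> N" and g: "\<And>u. u < 2 ^ N \<Longrightarrow> \<bar>g u\<bar> \<le> 1"
  shows "(\<Sum>t<2 ^ m. (B (e m t) g)\<^sup>2) \<le> K\<^sup>2 * q m"
proof -
  have "(\<Sum>t<2 ^ m. (B (e m t) g)\<^sup>2) \<le> (K * q m) * K"
  proof (rule sum_sq_le_max_times_sum[OF _ B_e_abs_sum1[OF m g]])
    fix t :: nat assume "t \<in> {..<2 ^ m}"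
    then have "\<bar>B (e m t) g\<bar> \<le> K * (1 / 2 ^ m) powr s" using B_e_le1[OF m _ g] by simp
    also have "\<dots> \<le> K * q m" using K_nonneg by (intro mult_left_mono powr_le_q) auto
    finally show "\<bar>B (e m t) g\<bar> \<le> K * q m" .
  qed (use K_nonneg q_nonneg in auto)
  then show ?thesis by (simp add: power2_eq_square mult_ac)
qed

lemma B_e_sq2:
  assumes m: "m \<le> N" and g: "\<And>u. u < 2 ^ N \<Longrightarrow> \<bar>g u\<bar> \<le> 1"
  shows "(\<Sum>t<2 ^ m. (B g (e m t))\<^sup>2) \<le> K\<^sup>2 * q m"
proof -
  have S: "(\<Sum>t<2 ^ m. \<bar>B g (e m t)\<bar>) \<le> K"
    using B_e_abs_sum2[OF m order_refl, of g] g by simp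
  have "(\<Sum>t<2 ^ m. (B g (e m t))\<^sup>2) \<le> (K * q m) * K"
  proof (rule sum_sq_le_max_times_sum[OF _ S])
    fix t :: nat assume "t \<in> {..<2 ^ m}"
    then have "\<bar>B g (e m t)\<bar> \<le> K * (1 / 2 ^ m) powr (1 - s)" using B_e_le2[OF m _ g] by simp
    also have "\<dots> \<le> K * q m" using K_nonneg by (intro mult_left_mono powr_le_q) auto
    finally show "\<bar>B g (e m t)\<bar> \<le> K * q m" .
  qed (use K_nonneg q_nonneg in auto)
  then show ?thesis by (simp add: power2_eq_square mult_ac)
qed

text \<open>In each of the 2^m rows the entries are at most K / 2^m. The row sum is at most K q m,
  because a single Haar function of level m lives on a set of measure 2^-m.\<close>

lemma B_ee_sq:
  assumes m: "m \<le> N"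
  shows "(\<Sum>t<2 ^ m. \<Sum>t'<2 ^ m. (B (e m t) (e m t'))\<^sup>2) \<le> K\<^sup>2 * q m"
proof -
  have "(\<Sum>t<2 ^ m. \<Sum>t'<2 ^ m. (B (e m t) (e m t'))\<^sup>2) \<le> (\<Sum>t<(2::nat) ^ m. (K / 2 ^ m) * (K * q m))"
  proof (rule sum_mono)
    fix t :: nat assume "t \<in> {..<2 ^ m}"
    then have t: "t < 2 ^ m" by simp
    have "(\<Sum>t'<2 ^ m. \<bar>B (e m t) (e m t')\<bar>) \<le> K * (card (blk m t) / 2 ^ N) powr s"
      by (rule B_e_abs_sum2[OF m]) (auto simp: blk_def e_eq)
    also have "\<dots> \<le> K * q m"
      unfolding card_blk_ratio[OF m t] using K_nonneg by (intro mult_left_mono powr_le_q) auto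
    finally show "(\<Sum>t'<2 ^ m. (B (e m t) (e m t'))\<^sup>2) \<le> (K / 2 ^ m) * (K * q m)"
      using B_ee_le[OF m t] K_nonneg by (intro sum_sq_le_max_times_sum) auto
  qed
  also have "\<dots> = K\<^sup>2 * q m" by (simp add: power2_eq_square)
  finally show ?thesis .
qed

definition Ex :: "(nat \<Rightarrow> real) \<Rightarrow> real" where "Ex f = (\<Sum>u<2 ^ N. f u) / 2 ^ N"

lemma Ex_e_le:
  assumes m: "m \<le> N" "t < 2 ^ m" and D: "\<And>u. u < 2 ^ N \<Longrightarrow> \<bar>D u\<bar> \<le> K"
  shows "\<bar>Ex (\<lambda>u. e m t u * D u)\<bar> \<le> K / 2 ^ m"
proof -
  have "\<bar>\<Sum>u<2 ^ N. e m t u * D u\<bar> \<le> (\<Sum>u<2 ^ N. indicator (blk m t) u * K)"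
  proof (rule order_trans[OF sum_abs sum_mono])
    fix u :: nat assume "u \<in> {..<2 ^ N}"
    then show "\<bar>e m t u * D u\<bar> \<le> indicator (blk m t) u * K"
      unfolding abs_mult using e_le_blk[of u m t] D[of u] by (intro mult_mono) auto
  qed
  also have "\<dots> = card (blk m t) * K"
  proof -
    have "(\<Sum>u<2 ^ N. indicator (blk m t) u * K) = (\<Sum>u\<in>blk m t. K)"
      by (rule sum.mono_neutral_cong_right) (auto simp: blk_def)
    then show ?thesis by simp
  qed
  finally have "\<bar>Ex (\<lambda>u. e m t u * D u)\<bar> \<le> (card (blk m t) / 2 ^ N) * K"
    unfolding Ex_def abs_divide by (simp add: divide_right_mono)
  then show ?thesis unfolding card_blk_ratio[OF m] by simp
qed

lemma Ex_e_sq: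
  assumes m: "m \<le> N" and D: "\<And>u. u < 2 ^ N \<Longrightarrow> \<bar>D u\<bar> \<le> K"
  shows "(\<Sum>t<2 ^ m. (Ex (\<lambda>u. e m t u * D u))\<^sup>2) \<le> K\<^sup>2 * q m"
proof -
  have "(\<Sum>t<2 ^ m. (Ex (\<lambda>u. e m t u * D u))\<^sup>2) \<le> (\<Sum>t<(2::nat) ^ m. (K / 2 ^ m)\<^sup>2)"
  proof (rule sum_mono)
    fix t :: nat assume "t \<in> {..<2 ^ m}"
    then have "\<bar>Ex (\<lambda>u. e m t u * D u)\<bar> \<le> \<bar>K / 2 ^ m\<bar>"
      using Ex_e_le[of m t D] m D K_nonneg by auto
    then show "(Ex (\<lambda>u. e m t u * D u))\<^sup>2 \<le> (K / 2 ^ m)\<^sup>2"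
      by (rule iffD1[OF abs_le_square_iff])
  qed
  also have "\<dots> = K\<^sup>2 * (1 / 2 ^ m) powr 1" by (simp add: power2_eq_square)
  also have "\<dots> \<le> K\<^sup>2 * q m" by (intro mult_left_mono powr_le_q) auto
  finally show ?thesis .
qed

lemma sum_if_sq_le:
  fixes a :: "nat \<Rightarrow> real"
  shows "(\<Sum>t\<in>F. (if P t then a t else 0)\<^sup>2) \<le> (\<Sum>t\<in>F. (a t)\<^sup>2)"
  by (intro sum_mono) auto

text \<open>The new functions are \<sigma> cut to the current blocks, where \<sigma> is the
  Rademacher function of level m with a free sign on each interval of that level. Everything to be
  made small is a linear form or an off-diagonal quadratic form in the free signs with small square
  sum, so \<open>exists_signs\<close> applies. The diagonal of the quadratic form does not depend on
  the signs and is the term subtracted in the last conjunct. The factor in the last hypothesis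
  counts two linear forms per block and element of \<Theta>, one per block and element of \<Delta>,
  and 4^k quadratic forms of weight 2.\<close>

lemma sign_step:
  fixes \<rho> :: "nat \<Rightarrow> nat" and \<Theta> \<Delta> :: "(nat \<Rightarrow> real) set"
  assumes m: "m < N" and \<rho>: "\<And>u. u < 2 ^ N \<Longrightarrow> \<rho> u = R (pre m u)"
    and fin: "finite \<Theta>" "finite \<Delta>"
    and \<Theta>: "\<And>g u. g \<in> \<Theta> \<Longrightarrow> u < 2 ^ N \<Longrightarrow> \<bar>g u\<bar> \<le> 1"
    and \<Delta>: "\<And>D u. D \<in> \<Delta> \<Longrightarrow> u < 2 ^ N \<Longrightarrow> \<bar>D u\<bar> \<le> K"
    and \<gamma>: "0 \<le> \<gamma>" "(2 * 2 ^ k * card \<Theta> + 2 ^ k * card \<Delta> + 2 * 4 ^ k) * (K\<^sup>2 * q m) \<le> \<gamma>\<^sup>2"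
  shows "\<exists>\<sigma>. (\<forall>u. \<sigma> u = 1 \<or> \<sigma> u = -1) \<and> (\<forall>u v. pre (Suc m) u = pre (Suc m) v \<longrightarrow> \<sigma> u = \<sigma> v) \<and>
     (\<forall>i<2 ^ k. (\<Sum>u<2 ^ N. if \<rho> u = i then \<sigma> u else 0) = 0) \<and>
     (\<forall>i<2 ^ k. \<forall>g\<in>\<Theta>. \<bar>B (\<lambda>u. if \<rho> u = i then \<sigma> u else 0) g\<bar> \<le> \<gamma> \<and> \<bar>B g (\<lambda>u. if \<rho> u = i then \<sigma> u else 0)\<bar> \<le> \<gamma>) \<and>
     (\<forall>i<2 ^ k. \<forall>D\<in>\<Delta>. \<bar>Ex (\<lambda>u. (if \<rho> u = i then \<sigma> u else 0) * D u)\<bar> \<le> \<gamma>) \<and>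
     (\<forall>i<2 ^ k. \<forall>i'<2 ^ k. \<bar>B (\<lambda>u. if \<rho> u = i then \<sigma> u else 0) (\<lambda>u. if \<rho> u = i' then \<sigma> u else 0)
         - (if i = i' then \<Sum>t<2 ^ m. if R t = i then B (e m t) (e m t) else 0 else 0)\<bar> \<le> \<gamma>)"
proof -
  define l1 where "l1 = (\<lambda>(i, g) t. if R t = i then B (e m t) g else 0)"
  define l2 where "l2 = (\<lambda>(i, g) t. if R t = i then B g (e m t) else 0)"
  define l3 where "l3 = (\<lambda>(i, D) t. if R t = i then Ex (\<lambda>u. e m t u * D u) else 0)"
  define qd where "qd = (\<lambda>(i, i') t t'. if R t = i \<and> R t' = i' then B (e m t) (e m t') else 0)"
  define \<Lambda> where "\<Lambda> = l1 ` ({..<2 ^ k} \<times> \<Theta>) \<union> l2 ` ({..<2 ^ k} \<times> \<Theta>) \<union> l3 ` ({..<2 ^ k} \<times> \<Delta>)"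
  define \<Gamma> where "\<Gamma> = qd ` ({..<2 ^ k} \<times> {..<2 ^ k})"
  have mN: "m \<le> N" using m by simp
  have "card \<Lambda> \<le> card (l1 ` ({..<2 ^ k} \<times> \<Theta>)) + card (l2 ` ({..<2 ^ k} \<times> \<Theta>)) + card (l3 ` ({..<2 ^ k} \<times> \<Delta>))"
    unfolding \<Lambda>_def by (meson add_le_mono1 card_Un_le le_trans)
  also have "\<dots> \<le> card ({..<2 ^ k :: nat} \<times> \<Theta>) + card ({..<2 ^ k :: nat} \<times> \<Theta>) + card ({..<2 ^ k :: nat} \<times> \<Delta>)"
    using fin by (intro add_mono card_image_le) auto
  finally have c\<Lambda>: "card \<Lambda> \<le> 2 * 2 ^ k * card \<Theta> + 2 ^ k * card \<Delta>"
    by (simp add: card_cartesian_product)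
  have "card \<Gamma> \<le> card ({..<2 ^ k :: nat} \<times> {..<2 ^ k :: nat})"
    unfolding \<Gamma>_def by (intro card_image_le) auto
  then have c\<Gamma>: "card \<Gamma> \<le> 4 ^ k"
    by (simp add: card_cartesian_product flip: power_mult_distrib)
  have c: "real (card \<Lambda>) + 2 * real (card \<Gamma>) \<le> 2 * 2 ^ k * card \<Theta> + 2 ^ k * card \<Delta> + 2 * 4 ^ k"
  proof -
    have "real (card \<Lambda> + 2 * card \<Gamma>) \<le> real (2 * 2 ^ k * card \<Theta> + 2 ^ k * card \<Delta> + 2 * 4 ^ k)"
      using c\<Lambda> c\<Gamma> by (intro of_nat_mono) linarith
    then show ?thesis by simp
  qed
  have "\<exists>\<epsilon>. (\<forall>x. \<epsilon> x = 1 \<or> \<epsilon> x = -1) \<and>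
     (\<forall>u\<in>\<Lambda>. (\<Sum>x<2 ^ m. \<epsilon> x * u x)\<^sup>2 \<le> (2 * 2 ^ k * card \<Theta> + 2 ^ k * card \<Delta> + 2 * 4 ^ k) * (K\<^sup>2 * q m)) \<and>
     (\<forall>v\<in>\<Gamma>. (\<Sum>x<2 ^ m. \<Sum>y\<in>{..<2 ^ m} - {x}. \<epsilon> x * \<epsilon> y * v x y)\<^sup>2
        \<le> (2 * 2 ^ k * card \<Theta> + 2 ^ k * card \<Delta> + 2 * 4 ^ k) * (K\<^sup>2 * q m))"
  proof (rule exists_signs)
    show "finite \<Lambda>" "finite \<Gamma>" using fin by (auto simp: \<Lambda>_def \<Gamma>_def)
    fix u assume "u \<in> \<Lambda>"
    then consider i g where "g \<in> \<Theta>" "u = l1 (i, g)" | i g where "g \<in> \<Theta>" "u = l2 (i, g)" | i D where "D \<in> \<Delta>" "u = l3 (i, D)"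
      unfolding \<Lambda>_def by auto
    then show "(\<Sum>x<2 ^ m. (u x)\<^sup>2) \<le> K\<^sup>2 * q m"
    proof cases
      case 1
      then show ?thesis unfolding l1_def using order_trans[OF sum_if_sq_le B_e_sq1[OF mN \<Theta>]] by auto
    next
      case 2
      then show ?thesis unfolding l2_def using order_trans[OF sum_if_sq_le B_e_sq2[OF mN \<Theta>]] by auto
    next
      case 3
      then show ?thesis unfolding l3_def using order_trans[OF sum_if_sq_le Ex_e_sq[OF mN \<Delta>]] by auto
    qed
  next
    fix v assume "v \<in> \<Gamma>"
    then obtain i i' where v: "v = qd (i, i')" unfolding \<Gamma>_def by auto
    have "(\<Sum>x<2 ^ m. \<Sum>y<2 ^ m. (v x y)\<^sup>2) \<le> (\<Sum>x<2 ^ m. \<Sum>y<2 ^ m. (B (e m x) (e m y))\<^sup>2)"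
      unfolding v qd_def by (intro sum_mono) auto
    also have "\<dots> \<le> K\<^sup>2 * q m" by (rule B_ee_sq[OF mN])
    finally show "(\<Sum>x<2 ^ m. \<Sum>y<2 ^ m. (v x y)\<^sup>2) \<le> K\<^sup>2 * q m" .
  qed (use c q_nonneg in auto)
  then obtain \<epsilon> where \<epsilon>: "\<And>x. \<epsilon> x = 1 \<or> \<epsilon> x = -1"
    and lin0: "\<forall>u\<in>\<Lambda>. (\<Sum>x<2 ^ m. \<epsilon> x * u x)\<^sup>2 \<le> (2 * 2 ^ k * card \<Theta> + 2 ^ k * card \<Delta> + 2 * 4 ^ k) * (K\<^sup>2 * q m)"
    and quad0: "\<forall>v\<in>\<Gamma>. (\<Sum>x<2 ^ m. \<Sum>y\<in>{..<2 ^ m} - {x}. \<epsilon> x * \<epsilon> y * v x y)\<^sup>2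
        \<le> (2 * 2 ^ k * card \<Theta> + 2 ^ k * card \<Delta> + 2 * 4 ^ k) * (K\<^sup>2 * q m)"
    by (elim exE conjE) blast
  have lin: "(\<Sum>x<2 ^ m. \<epsilon> x * u x)\<^sup>2 \<le> \<gamma>\<^sup>2" if "u \<in> \<Lambda>" for u
    using lin0 that by (intro order_trans[OF _ \<gamma>(2)]) blast
  have quad: "(\<Sum>x<2 ^ m. \<Sum>y\<in>{..<2 ^ m} - {x}. \<epsilon> x * \<epsilon> y * v x y)\<^sup>2 \<le> \<gamma>\<^sup>2" if "v \<in> \<Gamma>" for v
    using quad0 that by (intro order_trans[OF _ \<gamma>(2)]) blast
  have sq: "\<bar>x\<bar> \<le> \<gamma>" if "x\<^sup>2 \<le> \<gamma>\<^sup>2" for x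
    using that \<gamma>(1) by (simp add: abs_le_square_iff[symmetric])
  \<comment> \<open>Constant on the intervals of level m + 1 and of mean 0 on those of level m.
    Since \<rho> is constant on the latter, \<sigma> splits every block into two halves of equal
    size.\<close>
  define \<sigma> where "\<sigma> u = \<epsilon> (pre m u) * sg m u" for u
  define \<tau> where "\<tau> i u = (if \<rho> u = i then \<sigma> u else 0)" for i u
  define d where "d i t = (if R t = i then \<epsilon> t else 0)" for i t
  have \<tau>: "\<tau> i u = (\<Sum>t<2 ^ m. d i t * e m t u)" if "u < 2 ^ N" for i u
    unfolding e_expand[OF that mN] by (simp add: \<tau>_def \<sigma>_def d_def \<rho>[OF that])
  have Bt1: "B (\<tau> i) g = (\<Sum>t<2 ^ m. \<epsilon> t * l1 (i, g) t)" for i g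
  proof -
    have "B (\<tau> i) g = B (\<lambda>u. \<Sum>t<2 ^ m. d i t * e m t u) g" using \<tau> by (intro cong) auto
    then show ?thesis by (auto simp: B_sum1 l1_def d_def intro!: sum.cong)
  qed
  have Bt2: "B g (\<tau> i) = (\<Sum>t<2 ^ m. \<epsilon> t * l2 (i, g) t)" for i g
  proof -
    have "B g (\<tau> i) = B g (\<lambda>u. \<Sum>t<2 ^ m. d i t * e m t u)" using \<tau> by (intro cong) auto
    then show ?thesis by (auto simp: B_sum2 l2_def d_def intro!: sum.cong)
  qed
  have Et: "Ex (\<lambda>u. \<tau> i u * D u) = (\<Sum>t<2 ^ m. \<epsilon> t * l3 (i, D) t)" for i D
  proof -
    have "(\<Sum>u<2 ^ N. \<tau> i u * D u) = (\<Sum>u<2 ^ N. \<Sum>t<2 ^ m. d i t * (e m t u * D u))"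
      by (intro sum.cong) (auto simp: \<tau> sum_distrib_right mult.assoc)
    also have "\<dots> = (\<Sum>t<2 ^ m. \<Sum>u<2 ^ N. d i t * (e m t u * D u))" by (rule sum.swap)
    finally have "Ex (\<lambda>u. \<tau> i u * D u) = (\<Sum>t<2 ^ m. d i t * Ex (\<lambda>u. e m t u * D u))"
      by (simp add: Ex_def sum_divide_distrib sum_distrib_left)
    then show ?thesis by (auto simp: l3_def d_def intro!: sum.cong)
  qed
  have sum0: "(\<Sum>u<2 ^ N. \<tau> i u) = 0" for i
  proof -
    have "(\<Sum>u<2 ^ N. \<tau> i u) = (\<Sum>t<2 ^ m. \<Sum>u<2 ^ N. d i t * e m t u)"
      by (subst sum.swap) (auto simp: \<tau> intro!: sum.cong)
    also have "\<dots> = (\<Sum>t<2 ^ m. d i t * (\<Sum>u<2 ^ N. e m t u))" by (simp add: sum_distrib_left)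
    also have "\<dots> = 0"
    proof -
      have "(\<Sum>u<2 ^ N. e m t u) = 0" if "t < 2 ^ m" for t
        using that m by (intro dhaar_sum_zero) (auto simp: dyadic_def)
      then show ?thesis by simp
    qed
    finally show ?thesis .
  qed
  have BQ: "B (\<tau> i) (\<tau> i') - (if i = i' then \<Sum>t<2 ^ m. if R t = i then B (e m t) (e m t) else 0 else 0)
    = (\<Sum>x<2 ^ m. \<Sum>y\<in>{..<2 ^ m} - {x}. \<epsilon> x * \<epsilon> y * qd (i, i') x y)" for i i'
  proof -
    have "B (\<tau> i) (\<tau> i') = B (\<lambda>u. \<Sum>t<2 ^ m. d i t * e m t u) (\<lambda>u. \<Sum>t<2 ^ m. d i' t * e m t u)"
      using \<tau> by (intro cong) auto
    also have "\<dots> = (\<Sum>x<2 ^ m. d i x * (\<Sum>y<2 ^ m. d i' y * B (e m x) (e m y)))"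
      by (simp only: B_sum1[OF finite_lessThan] B_sum2[OF finite_lessThan])
    also have "\<dots> = (\<Sum>x<2 ^ m. \<Sum>y<2 ^ m. \<epsilon> x * \<epsilon> y * qd (i, i') x y)"
      unfolding sum_distrib_left by (intro sum.cong refl) (simp add: d_def qd_def)
    also have "\<dots> = (\<Sum>x<2 ^ m. \<epsilon> x * \<epsilon> x * qd (i, i') x x + (\<Sum>y\<in>{..<2 ^ m} - {x}. \<epsilon> x * \<epsilon> y * qd (i, i') x y))"
      by (intro sum.cong refl sum.remove) auto
    also have "\<dots> = (\<Sum>x<2 ^ m. qd (i, i') x x) + (\<Sum>x<2 ^ m. \<Sum>y\<in>{..<2 ^ m} - {x}. \<epsilon> x * \<epsilon> y * qd (i, i') x y)"
    proof -
      have "\<epsilon> x * \<epsilon> x = 1" for x using \<epsilon>[of x] by auto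
      then show ?thesis by (simp add: sum.distrib)
    qed
    also have "(\<Sum>x<2 ^ m. qd (i, i') x x) = (if i = i' then \<Sum>t<2 ^ m. if R t = i then B (e m t) (e m t) else 0 else 0)"
      by (auto simp: qd_def intro!: sum.cong sum.neutral)
    finally show ?thesis by simp
  qed
  have eta: "(\<lambda>u. if \<rho> u = i then \<sigma> u else 0) = \<tau> i" for i by (simp add: \<tau>_def[abs_def])
  show ?thesis
  proof (rule exI[of _ \<sigma>], intro conjI allI impI ballI)
    show "\<sigma> u = 1 \<or> \<sigma> u = -1" for u using \<epsilon>[of "pre m u"] by (auto simp: \<sigma>_def sg_def)
    show "\<sigma> u = \<sigma> v" if "pre (Suc m) u = pre (Suc m) v" for u v
      using that div_pow2_Suc[OF m, of u] div_pow2_Suc[OF m, of v] by (simp add: \<sigma>_def sg_def)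
    fix i :: nat assume i: "i < 2 ^ k"
    show "(\<Sum>u<2 ^ N. if \<rho> u = i then \<sigma> u else 0) = 0" using sum0[of i] by (simp add: \<tau>_def)
    show "\<bar>B (\<lambda>u. if \<rho> u = i then \<sigma> u else 0) g\<bar> \<le> \<gamma>" if "g \<in> \<Theta>" for g
      unfolding eta Bt1 using i that by (intro sq lin) (auto simp: \<Lambda>_def)
    show "\<bar>B g (\<lambda>u. if \<rho> u = i then \<sigma> u else 0)\<bar> \<le> \<gamma>" if "g \<in> \<Theta>" for g
      unfolding eta Bt2 using i that by (intro sq lin) (auto simp: \<Lambda>_def)
    show "\<bar>Ex (\<lambda>u. (if \<rho> u = i then \<sigma> u else 0) * D u)\<bar> \<le> \<gamma>" if "D \<in> \<Delta>" for D
      using Et[of i D] i that sq[OF lin, of "l3 (i, D)"] by (auto simp: \<Lambda>_def \<tau>_def)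
    fix i' :: nat assume i': "i' < 2 ^ k"
    show "\<bar>B (\<lambda>u. if \<rho> u = i then \<sigma> u else 0) (\<lambda>u. if \<rho> u = i' then \<sigma> u else 0)
         - (if i = i' then \<Sum>t<2 ^ m. if R t = i then B (e m t) (e m t) else 0 else 0)\<bar> \<le> \<gamma>"
      unfolding eta BQ using i i' by (intro sq quad) (auto simp: \<Gamma>_def)
  qed
qed


section \<open>Diagonal averages and the block construction\<close>

lemma Ex_pre:
  assumes "m \<le> N"
  shows "Ex (\<lambda>u. F (pre m u)) = (\<Sum>t<2 ^ m. F t) / 2 ^ m"
proof -
  have "(\<Sum>u<2 ^ N. F (pre m u)) = (\<Sum>t<2 ^ m. \<Sum>u\<in>{u\<in>{..<2 ^ N}. pre m u = t}. F (pre m u))"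
    using div_pow2_less[OF _ assms] by (intro sum.group[symmetric]) auto
  also have "\<dots> = (\<Sum>t<2 ^ m. card (blk m t) * F t)"
    by (intro sum.cong refl) (simp add: blk_def)
  also have "\<dots> = 2 ^ (N - m) * (\<Sum>t<2 ^ m. F t)"
    using assms by (simp add: card_blk sum_distrib_left)
  also have "\<dots> / 2 ^ N = (\<Sum>t<2 ^ m. F t) / 2 ^ m"
  proof -
    have "(2::real) ^ N = 2 ^ m * 2 ^ (N - m)" using assms by (simp flip: power_add)
    then show ?thesis by simp
  qed
  finally show ?thesis by (simp add: Ex_def)
qed

lemma pre_pre:
  assumes "m \<le> m'" "m' \<le> N"
  shows "pre m u = pre m' u div 2 ^ (m' - m)"
proof -
  have "N - m = (N - m') + (m' - m)" using assms by simp
  then show ?thesis by (simp add: power_add div_mult2_eq)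
qed

text \<open>The mean over level m of the normalised diagonal entries: the factor 2^m of the
  normalisation cancels against the number of intervals.\<close>

definition diag_avg :: "nat \<Rightarrow> real" where
  "diag_avg m = (\<Sum>t<2 ^ m. B (e m t) (e m t))"

text \<open>The normalised diagonal entries of level m spread out as a function on the atoms; its
  mean is \<open>diag_avg m\<close>. In this form the diagonal of a block can be tested against
  \<sigma>.\<close>

definition diag_fun :: "nat \<Rightarrow> nat \<Rightarrow> real" where
  "diag_fun m u = 2 ^ m * B (e m (pre m u)) (e m (pre m u))"

lemma diag_fun_le: "m \<le> N \<Longrightarrow> u < 2 ^ N \<Longrightarrow> \<bar>diag_fun m u\<bar> \<le> K"
  using B_ee_le[of m "pre m u" "pre m u"] div_pow2_less[of u N m]
  by (simp add: diag_fun_def abs_mult field_simps)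

lemma diag_avg_le: "m \<le> N \<Longrightarrow> \<bar>diag_avg m\<bar> \<le> K"
proof -
  assume m: "m \<le> N"
  have "\<bar>diag_avg m\<bar> \<le> (\<Sum>t<(2::nat) ^ m. K / 2 ^ m)"
    unfolding diag_avg_def using B_ee_le[OF m] by (intro order_trans[OF sum_abs sum_mono]) auto
  then show ?thesis by simp
qed

lemma Ex_lin: "Ex (\<lambda>u. (f u + c * g u) / 2) = (Ex f + c * Ex g) / 2"
  by (simp add: Ex_def sum.distrib add_divide_distrib flip: sum_distrib_left sum_divide_distrib)

text \<open>Stage \<open>k\<close> chooses the signs at level \<open>mm k\<close>. Besides the off-diagonal entries they make every block
  function nearly orthogonal to the diagonal functions of all later levels, so that each half of a
  block keeps the level averages of the diagonal.\<close>
lemma gamlen_gaudet_induct: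
  fixes mm :: "nat \<Rightarrow> nat" and n :: nat and \<mu> \<delta> \<gamma> :: real
  assumes mm: "\<And>l l'. l < l' \<Longrightarrow> l' < n \<Longrightarrow> mm l < mm l'" "\<And>l. l < n \<Longrightarrow> mm l < N"
    and \<mu>: "\<And>l. l < n \<Longrightarrow> \<bar>diag_avg (mm l) - \<mu>\<bar> \<le> \<delta> / 2"
    and \<gamma>: "0 \<le> \<gamma>" "\<gamma> \<le> \<delta> / 4"
    and c: "\<And>l. l < n \<Longrightarrow> (2 * 2 ^ n * card (dyadic n) + 2 ^ n * n + 2 * 4 ^ n) * (K\<^sup>2 * q (mm l)) \<le> \<gamma>\<^sup>2"
  shows "k \<le> n \<Longrightarrow> \<exists>\<rho>. (\<forall>u<2 ^ N. \<rho> u < 2 ^ k) \<and>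
     (\<forall>l u v. k \<le> l \<longrightarrow> l < n \<longrightarrow> u < 2 ^ N \<longrightarrow> v < 2 ^ N \<longrightarrow> pre (mm l) u = pre (mm l) v \<longrightarrow> \<rho> u = \<rho> v) \<and>
     (\<forall>i<2 ^ k. Ex (\<lambda>u. of_bool (\<rho> u = i)) = 1 / 2 ^ k) \<and>
     (\<forall>l<n. \<forall>i<2 ^ k. \<bar>Ex (\<lambda>u. of_bool (\<rho> u = i) * diag_fun (mm l) u) - diag_avg (mm l) / 2 ^ k\<bar> \<le> \<gamma>) \<and>
     (\<forall>I I'. fst I < k \<longrightarrow> snd I < 2 ^ fst I \<longrightarrow> fst I' < k \<longrightarrow> snd I' < 2 ^ fst I' \<longrightarrow>
        \<bar>B (\<lambda>u. dhaar k I (\<rho> u)) (\<lambda>u. dhaar k I' (\<rho> u)) - (if I = I' then \<mu> / 2 ^ fst I else 0)\<bar> \<le> \<delta>)"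
proof (induction k)
  case 0
  have "Ex (\<lambda>u. diag_fun (mm l) u) = diag_avg (mm l)" if "l < n" for l
    using Ex_pre[of "mm l" "\<lambda>t. 2 ^ mm l * B (e (mm l) t) (e (mm l) t)"] mm(2)[OF that]
    by (simp add: diag_fun_def[abs_def] diag_avg_def flip: sum_distrib_left)
  moreover have "Ex (\<lambda>u. 1) = 1" by (simp add: Ex_def)
  ultimately show ?case using \<gamma> by (intro exI[of _ "\<lambda>_. 0"]) auto
next
  case (Suc k)
  then have kn: "k < n" "k \<le> n" by auto
  define m where "m = mm k"
  have m: "m < N" "m \<le> N" using mm(2)[OF kn(1)] by (auto simp: m_def)
  obtain \<rho> where \<rho>lt: "\<And>u. u < 2 ^ N \<Longrightarrow> \<rho> u < 2 ^ k"
    and \<rho>pre: "\<And>l u v. k \<le> l \<Longrightarrow> l < n \<Longrightarrow> u < 2 ^ N \<Longrightarrow> v < 2 ^ N \<Longrightarrow> pre (mm l) u = pre (mm l) v \<Longrightarrow> \<rho> u = \<rho> v"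
    and \<rho>unif: "\<And>i. i < 2 ^ k \<Longrightarrow> Ex (\<lambda>u. of_bool (\<rho> u = i)) = 1 / 2 ^ k"
    and \<rho>diag: "\<And>l i. l < n \<Longrightarrow> i < 2 ^ k \<Longrightarrow> \<bar>Ex (\<lambda>u. of_bool (\<rho> u = i) * diag_fun (mm l) u) - diag_avg (mm l) / 2 ^ k\<bar> \<le> \<gamma>"
    and \<rho>B: "\<And>I I'. fst I < k \<Longrightarrow> snd I < 2 ^ fst I \<Longrightarrow> fst I' < k \<Longrightarrow> snd I' < 2 ^ fst I' \<Longrightarrow>
        \<bar>B (\<lambda>u. dhaar k I (\<rho> u)) (\<lambda>u. dhaar k I' (\<rho> u)) - (if I = I' then \<mu> / 2 ^ fst I else 0)\<bar> \<le> \<delta>"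
    using Suc.IH[OF kn(2)] by (elim exE conjE) blast
  \<comment> \<open>\<rho> depends only on the interval of level m, so its value there is read off
    at the leftmost atom.\<close>
  define R where "R t = \<rho> (t * 2 ^ (N - m))" for t
  have R: "\<rho> u = R (pre m u)" if "u < 2 ^ N" for u
  proof -
    have "pre m u * 2 ^ (N - m) < 2 ^ N" by (rule le_less_trans[OF _ that]) simp
    then show ?thesis unfolding R_def using that kn
      by (intro \<rho>pre[of k]) (auto simp: m_def)
  qed
  \<comment> \<open>The index set is \<open>dyadic n\<close> at every stage, so that one count
    suffices for all k. It contains the Haar functions chosen so far, and its other members still
    satisfy the bound 1.\<close>
  define \<Theta> where "\<Theta> = (\<lambda>I u. dhaar k I (\<rho> u)) ` dyadic n"
  define \<Delta> where "\<Delta> = (\<lambda>l. diag_fun (mm l)) ` {..<n}"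
  have "\<exists>\<sigma>. (\<forall>u. \<sigma> u = 1 \<or> \<sigma> u = -1) \<and> (\<forall>u v. pre (Suc m) u = pre (Suc m) v \<longrightarrow> \<sigma> u = \<sigma> v) \<and>
     (\<forall>i<2 ^ k. (\<Sum>u<2 ^ N. if \<rho> u = i then \<sigma> u else 0) = 0) \<and>
     (\<forall>i<2 ^ k. \<forall>g\<in>\<Theta>. \<bar>B (\<lambda>u. if \<rho> u = i then \<sigma> u else 0) g\<bar> \<le> \<gamma> \<and> \<bar>B g (\<lambda>u. if \<rho> u = i then \<sigma> u else 0)\<bar> \<le> \<gamma>) \<and>
     (\<forall>i<2 ^ k. \<forall>D\<in>\<Delta>. \<bar>Ex (\<lambda>u. (if \<rho> u = i then \<sigma> u else 0) * D u)\<bar> \<le> \<gamma>) \<and>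
     (\<forall>i<2 ^ k. \<forall>i'<2 ^ k. \<bar>B (\<lambda>u. if \<rho> u = i then \<sigma> u else 0) (\<lambda>u. if \<rho> u = i' then \<sigma> u else 0)
         - (if i = i' then \<Sum>t<2 ^ m. if R t = i then B (e m t) (e m t) else 0 else 0)\<bar> \<le> \<gamma>)"
  proof (rule sign_step[where \<rho> = \<rho> and R = R])
    show "m < N" by (rule m)
    show "\<rho> u = R (pre m u)" if "u < 2 ^ N" for u using R[OF that] .
    show "finite \<Theta>" "finite \<Delta>" by (auto simp: \<Theta>_def \<Delta>_def)
    show "\<bar>g u\<bar> \<le> 1" if "g \<in> \<Theta>" for g u using that by (auto simp: \<Theta>_def dhaar_abs_le)
    show "\<bar>D u\<bar> \<le> K" if "D \<in> \<Delta>" "u < 2 ^ N" for D u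
      using that mm(2) diag_fun_le less_imp_le by (fastforce simp: \<Delta>_def)
    have "card \<Theta> \<le> card (dyadic n)" unfolding \<Theta>_def by (intro card_image_le) auto
    moreover have "card \<Delta> \<le> n" unfolding \<Delta>_def using card_image_le[of "{..<n}"] by simp
    moreover have "(2::nat) ^ k \<le> 2 ^ n" "(4::nat) ^ k \<le> 4 ^ n" using kn by (auto intro: power_increasing)
    ultimately have "2 * 2 ^ k * card \<Theta> + 2 ^ k * card \<Delta> + 2 * 4 ^ k \<le> 2 * 2 ^ n * card (dyadic n) + 2 ^ n * n + 2 * 4 ^ n"
      by (intro add_mono mult_mono) auto
    then have "real (2 * 2 ^ k * card \<Theta> + 2 ^ k * card \<Delta> + 2 * 4 ^ k) \<le> real (2 * 2 ^ n * card (dyadic n) + 2 ^ n * n + 2 * 4 ^ n)"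
      by (rule of_nat_mono)
    then have "(2 * 2 ^ k * card \<Theta> + 2 ^ k * card \<Delta> + 2 * 4 ^ k) * (K\<^sup>2 * q m)
      \<le> (2 * 2 ^ n * card (dyadic n) + 2 ^ n * n + 2 * 4 ^ n) * (K\<^sup>2 * q m)"
      using q_nonneg by (intro mult_right_mono) auto
    also have "\<dots> \<le> \<gamma>\<^sup>2" using c[OF kn(1)] by (simp add: m_def)
    finally show "(2 * 2 ^ k * card \<Theta> + 2 ^ k * card \<Delta> + 2 * 4 ^ k) * (K\<^sup>2 * q m) \<le> \<gamma>\<^sup>2" .
  qed (use \<gamma> in auto)
  then obtain \<sigma> where \<sigma>: "\<And>u. \<sigma> u = 1 \<or> \<sigma> u = -1"
    and \<sigma>pre: "\<And>u v. pre (Suc m) u = pre (Suc m) v \<Longrightarrow> \<sigma> u = \<sigma> v"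
    and \<sigma>0: "\<And>i. i < 2 ^ k \<Longrightarrow> (\<Sum>u<2 ^ N. if \<rho> u = i then \<sigma> u else 0) = 0"
    and \<sigma>B: "\<And>i g. i < 2 ^ k \<Longrightarrow> g \<in> \<Theta> \<Longrightarrow> \<bar>B (\<lambda>u. if \<rho> u = i then \<sigma> u else 0) g\<bar> \<le> \<gamma> \<and> \<bar>B g (\<lambda>u. if \<rho> u = i then \<sigma> u else 0)\<bar> \<le> \<gamma>"
    and \<sigma>D: "\<And>i D. i < 2 ^ k \<Longrightarrow> D \<in> \<Delta> \<Longrightarrow> \<bar>Ex (\<lambda>u. (if \<rho> u = i then \<sigma> u else 0) * D u)\<bar> \<le> \<gamma>"
    and \<sigma>Q: "\<And>i i'. i < 2 ^ k \<Longrightarrow> i' < 2 ^ k \<Longrightarrow> \<bar>B (\<lambda>u. if \<rho> u = i then \<sigma> u else 0) (\<lambda>u. if \<rho> u = i' then \<sigma> u else 0)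
         - (if i = i' then \<Sum>t<2 ^ m. if R t = i then B (e m t) (e m t) else 0 else 0)\<bar> \<le> \<gamma>"
    by (elim exE conjE) blast
  define \<tau> where "\<tau> i u = (if \<rho> u = i then \<sigma> u else 0)" for i u
  \<comment> \<open>A binary digit is appended to the block number, 0 where \<sigma> = 1 and 1 where
    \<sigma> = -1. The Haar function of block i in the new numbering is then exactly \<sigma> on
    that block.\<close>
  define \<rho>' where "\<rho>' u = 2 * \<rho> u + (if \<sigma> u = 1 then 0 else 1)" for u
  have half: "\<rho>' u div 2 = \<rho> u" for u by (simp add: \<rho>'_def)
  have new: "(\<lambda>u. dhaar (Suc k) (k, i) (\<rho>' u)) = \<tau> i" for i
  proof
    fix u show "dhaar (Suc k) (k, i) (\<rho>' u) = \<tau> i u"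
      using half[of u] \<sigma>[of u] by (auto simp: dhaar_def \<tau>_def \<rho>'_def)
  qed
  have old: "(\<lambda>u. dhaar (Suc k) I (\<rho>' u)) = (\<lambda>u. dhaar k I (\<rho> u))" if "fst I < k" for I
    using dhaar_Suc[OF that] half by simp
  \<comment> \<open>The indicator of a half block is the mean of the indicator of its parent and of
    plus or minus \<tau>. This reduces mass and diagonal of the halves to those of the parent and to
    integrals against \<tau>.\<close>
  have ind: "of_bool (\<rho>' u = i) = (of_bool (\<rho> u = i div 2) + (if even i then 1 else -1) * \<tau> (i div 2) u) / 2" for u i
  proof (cases "\<rho> u = i div 2")
    case False
    then have "\<rho>' u \<noteq> i" using half[of u] by auto
    then show ?thesis using False by (simp add: \<tau>_def)
  next
    case True
    define a b :: nat where "a = (if \<sigma> u = 1 then 0 else 1)" and "b = (if even i then 0 else 1)"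
    have "i = 2 * (i div 2) + b" by (auto simp: b_def)
    then have "2 * \<rho> u + a = i \<longleftrightarrow> a = b" using True by linarith
    then have "\<rho>' u = i \<longleftrightarrow> a = b" by (simp add: \<rho>'_def a_def)
    then have "\<rho>' u = i \<longleftrightarrow> (\<sigma> u = 1 \<longleftrightarrow> even i)" by (auto simp: a_def b_def)
    then show ?thesis using True \<sigma>[of u] by (auto simp: \<tau>_def)
  qed
  have diag: "(\<Sum>t<2 ^ m. if R t = i then B (e m t) (e m t) else 0) = Ex (\<lambda>u. of_bool (\<rho> u = i) * diag_fun m u)" for i
  proof -
    have "Ex (\<lambda>u. of_bool (\<rho> u = i) * diag_fun m u)
      = Ex (\<lambda>u. (\<lambda>t. 2 ^ m * (if R t = i then B (e m t) (e m t) else 0)) (pre m u))"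
      unfolding Ex_def by (intro arg_cong2[where f = "(/)"] sum.cong) (auto simp: R diag_fun_def)
    also have "\<dots> = (\<Sum>t<2 ^ m. if R t = i then B (e m t) (e m t) else 0)"
      by (subst Ex_pre[OF m(2)]) (simp flip: sum_distrib_left)
    finally show ?thesis by simp
  qed
  have lev: "\<bar>B (\<tau> i) (\<tau> i') - (if i = i' then \<mu> / 2 ^ k else 0)\<bar> \<le> \<delta>" if "i < 2 ^ k" "i' < 2 ^ k" for i i'
  proof (cases "i = i'")
    case False
    then show ?thesis using \<sigma>Q[OF that] \<gamma> by (simp add: \<tau>_def[abs_def])
  next
    case True
    have 1: "\<bar>B (\<tau> i) (\<tau> i) - Ex (\<lambda>u. of_bool (\<rho> u = i) * diag_fun m u)\<bar> \<le> \<gamma>"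
      using \<sigma>Q[OF that(1,1)] by (simp add: \<tau>_def[abs_def] diag)
    have 2: "\<bar>Ex (\<lambda>u. of_bool (\<rho> u = i) * diag_fun m u) - diag_avg m / 2 ^ k\<bar> \<le> \<gamma>"
      using \<rho>diag[OF kn(1) that(1)] by (simp add: m_def)
    have "\<bar>diag_avg m / 2 ^ k - \<mu> / 2 ^ k\<bar> = \<bar>diag_avg m - \<mu>\<bar> / 2 ^ k"
      by (simp add: abs_divide flip: diff_divide_distrib)
    also have "\<dots> \<le> \<bar>diag_avg m - \<mu>\<bar> / 1" by (intro divide_left_mono) auto
    also have "\<dots> \<le> \<delta> / 2" using \<mu>[OF kn(1)] by (simp add: m_def)
    finally have 3: "\<bar>diag_avg m / 2 ^ k - \<mu> / 2 ^ k\<bar> \<le> \<delta> / 2" .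
    \<comment> \<open>Three errors: off-diagonal signs (\<gamma>), the diagonal seen by the block
      against the level average (\<gamma>), and the level average against \<mu> (\<delta>/2). The
      requirement \<gamma> \<le> \<delta>/4 keeps the total below \<delta>.\<close>
    have "\<bar>B (\<tau> i) (\<tau> i) - \<mu> / 2 ^ k\<bar> \<le> \<gamma> + \<gamma> + \<delta> / 2"
      using 1 2 3 by linarith
    also have "\<dots> \<le> \<delta>" using \<gamma> by linarith
    finally show ?thesis using True by simp
  qed
  show ?case
  proof (rule exI[of _ \<rho>'], intro conjI allI impI)
    show "\<rho>' u < 2 ^ Suc k" if "u < 2 ^ N" for u using \<rho>lt[OF that] by (auto simp: \<rho>'_def)
  next
    fix l u v assume l: "Suc k \<le> l" "l < n" and uv: "u < 2 ^ N" "v < 2 ^ N" and eq: "pre (mm l) u = pre (mm l) v"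
    have "Suc m \<le> mm l" using mm(1)[of k l] l by (simp add: m_def)
    then have "pre (Suc m) u = pre (Suc m) v"
      using pre_pre[of "Suc m" "mm l"] mm(2)[OF l(2)] eq by simp
    then have "\<sigma> u = \<sigma> v" by (rule \<sigma>pre)
    moreover have "\<rho> u = \<rho> v" using \<rho>pre[of l u v] l uv eq by simp
    ultimately show "\<rho>' u = \<rho>' v" by (simp add: \<rho>'_def)
  next
    fix i :: nat assume "i < 2 ^ Suc k"
    then have i: "i div 2 < 2 ^ k" by auto
    have "Ex (\<tau> (i div 2)) = 0" using \<sigma>0[OF i] by (simp add: Ex_def \<tau>_def)
    then show "Ex (\<lambda>u. of_bool (\<rho>' u = i)) = 1 / 2 ^ Suc k"
      unfolding ind Ex_lin using \<rho>unif[OF i] by simp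
    fix l assume l: "l < n"
    let ?E = "Ex (\<lambda>u. of_bool (\<rho> u = i div 2) * diag_fun (mm l) u)" and ?T = "Ex (\<lambda>u. \<tau> (i div 2) u * diag_fun (mm l) u)"
    have T: "\<bar>?T\<bar> \<le> \<gamma>" using \<sigma>D[OF i, of "diag_fun (mm l)"] l by (auto simp: \<Delta>_def \<tau>_def)
    have "Ex (\<lambda>u. of_bool (\<rho>' u = i) * diag_fun (mm l) u)
      = Ex (\<lambda>u. (of_bool (\<rho> u = i div 2) * diag_fun (mm l) u + (if even i then 1 else -1) * (\<tau> (i div 2) u * diag_fun (mm l) u)) / 2)"
      unfolding ind by (rule arg_cong[where f = Ex]) (auto simp: algebra_simps)
    also have "\<dots> = (?E + (if even i then 1 else -1) * ?T) / 2"
      by (rule Ex_lin)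
    \<comment> \<open>The error of a half block is half the sum of the error of the parent and a
      term of size \<gamma>. Thus the bound \<gamma> reproduces itself and does not accumulate over
      the stages.\<close>
    finally have "Ex (\<lambda>u. of_bool (\<rho>' u = i) * diag_fun (mm l) u) - diag_avg (mm l) / 2 ^ Suc k
      = ((?E - diag_avg (mm l) / 2 ^ k) + (if even i then 1 else -1) * ?T) / 2"
      by (simp add: algebra_simps)
    then show "\<bar>Ex (\<lambda>u. of_bool (\<rho>' u = i) * diag_fun (mm l) u) - diag_avg (mm l) / 2 ^ Suc k\<bar> \<le> \<gamma>"
      using \<rho>diag[OF l i] T by (auto split: if_splits)
  next
    fix I I' :: "nat \<times> nat"
    assume I: "fst I < Suc k" "snd I < 2 ^ fst I" and I': "fst I' < Suc k" "snd I' < 2 ^ fst I'"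
    have \<Theta>: "(\<lambda>u. dhaar k J (\<rho> u)) \<in> \<Theta>" if "fst J < k" "snd J < 2 ^ fst J" for J
      using that kn unfolding \<Theta>_def by (intro imageI) (auto simp: dyadic_def split: prod.splits)
    have \<gamma>\<delta>: "\<gamma> \<le> \<delta>" using \<gamma> by linarith
    consider "fst I < k" "fst I' < k" | "fst I = k" "fst I' < k" | "fst I < k" "fst I' = k" | "fst I = k" "fst I' = k"
      using I I' by linarith
    then show "\<bar>B (\<lambda>u. dhaar (Suc k) I (\<rho>' u)) (\<lambda>u. dhaar (Suc k) I' (\<rho>' u)) - (if I = I' then \<mu> / 2 ^ fst I else 0)\<bar> \<le> \<delta>"
    proof cases
      case 1
      then show ?thesis unfolding old[OF 1(1)] old[OF 1(2)] using I I' by (intro \<rho>B) auto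
    next
      case 2
      then obtain i where i: "I = (k, i)" by (metis prod.collapse)
      show ?thesis unfolding old[OF 2(2)] using 2 i new[of i] \<sigma>B[of i, OF _ \<Theta>[OF 2(2) I'(2)]] I \<gamma>\<delta>
        by (auto simp: \<tau>_def[abs_def])
    next
      case 3
      then obtain i where i: "I' = (k, i)" by (metis prod.collapse)
      show ?thesis unfolding old[OF 3(1)] using 3 i new[of i] \<sigma>B[of i, OF _ \<Theta>[OF 3(1) I(2)]] I' \<gamma>\<delta>
        by (auto simp: \<tau>_def[abs_def])
    next
      case 4
      then obtain i i' where i: "I = (k, i)" "I' = (k, i')" by (metis prod.collapse)
      show ?thesis using lev[of i i'] I I' unfolding i new by (auto split: if_splits)
    qed
  qed
qed

end

text \<open>The levels used by the construction must have nearly equal diagonal averages. These lie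
  in [-K,K]; cutting this range into cells of length \<delta>/2 and taking N large, some cell
  receives n levels above m0. N0 does not depend on the form, which matters because the form itself
  changes with N.\<close>

lemma gamlen_gaudet:
  fixes s K \<delta> :: real and n :: nat
  assumes s: "0 < s" "s < 1" and K: "0 \<le> K" and \<delta>: "0 < \<delta>" and n: "0 < n"
  shows "\<exists>N0. \<forall>N\<ge>N0. \<forall>B. bilinear_form N B K s \<longrightarrow>
    (\<exists>m<N. \<exists>\<rho>. (\<forall>u<2 ^ N. \<rho> u < (2::nat) ^ n) \<and>
       (\<forall>i<2 ^ n. (\<Sum>u<2 ^ N. of_bool (\<rho> u = i)) / 2 ^ N = 1 / (2::real) ^ n) \<and>
       (\<forall>I\<in>dyadic (n - 1). \<forall>I'\<in>dyadic (n - 1).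
          \<bar>B (\<lambda>u. dhaar n I (\<rho> u)) (\<lambda>u. dhaar n I' (\<rho> u))
            - (if I = I' then (\<Sum>t<2 ^ m. B (dhaar N (m, t)) (dhaar N (m, t))) / 2 ^ fst I else 0)\<bar> \<le> \<delta>))"
proof -
  define r where "r = min s (1 - s)"
  have r: "0 < r" using s by (simp add: r_def)
  define c1 where "c1 = (2 * 2 ^ n * real (card (dyadic n)) + 2 ^ n * n + 2 * 4 ^ n)"
  have c1: "0 \<le> c1" by (simp add: c1_def)
  have q_pow: "(1 / 2 ^ m) powr r = ((1/2) powr r) ^ m" for m :: nat
  proof -
    have "(1 / 2 ^ m :: real) = (1/2) powr m" by (simp add: powr_realpow power_one_over)
    moreover have "((1/2::real) powr r) ^ m = ((1/2) powr r) powr m" by (rule powr_realpow[symmetric]) simp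
    ultimately show ?thesis by (simp add: powr_powr mult.commute)
  qed
  have lt1: "(1/2::real) powr r < 1" using powr_less_mono2[of r "1/2" 1] r by simp
  \<comment> \<open>From this level on, \<open>q\<close> is small enough for \<gamma> = \<delta>/4.
    The summand 1 keeps the denominator positive when K = 0.\<close>
  obtain m0 where m0: "((1/2::real) powr r) ^ m0 < (\<delta> / 4)\<^sup>2 / (c1 * K\<^sup>2 + 1)"
    using real_arch_pow_inv[OF _ lt1, of "(\<delta> / 4)\<^sup>2 / (c1 * K\<^sup>2 + 1)"] \<delta> c1 by (auto simp: add_nonneg_pos)
  \<comment> \<open>Cells are labelled by the integer part of the average divided by \<delta>/2.
    This quotient has modulus at most 2 K / \<delta>, so all labels lie between -L and L.\<close>
  define L :: int where "L = \<lceil>2 * K / \<delta>\<rceil> + 1"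
  define cells where "cells = {- L..L}"
  have L: "0 \<le> L" using K \<delta> by (simp add: L_def) (smt (verit) divide_nonneg_pos mult_nonneg_nonneg ceiling_le_zero zero_le_ceiling)
  show ?thesis
  proof (rule exI[of _ "m0 + n * card cells"], intro allI impI)
    fix N B assume N: "m0 + n * card cells \<le> N" and "bilinear_form N B K s"
    then interpret bilinear_form N B K s by simp
    define f where "f m = \<lfloor>diag_avg m / (\<delta> / 2)\<rfloor>" for m
    have f_cells: "f \<in> {m0..<N} \<rightarrow> cells"
    proof
      fix m assume "m \<in> {m0..<N}"
      then have "\<bar>diag_avg m\<bar> \<le> K" using diag_avg_le by simp
      then have "\<bar>diag_avg m / (\<delta> / 2)\<bar> \<le> 2 * K / \<delta>"
        using \<delta> by (simp add: abs_divide abs_mult field_simps)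
      moreover have "2 * K / \<delta> \<le> L - 1" by (simp add: L_def)
      ultimately have "- real_of_int L \<le> diag_avg m / (\<delta> / 2)" "diag_avg m / (\<delta> / 2) < real_of_int L + 1"
        by linarith+
      then show "f m \<in> cells" unfolding f_def cells_def atLeastAtMost_iff le_floor_iff floor_le_iff by simp
    qed
    have "\<exists>y\<in>cells. card (f -` {y} \<inter> {m0..<N}) * card cells \<ge> card {m0..<N}"
      using L by (intro pigeonhole_card[OF f_cells]) (auto simp: cells_def)
    then obtain y where "card (f -` {y} \<inter> {m0..<N}) * card cells \<ge> card {m0..<N}" by blast
    then have "n * card cells \<le> card (f -` {y} \<inter> {m0..<N}) * card cells" using N unfolding card_atLeastLessThan by linarith
    then have "n \<le> card (f -` {y} \<inter> {m0..<N})" using L by (auto simp: cells_def)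
    then obtain A where A: "A \<subseteq> f -` {y} \<inter> {m0..<N}" "card A = n" "finite A"
      by (metis obtain_subset_with_card_n)
    define mm where "mm l = sorted_list_of_set A ! l" for l
    have mmA: "mm l \<in> A" if "l < n" for l
      using that A nth_mem[of l "sorted_list_of_set A"] by (simp add: mm_def)
    have mm1: "mm l < mm l'" if "l < l'" "l' < n" for l l'
      using that A sorted_wrt_nth_less[OF strict_sorted_list_of_set, of l l' A] by (simp add: mm_def)
    have mm2: "m0 \<le> mm l" "mm l < N" "f (mm l) = y" if "l < n" for l
      using mmA[OF that] A by auto
    define m where "m = mm 0"
    have m: "m < N" "f m = y" using mm2[OF n] by (auto simp: m_def)
    have avg: "\<bar>diag_avg (mm l) - diag_avg m\<bar> \<le> \<delta> / 2" if "l < n" for l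
    proof -
      have "\<lfloor>diag_avg (mm l) / (\<delta> / 2)\<rfloor> = \<lfloor>diag_avg m / (\<delta> / 2)\<rfloor>"
        using mm2(3)[OF that] m(2) by (simp add: f_def)
      then have "\<bar>diag_avg (mm l) / (\<delta> / 2) - diag_avg m / (\<delta> / 2)\<bar> \<le> 1" by linarith
      then have "\<bar>diag_avg (mm l) * 2 - diag_avg m * 2\<bar> \<le> \<delta>"
        using \<delta> by (simp add: abs_divide flip: diff_divide_distrib)
      then show ?thesis by linarith
    qed
    have "\<exists>\<rho>. (\<forall>u<2 ^ N. \<rho> u < 2 ^ n) \<and>
     (\<forall>l u v. n \<le> l \<longrightarrow> l < n \<longrightarrow> u < 2 ^ N \<longrightarrow> v < 2 ^ N \<longrightarrow> pre (mm l) u = pre (mm l) v \<longrightarrow> \<rho> u = \<rho> v) \<and>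
     (\<forall>i<2 ^ n. Ex (\<lambda>u. of_bool (\<rho> u = i)) = 1 / 2 ^ n) \<and>
     (\<forall>l<n. \<forall>i<2 ^ n. \<bar>Ex (\<lambda>u. of_bool (\<rho> u = i) * diag_fun (mm l) u) - diag_avg (mm l) / 2 ^ n\<bar> \<le> \<delta> / 4) \<and>
     (\<forall>I I'. fst I < n \<longrightarrow> snd I < 2 ^ fst I \<longrightarrow> fst I' < n \<longrightarrow> snd I' < 2 ^ fst I' \<longrightarrow>
        \<bar>B (\<lambda>u. dhaar n I (\<rho> u)) (\<lambda>u. dhaar n I' (\<rho> u)) - (if I = I' then diag_avg m / 2 ^ fst I else 0)\<bar> \<le> \<delta>)"
    proof (rule gamlen_gaudet_induct[OF mm1 _ avg])
      fix l assume l: "l < n"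
      have "q (mm l) = ((1/2) powr r) ^ mm l" unfolding q_def r_def[symmetric] q_pow ..
      also have "\<dots> \<le> ((1/2) powr r) ^ m0" using mm2(1)[OF l] lt1 by (intro power_decreasing) auto
      finally have q: "q (mm l) \<le> (\<delta> / 4)\<^sup>2 / (c1 * K\<^sup>2 + 1)" using m0 by linarith
      have "c1 * (K\<^sup>2 * q (mm l)) \<le> (c1 * K\<^sup>2 + 1) * q (mm l)"
        using q_nonneg by (simp add: algebra_simps)
      also have "\<dots> \<le> (c1 * K\<^sup>2 + 1) * ((\<delta> / 4)\<^sup>2 / (c1 * K\<^sup>2 + 1))"
        using q c1 by (intro mult_left_mono) auto
      also have "\<dots> = (\<delta> / 4)\<^sup>2"
      proof -
        have "c1 * K\<^sup>2 + 1 \<noteq> 0" using c1 by (smt (verit) mult_nonneg_nonneg zero_le_power2)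
        then show ?thesis by simp
      qed
      finally show "(2 * 2 ^ n * card (dyadic n) + 2 ^ n * n + 2 * 4 ^ n) * (K\<^sup>2 * q (mm l)) \<le> (\<delta> / 4)\<^sup>2"
        by (simp add: c1_def)
    qed (use mm2 \<delta> in auto)
    then obtain \<rho> where \<rho>: "\<forall>u<2 ^ N. \<rho> u < 2 ^ n" "\<forall>i<2 ^ n. Ex (\<lambda>u. of_bool (\<rho> u = i)) = 1 / 2 ^ n"
      "\<forall>I I'. fst I < n \<longrightarrow> snd I < 2 ^ fst I \<longrightarrow> fst I' < n \<longrightarrow> snd I' < 2 ^ fst I' \<longrightarrow>
        \<bar>B (\<lambda>u. dhaar n I (\<rho> u)) (\<lambda>u. dhaar n I' (\<rho> u)) - (if I = I' then diag_avg m / 2 ^ fst I else 0)\<bar> \<le> \<delta>"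
      by (elim exE conjE) blast
    have dy: "fst I < n" "snd I < 2 ^ fst I" if "I \<in> dyadic (n - 1)" for I
      using that n by (auto simp: dyadic_def)
    show "\<exists>m<N. \<exists>\<rho>. (\<forall>u<2 ^ N. \<rho> u < (2::nat) ^ n) \<and>
       (\<forall>i<2 ^ n. (\<Sum>u<2 ^ N. of_bool (\<rho> u = i)) / 2 ^ N = 1 / (2::real) ^ n) \<and>
       (\<forall>I\<in>dyadic (n - 1). \<forall>I'\<in>dyadic (n - 1).
          \<bar>B (\<lambda>u. dhaar n I (\<rho> u)) (\<lambda>u. dhaar n I' (\<rho> u))
            - (if I = I' then (\<Sum>t<2 ^ m. B (dhaar N (m, t)) (dhaar N (m, t))) / 2 ^ fst I else 0)\<bar> \<le> \<delta>)"
    proof (rule exI[of _ m], intro conjI m(1) exI[of _ \<rho>] ballI)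
      show "\<forall>i<2 ^ n. (\<Sum>u<2 ^ N. of_bool (\<rho> u = i)) / 2 ^ N = 1 / (2::real) ^ n"
        using \<rho>(2) by (simp add: Ex_def)
      show "\<bar>B (\<lambda>u. dhaar n I (\<rho> u)) (\<lambda>u. dhaar n I' (\<rho> u))
            - (if I = I' then (\<Sum>t<2 ^ m. B (dhaar N (m, t)) (dhaar N (m, t))) / 2 ^ fst I else 0)\<bar> \<le> \<delta>"
        if "I \<in> dyadic (n - 1)" "I' \<in> dyadic (n - 1)" for I I'
        using \<rho>(3)[rule_format, OF dy[OF that(1)] dy[OF that(2)]] unfolding diag_avg_def .
    qed (rule \<rho>(1))
  qed
qed

section \<open>Independent uniform copies\<close>

lemma Lp_approx_bounded:
  assumes p: "1 \<le> p" and f: "f \<in> Lp p" and e: "0 < e"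
  shows "\<exists>g B. g \<in> borel_measurable M01 \<and> (\<forall>x. \<bar>g x\<bar> \<le> B) \<and> lpnorm p (\<lambda>x. f x - g x) < e"
proof -
  note [measurable] = LpD(1)[OF f]
  define g where "g k x = (if \<bar>f x\<bar> \<le> real k then f x else 0)" for k :: nat and x
  have [measurable]: "g k \<in> borel_measurable M01" for k unfolding g_def by measurable
  have bd: "\<bar>g k x\<bar> \<le> real k" for k x by (simp add: g_def)
  have "(\<lambda>k. LINT x|M01. \<bar>f x - g k x\<bar> powr p) \<longlonglongrightarrow> (LINT x|M01. 0)"
  proof (rule integral_dominated_convergence[where w = "\<lambda>x. \<bar>f x\<bar> powr p"])
    show "integrable M01 (\<lambda>x. \<bar>f x\<bar> powr p)" using f by auto
    show "AE x in M01. (\<lambda>k. \<bar>f x - g k x\<bar> powr p) \<longlonglongrightarrow> 0"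
    proof (intro AE_I2)
      fix x
      obtain k0 where k0: "\<bar>f x\<bar> \<le> real k0" using real_arch_simple by blast
      have "\<bar>f x - g k x\<bar> powr p = 0" if "k0 \<le> k" for k using k0 that by (simp add: g_def)
      then show "(\<lambda>k. \<bar>f x - g k x\<bar> powr p) \<longlonglongrightarrow> 0"
        by (intro tendsto_eventually eventually_sequentiallyI[of k0])
    qed
    show "AE x in M01. norm (\<bar>f x - g k x\<bar> powr p) \<le> \<bar>f x\<bar> powr p" for k
      using p by (intro AE_I2) (auto simp: g_def intro!: powr_mono2)
  qed auto
  then have "(\<lambda>k. LINT x|M01. \<bar>f x - g k x\<bar> powr p) \<longlonglongrightarrow> 0" by simp
  then obtain k where k: "norm ((LINT x|M01. \<bar>f x - g k x\<bar> powr p) - 0) < (e / 2) powr p"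
    using e LIMSEQ_D[of "\<lambda>k. LINT x|M01. \<bar>f x - g k x\<bar> powr p" 0 "(e / 2) powr p"] by auto
  then have "lpnorm p (\<lambda>x. f x - g k x) \<le> e / 2"
    using p e by (subst lpnorm_le_iff) auto
  then show ?thesis using e bd[of k] by (intro exI[of _ "g k"] exI[of _ "real k"]) auto
qed

text \<open>\<open>Rosenthal\<close> is stated for p > 2. At p = 2 the von Bahr--Esseen inequality
  takes its place, with 2 p = 4.\<close>

definition Rosenthal_const :: "real \<Rightarrow> real" where "Rosenthal_const p = (if p = 2 then 4 else 2 * expand_const p)"

lemma Rosenthal_const_nonneg: "2 \<le> p \<Longrightarrow> 0 \<le> Rosenthal_const p" by (simp add: Rosenthal_const_def expand_const_def)

lemma (in indep_centered) Rosenthal_ge_2: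
  assumes p: "2 \<le> p" and G: "G \<subseteq> F"
  shows "(LINT x|M01. \<bar>\<Sum>i\<in>G. X i x\<bar> powr p)
    \<le> (Rosenthal_const p * (\<Sum>i\<in>G. LINT x|M01. \<bar>X i x\<bar> powr 2)) powr (p / 2)
      + Rosenthal_const p * (\<Sum>i\<in>G. LINT x|M01. \<bar>X i x\<bar> powr p)"
proof (cases "p = 2")
  case True
  have "(LINT x|M01. \<bar>\<Sum>i\<in>G. X i x\<bar> powr p) \<le> Rosenthal_const p * (\<Sum>i\<in>G. LINT x|M01. \<bar>X i x\<bar> powr p)"
    using von_Bahr_Esseen[OF _ _ G, of p] True by (simp add: Rosenthal_const_def)
  then show ?thesis by (rule order_trans) simp
next
  case False
  then have "2 < p" using p by simp
  then show ?thesis using Rosenthal[OF _ G, of p] False by (simp add: Rosenthal_const_def)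
qed

text \<open>\<open>W n x\<close> is the number of the atom of the n-th copy that contains x. The
  bound by 2^n is demanded for every x and not just almost everywhere, so that identities between
  functions of \<open>W n\<close> hold pointwise.\<close>

locale copies =
  fixes W :: "nat \<Rightarrow> real \<Rightarrow> nat"
  assumes W_lt: "\<And>n x. 1 \<le> n \<Longrightarrow> W n x < 2 ^ n"
    and W_meas: "\<And>n. 1 \<le> n \<Longrightarrow> W n \<in> measurable M01 (count_space UNIV)"
    and W_unif: "\<And>n u. 1 \<le> n \<Longrightarrow> u < 2 ^ n \<Longrightarrow> measure M01 {x \<in> space M01. W n x = u} = 1 / 2 ^ n"
    and W_indep: "M01.indep_vars (\<lambda>_. count_space UNIV) W {1..}"
begin

section \<open>Coefficients and partial sums for a system of copies\<close>

lemma gW_meas: "1 \<le> n \<Longrightarrow> (\<lambda>x. g (W n x)) \<in> measurable M01 M" if "range g \<subseteq> space M"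
  using that by (intro measurable_compose[OF W_meas]) (auto simp: measurable_count_space_eq1)

lemma gW_borel [measurable]: "1 \<le> n \<Longrightarrow> (\<lambda>x. g (W n x)) \<in> borel_measurable M01"
  by (rule gW_meas) auto

lemma gW_bdd: "1 \<le> n \<Longrightarrow> \<bar>g (W n x) :: real\<bar> \<le> (\<Sum>u<2 ^ n. \<bar>g u\<bar>)"
  using W_lt[of n x] by (intro member_le_sum[of _ _ "\<lambda>u. \<bar>g u\<bar>"]) auto

lemma gW_expand: "1 \<le> n \<Longrightarrow> g (W n x) = (\<Sum>u<2 ^ n. (g u :: real) * of_bool (W n x = u))"
  using W_lt[of n x] by (subst sum.remove[of _ "W n x"]) (auto intro!: sum.neutral)

lemma ind_meas [measurable]: "1 \<le> n \<Longrightarrow> (\<lambda>x. of_bool (W n x = u) :: real) \<in> borel_measurable M01"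
  using gW_borel[of n "\<lambda>w. of_bool (w = u)"] .

lemma gW_integrable: "1 \<le> n \<Longrightarrow> integrable M01 (\<lambda>x. g (W n x) :: real)"
  using gW_bdd by (intro integrable_bounded) auto

lemma mult_ind_integrable: "1 \<le> n \<Longrightarrow> integrable M01 f \<Longrightarrow> integrable M01 (\<lambda>x. f x * of_bool (W n x = u) :: real)"
  by (rule Bochner_Integration.integrable_bound[of M01 f]) (auto simp: abs_mult)

lemma mult_gW_integrable: "1 \<le> n \<Longrightarrow> integrable M01 f \<Longrightarrow> integrable M01 (\<lambda>x. f x * g (W n x) :: real)"
proof -
  assume n: "1 \<le> n" and f: "integrable M01 f"
  note [measurable] = gW_borel[OF n] borel_measurable_integrable[OF f]
  define b where "b = (\<Sum>u<2 ^ n. \<bar>g u\<bar>)"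
  show "integrable M01 (\<lambda>x. f x * g (W n x))"
  proof (rule Bochner_Integration.integrable_bound)
    show "integrable M01 (\<lambda>x. f x * b)" using f by auto
    show "AE x in M01. norm (f x * g (W n x)) \<le> norm (f x * b)"
    proof (intro AE_I2)
      fix x
      have "\<bar>g (W n x)\<bar> \<le> \<bar>b\<bar>" using gW_bdd[OF n, of g x] unfolding b_def by linarith
      then show "norm (f x * g (W n x)) \<le> norm (f x * b)"
        unfolding real_norm_def abs_mult by (intro mult_left_mono) auto
    qed
  qed measurable
qed

lemma integral_ind: "1 \<le> n \<Longrightarrow> u < 2 ^ n \<Longrightarrow> (LINT x|M01. of_bool (W n x = u) :: real) = 1 / 2 ^ n"
proof -
  assume n: "1 \<le> n" and u: "u < 2 ^ n"
  have "(LINT x|M01. of_bool (W n x = u) :: real) = (LINT x|M01. indicator {x \<in> space M01. W n x = u} x)"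
    by (intro Bochner_Integration.integral_cong) (auto simp: indicator_def)
  also have "\<dots> = measure M01 {x \<in> space M01. W n x = u}"
    by (auto intro!: arg_cong[where f = "measure M01"])
  finally show ?thesis using W_unif[OF n u] by simp
qed

lemma integral_mult_gW:
  assumes n: "1 \<le> n" and f: "integrable M01 f"
  shows "(LINT x|M01. f x * g (W n x)) = (\<Sum>u<2 ^ n. g u * (LINT x|M01. f x * of_bool (W n x = u) :: real))"
proof -
  have "(LINT x|M01. f x * g (W n x)) = (LINT x|M01. (\<Sum>u<2 ^ n. g u * (f x * of_bool (W n x = u))))"
  proof (intro Bochner_Integration.integral_cong refl)
    fix x show "f x * g (W n x) = (\<Sum>u<2 ^ n. g u * (f x * of_bool (W n x = u)))"
      by (subst gW_expand[OF n]) (auto simp: sum_distrib_left mult_ac intro!: sum.cong)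
  qed
  also have "\<dots> = (\<Sum>u<2 ^ n. LINT x|M01. g u * (f x * of_bool (W n x = u)))"
    using mult_ind_integrable[OF n f] by (intro Bochner_Integration.integral_sum) auto
  finally show ?thesis by simp
qed

lemma integral_gW: "1 \<le> n \<Longrightarrow> (LINT x|M01. g (W n x) :: real) = (\<Sum>u<2 ^ n. g u) / 2 ^ n"
  using integral_mult_gW[of n "\<lambda>_. 1" g] by (simp add: integral_ind sum_divide_distrib)

text \<open>\<open>G n f\<close> is the conditional expectation of \<open>f - \<integral>f\<close> given \<open>W n\<close>, as a function of the value of \<open>W n\<close>.\<close>
definition G :: "nat \<Rightarrow> (real \<Rightarrow> real) \<Rightarrow> nat \<Rightarrow> real" where
  "G n f u = 2 ^ n * (LINT x|M01. f x * of_bool (W n x = u)) - (LINT x|M01. f x)"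

text \<open>The partial sums of the orthogonal projection onto the span of all copies.\<close>

definition S :: "nat \<Rightarrow> (real \<Rightarrow> real) \<Rightarrow> real \<Rightarrow> real" where
  "S M f x = (\<Sum>n\<in>{1..M}. G n f (W n x))"

lemma G_lincomb:
  assumes "1 \<le> n" "integrable M01 f" "integrable M01 g"
  shows "G n (\<lambda>x. a * f x + b * g x) u = a * G n f u + b * G n g u"
proof -
  have "(LINT x|M01. (a * f x + b * g x) * of_bool (W n x = u))
    = (LINT x|M01. a * (f x * of_bool (W n x = u)) + b * (g x * of_bool (W n x = u)))"
    by (intro Bochner_Integration.integral_cong) (auto simp: algebra_simps)
  then show ?thesis
    using assms mult_ind_integrable[of n f u] mult_ind_integrable[of n g u]
    by (simp add: G_def algebra_simps)
qed

lemma G_cong_AE: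
  assumes "1 \<le> n" "eqae f g" "f \<in> borel_measurable M01" "g \<in> borel_measurable M01"
  shows "G n f u = G n g u"
proof -
  note [measurable] = assms(3,4) ind_meas[OF assms(1)]
  have "(LINT x|M01. f x * of_bool (W n x = u)) = (LINT x|M01. g x * of_bool (W n x = u))"
    "(LINT x|M01. f x) = (LINT x|M01. g x)"
    using assms(2) by (auto intro!: integral_cong_AE simp: eqae_def)
  then show ?thesis by (simp add: G_def)
qed

lemma G_sum_zero: "1 \<le> n \<Longrightarrow> integrable M01 f \<Longrightarrow> (\<Sum>u<2 ^ n. G n f u) = 0"
  using integral_mult_gW[of n f "\<lambda>_. 1"] by (simp add: G_def sum_subtractf flip: sum_distrib_left)

text \<open>Conditioning on \<open>W n\<close> replaces f by its conditional expectation, and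
  subtracting the mean changes nothing because k sums to 0.\<close>

lemma integral_mult_centered:
  assumes n: "1 \<le> n" and f: "integrable M01 f" and k: "(\<Sum>u<2 ^ n. k u) = 0"
  shows "(LINT x|M01. f x * k (W n x)) = (LINT x|M01. G n f (W n x) * k (W n x))"
proof -
  have "(LINT x|M01. G n f (W n x) * k (W n x)) = (\<Sum>u<2 ^ n. G n f u * k u) / 2 ^ n"
    using integral_gW[OF n, of "\<lambda>w. G n f w * k w"] .
  also have "(\<Sum>u<2 ^ n. G n f u * k u)
    = (\<Sum>u<2 ^ n. 2 ^ n * (k u * (LINT x|M01. f x * of_bool (W n x = u)))) - (\<Sum>u<2 ^ n. (LINT x|M01. f x) * k u)"
    unfolding sum_subtractf[symmetric] by (intro sum.cong) (auto simp: G_def algebra_simps)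
  also have "\<dots> = 2 ^ n * (LINT x|M01. f x * k (W n x))"
    unfolding integral_mult_gW[OF n f] sum_distrib_left[symmetric] k by simp
  finally show ?thesis by simp
qed

lemma indep_gW:
  assumes "F \<subseteq> {1..}"
  shows "M01.indep_vars (\<lambda>_. borel) (\<lambda>n x. k n (W n x) :: real) F"
  by (rule M01.indep_vars_compose2[OF M01.indep_vars_subset[OF W_indep assms]]) auto

lemma indep_centered_gW:
  assumes "finite F" "F \<subseteq> {1..}" "\<And>n. n \<in> F \<Longrightarrow> (\<Sum>u<2 ^ n. k n u) = 0"
  shows "indep_centered (\<lambda>n x. k n (W n x)) F (\<lambda>n. \<Sum>u<2 ^ n. \<bar>k n u\<bar>)"
proof
  show "\<bar>k i (W i x)\<bar> \<le> (\<Sum>u<2 ^ i. \<bar>k i u\<bar>)" if "i \<in> F" for i x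
    using that assms(2) by (intro gW_bdd) auto
  show "(LINT x|M01. k i (W i x)) = 0" if "i \<in> F" for i
    using that assms by (subst integral_gW) auto
qed (use assms indep_gW in auto)

lemma G_own:
  assumes n: "1 \<le> n" "u < 2 ^ n" and k: "(\<Sum>u<2 ^ n. k u) = 0"
  shows "G n (\<lambda>x. k (W n x)) u = k u"
proof -
  have "(LINT x|M01. k (W n x) * of_bool (W n x = u)) = (\<Sum>w<2 ^ n. k w * of_bool (w = u)) / 2 ^ n"
    using integral_gW[OF n(1), of "\<lambda>w. k w * of_bool (w = u)"] .
  also have "(\<Sum>w<2 ^ n. k w * of_bool (w = u)) = k u"
    using n by (subst sum.remove[of _ u]) (auto intro!: sum.neutral)
  finally show ?thesis using k n by (simp add: G_def integral_gW)
qed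

lemma G_other:
  assumes n: "1 \<le> n" "1 \<le> m" "n \<noteq> m" "u < 2 ^ n" and k: "(\<Sum>u<2 ^ m. k u) = 0"
  shows "G n (\<lambda>x. k (W m x)) u = 0"
proof -
  \<comment> \<open>The independence of a member from a sum of other members is available for one
    family; \<open>kk\<close> packs the two different functions into one family, and the sum has a
    single term.\<close>
  define kk where "kk i = (if i = m then k else (\<lambda>w. of_bool (w = u)))" for i
  have "M01.indep_vars (\<lambda>_. borel) (\<lambda>n x. kk n (W n x)) {n, m}"
    using n by (intro indep_gW) auto
  then have "M01.indep_var borel (\<lambda>x. kk m (W m x)) borel (\<lambda>x. \<Sum>i\<in>{n}. kk i (W i x))"
    using n by (intro M01.indep_vars_sum) (auto simp: insert_commute)
  then have "M01.indep_var borel (\<lambda>x. k (W m x)) borel (\<lambda>x. of_bool (W n x = u))"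
  proof -
    have "(\<lambda>x. \<Sum>i\<in>{n}. kk i (W i x)) = (\<lambda>x. kk n (W n x))" by simp
    moreover have "kk n = (\<lambda>w. of_bool (w = u))" "kk m = k" using n by (auto simp: kk_def)
    moreover assume "M01.indep_var borel (\<lambda>x. kk m (W m x)) borel (\<lambda>x. \<Sum>i\<in>{n}. kk i (W i x))"
    ultimately show ?thesis by (simp only:)
  qed
  then have "(LINT x|M01. k (W m x) * of_bool (W n x = u)) = (LINT x|M01. k (W m x)) * (LINT x|M01. of_bool (W n x = u))"
    using gW_integrable[OF n(2), of k] gW_integrable[OF n(1), of "\<lambda>w. of_bool (w = u)"]
    by (intro M01.indep_var_lebesgue_integral)
  moreover have "(LINT x|M01. k (W m x)) = 0" using integral_gW[OF n(2), of k] k by simp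
  ultimately show ?thesis by (simp add: G_def)
qed

lemma G_sum:
  assumes "1 \<le> n" "finite F" "\<And>i. i \<in> F \<Longrightarrow> integrable M01 (f i)"
  shows "G n (\<lambda>x. \<Sum>i\<in>F. f i x) u = (\<Sum>i\<in>F. G n (f i) u)"
  using assms(2,3)
proof (induction F rule: finite_induct)
  case empty
  then show ?case by (simp add: G_def)
next
  case (insert i F)
  then show ?case using G_lincomb[OF assms(1), of "f i" "\<lambda>x. \<Sum>i\<in>F. f i x" 1 1 u] by auto
qed

lemma G_partial:
  assumes "1 \<le> n" "u < 2 ^ n" "\<And>i. i \<in> {1..M} \<Longrightarrow> (\<Sum>u<2 ^ i. k i u) = 0"
  shows "G n (\<lambda>x. \<Sum>i\<in>{1..M}. k i (W i x)) u = (if n \<le> M then k n u else 0)"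
proof -
  have "G n (\<lambda>x. \<Sum>i\<in>{1..M}. k i (W i x)) u = (\<Sum>i\<in>{1..M}. G n (\<lambda>x. k i (W i x)) u)"
    using assms gW_integrable by (intro G_sum) auto
  also have "\<dots> = (\<Sum>i\<in>{1..M}. if i = n then k n u else 0)"
    using assms by (intro sum.cong) (auto simp: G_own G_other)
  finally show ?thesis using assms by simp
qed

lemma partial_meas: "F \<subseteq> {1..} \<Longrightarrow> (\<lambda>x. \<Sum>i\<in>F. k i (W i x) :: real) \<in> borel_measurable M01"
  by (intro borel_measurable_sum gW_borel) auto

lemma partial_bdd: "F \<subseteq> {1..} \<Longrightarrow> \<bar>\<Sum>i\<in>F. k i (W i x) :: real\<bar> \<le> (\<Sum>i\<in>F. \<Sum>u<2 ^ i. \<bar>k i u\<bar>)"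
  by (rule order_trans[OF sum_abs sum_mono]) (auto intro!: gW_bdd)

lemma partial_Lp: "F \<subseteq> {1..} \<Longrightarrow> 0 < r \<Longrightarrow> (\<lambda>x. \<Sum>i\<in>F. k i (W i x) :: real) \<in> Lp r"
  using partial_meas partial_bdd by (intro Lp_bounded) auto

lemma S_Lp: "0 < r \<Longrightarrow> S M f \<in> Lp r"
  unfolding S_def[abs_def] by (rule partial_Lp) auto

lemma S_partial:
  assumes "\<And>i. i \<in> {1..M} \<Longrightarrow> (\<Sum>u<2 ^ i. k i u) = 0" "M \<le> M'"
  shows "S M' (\<lambda>x. \<Sum>i\<in>{1..M}. k i (W i x)) x = (\<Sum>i\<in>{1..M}. k i (W i x))"
proof -
  have "S M' (\<lambda>x. \<Sum>i\<in>{1..M}. k i (W i x)) x = (\<Sum>n\<in>{1..M'}. if n \<le> M then k n (W n x) else 0)"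
    unfolding S_def using assms W_lt by (intro sum.cong refl G_partial) auto
  also have "\<dots> = (\<Sum>n\<in>{1..M}. k n (W n x))"
    using assms(2) by (intro sum.mono_neutral_cong_right) auto
  finally show ?thesis .
qed

lemma S_lincomb:
  assumes "integrable M01 f" "integrable M01 g"
  shows "S M (\<lambda>x. a * f x + b * g x) x = a * S M f x + b * S M g x"
  unfolding S_def sum_distrib_left sum.distrib[symmetric] using assms
  by (intro sum.cong refl G_lincomb) auto

lemma S_diff:
  assumes "integrable M01 f" "integrable M01 g"
  shows "S M (\<lambda>x. f x - g x) x = S M f x - S M g x"
  using S_lincomb[OF assms, of M 1 "-1" x] by simp

lemma S_cong_AE:
  assumes "eqae f g" "f \<in> borel_measurable M01" "g \<in> borel_measurable M01"
  shows "S M f = S M g"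
  unfolding S_def[abs_def] using assms by (intro ext sum.cong refl G_cong_AE) auto

text \<open>The right-hand side is symmetric in f and g, which makes every partial sum operator
  self-adjoint.\<close>

lemma pair_S:
  assumes "integrable M01 f" "integrable M01 g"
  shows "pair (S M f) g = (\<Sum>n\<in>{1..M}. LINT x|M01. G n f (W n x) * G n g (W n x))"
proof -
  have "pair (S M f) g = (LINT x|M01. (\<Sum>n\<in>{1..M}. g x * G n f (W n x)))"
    unfolding pair_def S_def by (simp add: sum_distrib_left mult.commute)
  also have "\<dots> = (\<Sum>n\<in>{1..M}. LINT x|M01. g x * G n f (W n x))"
    using assms by (intro Bochner_Integration.integral_sum mult_gW_integrable) auto
  also have "\<dots> = (\<Sum>n\<in>{1..M}. LINT x|M01. G n g (W n x) * G n f (W n x))"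
    using assms by (intro sum.cong refl integral_mult_centered) (auto simp: G_sum_zero)
  finally show ?thesis by (simp add: mult.commute)
qed

lemma pair_S_sym:
  assumes "integrable M01 f" "integrable M01 g"
  shows "pair (S M f) g = pair f (S M g)"
proof -
  have "pair f (S M g) = pair (S M g) f" by (simp add: pair_def mult.commute)
  then show ?thesis using pair_S[OF assms] pair_S[OF assms(2,1)] by (simp add: mult.commute)
qed

text \<open>With q = p/(p-1): 2 q is the von Bahr--Esseen constant, 2^q * 2 is the price of centring
  the dual coefficients, and the exponent p - 1 = p/q arises when the self-referring bound at the
  end of the next proof is solved.\<close>

definition pow_const :: "real \<Rightarrow> real" where
  "pow_const p = (2 * (p / (p - 1)) * (2 powr (p / (p - 1)) * 2)) powr (p - 1)"

text \<open>Testing \<open>f\<close> against the centred duals of its coefficients reduces the claim to the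
  von Bahr--Esseen inequality for the conjugate exponent.\<close>
lemma sum_power_coeff_le:
  assumes p: "2 \<le> p" and f: "f \<in> Lp p"
  shows "(\<Sum>n\<in>{1..M}. LINT x|M01. \<bar>G n f (W n x)\<bar> powr p) \<le> pow_const p * lpnorm p f powr p"
proof -
  define q where "q = p / (p - 1)"
  have q: "1 < q" "q \<le> 2" "1 / p + 1 / q = 1" "(p - 1) * q = p" "p / q = p - 1"
    using p by (auto simp: q_def field_simps)
  have p1: "1 < p" "1 \<le> p" using p by auto
  have fi: "integrable M01 f" using Lp_integrable[OF _ f] p by simp
  define Bs where "Bs = (\<Sum>n\<in>{1..M}. LINT x|M01. \<bar>G n f (W n x)\<bar> powr p)"
  \<comment> \<open>The dual coefficient: G times Y is |G|^p, and |Y|^q = |G|^p as well. Its mean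
    \<open>a n\<close> is removed below to make the terms centred, which does not affect the pairing
    with the centred G.\<close>
  define Y where "Y n u = sgpow (p - 1) (G n f u)" for n u
  define a where "a n = (\<Sum>u<2 ^ n. Y n u) / 2 ^ n" for n
  define k where "k n u = Y n u - a n" for n u
  have k0: "(\<Sum>u<2 ^ n. k n u) = 0" for n by (simp add: k_def a_def sum_subtractf)
  interpret Z: indep_centered "\<lambda>n x. k n (W n x)" "{1..M}" "\<lambda>n. \<Sum>u<2 ^ n. \<bar>k n u\<bar>"
    using k0 by (intro indep_centered_gW) auto
  let ?Z = "\<lambda>x. \<Sum>n\<in>{1..M}. k n (W n x)"
  have ZL: "?Z \<in> Lp q" using q by (intro partial_Lp) auto
  have B0: "0 \<le> Bs" by (auto simp: Bs_def intro!: sum_nonneg)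
  have dual: "(LINT x|M01. f x * k n (W n x)) = (LINT x|M01. \<bar>G n f (W n x)\<bar> powr p)" if n: "1 \<le> n" for n
  proof -
    have "(LINT x|M01. f x * k n (W n x)) = (LINT x|M01. G n f (W n x) * k n (W n x))"
      using n fi k0 by (rule integral_mult_centered)
    also have "\<dots> = (LINT x|M01. \<bar>G n f (W n x)\<bar> powr p - a n * G n f (W n x))"
      by (intro Bochner_Integration.integral_cong) (auto simp: k_def Y_def algebra_simps mult_sgpow)
    also have "\<dots> = (LINT x|M01. \<bar>G n f (W n x)\<bar> powr p) - a n * (LINT x|M01. G n f (W n x))"
      using gW_integrable[OF n, of "\<lambda>u. \<bar>G n f u\<bar> powr p"] gW_integrable[OF n, of "G n f"] by simp
    also have "(LINT x|M01. G n f (W n x)) = 0"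
      using integral_gW[OF n, of "G n f"] G_sum_zero[OF n fi] by simp
    finally show ?thesis by simp
  qed
  have "Bs = (\<Sum>n\<in>{1..M}. LINT x|M01. f x * k n (W n x))"
    unfolding Bs_def by (intro sum.cong) (auto simp: dual)
  also have "\<dots> = pair f ?Z"
    unfolding pair_def sum_distrib_left
    using fi by (intro Bochner_Integration.integral_sum[symmetric] mult_gW_integrable) auto
  also have "\<dots> \<le> lpnorm p f * lpnorm q ?Z"
    using pair_le_lpnorm[OF q(1) p1(1) _ f ZL] q(3) by (simp add: add.commute)
  finally have B1: "Bs \<le> lpnorm p f * lpnorm q ?Z" .
  have Zn: "(LINT x|M01. \<bar>k n (W n x)\<bar> powr q) \<le> 2 powr q * 2 * (LINT x|M01. \<bar>G n f (W n x)\<bar> powr p)" if n: "1 \<le> n" for n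
  proof -
    have YL: "(\<lambda>x. Y n (W n x)) \<in> Lp q"
      using gW_bdd[OF n, of "Y n"] n q by (intro Lp_bounded) auto
    have Yp: "\<bar>Y n u\<bar> powr q = \<bar>G n f u\<bar> powr p" for u
      using q by (simp add: Y_def abs_sgpow powr_powr)
    have "\<bar>a n\<bar> \<le> lpnorm 1 (\<lambda>x. Y n (W n x))"
    proof -
      have "a n = (LINT x|M01. Y n (W n x))" using integral_gW[OF n, of "Y n"] by (simp add: a_def)
      then show ?thesis by (simp add: lpnorm_one integral_abs_bound)
    qed
    also have "\<dots> \<le> lpnorm q (\<lambda>x. Y n (W n x))" using q YL by (intro Lp_mono_exponent(2)) auto
    finally have "\<bar>a n\<bar> powr q \<le> lpnorm q (\<lambda>x. Y n (W n x)) powr q" using q by (intro powr_mono2) auto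
    also have "\<dots> = (LINT x|M01. \<bar>G n f (W n x)\<bar> powr p)" using q by (simp add: lpnorm_powr Yp)
    finally have an: "\<bar>a n\<bar> powr q \<le> (LINT x|M01. \<bar>G n f (W n x)\<bar> powr p)" .
    have "(LINT x|M01. \<bar>k n (W n x)\<bar> powr q) \<le> (LINT x|M01. 2 powr q * (\<bar>G n f (W n x)\<bar> powr p + \<bar>a n\<bar> powr q))"
    proof (rule integral_mono)
      show "integrable M01 (\<lambda>x. \<bar>k n (W n x)\<bar> powr q)" using gW_integrable[OF n, of "\<lambda>u. \<bar>k n u\<bar> powr q"] .
      show "integrable M01 (\<lambda>x. 2 powr q * (\<bar>G n f (W n x)\<bar> powr p + \<bar>a n\<bar> powr q))"
        using gW_integrable[OF n, of "\<lambda>u. \<bar>G n f u\<bar> powr p"] by auto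
      fix x
      have "\<bar>k n (W n x)\<bar> powr q \<le> (\<bar>Y n (W n x)\<bar> + \<bar>a n\<bar>) powr q"
        using q by (intro powr_mono2) (auto simp: k_def)
      also have "\<dots> \<le> 2 powr q * (\<bar>Y n (W n x)\<bar> powr q + \<bar>a n\<bar> powr q)"
        using q by (intro powr_add_le_real) auto
      finally show "\<bar>k n (W n x)\<bar> powr q \<le> 2 powr q * (\<bar>G n f (W n x)\<bar> powr p + \<bar>a n\<bar> powr q)" by (simp add: Yp)
    qed
    also have "\<dots> = 2 powr q * ((LINT x|M01. \<bar>G n f (W n x)\<bar> powr p) + \<bar>a n\<bar> powr q)"
      using gW_integrable[OF n, of "\<lambda>u. \<bar>G n f u\<bar> powr p"] by (simp add: M01.prob_space)
    also have "\<dots> \<le> 2 powr q * ((LINT x|M01. \<bar>G n f (W n x)\<bar> powr p) + (LINT x|M01. \<bar>G n f (W n x)\<bar> powr p))"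
      using an by (intro mult_left_mono add_left_mono) auto
    finally show ?thesis by simp
  qed
  have "lpnorm q ?Z powr q \<le> 2 * q * (\<Sum>n\<in>{1..M}. LINT x|M01. \<bar>k n (W n x)\<bar> powr q)"
    using Z.von_Bahr_Esseen[OF q(1,2) order_refl] q by (simp add: lpnorm_powr)
  also have "\<dots> \<le> 2 * q * (\<Sum>n\<in>{1..M}. 2 powr q * 2 * (LINT x|M01. \<bar>G n f (W n x)\<bar> powr p))"
    using q Zn by (intro mult_left_mono sum_mono) auto
  also have "\<dots> = (2 * q * (2 powr q * 2)) * Bs" by (simp add: Bs_def flip: sum_distrib_left)
  finally have Zq: "lpnorm q ?Z powr q \<le> (2 * q * (2 powr q * 2)) * Bs" .
  define c where "c = 2 * q * (2 powr q * 2)"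
  have c: "0 \<le> c" using q by (simp add: c_def)
  have "lpnorm q ?Z = (lpnorm q ?Z powr q) powr (1 / q)" using q by (simp add: powr_powr)
  also have "\<dots> \<le> (c * Bs) powr (1 / q)" using Zq q by (intro powr_mono2) (auto simp: c_def)
  finally have "lpnorm p f * lpnorm q ?Z \<le> lpnorm p f * (c * Bs) powr (1 / q)"
    by (intro mult_left_mono) auto
  with B1 have B2: "Bs \<le> lpnorm p f * (c * Bs) powr (1 / q)" by linarith
  \<comment> \<open>Here Bs is bounded by a multiple of its own power 1/q. Taking p-th powers and
    dividing by Bs^(p-1), where p/q = p - 1, solves this for Bs.\<close>
  have "Bs \<le> c powr (p - 1) * lpnorm p f powr p"
  proof (cases "Bs = 0")
    case False
    then have Bpos: "0 < Bs" using B0 by simp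
    have "Bs powr p \<le> (lpnorm p f * (c * Bs) powr (1 / q)) powr p"
      using B2 B0 p by (intro powr_mono2) auto
    also have "\<dots> = lpnorm p f powr p * (c powr (p - 1) * Bs powr (p - 1))"
      using q c B0 by (simp add: powr_mult powr_powr)
    also have "Bs powr (p - 1) = Bs powr p / Bs" using Bpos by (simp add: powr_diff)
    finally have "Bs * Bs powr p \<le> (lpnorm p f powr p * c powr (p - 1)) * Bs powr p"
      using Bpos by (simp add: field_simps)
    then have "Bs \<le> lpnorm p f powr p * c powr (p - 1)"
      using Bpos by (simp add: mult_le_cancel_right)
    then show ?thesis by (simp add: mult.commute)
  qed auto
  then show ?thesis by (simp add: Bs_def c_def pow_const_def q_def)
qed

text \<open>\<open>sum_power_coeff_le\<close> controls both sums in Rosenthal's inequality: with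
  exponent p directly, and with exponent 2 after comparing the L_2 norm with the L_p norm.\<close>

lemma S_bounded_ge_2:
  assumes p: "2 \<le> p"
  shows "\<exists>C\<ge>0. \<forall>f\<in>Lp p. \<forall>M. lpnorm p (S M f) \<le> C * lpnorm p f"
proof -
  define A where "A = (Rosenthal_const p * pow_const 2) powr (p / 2) + Rosenthal_const p * pow_const p"
  have pc: "0 \<le> pow_const r" for r by (simp add: pow_const_def)
  have D: "0 \<le> Rosenthal_const p" using Rosenthal_const_nonneg[OF p] .
  have A0: "0 \<le> A" using D pc by (auto simp: A_def)
  have "lpnorm p (S M f) \<le> A powr (1 / p) * lpnorm p f" if f: "f \<in> Lp p" for f M
  proof -
    have fi: "integrable M01 f" using Lp_integrable[OF _ f] p by simp
    have f2: "f \<in> Lp 2" "lpnorm 2 f \<le> lpnorm p f" using Lp_mono_exponent[OF _ p f] by auto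
    interpret X: indep_centered "\<lambda>n x. G n f (W n x)" "{1..M}" "\<lambda>n. \<Sum>u<2 ^ n. \<bar>G n f u\<bar>"
      using G_sum_zero fi by (intro indep_centered_gW) auto
    have "(\<Sum>n\<in>{1..M}. LINT x|M01. \<bar>G n f (W n x)\<bar> powr 2) \<le> pow_const 2 * lpnorm 2 f powr 2"
      by (rule sum_power_coeff_le[OF _ f2(1)]) simp
    also have "\<dots> \<le> pow_const 2 * lpnorm p f powr 2"
      using f2 pc by (intro mult_left_mono powr_mono2) auto
    finally have s2: "(\<Sum>n\<in>{1..M}. LINT x|M01. \<bar>G n f (W n x)\<bar> powr 2) \<le> pow_const 2 * lpnorm p f powr 2" .
    have "(LINT x|M01. \<bar>S M f x\<bar> powr p)
      \<le> (Rosenthal_const p * (\<Sum>n\<in>{1..M}. LINT x|M01. \<bar>G n f (W n x)\<bar> powr 2)) powr (p / 2)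
        + Rosenthal_const p * (\<Sum>n\<in>{1..M}. LINT x|M01. \<bar>G n f (W n x)\<bar> powr p)"
      unfolding S_def by (rule X.Rosenthal_ge_2[OF p order_refl])
    also have "\<dots> \<le> (Rosenthal_const p * (pow_const 2 * lpnorm p f powr 2)) powr (p / 2) + Rosenthal_const p * (pow_const p * lpnorm p f powr p)"
      using s2 sum_power_coeff_le[OF p f, of M] D p
      by (intro add_mono mult_left_mono powr_mono2) (auto intro!: mult_nonneg_nonneg sum_nonneg)
    also have "\<dots> = A * lpnorm p f powr p"
    proof -
      have "(Rosenthal_const p * (pow_const 2 * lpnorm p f powr 2)) powr (p / 2)
        = (Rosenthal_const p * pow_const 2) powr (p / 2) * lpnorm p f powr p"
        by (simp only: powr_mult powr_powr mult.assoc) simp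
      then show ?thesis by (simp add: A_def algebra_simps)
    qed
    also have "\<dots> = (A powr (1 / p) * lpnorm p f) powr p"
      using A0 p by (simp add: powr_mult powr_powr)
    finally show ?thesis
      using p by (subst lpnorm_le_iff) auto
  qed
  then show ?thesis by (intro exI[of _ "A powr (1 / p)"]) auto
qed

text \<open>For p < 2 the partial sum S f is paired with its norming function g =
  \<open>sgpow (p - 1)\<close> of S f. Self-adjointness moves S to g, where the bound for the
  conjugate exponent applies, and the norm of g is the (p-1)-th power of the norm of S f.\<close>

lemma S_bounded:
  assumes p: "1 < p"
  shows "\<exists>C\<ge>0. \<forall>f\<in>Lp p. \<forall>M. lpnorm p (S M f) \<le> C * lpnorm p f"
proof (cases "2 \<le> p")
  case True
  then show ?thesis by (rule S_bounded_ge_2)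
next
  case False
  define q where "q = p / (p - 1)"
  have q: "2 \<le> q" "1 / p + 1 / q = 1" "(p - 1) * q = p" "p / q = p - 1"
    using p False by (auto simp: q_def field_simps)
  obtain C where C: "0 \<le> C" "\<And>f M. f \<in> Lp q \<Longrightarrow> lpnorm q (S M f) \<le> C * lpnorm q f"
    using S_bounded_ge_2[OF q(1)] by blast
  have "lpnorm p (S M f) \<le> C * lpnorm p f" if f: "f \<in> Lp p" for f M
  proof (cases "lpnorm p (S M f) = 0")
    case True
    then show ?thesis using C by simp
  next
    case nz: False
    have fi: "integrable M01 f" using Lp_integrable[OF _ f] p by simp
    define g where "g x = sgpow (p - 1) (S M f x)" for x
    have S_meas [measurable]: "S M f \<in> borel_measurable M01" using S_Lp[of 1 M f] by auto
    define b where "b = (\<Sum>i\<in>{1..M}. \<Sum>u<2 ^ i. \<bar>G i f u\<bar>)"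
    have S_bdd: "\<bar>S M f x\<bar> \<le> b" for x unfolding b_def S_def by (rule partial_bdd) auto
    have g_meas [measurable]: "g \<in> borel_measurable M01" unfolding g_def[abs_def] by measurable
    have g_bdd: "\<bar>g x\<bar> \<le> b powr (p - 1)" for x
      using S_bdd[of x] p by (simp add: g_def abs_sgpow powr_mono2)
    have gL: "g \<in> Lp q" "integrable M01 g"
      using g_bdd g_meas q by (auto intro!: Lp_bounded[where B = "b powr (p - 1)"] integrable_bounded[where B = "b powr (p - 1)"])
    have gq: "lpnorm q g = lpnorm p (S M f) powr (p - 1)"
    proof -
      have "lpnorm q g powr q = lpnorm p (S M f) powr p"
        using p q by (simp add: lpnorm_powr g_def abs_sgpow powr_powr)
      then have "(lpnorm q g powr q) powr (1 / q) = (lpnorm p (S M f) powr p) powr (1 / q)" by simp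
      then show ?thesis using q by (simp add: powr_powr)
    qed
    have "lpnorm p (S M f) powr p = pair (S M f) g"
      using p by (simp add: lpnorm_powr pair_def g_def mult_sgpow)
    also have "\<dots> = pair f (S M g)" using fi gL by (intro pair_S_sym)
    also have "\<dots> \<le> lpnorm p f * lpnorm q (S M g)"
    proof -
      have "S M g \<in> Lp q" using q by (intro S_Lp) auto
      from pair_le_lpnorm[of q p, OF _ p _ f this] q show ?thesis by (simp add: add.commute)
    qed
    also have "\<dots> \<le> lpnorm p f * (C * lpnorm q g)" using C(2)[OF gL(1)] by (intro mult_left_mono) auto
    also have "\<dots> = C * lpnorm p f * lpnorm p (S M f) powr (p - 1)" by (simp add: gq)
    finally have "lpnorm p (S M f) * lpnorm p (S M f) powr (p - 1) \<le> C * lpnorm p f * lpnorm p (S M f) powr (p - 1)"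
      using nz lpnorm_nonneg[of p "S M f"] by (simp add: powr_diff)
    then show ?thesis using nz by (simp add: mult_le_cancel_right)
  qed
  then show ?thesis using C(1) by blast
qed

end

section \<open>Orthogonal projections and the space spanned by the copies\<close>

lemma lp_lim_Cauchy:
  assumes "1 \<le> p" "\<And>n. s n \<in> Lp p" "lp_lim p s f" "0 < e"
  shows "\<exists>N. \<forall>i\<ge>N. \<forall>j\<ge>N. lpnorm p (\<lambda>x. s i x - s j x) < e"
proof -
  have f: "f \<in> Lp p" using assms by (simp add: lp_lim_def)
  have "(\<lambda>n. lpnorm p (\<lambda>x. s n x - f x)) \<longlonglongrightarrow> 0" using assms(3) by (simp add: lp_lim_def)
  from LIMSEQ_D[OF this, of "e / 2"] assms(4)
  obtain N where "\<forall>n\<ge>N. norm (lpnorm p (\<lambda>x. s n x - f x) - 0) < e / 2" by auto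
  then have N: "lpnorm p (\<lambda>x. s n x - f x) < e / 2" if "N \<le> n" for n using that by simp
  have "lpnorm p (\<lambda>x. s i x - s j x) < e" if "N \<le> i" "N \<le> j" for i j
    using lpnorm_triangle_diff[OF assms(1,2) f assms(2), of i j] N[OF that(1)] N[OF that(2)]
      lpnorm_minus_commute[of p f "s j"] by linarith
  then show ?thesis by blast
qed

context copies
begin

text \<open>The increments of the partial sums are again sums of independent centred terms. The sums
  of second and of p-th moments converge by \<open>sum_power_coeff_le\<close>, so Rosenthal's
  inequality makes the increments small.\<close>

lemma S_Cauchy_ge_2:
  assumes p: "2 \<le> p" and f: "f \<in> Lp p" and e: "0 < e"
  shows "\<exists>N. \<forall>i\<ge>N. \<forall>j\<ge>N. lpnorm p (\<lambda>x. S i f x - S j f x) < e"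
proof -
  define D where "D = Rosenthal_const p"
  have D: "0 \<le> D" using Rosenthal_const_nonneg[OF p] by (simp add: D_def)
  have fi: "integrable M01 f" using Lp_integrable[OF _ f] p by simp
  have f2: "f \<in> Lp 2" using Lp_mono_exponent[OF _ p f] by auto
  define a where "a n = (LINT x|M01. \<bar>G n f (W n x)\<bar> powr 2) + (LINT x|M01. \<bar>G n f (W n x)\<bar> powr p)" for n
  have a0: "0 \<le> a n" for n by (auto simp: a_def)
  have "summable (\<lambda>n. a (Suc n))"
  proof (rule summableI_nonneg_bounded)
    fix M
    have "(\<Sum>n<M. a (Suc n)) = (\<Sum>n\<in>{1..M}. a n)" by (simp add: sum.atLeast1_atMost_eq)
    also have "\<dots> \<le> pow_const 2 * lpnorm 2 f powr 2 + pow_const p * lpnorm p f powr p"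
      unfolding a_def sum.distrib using f2 f p by (intro add_mono sum_power_coeff_le) auto
    finally show "(\<Sum>n<M. a (Suc n)) \<le> pow_const 2 * lpnorm 2 f powr 2 + pow_const p * lpnorm p f powr p" .
  qed (rule a0)
  \<comment> \<open>D d \<le> 1 gives (D d)^(p/2) \<le> D d because p/2 \<ge> 1, and 2 D d \<le>
    (e/2)^p then bounds both terms of Rosenthal's inequality together.\<close>
  define d where "d = min 1 ((e / 2) powr p) / (2 * (D + 1))"
  have d: "0 < d" using e D by (simp add: d_def)
  have Dd: "D * d \<le> 1" "2 * (D * d) \<le> (e / 2) powr p"
  proof -
    have "2 * (D * d) = min 1 ((e / 2) powr p) * (D / (D + 1))" using D by (simp add: d_def field_simps)
    also have "\<dots> \<le> min 1 ((e / 2) powr p) * 1" using D by (intro mult_left_mono) auto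
    finally show "D * d \<le> 1" "2 * (D * d) \<le> (e / 2) powr p" by auto
  qed
  obtain N where N: "\<And>m n. N \<le> m \<Longrightarrow> norm (\<Sum>k=m..<n. a (Suc k)) < d"
    using \<open>summable (\<lambda>n. a (Suc n))\<close> d unfolding summable_Cauchy by blast
  have main: "lpnorm p (\<lambda>x. S j f x - S i f x) < e" if "N \<le> i" "i \<le> j" for i j
  proof -
    interpret X: indep_centered "\<lambda>n x. G n f (W n x)" "{Suc i..j}" "\<lambda>n. \<Sum>u<2 ^ n. \<bar>G n f u\<bar>"
      using G_sum_zero fi by (intro indep_centered_gW) auto
    have "(\<Sum>n\<in>{Suc i..j}. a n) = (\<Sum>k=i..<j. a (Suc k))"
      by (metis atLeastLessThanSuc_atLeastAtMost sum.shift_bounds_Suc_ivl)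
    then have sa: "(\<Sum>n\<in>{Suc i..j}. a n) \<le> d"
      using N[OF that(1), of j] by simp
    have s1: "(\<Sum>n\<in>{Suc i..j}. LINT x|M01. \<bar>G n f (W n x)\<bar> powr 2) \<le> d"
      "(\<Sum>n\<in>{Suc i..j}. LINT x|M01. \<bar>G n f (W n x)\<bar> powr p) \<le> d"
      by (rule order_trans[OF sum_mono sa], simp add: a_def)+
    have "(\<lambda>x. S j f x - S i f x) = (\<lambda>x. \<Sum>n\<in>{Suc i..j}. G n f (W n x))"
    proof
      fix x
      have "{1..j} = {1..i} \<union> {Suc i..j}" using that by auto
      then have "S j f x = S i f x + (\<Sum>n\<in>{Suc i..j}. G n f (W n x))"
        unfolding S_def by (simp add: sum.union_disjoint)
      then show "S j f x - S i f x = (\<Sum>n\<in>{Suc i..j}. G n f (W n x))" by simp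
    qed
    then have "(LINT x|M01. \<bar>S j f x - S i f x\<bar> powr p)
      \<le> (D * (\<Sum>n\<in>{Suc i..j}. LINT x|M01. \<bar>G n f (W n x)\<bar> powr 2)) powr (p / 2)
        + D * (\<Sum>n\<in>{Suc i..j}. LINT x|M01. \<bar>G n f (W n x)\<bar> powr p)"
      using X.Rosenthal_ge_2[OF p order_refl] by (simp only: D_def fun_eq_iff)
    also have "\<dots> \<le> (D * d) powr (p / 2) + D * d"
      using s1 D p by (intro add_mono mult_left_mono powr_mono2) (auto intro!: mult_nonneg_nonneg sum_nonneg)
    also have "(D * d) powr (p / 2) \<le> (D * d) powr 1"
      using Dd d D p by (intro powr_mono') auto
    also have "(D * d) powr 1 = D * d" using D d by simp
    finally have "(LINT x|M01. \<bar>S j f x - S i f x\<bar> powr p) \<le> (e / 2) powr p" using Dd by simp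
    then have "lpnorm p (\<lambda>x. S j f x - S i f x) \<le> e / 2" using p e by (subst lpnorm_le_iff) auto
    then show ?thesis using e by simp
  qed
  have "lpnorm p (\<lambda>x. S i f x - S j f x) < e" if "N \<le> i" "N \<le> j" for i j
    using main[of i j] main[of j i] that lpnorm_minus_commute[of p "S i f" "S j f"] by (cases "i \<le> j") auto
  then show ?thesis by blast
qed

text \<open>For p < 2 approximate f by a bounded g. Its partial sums are Cauchy in L_2, hence in
  L_p, and uniform boundedness of the partial sum operators carries this over to f.\<close>

lemma S_Cauchy:
  assumes p: "1 < p" and f: "f \<in> Lp p" and e: "0 < e"
  shows "\<exists>N. \<forall>i\<ge>N. \<forall>j\<ge>N. lpnorm p (\<lambda>x. S i f x - S j f x) < e"
proof (cases "2 \<le> p")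
  case True
  then show ?thesis using S_Cauchy_ge_2 f e by blast
next
  case False
  have p0: "0 < p" "1 \<le> p" using p by auto
  obtain C where C: "0 \<le> C" "\<And>f M. f \<in> Lp p \<Longrightarrow> lpnorm p (S M f) \<le> C * lpnorm p f"
    using S_bounded[OF p] by blast
  define d where "d = e / (4 * (C + 1))"
  have d: "0 < d" using e C by (simp add: d_def)
  obtain g B where g: "g \<in> borel_measurable M01" "\<And>x. \<bar>g x\<bar> \<le> B" "lpnorm p (\<lambda>x. f x - g x) < d"
    using Lp_approx_bounded[OF p0(2) f d] by blast
  have gL: "g \<in> Lp 2" "g \<in> Lp p" using g p by (auto intro!: Lp_bounded[where B = B])
  have fgL: "(\<lambda>x. f x - g x) \<in> Lp p" using Lp_diff[OF p0(1) f gL(2)] .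
  have int: "integrable M01 f" "integrable M01 g" using Lp_integrable[OF p0(2)] f gL by auto
  obtain N where N: "\<forall>i\<ge>N. \<forall>j\<ge>N. lpnorm 2 (\<lambda>x. S i g x - S j g x) < e / 2"
    using S_Cauchy_ge_2[OF _ gL(1), of "e / 2"] e by auto
  have "lpnorm p (\<lambda>x. S i f x - S j f x) < e" if "N \<le> i" "N \<le> j" for i j
  proof -
    have small: "lpnorm p (\<lambda>x. S M f x - S M g x) \<le> C * d" for M
    proof -
      have "(\<lambda>x. S M f x - S M g x) = S M (\<lambda>x. f x - g x)" by (intro ext S_diff[OF int, symmetric])
      then have "lpnorm p (\<lambda>x. S M f x - S M g x) \<le> C * lpnorm p (\<lambda>x. f x - g x)" using C(2)[OF fgL] by simp
      also have "\<dots> \<le> C * d" using g(3) C(1) by (intro mult_left_mono) auto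
      finally show ?thesis .
    qed
    have L: "S M k \<in> Lp p" for M k using S_Lp[OF p0(1)] .
    have "lpnorm p (\<lambda>x. S i g x - S j g x) \<le> lpnorm 2 (\<lambda>x. S i g x - S j g x)"
      using False p0 by (intro Lp_mono_exponent(2) Lp_diff S_Lp) auto
    also have "\<dots> < e / 2" using N that by blast
    finally have 2: "lpnorm p (\<lambda>x. S i g x - S j g x) < e / 2" .
    have "lpnorm p (\<lambda>x. S i f x - S j f x) \<le> lpnorm p (\<lambda>x. S i f x - S i g x) + lpnorm p (\<lambda>x. S i g x - S j f x)"
      by (rule lpnorm_triangle_diff[OF p0(2) L L L])
    also have "lpnorm p (\<lambda>x. S i g x - S j f x) \<le> lpnorm p (\<lambda>x. S i g x - S j g x) + lpnorm p (\<lambda>x. S j g x - S j f x)"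
      by (rule lpnorm_triangle_diff[OF p0(2) L L L])
    finally have "lpnorm p (\<lambda>x. S i f x - S j f x) < C * d + (e / 2 + C * d)"
      using small[of i] small[of j] 2 lpnorm_minus_commute[of p "S j g" "S j f"] by linarith
    also have "\<dots> \<le> e"
    proof -
      have "C * d * 4 = e * (C / (C + 1))" using C by (simp add: d_def field_simps)
      also have "\<dots> \<le> e * 1" using C e by (intro mult_left_mono) auto
      finally show ?thesis by simp
    qed
    finally show ?thesis .
  qed
  then show ?thesis by blast
qed

text \<open>The choice depends on f only through its sequence of partial sums, so functions equal
  almost everywhere have literally the same image. The exponent is a parameter because limits for
  different exponents agree only almost everywhere.\<close>

definition lim_proj :: "real \<Rightarrow> (real \<Rightarrow> real) \<Rightarrow> real \<Rightarrow> real" where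
  "lim_proj r f = (SOME g. lp_lim r (\<lambda>M. S M f) g)"

lemma lim_proj_lim:
  assumes "1 < r" "f \<in> Lp r"
  shows "lp_lim r (\<lambda>M. S M f) (lim_proj r f)"
proof -
  have "\<exists>g. lp_lim r (\<lambda>M. S M f) g"
    using assms S_Cauchy[OF assms] S_Lp by (intro Lp_complete) auto
  then show ?thesis unfolding lim_proj_def by (rule someI_ex)
qed

lemma lim_proj_Lp: "1 < r \<Longrightarrow> f \<in> Lp r \<Longrightarrow> lim_proj r f \<in> Lp r"
  using lim_proj_lim[of r f] by (simp add: lp_lim_def)

lemma lim_proj_bounded:
  assumes "1 < r"
  shows "\<exists>C\<ge>0. \<forall>f\<in>Lp r. lpnorm r (lim_proj r f) \<le> C * lpnorm r f"
proof -
  obtain C where C: "0 \<le> C" "\<And>f M. f \<in> Lp r \<Longrightarrow> lpnorm r (S M f) \<le> C * lpnorm r f"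
    using S_bounded[OF assms] by blast
  have "lpnorm r (lim_proj r f) \<le> C * lpnorm r f" if "f \<in> Lp r" for f
    using assms that by (intro lp_lim_lpnorm_le[OF _ _ lim_proj_lim[OF assms that]]) (auto intro: S_Lp C)
  then show ?thesis using C(1) by blast
qed

lemma lim_proj_lin: 
  assumes r: "1 < r"
  shows "lin_on (Lp r) (lim_proj r)"
  unfolding lin_on_def
proof (intro ballI allI)
  fix f g a b assume f: "f \<in> Lp r" and g: "g \<in> Lp r"
  have r0: "0 < r" "1 \<le> r" using r by auto
  have int: "integrable M01 f" "integrable M01 g" using Lp_integrable[OF r0(2)] f g by auto
  have "lp_lim r (\<lambda>M x. a * S M f x + b * S M g x) (\<lambda>x. a * lim_proj r f x + b * lim_proj r g x)"
    using r0 f g r by (intro lp_lim_lincomb lim_proj_lim S_Lp) auto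
  moreover have "(\<lambda>M. S M (\<lambda>x. a * f x + b * g x)) = (\<lambda>M x. a * S M f x + b * S M g x)"
    by (intro ext S_lincomb[OF int])
  ultimately have "lp_lim r (\<lambda>M. S M (\<lambda>x. a * f x + b * g x)) (\<lambda>x. a * lim_proj r f x + b * lim_proj r g x)" by simp
  then show "eqae (lim_proj r (\<lambda>x. a * f x + b * g x)) (\<lambda>x. a * lim_proj r f x + b * lim_proj r g x)"
    using r0 r f g by (intro lp_lim_unique[OF r0(2) S_Lp[OF r0(1)] lim_proj_lim]) (auto intro: Lp_lincomb)
qed

lemma lim_proj_cong:
  assumes "eqae f g" "f \<in> borel_measurable M01" "g \<in> borel_measurable M01"
  shows "lim_proj r f = lim_proj r g"
  unfolding lim_proj_def S_cong_AE[OF assms] ..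

text \<open>The constant grows with n; the estimate is meant for the continuity of one coefficient
  at a time.\<close>

lemma G_le:
  assumes n: "1 \<le> n" and r: "1 \<le> r" and f: "f \<in> Lp r"
  shows "\<bar>G n f u\<bar> \<le> (2 ^ n + 1) * lpnorm r f"
proof -
  have fi: "integrable M01 f" using Lp_integrable[OF r f] .
  have "\<bar>LINT x|M01. f x * of_bool (W n x = u)\<bar> \<le> (LINT x|M01. \<bar>f x * of_bool (W n x = u)\<bar>)"
    by (rule integral_abs_bound)
  also have "\<dots> \<le> (LINT x|M01. \<bar>f x\<bar>)"
    by (rule integral_mono[OF integrable_abs[OF mult_ind_integrable[OF n fi]] integrable_abs[OF fi]])
      (simp add: abs_mult)
  finally have 1: "\<bar>LINT x|M01. f x * of_bool (W n x = u)\<bar> \<le> (LINT x|M01. \<bar>f x\<bar>)" .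
  have 2: "\<bar>LINT x|M01. f x\<bar> \<le> (LINT x|M01. \<bar>f x\<bar>)" by (rule integral_abs_bound)
  have "\<bar>G n f u\<bar> \<le> \<bar>2 ^ n * (LINT x|M01. f x * of_bool (W n x = u))\<bar> + \<bar>LINT x|M01. f x\<bar>"
    unfolding G_def by (rule abs_triangle_ineq4)
  also have "\<dots> \<le> 2 ^ n * (LINT x|M01. \<bar>f x\<bar>) + (LINT x|M01. \<bar>f x\<bar>)"
    using 1 by (intro add_mono 2) (simp add: abs_mult)
  also have "\<dots> = (2 ^ n + 1) * lpnorm 1 f" by (simp add: lpnorm_one algebra_simps)
  also have "\<dots> \<le> (2 ^ n + 1) * lpnorm r f"
    using r f by (intro mult_left_mono Lp_mono_exponent(2)) auto
  finally show ?thesis .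
qed

lemma G_lim:
  assumes n: "1 \<le> n" and r: "1 \<le> r" and s: "\<And>M. s M \<in> Lp r" and lim: "lp_lim r s f"
  shows "(\<lambda>M. G n (s M) u) \<longlonglongrightarrow> G n f u"
proof -
  have r0: "0 < r" using r by simp
  have f: "f \<in> Lp r" using lim by (simp add: lp_lim_def)
  have le: "\<bar>G n (s M) u - G n f u\<bar> \<le> (2 ^ n + 1) * lpnorm r (\<lambda>x. s M x - f x)" for M
  proof -
    have "G n (\<lambda>x. s M x - f x) u = G n (s M) u - G n f u"
      using G_lincomb[OF n, of "s M" f 1 "-1" u] Lp_integrable[OF r] s f by simp
    then show ?thesis using G_le[OF n r Lp_diff[OF r0 s f], of M u] by simp
  qed
  have "(\<lambda>M. (2 ^ n + 1) * lpnorm r (\<lambda>x. s M x - f x)) \<longlonglongrightarrow> (2 ^ n + 1) * 0"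
    using lim unfolding lp_lim_def by (intro tendsto_intros) auto
  then have "(\<lambda>M. (2 ^ n + 1) * lpnorm r (\<lambda>x. s M x - f x)) \<longlonglongrightarrow> 0" by simp
  from tendsto_0_le[OF this abs_ge_zero le] have "(\<lambda>M. \<bar>G n (s M) u - G n f u\<bar>) \<longlonglongrightarrow> 0" .
  then show ?thesis using LIM_zero_cancel tendsto_rabs_zero_iff by blast
qed

text \<open>From M = n on, all partial sums have the same n-th coefficient k n, and coefficients are
  continuous.\<close>

lemma G_of_partial_lim:
  assumes r: "1 \<le> r" and k: "\<And>n. 1 \<le> n \<Longrightarrow> (\<Sum>u<2 ^ n. k n u) = 0"
    and lim: "lp_lim r (\<lambda>M x. \<Sum>n\<in>{1..M}. k n (W n x)) f" and n: "1 \<le> n" "u < 2 ^ n"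
  shows "G n f u = k n u"
proof -
  have "(\<lambda>M. G n (\<lambda>x. \<Sum>n\<in>{1..M}. k n (W n x)) u) \<longlonglongrightarrow> G n f u"
    using r by (intro G_lim[OF n(1) r _ lim] partial_Lp) auto
  moreover have "(\<lambda>M. G n (\<lambda>x. \<Sum>n\<in>{1..M}. k n (W n x)) u) \<longlonglongrightarrow> k n u"
  proof (rule tendsto_eventually, rule eventually_sequentiallyI[of n])
    fix M assume "n \<le> M"
    then show "G n (\<lambda>x. \<Sum>n\<in>{1..M}. k n (W n x)) u = k n u"
      using G_partial[OF n, of M k] k by simp
  qed
  ultimately show ?thesis by (rule LIMSEQ_unique)
qed

lemma S_of_partial_lim:
  assumes "1 \<le> r" "\<And>n. 1 \<le> n \<Longrightarrow> (\<Sum>u<2 ^ n. k n u) = 0"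
    "lp_lim r (\<lambda>M x. \<Sum>n\<in>{1..M}. k n (W n x)) f"
  shows "S M f = (\<lambda>x. \<Sum>n\<in>{1..M}. k n (W n x))"
  unfolding S_def[abs_def] using G_of_partial_lim[OF assms] W_lt by (intro ext sum.cong) auto

lemma S_lim_proj: "1 < r \<Longrightarrow> f \<in> Lp r \<Longrightarrow> S M (lim_proj r f) = S M f"
proof -
  assume r: "1 < r" and f: "f \<in> Lp r"
  have "integrable M01 f" using Lp_integrable[OF _ f] r by simp
  then have "S M (lim_proj r f) = (\<lambda>x. \<Sum>n\<in>{1..M}. G n f (W n x))"
    using r G_sum_zero lim_proj_lim[OF r f] by (intro S_of_partial_lim[of r]) (auto simp: S_def[abs_def])
  then show ?thesis by (simp add: S_def[abs_def])
qed

lemma lim_proj_lim_proj: "1 < r \<Longrightarrow> f \<in> Lp r \<Longrightarrow> lim_proj r (lim_proj r f) = lim_proj r f"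
  unfolding lim_proj_def[of r "lim_proj r f"] S_lim_proj by (simp add: lim_proj_def)

lemma orth_proj_lim_proj: "orth_proj (lim_proj 2)"
  unfolding orth_proj_def
proof (intro conjI ballI impI)
  show "lim_proj 2 f \<in> Lp 2" if "f \<in> Lp 2" for f using that by (simp add: lim_proj_Lp)
  show "eqae (lim_proj 2 f) (lim_proj 2 g)" if "f \<in> Lp 2" "g \<in> Lp 2" "eqae f g" for f g
    using lim_proj_cong[OF that(3) LpD(1)[OF that(1)] LpD(1)[OF that(2)]] by simp
  show "lin_on (Lp 2) (lim_proj 2)" by (rule lim_proj_lin) simp
  show "eqae (lim_proj 2 (lim_proj 2 f)) (lim_proj 2 f)" if "f \<in> Lp 2" for f using that by (simp add: lim_proj_lim_proj)
  fix f g assume f: "f \<in> Lp 2" and g: "g \<in> Lp 2"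
  have int: "integrable M01 f" "integrable M01 g" using Lp_integrable[of 2] f g by auto
  have "(\<lambda>M. pair g (S M f)) \<longlonglongrightarrow> pair g (lim_proj 2 f)"
    by (rule lp_lim_pair[of 2 2]) (auto intro: S_Lp lim_proj_lim f g)
  moreover have "(\<lambda>M. pair f (S M g)) \<longlonglongrightarrow> pair f (lim_proj 2 g)"
    by (rule lp_lim_pair[of 2 2]) (auto intro: S_Lp lim_proj_lim f g)
  moreover have "pair g (S M f) = pair f (S M g)" for M
    using pair_S_sym[OF int, of M] by (simp add: pair_def mult.commute)
  ultimately have "pair g (lim_proj 2 f) = pair f (lim_proj 2 g)" by (simp add: LIMSEQ_unique)
  then show "pair (lim_proj 2 f) g = pair f (lim_proj 2 g)" by (simp add: pair_def mult.commute)
qed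

text \<open>Both functions are limits of the same partial sums in the weaker of the two
  norms.\<close>

lemma lim_proj_eqae:
  assumes "1 < p" "1 < r" "f \<in> Lp p" "f \<in> Lp r"
  shows "eqae (lim_proj p f) (lim_proj r f)"
proof -
  define t where "t = min p r"
  have "lp_lim t (\<lambda>M. S M f) (lim_proj p f)" "lp_lim t (\<lambda>M. S M f) (lim_proj r f)"
    using assms by (auto simp: t_def intro!: lp_lim_mono_exponent[OF _ _ _ lim_proj_lim] S_Lp)
  then show ?thesis using assms by (intro lp_lim_unique[of t]) (auto simp: t_def intro!: S_Lp)
qed

lemma p_C_bounded_lim_proj:
  assumes p: "1 < p"
  shows "\<exists>C. p_C_bounded p C (lim_proj 2)"
proof -
  obtain C where C: "0 \<le> C" "\<And>f. f \<in> Lp p \<Longrightarrow> lpnorm p (lim_proj p f) \<le> C * lpnorm p f"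
    using lim_proj_bounded[OF p] by blast
  have "lim_proj 2 f \<in> Lp p \<and> lpnorm p (lim_proj 2 f) \<le> C * lpnorm p f" if f: "f \<in> Lp 2" "f \<in> Lp p" for f
  proof -
    have eq: "eqae (lim_proj p f) (lim_proj 2 f)" using p f by (intro lim_proj_eqae) auto
    have m: "lim_proj 2 f \<in> borel_measurable M01" "lim_proj p f \<in> Lp p" using lim_proj_Lp[of 2 f] lim_proj_Lp[OF p] f by auto
    then have "lpnorm p (lim_proj 2 f) = lpnorm p (lim_proj p f)" using lpnorm_eqae[OF eq] by auto
    then show ?thesis using Lp_eqae[OF eq m(2,1)] C(2)[OF f(2)] by simp
  qed
  then show ?thesis unfolding p_C_bounded_def by blast
qed

lemma lp_extension_lim_proj:
  assumes p: "1 < p"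
  shows "lp_extension p (lim_proj 2) (lim_proj p)"
  unfolding lp_extension_def
proof (intro conjI ballI)
  show "lim_proj p f \<in> Lp p" if "f \<in> Lp p" for f using lim_proj_Lp[OF p that] .
  show "lin_on (Lp p) (lim_proj p)" by (rule lim_proj_lin[OF p])
  show "\<exists>K. \<forall>f\<in>Lp p. lpnorm p (lim_proj p f) \<le> K * lpnorm p f" using lim_proj_bounded[OF p] by blast
  show "eqae (lim_proj p f) (lim_proj 2 f)" if "f \<in> Lp 2 \<inter> Lp p" for f using that p by (intro lim_proj_eqae) auto
qed

section \<open>Replacing one system of copies by another\<close>

lemma distr_W_unique:
  assumes "copies V" "1 \<le> n"
  shows "distr M01 (count_space UNIV) (W n) = distr M01 (count_space UNIV) (V n)"
proof -
  interpret V: copies V by fact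
  have emb: "emeasure (distr M01 (count_space UNIV) (W n)) {u} = ennreal (if u < 2 ^ n then 1 / 2 ^ n else 0)"
    if "copies W" for W u
  proof -
    interpret W: copies W by fact
    have "emeasure (distr M01 (count_space UNIV) (W n)) {u} = emeasure M01 {x \<in> space M01. W n x = u}"
      using W.W_meas[OF assms(2)] by (subst emeasure_distr) (auto intro!: arg_cong[where f = "emeasure M01"])
    also have "\<dots> = ennreal (measure M01 {x \<in> space M01. W n x = u})"
      by (rule M01.emeasure_eq_measure)
    also have "measure M01 {x \<in> space M01. W n x = u} = (if u < 2 ^ n then 1 / 2 ^ n else 0)"
    proof (cases "u < 2 ^ n")
      case True
      then show ?thesis using W.W_unif[OF assms(2)] by simp
    next
      case False
      then have "{x \<in> space M01. W n x = u} = {}" using W.W_lt[OF assms(2)] by auto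
      then have "measure M01 {x \<in> space M01. W n x = u} = 0" by (simp only: measure_empty)
      then show ?thesis using False by simp
    qed
    finally show ?thesis .
  qed
  show ?thesis
    by (rule measure_eqI_countable[of _ UNIV]) (auto simp: emb[OF copies_axioms] emb[OF assms(1)])
qed

text \<open>Independence factors the characteristic function, and each factor depends only on the
  uniform law of a single copy.\<close>

lemma distr_partial_unique:
  assumes "copies V" "finite F" "F \<subseteq> {1..}"
  shows "distr M01 borel (\<lambda>x. \<Sum>n\<in>F. k n (W n x) :: real) = distr M01 borel (\<lambda>x. \<Sum>n\<in>F. k n (V n x))"
proof -
  interpret V: copies V by fact
  have single: "distr M01 borel (\<lambda>x. k n (W n x)) = distr M01 borel (\<lambda>x. k n (V n x))" if n: "1 \<le> n" for n
  proof -
    have d: "distr M01 borel (\<lambda>x. k n (W n x)) = distr (distr M01 (count_space UNIV) (W n)) borel (k n)"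
      if "copies W" for W
    proof -
      interpret W: copies W by fact
      show ?thesis using W.W_meas[OF n] by (subst distr_distr) (auto simp: comp_def)
    qed
    show ?thesis unfolding d[OF copies_axioms] d[OF assms(1)] distr_W_unique[OF assms(1) n] ..
  qed
  have "char (distr M01 borel (\<lambda>x. \<Sum>n\<in>F. k n (W n x))) t = char (distr M01 borel (\<lambda>x. \<Sum>n\<in>F. k n (V n x))) t" for t
  proof -
    have "char (distr M01 borel (\<lambda>x. \<Sum>n\<in>F. k n (W n x))) t = (\<Prod>n\<in>F. char (distr M01 borel (\<lambda>x. k n (W n x))) t)"
      by (rule M01.char_distr_sum[OF indep_gW[OF assms(3)]])
    also have "\<dots> = (\<Prod>n\<in>F. char (distr M01 borel (\<lambda>x. k n (V n x))) t)"
      using assms(3) single by (intro prod.cong) auto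
    also have "\<dots> = char (distr M01 borel (\<lambda>x. \<Sum>n\<in>F. k n (V n x))) t"
      by (rule M01.char_distr_sum[OF V.indep_gW[OF assms(3)], symmetric])
    finally show ?thesis .
  qed
  then show ?thesis
    using partial_meas[OF assms(3), of k] V.partial_meas[OF assms(3), of k]
    by (intro Levy_uniqueness M01.real_distribution_distr ext) auto
qed

lemma lpnorm_partial_unique:
  assumes "copies V" "finite F" "F \<subseteq> {1..}"
  shows "lpnorm p (\<lambda>x. \<Sum>n\<in>F. k n (W n x)) = lpnorm p (\<lambda>x. \<Sum>n\<in>F. k n (V n x))"
proof -
  interpret V: copies V by fact
  have "(LINT x|M01. \<bar>f x\<bar> powr p) = (LINT t|distr M01 borel f. \<bar>t\<bar> powr p)"
    if "f \<in> borel_measurable M01" for f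
    using that by (subst integral_distr) auto
  then show ?thesis
    using partial_meas[OF assms(3), of k] V.partial_meas[OF assms(3), of k] distr_partial_unique[OF assms, of k]
    by (simp add: lpnorm_def)
qed

text \<open>A difference of partial sums becomes one sum over the copies with modified coefficients,
  the form required by \<open>lpnorm_partial_unique\<close>.\<close>

lemma partial_diff:
  fixes k :: "nat \<Rightarrow> nat \<Rightarrow> real"
  shows "(\<Sum>n\<in>{1..i}. k n (w n)) - (\<Sum>n\<in>{1..j}. k n (w n))
     = (\<Sum>n\<in>{1..max i j}. (of_bool (n \<le> i) - of_bool (n \<le> j)) * k n (w n))"
proof -
  have "(\<Sum>n\<in>{1..i}. k n (w n)) = (\<Sum>n\<in>{1..max i j}. of_bool (n \<le> i) * k n (w n))" for i j
    by (rule sum.mono_neutral_cong_left) auto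
  from this[of i j] this[of j i] show ?thesis
    by (simp add: left_diff_distrib sum_subtractf max.commute)
qed

text \<open>Norms of differences of partial sums depend only on the joint law of the copies, so the
  Cauchy property passes from W to V and completeness supplies the limit.\<close>

lemma partial_lim_transfer:
  assumes V: "copies V" and p: "1 \<le> p" and lim: "lp_lim p (\<lambda>M x. \<Sum>n\<in>{1..M}. k n (W n x)) f"
  shows "\<exists>g. lp_lim p (\<lambda>M x. \<Sum>n\<in>{1..M}. k n (V n x)) g"
proof -
  interpret V: copies V by fact
  have p0: "0 < p" using p by simp
  have eq: "lpnorm p (\<lambda>x. (\<Sum>n\<in>{1..i}. k n (V n x)) - (\<Sum>n\<in>{1..j}. k n (V n x)))
     = lpnorm p (\<lambda>x. (\<Sum>n\<in>{1..i}. k n (W n x)) - (\<Sum>n\<in>{1..j}. k n (W n x)))" for i j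
    unfolding partial_diff[of k "\<lambda>n. V n x" i j for x] partial_diff[of k "\<lambda>n. W n x" i j for x]
    by (rule lpnorm_partial_unique[OF V, symmetric, where k = "\<lambda>n u. (of_bool (n \<le> i) - of_bool (n \<le> j)) * k n u"]) auto
  show ?thesis
  proof (rule Lp_complete[OF p])
    show "(\<lambda>x. \<Sum>n\<in>{1..M}. k n (V n x)) \<in> Lp p" for M using p0 by (intro V.partial_Lp) auto
    show "\<exists>N. \<forall>i\<ge>N. \<forall>j\<ge>N. lpnorm p (\<lambda>x. (\<Sum>n\<in>{1..i}. k n (V n x)) - (\<Sum>n\<in>{1..j}. k n (V n x))) < e" if "0 < e" for e
      unfolding eq using p0 by (intro lp_lim_Cauchy[OF p _ lim that] partial_Lp) auto
  qed
qed

section \<open>Haar expansions within a copy and the span of the copies\<close>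

definition hW :: "nat \<Rightarrow> nat \<times> nat \<Rightarrow> real \<Rightarrow> real" where
  "hW n I x = dhaar n I (W n x)"

lemma hW_meas: "1 \<le> n \<Longrightarrow> hW n I \<in> borel_measurable M01"
  unfolding hW_def[abs_def] by (rule gW_borel)

lemma hW_bdd: "\<bar>hW n I x\<bar> \<le> 1" by (simp add: hW_def dhaar_abs_le)

lemma hW_Lp: "1 \<le> n \<Longrightarrow> 0 < r \<Longrightarrow> hW n I \<in> Lp r"
  using hW_meas hW_bdd by (intro Lp_bounded[where B = 1]) auto

text \<open>Integrating f against the identity of \<open>dhaar_kernel\<close> reproduces the centred
  conditional expectation.\<close>

lemma G_haar:
  assumes n: "1 \<le> n" and v: "v < 2 ^ n" and f: "integrable M01 f"
  shows "G n f v = (\<Sum>I\<in>dyadic (n - 1). 2 ^ fst I * pair (hW n I) f * dhaar n I v)"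
proof -
  have "(\<Sum>I\<in>dyadic (n - 1). 2 ^ fst I * pair (hW n I) f * dhaar n I v)
    = (\<Sum>I\<in>dyadic (n - 1). LINT x|M01. f x * (2 ^ fst I * (dhaar n I (W n x) * dhaar n I v)))"
    by (intro sum.cong refl) (simp add: pair_def hW_def mult_ac flip: integral_mult_right_zero)
  also have "\<dots> = (LINT x|M01. (\<Sum>I\<in>dyadic (n - 1). f x * (2 ^ fst I * (dhaar n I (W n x) * dhaar n I v))))"
    by (intro Bochner_Integration.integral_sum[symmetric] mult_gW_integrable[OF n f])
  also have "\<dots> = (LINT x|M01. 2 ^ n * (f x * of_bool (W n x = v)) - f x)"
  proof (intro Bochner_Integration.integral_cong refl)
    fix x
    have "(\<Sum>I\<in>dyadic (n - 1). f x * (2 ^ fst I * (dhaar n I (W n x) * dhaar n I v)))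
      = f x * ((if W n x = v then 2 ^ n else 0) - 1)"
      using n v W_lt[OF n, of x] by (simp only: sum_distrib_left[symmetric]) (subst dhaar_kernel, auto)
    then show "(\<Sum>I\<in>dyadic (n - 1). f x * (2 ^ fst I * (dhaar n I (W n x) * dhaar n I v)))
      = 2 ^ n * (f x * of_bool (W n x = v)) - f x"
      by (auto simp: algebra_simps)
  qed
  also have "\<dots> = G n f v"
    using f mult_ind_integrable[OF n f, of v] by (simp add: G_def)
  finally show ?thesis by simp
qed

lemma S_haar:
  assumes f: "integrable M01 f"
  shows "S M f x = (\<Sum>n\<in>{1..M}. \<Sum>I\<in>dyadic (n - 1). 2 ^ fst I * pair (hW n I) f * hW n I x)"
  unfolding S_def using W_lt f by (intro sum.cong refl) (auto simp: G_haar hW_def)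

lemma Rspace_subset_Lp: "f \<in> Rspace p h \<Longrightarrow> f \<in> Lp p"
  by (simp add: Rspace_def lp_closure_def)

lemma S_in_span:
  assumes f: "integrable M01 f"
  shows "S M f \<in> {(\<lambda>x. \<Sum>\<iota>\<in>F. c \<iota> * hW (fst \<iota>) (snd \<iota>) x) | F c. finite F \<and> F \<subseteq> Domega}"
proof -
  let ?F = "Sigma {1..M} (\<lambda>n. dyadic (n - 1))"
  have "S M f = (\<lambda>x. \<Sum>\<iota>\<in>?F. (2 ^ fst (snd \<iota>) * pair (hW (fst \<iota>) (snd \<iota>)) f) * hW (fst \<iota>) (snd \<iota>) x)"
    unfolding S_haar[OF f, abs_def] by (subst sum.Sigma) (auto simp: case_prod_beta)
  moreover have "finite ?F" "?F \<subseteq> Domega" by (auto simp: Domega_def)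
  ultimately show ?thesis
    by (intro CollectI exI[of _ ?F] exI[of _ "\<lambda>\<iota>. 2 ^ fst (snd \<iota>) * pair (hW (fst \<iota>) (snd \<iota>)) f"] conjI)
qed

lemma span_eq_partial:
  assumes "finite F" "F \<subseteq> Domega"
  shows "\<exists>M k. (\<forall>n\<ge>1. (\<Sum>u<2 ^ n. k n u) = 0) \<and>
    (\<forall>x. (\<Sum>\<iota>\<in>F. c \<iota> * hW (fst \<iota>) (snd \<iota>) x) = (\<Sum>n\<in>{1..M}. k n (W n x)))"
proof -
  define k where "k n u = (\<Sum>\<iota>\<in>{\<iota>\<in>F. fst \<iota> = n}. c \<iota> * dhaar n (snd \<iota>) u)" for n u
  obtain M where M: "\<And>\<iota>. \<iota> \<in> F \<Longrightarrow> fst \<iota> \<le> M"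
    using finite_nat_set_iff_bounded_le[of "fst ` F"] assms(1) by auto
  have "(\<Sum>u<2 ^ n. k n u) = 0" if n: "1 \<le> n" for n
  proof -
    have "(\<Sum>u<2 ^ n. k n u) = (\<Sum>\<iota>\<in>{\<iota>\<in>F. fst \<iota> = n}. c \<iota> * (\<Sum>u<2 ^ n. dhaar n (snd \<iota>) u))"
      unfolding k_def by (subst sum.swap) (simp add: sum_distrib_left)
    also have "\<dots> = 0"
    proof (rule sum.neutral, rule ballI)
      fix \<iota> assume "\<iota> \<in> {\<iota>\<in>F. fst \<iota> = n}"
      then have "snd \<iota> \<in> dyadic (n - 1)" using assms(2) by (auto simp: Domega_def)
      then show "c \<iota> * (\<Sum>u<2 ^ n. dhaar n (snd \<iota>) u) = 0" using n by (simp add: dhaar_sum_zero)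
    qed
    finally show ?thesis .
  qed
  moreover have "(\<Sum>\<iota>\<in>F. c \<iota> * hW (fst \<iota>) (snd \<iota>) x) = (\<Sum>n\<in>{1..M}. k n (W n x))" for x
  proof -
    have "(\<Sum>n\<in>{1..M}. k n (W n x)) = (\<Sum>n\<in>{1..M}. \<Sum>\<iota>\<in>{\<iota>\<in>F. fst \<iota> = n}. c \<iota> * hW (fst \<iota>) (snd \<iota>) x)"
      unfolding k_def hW_def by (intro sum.cong) auto
    also have "\<dots> = (\<Sum>\<iota>\<in>F. c \<iota> * hW (fst \<iota>) (snd \<iota>) x)"
      using assms M by (intro sum.group) (auto simp: Domega_def)
    finally show ?thesis by simp
  qed
  ultimately show ?thesis by (intro exI[of _ M] exI[of _ k]) blast
qed

text \<open>A finite combination close to y is fixed by all late partial sum operators, and these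
  are uniformly bounded. Together with \<open>Rspace_of_lim\<close> this describes the space as the
  functions that are limits of their own partial sums, the form in which membership is checked
  afterwards.\<close>

lemma Rspace_lim:
  assumes p: "1 < p" and y: "y \<in> Rspace p hW"
  shows "lp_lim p (\<lambda>M. S M y) y"
proof -
  have p0: "0 < p" "1 \<le> p" using p by auto
  have yL: "y \<in> Lp p" using Rspace_subset_Lp[OF y] .
  have yi: "integrable M01 y" using Lp_integrable[OF p0(2) yL] .
  obtain C where C: "0 \<le> C" "\<And>f M. f \<in> Lp p \<Longrightarrow> lpnorm p (S M f) \<le> C * lpnorm p f"
    using S_bounded[OF p] by blast
  have "\<exists>N. \<forall>M\<ge>N. norm (lpnorm p (\<lambda>x. S M y x - y x) - 0) < e" if e: "0 < e" for e
  proof -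
    define d where "d = e / 2 / (C + 1)"
    have d: "0 < d" using e C by (simp add: d_def)
    then obtain F c where F: "finite F" "F \<subseteq> Domega"
      and gd: "lpnorm p (\<lambda>x. y x - (\<Sum>\<iota>\<in>F. c \<iota> * hW (fst \<iota>) (snd \<iota>) x)) < d"
      using y unfolding Rspace_def lp_closure_def by blast
    obtain N k where k0: "\<forall>n\<ge>1. (\<Sum>u<2 ^ n. k n u) = 0"
      and g: "\<forall>x. (\<Sum>\<iota>\<in>F. c \<iota> * hW (fst \<iota>) (snd \<iota>) x) = (\<Sum>n\<in>{1..N}. k n (W n x))"
      using span_eq_partial[OF F, of c] by (elim exE conjE)
    have k: "(\<Sum>u<2 ^ n. k n u) = 0" if "1 \<le> n" for n using k0 that by blast
    define gg where "gg x = (\<Sum>n\<in>{1..N}. k n (W n x))" for x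
    have ggL: "gg \<in> Lp p" unfolding gg_def[abs_def] using p0 by (intro partial_Lp) auto
    have ggi: "integrable M01 gg" using Lp_integrable[OF p0(2) ggL] .
    have dist: "lpnorm p (\<lambda>x. y x - gg x) < d" using gd unfolding g[rule_format] gg_def .
    have "lpnorm p (\<lambda>x. S M y x - y x) < e" if M: "N \<le> M" for M
    proof -
      have Sg: "S M gg = gg" unfolding gg_def[abs_def] using S_partial[of N k M] k M by auto
      have L: "S M y \<in> Lp p" using S_Lp[OF p0(1)] .
      have "(\<lambda>x. S M y x - gg x) = S M (\<lambda>x. y x - gg x)" using S_diff[OF yi ggi, of M] Sg by auto
      then have "lpnorm p (\<lambda>x. S M y x - gg x) \<le> C * lpnorm p (\<lambda>x. y x - gg x)"
        using C(2)[OF Lp_diff[OF p0(1) yL ggL]] by simp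
      also have "\<dots> \<le> C * d" using dist C by (intro mult_left_mono) auto
      finally have 1: "lpnorm p (\<lambda>x. S M y x - gg x) \<le> C * d" .
      have "lpnorm p (\<lambda>x. S M y x - y x) \<le> lpnorm p (\<lambda>x. S M y x - gg x) + lpnorm p (\<lambda>x. gg x - y x)"
        by (rule lpnorm_triangle_diff[OF p0(2) L ggL yL])
      also have "\<dots> < C * d + d" using 1 dist lpnorm_minus_commute[of p gg y] by linarith
      also have "C * d + d = d * (C + 1)" by (simp add: algebra_simps)
      also have "\<dots> = e / 2" using C(1) by (intro iffD1[OF nonzero_eq_divide_eq d_def]) auto
      finally show ?thesis using e by simp
    qed
    then show ?thesis by auto
  qed
  then show ?thesis using yL unfolding lp_lim_def by (intro conjI LIMSEQ_I) auto
qed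

lemma Rspace_of_lim:
  assumes p: "1 < p" and f: "f \<in> Lp p" and lim: "lp_lim p (\<lambda>M. S M f) f"
  shows "f \<in> Rspace p hW"
proof -
  have fi: "integrable M01 f" using Lp_integrable[OF _ f] p by simp
  have "\<exists>g\<in>{(\<lambda>x. \<Sum>\<iota>\<in>F. c \<iota> * hW (fst \<iota>) (snd \<iota>) x) | F c. finite F \<and> F \<subseteq> Domega}. lpnorm p (\<lambda>x. f x - g x) < e"
    if e: "0 < e" for e
  proof -
    have "(\<lambda>M. lpnorm p (\<lambda>x. S M f x - f x)) \<longlonglongrightarrow> 0" using lim by (simp add: lp_lim_def)
    from LIMSEQ_D[OF this e] obtain M where "lpnorm p (\<lambda>x. S M f x - f x) < e" by auto
    then have "lpnorm p (\<lambda>x. f x - S M f x) < e" using lpnorm_minus_commute[of p f "S M f"] by simp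
    then show ?thesis by (rule bexI[OF _ S_in_span[OF fi]])
  qed
  then show ?thesis using f unfolding Rspace_def lp_closure_def by blast
qed

lemma Rspace_lincomb:
  assumes p: "1 < p" and f: "f \<in> Rspace p hW" and g: "g \<in> Rspace p hW"
  shows "(\<lambda>x. a * f x + b * g x) \<in> Rspace p hW"
proof (rule Rspace_of_lim[OF p])
  have p0: "0 < p" "1 \<le> p" using p by auto
  have L: "f \<in> Lp p" "g \<in> Lp p" using f g Rspace_subset_Lp by auto
  have int: "integrable M01 f" "integrable M01 g" using Lp_integrable[OF p0(2)] L by auto
  show "(\<lambda>x. a * f x + b * g x) \<in> Lp p" using p0 L by (intro Lp_lincomb)
  have "lp_lim p (\<lambda>M x. a * S M f x + b * S M g x) (\<lambda>x. a * f x + b * g x)"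
    using p0 by (intro lp_lim_lincomb Rspace_lim p f g S_Lp) auto
  moreover have "(\<lambda>M. S M (\<lambda>x. a * f x + b * g x)) = (\<lambda>M x. a * S M f x + b * S M g x)"
    by (intro ext S_lincomb[OF int])
  ultimately show "lp_lim p (\<lambda>M. S M (\<lambda>x. a * f x + b * g x)) (\<lambda>x. a * f x + b * g x)" by simp
qed

lemma Rspace_gW:
  assumes p: "1 < p" and m: "1 \<le> m" and k: "(\<Sum>u<2 ^ m. k u) = 0"
  shows "(\<lambda>x. k (W m x)) \<in> Rspace p hW"
proof (rule Rspace_of_lim[OF p])
  have p0: "0 < p" "1 \<le> p" using p by auto
  show L: "(\<lambda>x. k (W m x)) \<in> Lp p" using gW_bdd[OF m, of k] m p0 by (intro Lp_bounded) auto
  define kk where "kk i = (if i = m then k else (\<lambda>_. 0))" for i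
  have eq: "(\<lambda>x. \<Sum>i\<in>{1..m}. kk i (W i x)) = (\<lambda>x. k (W m x))"
  proof
    fix x
    have "(\<Sum>i\<in>{1..m}. kk i (W i x)) = (\<Sum>i\<in>{1..m}. if i = m then k (W m x) else 0)"
      by (intro sum.cong) (auto simp: kk_def)
    then show "(\<Sum>i\<in>{1..m}. kk i (W i x)) = k (W m x)" using m by simp
  qed
  have kk0: "(\<Sum>u<2 ^ i. kk i u) = 0" for i using k by (simp add: kk_def)
  have "S M (\<lambda>x. k (W m x)) = (\<lambda>x. k (W m x))" if "m \<le> M" for M
  proof -
    have "S M (\<lambda>x. \<Sum>i\<in>{1..m}. kk i (W i x)) = (\<lambda>x. \<Sum>i\<in>{1..m}. kk i (W i x))"
      by (intro ext S_partial kk0 that)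
    then show ?thesis by (simp only: eq)
  qed
  then have "(\<lambda>M. lpnorm p (\<lambda>x. S M (\<lambda>x. k (W m x)) x - k (W m x))) \<longlonglongrightarrow> 0"
    using p0 by (intro tendsto_eventually eventually_sequentiallyI[of m]) (simp add: lpnorm_def)
  then show "lp_lim p (\<lambda>M. S M (\<lambda>x. k (W m x))) (\<lambda>x. k (W m x))" using L by (simp add: lp_lim_def)
qed

lemma Rspace_sum:
  assumes p: "1 < p" and f: "\<And>i. i \<in> F \<Longrightarrow> f i \<in> Rspace p hW"
  shows "(\<lambda>x. \<Sum>i\<in>F. c i * f i x) \<in> Rspace p hW"
  using f
proof (induction F rule: infinite_finite_induct)
  case (insert i F)
  then show ?case using Rspace_lincomb[OF p, of "f i" "\<lambda>x. \<Sum>i\<in>F. c i * f i x" "c i" 1] by simp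
qed (use Rspace_gW[OF p, of 1 "\<lambda>_. 0"] in auto)

lemma Rspace_closed:
  assumes p: "1 < p" and s: "\<And>M. s M \<in> Rspace p hW" and lim: "lp_lim p s f"
  shows "f \<in> Rspace p hW"
proof -
  have p0: "0 < p" "1 \<le> p" using p by auto
  have f: "f \<in> Lp p" using lim by (simp add: lp_lim_def)
  have "\<exists>g\<in>{(\<lambda>x. \<Sum>\<iota>\<in>F. c \<iota> * hW (fst \<iota>) (snd \<iota>) x) | F c. finite F \<and> F \<subseteq> Domega}. lpnorm p (\<lambda>x. f x - g x) < e"
    if e: "0 < e" for e
  proof -
    have "(\<lambda>M. lpnorm p (\<lambda>x. s M x - f x)) \<longlonglongrightarrow> 0" using lim by (simp add: lp_lim_def)
    from LIMSEQ_D[OF this, of "e / 2"] obtain M where M: "lpnorm p (\<lambda>x. s M x - f x) < e / 2" using e by auto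
    have "lp_lim p (\<lambda>i. S i (s M)) (s M)" by (rule Rspace_lim[OF p s])
    then have "(\<lambda>i. lpnorm p (\<lambda>x. S i (s M) x - s M x)) \<longlonglongrightarrow> 0" by (simp add: lp_lim_def)
    from LIMSEQ_D[OF this, of "e / 2"] obtain i where i: "lpnorm p (\<lambda>x. S i (s M) x - s M x) < e / 2" using e by auto
    have sL: "s M \<in> Lp p" using Rspace_subset_Lp[OF s] .
    have "lpnorm p (\<lambda>x. f x - S i (s M) x) \<le> lpnorm p (\<lambda>x. f x - s M x) + lpnorm p (\<lambda>x. s M x - S i (s M) x)"
      by (rule lpnorm_triangle_diff[OF p0(2) f sL S_Lp[OF p0(1)]])
    then have "lpnorm p (\<lambda>x. f x - S i (s M) x) < e"
      using M i lpnorm_minus_commute[of p f "s M"] lpnorm_minus_commute[of p "s M" "S i (s M)"] by linarith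
    then show ?thesis by (rule bexI[OF _ S_in_span[OF Lp_integrable[OF p0(2) sL]]])
  qed
  then show ?thesis using f unfolding Rspace_def lp_closure_def by blast
qed

end

section \<open>Factorization through a second system of copies\<close>

lemma card_dyadic_le: "1 \<le> n \<Longrightarrow> card (dyadic (n - 1)) \<le> 2 ^ n"
proof -
  assume n: "1 \<le> n"
  have "card (dyadic (n - 1)) = (\<Sum>k\<le>n - 1. 2 ^ k)"
    unfolding dyadic_eq_Sigma by (subst card_SigmaI) auto
  also have "\<dots> = (\<Sum>k<n. 2 ^ k)" using n by (intro sum.cong) auto
  also have "\<dots> = 2 ^ n - 1" using mask_eq_sum_exp_nat[of n] by (simp add: lessThan_def)
  finally show ?thesis by simp
qed

lemma dyadic_fst_le: "I \<in> dyadic (n - 1) \<Longrightarrow> (2::real) ^ fst I \<le> 2 ^ n"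
  by (auto simp: dyadic_def intro!: power_increasing)

lemma sum_half_le: "(\<Sum>n\<in>{1..M}. (1/2::real) ^ n) \<le> 1"
proof -
  have "(\<Sum>n\<in>{1..M}. (1/2::real) ^ n) = 1 - (1/2) ^ M"
    by (induction M) (auto simp: atLeastAtMostSuc_conv)
  then show ?thesis by simp
qed

text \<open>The origin of the 8: at most 2^n intervals, each of weight at most 2^n, leave 2^-n of
  8^-n, and this is summable over n.\<close>

lemma sum_dyadic_weight_le:
  assumes "1 \<le> n" "0 \<le> b"
  shows "(\<Sum>I\<in>dyadic (n - 1). 2 ^ fst I * (b / 8 ^ n)) \<le> b * (1/2::real) ^ n"
proof -
  have "(\<Sum>I\<in>dyadic (n - 1). 2 ^ fst I * (b / 8 ^ n)) \<le> (\<Sum>I\<in>dyadic (n - 1). 2 ^ n * (b / 8 ^ n))"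
    using assms dyadic_fst_le by (intro sum_mono mult_right_mono) auto
  also have "\<dots> = card (dyadic (n - 1)) * (2 ^ n * (b / 8 ^ n))" by simp
  also have "\<dots> \<le> 2 ^ n * (2 ^ n * (b / 8 ^ n))"
  proof (rule mult_right_mono)
    have "real (card (dyadic (n - 1))) \<le> real (2 ^ n)" using card_dyadic_le[OF assms(1)] by (rule of_nat_mono)
    then show "real (card (dyadic (n - 1))) \<le> 2 ^ n" by simp
  qed (use assms in auto)
  also have "\<dots> = b * (1/2) ^ n"
  proof -
    have "(8::real) ^ n = 2 ^ n * (2 ^ n * 2 ^ n)" by (simp flip: power_mult_distrib)
    then show ?thesis by (simp add: power_one_over)
  qed
  finally show ?thesis .
qed

locale operator_on_copies = copies +
  fixes p q K :: real and T :: "(real \<Rightarrow> real) \<Rightarrow> real \<Rightarrow> real"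
  assumes p: "1 < p" and q: "q = p / (p - 1)"
    and T_R: "\<And>f. f \<in> Rspace p hW \<Longrightarrow> T f \<in> Rspace p hW"
    and T_lin: "lin_on (Rspace p hW) T"
    and K: "0 \<le> K" and T_bdd: "\<And>f. f \<in> Rspace p hW \<Longrightarrow> lpnorm p (T f) \<le> K * lpnorm p f"
begin

abbreviation R :: "(real \<Rightarrow> real) set" where "R \<equiv> Rspace p hW"

lemma pq: "0 < p" "1 \<le> p" "1 < q" "0 < q" "1 \<le> q" "1 / p + 1 / q = 1" "1 / q + 1 / p = 1"
  using p by (auto simp: q field_simps)

lemma R_Lp: "f \<in> R \<Longrightarrow> f \<in> Lp p"
  by (rule Rspace_subset_Lp)

lemma T_Lp: "f \<in> R \<Longrightarrow> T f \<in> Lp p"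
  by (intro R_Lp T_R)

lemma pair_T_bound:
  assumes "g \<in> Lp q" "f \<in> R"
  shows "\<bar>pair g (T f)\<bar> \<le> lpnorm q g * (K * lpnorm p f)"
proof -
  have "\<bar>pair g (T f)\<bar> \<le> lpnorm q g * lpnorm p (T f)"
    using pair_le_lpnorm[OF p pq(3) pq(6) assms(1) T_Lp[OF assms(2)]] .
  also have "\<dots> \<le> lpnorm q g * (K * lpnorm p f)" using T_bdd[OF assms(2)] by (intro mult_left_mono) auto
  finally show ?thesis .
qed

lemma pair_lincomb2:
  assumes "g \<in> Lp q" "f \<in> Lp p" "f' \<in> Lp p"
  shows "pair g (\<lambda>x. a * f x + b * f' x) = a * pair g f + b * pair g f'"
proof -
  have "pair g (\<lambda>x. a * f x + b * f' x) = (LINT x|M01. a * (g x * f x) + b * (g x * f' x))"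
    unfolding pair_def by (intro Bochner_Integration.integral_cong) (auto simp: algebra_simps)
  then show ?thesis
    using Holder(1)[OF pq(3) p pq(7) assms(1,2)] Holder(1)[OF pq(3) p pq(7) assms(1,3)] by (simp add: pair_def)
qed

lemma pair_T_lincomb:
  assumes g: "g \<in> Lp q" and f: "f \<in> R" "f' \<in> R"
  shows "pair g (T (\<lambda>x. a * f x + b * f' x)) = a * pair g (T f) + b * pair g (T f')"
proof -
  have "eqae (T (\<lambda>x. a * f x + b * f' x)) (\<lambda>x. a * T f x + b * T f' x)"
    using T_lin f unfolding lin_on_def by blast
  moreover have "T (\<lambda>x. a * f x + b * f' x) \<in> Lp p" by (intro T_Lp Rspace_lincomb p f)
  moreover have "(\<lambda>x. a * T f x + b * T f' x) \<in> Lp p" using pq T_Lp f by (intro Lp_lincomb) auto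
  ultimately have "pair g (T (\<lambda>x. a * f x + b * f' x)) = pair g (\<lambda>x. a * T f x + b * T f' x)"
    using g by (intro pair_eqae) auto
  then show ?thesis using pair_lincomb2[OF g T_Lp[OF f(1)] T_Lp[OF f(2)]] by simp
qed

lemma zero_R: "(\<lambda>x. 0) \<in> R"
  using Rspace_gW[OF p, of 1 "\<lambda>_. 0"] by simp

lemma pair_T_zero: "g \<in> Lp q \<Longrightarrow> pair g (T (\<lambda>x. 0)) = 0"
  using pair_T_lincomb[OF _ zero_R zero_R, of g 0 0] by simp

lemma pair_T_sum:
  assumes g: "g \<in> Lp q" and f: "\<And>i. i \<in> F \<Longrightarrow> f i \<in> R" and fin: "finite F"
  shows "pair g (T (\<lambda>x. \<Sum>i\<in>F. c i * f i x)) = (\<Sum>i\<in>F. c i * pair g (T (f i)))"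
  using fin f
proof (induction F rule: finite_induct)
  case (insert i F)
  have "(\<lambda>x. \<Sum>i\<in>F. c i * f i x) \<in> R" using insert by (intro Rspace_sum p) auto
  then show ?case
    using pair_T_lincomb[OF g, of "f i" "\<lambda>x. \<Sum>i\<in>F. c i * f i x" "c i" 1] insert by simp
qed (simp add: pair_T_zero[OF g])

lemma pair_T_lim:
  assumes g: "g \<in> Lp q" and s: "\<And>M. s M \<in> R" and lim: "lp_lim p s f"
  shows "(\<lambda>M. pair g (T (s M))) \<longlonglongrightarrow> pair g (T f)"
proof -
  have f: "f \<in> R" by (rule Rspace_closed[OF p s lim])
  have le: "\<bar>pair g (T (s M)) - pair g (T f)\<bar> \<le> lpnorm q g * (K * lpnorm p (\<lambda>x. s M x - f x))" for M
    using pair_T_lincomb[OF g s f, of 1 M "-1"] pair_T_bound[OF g, of "\<lambda>x. s M x - f x"]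
      Rspace_lincomb[OF p s f, of 1 M "-1"] by simp
  have "(\<lambda>M. lpnorm q g * (K * lpnorm p (\<lambda>x. s M x - f x))) \<longlonglongrightarrow> lpnorm q g * (K * 0)"
    using lim unfolding lp_lim_def by (intro tendsto_intros) auto
  then have "(\<lambda>M. lpnorm q g * (K * lpnorm p (\<lambda>x. s M x - f x))) \<longlonglongrightarrow> 0" by simp
  from tendsto_0_le[OF this abs_ge_zero le] show ?thesis using LIM_zero_cancel tendsto_rabs_zero_iff by blast
qed

text \<open>The embedding keeps the coefficients of y and replaces each \<open>W n\<close> by
  \<open>V n\<close>; since both systems have the same joint law it preserves distributions. The
  compression of T to its image has, up to normalisation, the given entries as its matrix in the
  Haar system. Its difference from \<mu> is small enough to be summed in absolute value, which gives
  the error \<theta>.\<close>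

lemma orth_factor_of_copies:
  fixes V :: "nat \<Rightarrow> real \<Rightarrow> nat" and \<mu> \<theta> lam0 \<epsilon> :: real
  assumes V: "copies V"
    and VR: "\<And>n k. 1 \<le> n \<Longrightarrow> (\<Sum>u<2 ^ n. k u) = 0 \<Longrightarrow> (\<lambda>x. k (V n x)) \<in> R"
    and entries: "\<And>n I n' I'. 1 \<le> n \<Longrightarrow> I \<in> dyadic (n - 1) \<Longrightarrow> 1 \<le> n' \<Longrightarrow> I' \<in> dyadic (n' - 1) \<Longrightarrow>
       \<bar>pair (copies.hW V n I) (T (copies.hW V n' I')) - (if n = n' \<and> I = I' then \<mu> / 2 ^ fst I else 0)\<bar> \<le> \<theta> / 8 ^ (n + n')"
    and \<theta>: "0 \<le> \<theta>" and \<epsilon>: "\<theta> + \<bar>\<mu> - lam0\<bar> < \<epsilon>"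
  shows "orth_factor p R R T (\<lambda>y x. lam0 * y x) \<epsilon>"
proof -
  interpret V: copies V by fact
  \<comment> \<open>Partial sums of the image of y: coefficients computed with W, evaluated at
    V.\<close>
  define js where "js y M x = (\<Sum>n\<in>{1..M}. G n y (V n x))" for y M x
  define j where "j y = (SOME g. lp_lim p (js y) g)" for y
  have yi: "integrable M01 y" if "y \<in> R" for y using Lp_integrable[OF pq(2) R_Lp[OF that]] .
  have ylim: "lp_lim p (\<lambda>M x. \<Sum>n\<in>{1..M}. G n y (W n x)) y" if "y \<in> R" for y
    using Rspace_lim[OF p that] by (simp add: S_def[abs_def])
  have jlim: "lp_lim p (js y) (j y)" if "y \<in> R" for y
    unfolding j_def js_def[abs_def] by (rule someI_ex[OF partial_lim_transfer[OF V pq(2) ylim[OF that]]])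
  have VsumR: "(\<lambda>x. \<Sum>n\<in>{1..M}. k n (V n x)) \<in> R" if "\<And>n. 1 \<le> n \<Longrightarrow> (\<Sum>u<2 ^ n. k n u) = 0" for k M
    using Rspace_sum[OF p, of "{1..M}" "\<lambda>n x. k n (V n x)" "\<lambda>_. 1"] VR that by simp
  have jsR: "js y M \<in> R" if "y \<in> R" for y M
    unfolding js_def[abs_def] using G_sum_zero yi[OF that] by (intro VsumR) auto
  have jsL: "js y M \<in> Lp p" for y M unfolding js_def[abs_def] using pq by (intro V.partial_Lp) auto
  have jR: "j y \<in> R" if "y \<in> R" for y by (rule Rspace_closed[OF p jsR[OF that] jlim[OF that]])
  have jLp: "j y \<in> Lp p" if "y \<in> R" for y using jR[OF that] by (rule R_Lp)
  have jVS: "V.S M (j y) = js y M" if "y \<in> R" for y M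
    unfolding js_def[abs_def]
    by (rule V.S_of_partial_lim[OF pq(2) _ jlim[OF that, unfolded js_def[abs_def]]]) (rule G_sum_zero[OF _ yi[OF that]])
  have emb: "dist_embedding R R j"
    unfolding dist_embedding_def
  proof (intro conjI ballI)
    show "j y \<in> R" if "y \<in> R" for y by (rule jR[OF that])
    show "lin_on R j"
      unfolding lin_on_def
    proof (intro ballI allI)
      fix f g a b assume f: "f \<in> R" and g: "g \<in> R"
      have "lp_lim p (\<lambda>M x. a * js f M x + b * js g M x) (\<lambda>x. a * j f x + b * j g x)"
        by (intro lp_lim_lincomb pq jsL jlim f g)
      moreover have "js (\<lambda>x. a * f x + b * g x) = (\<lambda>M x. a * js f M x + b * js g M x)"
        unfolding js_def[abs_def] using yi[OF f] yi[OF g]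
        by (auto simp: fun_eq_iff G_lincomb sum.distrib sum_distrib_left intro!: sum.cong)
      ultimately have "lp_lim p (js (\<lambda>x. a * f x + b * g x)) (\<lambda>x. a * j f x + b * j g x)" by simp
      then show "eqae (j (\<lambda>x. a * f x + b * g x)) (\<lambda>x. a * j f x + b * j g x)"
        by (rule lp_lim_unique[OF pq(2) jsL jlim[OF Rspace_lincomb[OF p f g]]])
    qed
    show "distr M01 borel (j y) = distr M01 borel y" if y: "y \<in> R" for y
    proof (rule distr_eq_of_lp_lim[OF pq(2) jsL S_Lp[OF pq(1)] jlim[OF y] Rspace_lim[OF p y]])
      show "distr M01 borel (js y M) = distr M01 borel (S M y)" for M
        unfolding js_def[abs_def] S_def[abs_def]
        by (rule distr_partial_unique[OF V, symmetric]) auto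
    qed
  qed
  \<comment> \<open>The inverse of j on the range of the projection: take the V-coefficients of w
    and put W in place of V.\<close>
  have pullback: "\<exists>z\<in>R. (\<forall>n\<ge>1. \<forall>u<2 ^ n. G n z u = V.G n w u) \<and> lp_lim p (\<lambda>M x. \<Sum>n\<in>{1..M}. V.G n w (W n x)) z \<and> eqae (j z) (V.lim_proj p w)"
    if w: "w \<in> Lp p" for w
  proof -
    have wi: "integrable M01 w" using Lp_integrable[OF pq(2) w] .
    have "lp_lim p (\<lambda>M x. \<Sum>n\<in>{1..M}. V.G n w (V n x)) (V.lim_proj p w)"
      using V.lim_proj_lim[OF p w] by (simp add: V.S_def[abs_def])
    from V.partial_lim_transfer[OF copies_axioms pq(2) this]
    obtain z where z: "lp_lim p (\<lambda>M x. \<Sum>n\<in>{1..M}. V.G n w (W n x)) z" by blast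
    have zR: "z \<in> R"
    proof (rule Rspace_closed[OF p _ z])
      show "(\<lambda>x. \<Sum>n\<in>{1..M}. V.G n w (W n x)) \<in> R" for M
        using Rspace_sum[OF p, of "{1..M}" "\<lambda>n x. V.G n w (W n x)" "\<lambda>_. 1"] Rspace_gW[OF p] V.G_sum_zero[OF _ wi] by simp
    qed
    have Gz: "G n z u = V.G n w u" if "1 \<le> n" "u < 2 ^ n" for n u
      by (rule G_of_partial_lim[OF pq(2) V.G_sum_zero[OF _ wi] z that])
    have "js z = (\<lambda>M. V.S M w)"
      unfolding js_def[abs_def] V.S_def[abs_def] using Gz V.W_lt by (auto simp: fun_eq_iff intro!: sum.cong)
    then have "lp_lim p (\<lambda>M. V.S M w) (j z)" using jlim[OF zR] by simp
    then have "eqae (j z) (V.lim_proj p w)"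
      by (rule lp_lim_unique[OF pq(2) V.S_Lp[OF pq(1)] _ V.lim_proj_lim[OF p w]])
    then show ?thesis using zR Gz z by blast
  qed
  have image: "{f \<in> Lp p. \<exists>y\<in>R. eqae f (j y)} = lp_closure p (V.lim_proj 2 ` (Lp 2 \<inter> Lp p))"
  proof (intro set_eqI iffI)
    fix f assume "f \<in> {f \<in> Lp p. \<exists>y\<in>R. eqae f (j y)}"
    then obtain y where f: "f \<in> Lp p" and y: "y \<in> R" and fy: "eqae f (j y)" by blast
    have "\<exists>g\<in>V.lim_proj 2 ` (Lp 2 \<inter> Lp p). lpnorm p (\<lambda>x. f x - g x) < e" if e: "0 < e" for e
    proof -
      have "(\<lambda>M. lpnorm p (\<lambda>x. js y M x - j y x)) \<longlonglongrightarrow> 0" using jlim[OF y] by (simp add: lp_lim_def)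
      from LIMSEQ_D[OF this e] obtain M where M: "lpnorm p (\<lambda>x. js y M x - j y x) < e" by auto
      have s2: "js y M \<in> Lp 2" unfolding js_def[abs_def] by (intro V.partial_Lp) auto
      have S_fix: "V.S i (js y M) = js y M" if "M \<le> i" for i
        unfolding js_def[abs_def] using yi[OF y] by (intro ext V.S_partial that) (auto simp: G_sum_zero)
      have "lp_lim 2 (\<lambda>i. V.S i (js y M)) (js y M)"
        unfolding lp_lim_def using s2
        by (intro conjI tendsto_eventually eventually_sequentiallyI[of M]) (auto simp: S_fix lpnorm_def)
      then have ae: "eqae (V.lim_proj 2 (js y M)) (js y M)"
        using s2 by (intro lp_lim_unique[of 2 "\<lambda>i. V.S i (js y M)"] V.lim_proj_lim V.S_Lp) auto
      have "eqae (\<lambda>x. f x - V.lim_proj 2 (js y M) x) (\<lambda>x. j y x - js y M x)"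
        using fy ae by (auto simp: eqae_def)
      then have "lpnorm p (\<lambda>x. f x - V.lim_proj 2 (js y M) x) = lpnorm p (\<lambda>x. j y x - js y M x)"
        using f jLp[OF y] jsL[of y M] V.lim_proj_Lp[OF _ s2] by (intro lpnorm_eqae borel_measurable_diff) auto
      then have "lpnorm p (\<lambda>x. f x - V.lim_proj 2 (js y M) x) < e" using M lpnorm_minus_commute[of p "j y"] by simp
      then show ?thesis using s2 jsL by blast
    qed
    then show "f \<in> lp_closure p (V.lim_proj 2 ` (Lp 2 \<inter> Lp p))" using f by (auto simp: lp_closure_def)
  next
    fix f assume "f \<in> lp_closure p (V.lim_proj 2 ` (Lp 2 \<inter> Lp p))"
    then have f: "f \<in> Lp p" and cl: "\<And>e. 0 < e \<Longrightarrow> \<exists>g\<in>Lp 2 \<inter> Lp p. lpnorm p (\<lambda>x. f x - V.lim_proj 2 g x) < e"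
      by (auto simp: lp_closure_def)
    obtain C where C: "0 \<le> C" "\<And>f. f \<in> Lp p \<Longrightarrow> lpnorm p (V.lim_proj p f) \<le> C * lpnorm p f"
      using V.lim_proj_bounded[OF p] by blast
    \<comment> \<open>An element of the closure is fixed by the projection: compare f and its
      projection with the projection of g, which is fixed. The distance is at most C + 1 times that
      from f to the projection of g. Then f is in the image by \<open>pullback\<close>.\<close>
    have "lpnorm p (\<lambda>x. f x - V.lim_proj p f x) \<le> 0 + e" if e: "0 < e" for e
    proof -
      define d where "d = e / (C + 1)"
      have d: "0 < d" "C * d + d = e" using C e
      proof -
        show "0 < d" using C e by (simp add: d_def)
        have "d * (C + 1) = e" using C(1) by (intro iffD1[OF nonzero_eq_divide_eq d_def]) auto
        then show "C * d + d = e" by (simp add: algebra_simps)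
      qed
      obtain g where g: "g \<in> Lp 2" "g \<in> Lp p" "lpnorm p (\<lambda>x. f x - V.lim_proj 2 g x) < d" using cl[OF d(1)] by blast
      have Pg: "V.lim_proj p g \<in> Lp p" "V.lim_proj 2 g \<in> borel_measurable M01" using V.lim_proj_Lp[OF p g(2)] V.lim_proj_Lp[of 2 g] g by auto
      have "eqae (V.lim_proj p g) (V.lim_proj 2 g)" using p g by (intro V.lim_proj_eqae) auto
      then have "eqae (\<lambda>x. f x - V.lim_proj p g x) (\<lambda>x. f x - V.lim_proj 2 g x)" by (auto simp: eqae_def)
      then have "lpnorm p (\<lambda>x. f x - V.lim_proj p g x) = lpnorm p (\<lambda>x. f x - V.lim_proj 2 g x)"
        using f Pg by (intro lpnorm_eqae borel_measurable_diff) auto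
      then have 1: "lpnorm p (\<lambda>x. f x - V.lim_proj p g x) < d" using g by simp
      have dL: "(\<lambda>x. f x - V.lim_proj p g x) \<in> Lp p" using Lp_diff[OF pq(1) f Pg(1)] .
      have PfL: "V.lim_proj p f \<in> Lp p" using V.lim_proj_Lp[OF p f] .
      have "eqae (V.lim_proj p (\<lambda>x. 1 * f x + (-1) * V.lim_proj p g x)) (\<lambda>x. 1 * V.lim_proj p f x + (-1) * V.lim_proj p (V.lim_proj p g) x)"
        using V.lim_proj_lin[OF p] f Pg(1) unfolding lin_on_def by blast
      then have "eqae (V.lim_proj p (\<lambda>x. f x - V.lim_proj p g x)) (\<lambda>x. V.lim_proj p f x - V.lim_proj p g x)"
        by (simp add: V.lim_proj_lim_proj[OF p g(2)])
      then have "lpnorm p (\<lambda>x. V.lim_proj p f x - V.lim_proj p g x) = lpnorm p (V.lim_proj p (\<lambda>x. f x - V.lim_proj p g x))"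
        by (rule lpnorm_eqae[OF eqae_sym borel_measurable_diff[OF LpD(1)[OF PfL] LpD(1)[OF Pg(1)]] LpD(1)[OF V.lim_proj_Lp[OF p dL]]])
      also have "\<dots> \<le> C * lpnorm p (\<lambda>x. f x - V.lim_proj p g x)" using C(2)[OF dL] .
      also have "\<dots> \<le> C * d" using 1 C by (intro mult_left_mono) auto
      finally have 2: "lpnorm p (\<lambda>x. V.lim_proj p f x - V.lim_proj p g x) \<le> C * d" .
      show ?thesis
        using lpnorm_triangle_diff[OF pq(2) f Pg(1) PfL] 1 2 d(2) lpnorm_minus_commute[of p "V.lim_proj p g" "V.lim_proj p f"] by linarith
    qed
    then have "lpnorm p (\<lambda>x. f x - V.lim_proj p f x) \<le> 0" by (rule field_le_epsilon)
    then have "lpnorm p (\<lambda>x. f x - V.lim_proj p f x) = 0" using lpnorm_nonneg by (intro antisym) auto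
    then have "eqae f (V.lim_proj p f)" using eqae_iff_lpnorm_diff[OF pq(1) f V.lim_proj_Lp[OF p f]] by simp
    moreover obtain z where "z \<in> R" "eqae (j z) (V.lim_proj p f)" using pullback[OF f] by blast
    ultimately show "f \<in> {f \<in> Lp p. \<exists>y\<in>R. eqae f (j y)}" using f eqae_trans eqae_sym by blast
  qed
  have est: "\<exists>z\<in>R. eqae (j z) (V.lim_proj p (T (j y))) \<and> lpnorm p (\<lambda>x. z x - lam0 * y x) \<le> (\<theta> + \<bar>\<mu> - lam0\<bar>) * lpnorm p y"
    if y: "y \<in> R" for y
  proof -
    define w where "w = T (j y)"
    define N where "N = lpnorm p y"
    have N0: "0 \<le> N" by (simp add: N_def)
    have wL: "w \<in> Lp p" unfolding w_def by (intro T_Lp jR y)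
    have wi: "integrable M01 w" using Lp_integrable[OF pq(2) wL] .
    obtain z where z: "z \<in> R" "eqae (j z) (V.lim_proj p w)" "lp_lim p (\<lambda>M x. \<Sum>n\<in>{1..M}. V.G n w (W n x)) z"
      using pullback[OF wL] by blast
    define cy where "cy n I = 2 ^ fst I * pair (hW n I) y" for n I
    have cy: "\<bar>cy n I\<bar> \<le> 2 ^ fst I * N" if n: "1 \<le> n" for n I
    proof -
      have "\<bar>pair (hW n I) y\<bar> \<le> lpnorm q (hW n I) * lpnorm p y"
        using pair_le_lpnorm[OF p pq(3,6) hW_Lp[OF n pq(4)] R_Lp[OF y]] .
      also have "\<dots> \<le> 1 * lpnorm p y"
        using lpnorm_le_bound[OF pq(4) hW_bdd hW_meas[OF n]] by (intro mult_right_mono) auto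
      finally show ?thesis by (simp add: cy_def N_def abs_mult)
    qed
    have hVL: "V.hW n I \<in> Lp q" if "1 \<le> n" for n I using V.hW_Lp[OF that pq(4)] .
    have hVR: "V.hW n I \<in> R" if "1 \<le> n" "I \<in> dyadic (n - 1)" for n I
      unfolding V.hW_def[abs_def] using that by (intro VR) (auto simp: dhaar_sum_zero)
    have js_eq: "js y M = (\<lambda>x. \<Sum>\<iota>\<in>Sigma {1..M} (\<lambda>n. dyadic (n - 1)). cy (fst \<iota>) (snd \<iota>) * V.hW (fst \<iota>) (snd \<iota>) x)" for M
    proof
      fix x
      have "js y M x = (\<Sum>n\<in>{1..M}. \<Sum>I\<in>dyadic (n - 1). cy n I * V.hW n I x)"
        unfolding js_def using V.W_lt by (intro sum.cong refl) (auto simp: G_haar[OF _ _ yi[OF y]] cy_def V.hW_def)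
      then show "js y M x = (\<Sum>\<iota>\<in>Sigma {1..M} (\<lambda>n. dyadic (n - 1)). cy (fst \<iota>) (snd \<iota>) * V.hW (fst \<iota>) (snd \<iota>) x)"
        by (subst (asm) sum.Sigma) (auto simp: case_prod_beta)
    qed
    \<comment> \<open>Expanding the image of y turns the deviation into a sum of Haar coefficients
      of y, each at most 2^(fst I) times the norm, against entries at most \<theta> / 8^(n + n').
      Summing over n' uses up 8^n' and leaves 8^n for the outer sum in
      \<open>Dbound\<close>.\<close>
    have coef: "\<bar>pair (V.hW n I) w - \<mu> * pair (hW n I) y\<bar> \<le> \<theta> * N / 8 ^ n"
      if n: "1 \<le> n" and I: "I \<in> dyadic (n - 1)" for n I
    proof -
      have lim: "(\<lambda>M. pair (V.hW n I) (T (js y M))) \<longlonglongrightarrow> pair (V.hW n I) w"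
        unfolding w_def by (rule pair_T_lim[OF hVL[OF n] jsR[OF y] jlim[OF y]])
      have "\<bar>pair (V.hW n I) (T (js y M)) - \<mu> * pair (hW n I) y\<bar> \<le> \<theta> * N / 8 ^ n" if M: "n \<le> M" for M
      proof -
        let ?F = "Sigma {1..M} (\<lambda>n. dyadic (n - 1))"
        let ?d = "\<lambda>\<iota>. if n = fst \<iota> \<and> I = snd \<iota> then \<mu> / 2 ^ fst I else 0"
        have 1: "pair (V.hW n I) (T (js y M)) = (\<Sum>\<iota>\<in>?F. cy (fst \<iota>) (snd \<iota>) * pair (V.hW n I) (T (V.hW (fst \<iota>) (snd \<iota>))))"
          unfolding js_eq using hVR by (intro pair_T_sum hVL[OF n]) auto
        have "(\<Sum>\<iota>\<in>?F. cy (fst \<iota>) (snd \<iota>) * ?d \<iota>) = (\<Sum>\<iota>\<in>?F. if \<iota> = (n, I) then cy n I * (\<mu> / 2 ^ fst I) else 0)"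
          by (intro sum.cong) auto
        also have "\<dots> = \<mu> * pair (hW n I) y"
          using n M I by (subst sum.delta) (auto simp: cy_def)
        finally have 2: "\<mu> * pair (hW n I) y = (\<Sum>\<iota>\<in>?F. cy (fst \<iota>) (snd \<iota>) * ?d \<iota>)" by simp
        have "\<bar>pair (V.hW n I) (T (js y M)) - \<mu> * pair (hW n I) y\<bar>
          = \<bar>\<Sum>\<iota>\<in>?F. cy (fst \<iota>) (snd \<iota>) * (pair (V.hW n I) (T (V.hW (fst \<iota>) (snd \<iota>))) - ?d \<iota>)\<bar>"
          unfolding 1 2 by (simp add: right_diff_distrib sum_subtractf)
        also have "\<dots> \<le> (\<Sum>\<iota>\<in>?F. (2 ^ fst (snd \<iota>) * N) * (\<theta> / 8 ^ (n + fst \<iota>)))"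
        proof (rule order_trans[OF sum_abs sum_mono])
          fix \<iota> assume "\<iota> \<in> ?F"
          then have \<iota>: "1 \<le> fst \<iota>" "snd \<iota> \<in> dyadic (fst \<iota> - 1)" by auto
          show "\<bar>cy (fst \<iota>) (snd \<iota>) * (pair (V.hW n I) (T (V.hW (fst \<iota>) (snd \<iota>))) - ?d \<iota>)\<bar>
            \<le> (2 ^ fst (snd \<iota>) * N) * (\<theta> / 8 ^ (n + fst \<iota>))"
            unfolding abs_mult using cy[OF \<iota>(1)] entries[OF n I \<iota>] N0 by (intro mult_mono) auto
        qed
        also have "\<dots> = (\<Sum>n'\<in>{1..M}. \<Sum>I'\<in>dyadic (n' - 1). 2 ^ fst I' * ((\<theta> * N / 8 ^ n) / 8 ^ n'))"
          by (subst sum.Sigma) (auto simp: case_prod_beta power_add mult_ac intro!: sum.cong)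
        also have "\<dots> \<le> (\<Sum>n'\<in>{1..M}. (\<theta> * N / 8 ^ n) * (1/2) ^ n')"
          using \<theta> N0 by (intro sum_mono sum_dyadic_weight_le) auto
        also have "\<dots> = (\<theta> * N / 8 ^ n) * (\<Sum>n'\<in>{1..M}. (1/2) ^ n')" by (simp add: sum_distrib_left)
        also have "\<dots> \<le> (\<theta> * N / 8 ^ n) * 1" using \<theta> N0 sum_half_le by (intro mult_left_mono) auto
        finally show ?thesis by simp
      qed
      moreover have "(\<lambda>M. \<bar>pair (V.hW n I) (T (js y M)) - \<mu> * pair (hW n I) y\<bar>) \<longlonglongrightarrow> \<bar>pair (V.hW n I) w - \<mu> * pair (hW n I) y\<bar>"
        using lim by (intro tendsto_intros)
      ultimately show ?thesis by (intro LIMSEQ_le_const2) auto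
    qed
    \<comment> \<open>The partial sums of z - \<mu> y, written in the copies W. They are bounded
      pointwise by \<theta> N, and the supremum dominates the norm on a probability space.\<close>
    define D where "D M x = (\<Sum>n\<in>{1..M}. V.G n w (W n x)) + (- \<mu>) * S M y x" for M x
    have pL: "(\<lambda>x. \<Sum>n\<in>{1..M}. V.G n w (W n x)) \<in> Lp p" for M
      using pq by (intro partial_Lp) auto
    have Dlim: "lp_lim p D (\<lambda>x. z x + (- \<mu>) * y x)"
      using lp_lim_lincomb[OF pq(2) pL S_Lp[OF pq(1)] z(3) Rspace_lim[OF p y], of 1 "- \<mu>"]
      unfolding D_def[abs_def] by simp
    have Dbound: "lpnorm p (D M) \<le> \<theta> * N" for M
    proof (rule lpnorm_le_bound)
      show "D M \<in> borel_measurable M01"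
        unfolding D_def[abs_def] S_def using partial_meas[of "{1..M}"] by (intro borel_measurable_add borel_measurable_times) auto
      fix x
      have "D M x = (\<Sum>n\<in>{1..M}. V.G n w (W n x) - \<mu> * G n y (W n x))"
        by (simp add: D_def S_def sum_subtractf flip: sum_distrib_left)
      also have "\<bar>\<dots>\<bar> \<le> (\<Sum>n\<in>{1..M}. \<theta> * N * (1/2) ^ n)"
      proof (rule order_trans[OF sum_abs sum_mono])
        fix n assume "n \<in> {1..M}"
        then have n: "1 \<le> n" by simp
        have "V.G n w (W n x) - \<mu> * G n y (W n x)
          = (\<Sum>I\<in>dyadic (n - 1). 2 ^ fst I * (pair (V.hW n I) w - \<mu> * pair (hW n I) y) * dhaar n I (W n x))"
          unfolding G_haar[OF n W_lt[OF n] yi[OF y]] V.G_haar[OF n W_lt[OF n] wi]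
          by (simp add: sum_distrib_left algebra_simps sum_subtractf[symmetric])
        also have "\<bar>\<dots>\<bar> \<le> (\<Sum>I\<in>dyadic (n - 1). 2 ^ fst I * ((\<theta> * N) / 8 ^ n))"
        proof (rule order_trans[OF sum_abs sum_mono])
          fix I assume I: "I \<in> dyadic (n - 1)"
          have "\<bar>2 ^ fst I * (pair (V.hW n I) w - \<mu> * pair (hW n I) y) * dhaar n I (W n x)\<bar>
            \<le> 2 ^ fst I * \<bar>pair (V.hW n I) w - \<mu> * pair (hW n I) y\<bar> * 1"
            unfolding abs_mult using dhaar_abs_le by (intro mult_mono) auto
          also have "\<dots> \<le> 2 ^ fst I * ((\<theta> * N) / 8 ^ n)" using mult_left_mono[OF coef[OF n I], of "2 ^ fst I"] by simp
          finally show "\<bar>2 ^ fst I * (pair (V.hW n I) w - \<mu> * pair (hW n I) y) * dhaar n I (W n x)\<bar> \<le> 2 ^ fst I * ((\<theta> * N) / 8 ^ n)" .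
        qed
        also have "\<dots> \<le> \<theta> * N * (1/2) ^ n" using \<theta> N0 n by (intro sum_dyadic_weight_le) auto
        finally show "\<bar>V.G n w (W n x) - \<mu> * G n y (W n x)\<bar> \<le> \<theta> * N * (1/2) ^ n" .
      qed
      also have "\<dots> = \<theta> * N * (\<Sum>n\<in>{1..M}. (1/2) ^ n)" by (simp add: sum_distrib_left)
      also have "\<dots> \<le> \<theta> * N * 1" using \<theta> N0 sum_half_le by (intro mult_left_mono) auto
      finally show "\<bar>D M x\<bar> \<le> \<theta> * N" by simp
    qed (use pq \<theta> N0 in auto)
    have DL: "D M \<in> Lp p" for M
      unfolding D_def[abs_def] using pq by (intro Lp_add Lp_cmult partial_Lp S_Lp) auto
    have 1: "lpnorm p (\<lambda>x. z x + (- \<mu>) * y x) \<le> \<theta> * N"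
      by (rule lp_lim_lpnorm_le[OF pq(2) DL Dlim Dbound])
    have "lpnorm p (\<lambda>x. z x - lam0 * y x) = lpnorm p (\<lambda>x. (z x + (- \<mu>) * y x) + (\<mu> - lam0) * y x)"
      by (simp add: algebra_simps)
    also have "\<dots> \<le> lpnorm p (\<lambda>x. z x + (- \<mu>) * y x) + lpnorm p (\<lambda>x. (\<mu> - lam0) * y x)"
      using pq R_Lp[OF y] R_Lp[OF z(1)] by (intro Minkowski Lp_add Lp_cmult) auto
    also have "\<dots> \<le> \<theta> * N + \<bar>\<mu> - lam0\<bar> * N"
      using 1 pq by (simp add: lpnorm_cmult N_def)
    finally have "lpnorm p (\<lambda>x. z x - lam0 * y x) \<le> (\<theta> + \<bar>\<mu> - lam0\<bar>) * lpnorm p y"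
      by (simp add: N_def algebra_simps)
    then show ?thesis using z(1,2) unfolding w_def by blast
  qed
  obtain C where C: "p_C_bounded p C (V.lim_proj 2)" using V.p_C_bounded_lim_proj[OF p] by blast
  show ?thesis
    unfolding orth_factor_def
    by (intro exI[of _ j] exI[of _ "V.lim_proj 2"] exI[of _ "V.lim_proj p"] exI[of _ C] exI[of _ "\<theta> + \<bar>\<mu> - lam0\<bar>"] conjI
        emb V.orth_proj_lim_proj C image V.lp_extension_lim_proj[OF p] \<epsilon> ballI est)
qed

end

section \<open>Choice of the copies\<close>

text \<open>A family of events indexed by a finite part of J is transported to its image under f,
  where independence is known; injectivity keeps the products equal.\<close>

lemma (in prob_space) indep_vars_reindex_inj:
  assumes indep: "indep_vars (\<lambda>_. N) X (f ` J)" and inj: "inj_on f J"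
  shows "indep_vars (\<lambda>_. N) (\<lambda>i. X (f i)) J"
  unfolding indep_vars_def indep_sets_def
proof (intro conjI ballI allI impI)
  let ?F = "\<lambda>i. sigma_sets (space M) {X i -` A \<inter> space M |A. A \<in> sets N}"
  have I: "indep_sets ?F (f ` J)" and rv: "\<And>i. i \<in> J \<Longrightarrow> random_variable N (X (f i))"
    using indep by (auto simp: indep_vars_def)
  show "random_variable N (X (f i))" if "i \<in> J" for i by (rule rv[OF that])
  show "?F (f i) \<subseteq> events" if "i \<in> J" for i
    using I that unfolding indep_sets_def by blast
  fix J' A assume J': "J' \<subseteq> J" "J' \<noteq> {}" "finite J'" and A: "A \<in> Pi J' (\<lambda>i. ?F (f i))"
  have inj': "inj_on f J'" using inj J'(1) by (rule inj_on_subset)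
  define A' where "A' m = A (the_inv_into J' f m)" for m
  have A': "A' (f i) = A i" if "i \<in> J'" for i using that inj' by (simp add: A'_def the_inv_into_f_f)
  have "prob (\<Inter>m\<in>f ` J'. A' m) = (\<Prod>m\<in>f ` J'. prob (A' m))"
  proof -
    have "A' \<in> Pi (f ` J') ?F" using A A' by (auto simp: Pi_iff)
    moreover have "f ` J' \<subseteq> f ` J" "f ` J' \<noteq> {}" "finite (f ` J')" using J' by auto
    ultimately show ?thesis using I unfolding indep_sets_def by blast
  qed
  moreover have "(\<Inter>m\<in>f ` J'. A' m) = (\<Inter>i\<in>J'. A i)" using A' by auto
  moreover have "(\<Prod>m\<in>f ` J'. prob (A' m)) = (\<Prod>i\<in>J'. prob (A i))"
    using A' by (subst prod.reindex[OF inj']) (auto intro!: prod.cong)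
  ultimately show "prob (\<Inter>j\<in>J'. A j) = (\<Prod>j\<in>J'. prob (A j))" by simp
qed

context copies
begin

text \<open>A signed sum of \<open>M\<close> bounded independent terms has norm \<open>o(M)\<close>, so only finitely many terms can
  be mapped to values that stay away from 0.\<close>
lemma functional_small_on_late_copies:
  assumes r: "1 \<le> r" and A: "0 \<le> A" and \<delta>: "0 < \<delta>"
    and add: "\<And>F c k. finite F \<Longrightarrow> F \<subseteq> {1..} \<Longrightarrow> (\<And>n. n \<in> F \<Longrightarrow> (\<Sum>u<2 ^ n. k n u) = 0) \<Longrightarrow>
       \<Phi> (\<lambda>x. \<Sum>n\<in>F. c n * k n (W n x)) = (\<Sum>n\<in>F. c n * \<Phi> (\<lambda>x. k n (W n x)))"
    and bnd: "\<And>F k. finite F \<Longrightarrow> F \<subseteq> {1..} \<Longrightarrow> (\<And>n. n \<in> F \<Longrightarrow> (\<Sum>u<2 ^ n. k n u) = 0) \<Longrightarrow>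
       \<bar>\<Phi> (\<lambda>x. \<Sum>n\<in>F. k n (W n x)) :: real\<bar> \<le> A * lpnorm r (\<lambda>x. \<Sum>n\<in>F. k n (W n x))"
  shows "\<forall>\<^sub>F N in sequentially. \<forall>k. (\<Sum>u<2 ^ N. k u) = 0 \<longrightarrow> (\<forall>u<2 ^ N. \<bar>k u\<bar> \<le> 1) \<longrightarrow> \<bar>\<Phi> (\<lambda>x. k (W N x))\<bar> \<le> \<delta>"
proof -
  define bad where "bad N k \<longleftrightarrow> (\<Sum>u<2 ^ N. k u) = 0 \<and> (\<forall>u<2 ^ N. \<bar>k u\<bar> \<le> 1) \<and> \<not> \<bar>\<Phi> (\<lambda>x. k (W N x))\<bar> \<le> \<delta>" for N and k :: "nat \<Rightarrow> real"
  define Bad where "Bad = {N. 1 \<le> N \<and> (\<exists>k. bad N k)}"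
  have "finite Bad"
  proof (rule ccontr)
    assume inf: "infinite Bad"
    \<comment> \<open>An exponent s \<ge> 2 with s \<ge> r: the L_r norm is below the L_s norm, and
      for a sum bounded by M the s-th moment is at most M^(s-2) times the second moment, which is at
      most 4 M.\<close>
    define s where "s = max r 2"
    have s: "2 \<le> s" "r \<le> s" "0 < s" by (auto simp: s_def)
    \<comment> \<open>With M bad terms the estimates give (M \<delta>)^s \<le> 4 A^s M^(s-1), that
      is M \<delta>^s \<le> 4 A^s; this M violates it.\<close>
    obtain M :: nat where M: "4 * (A powr s) / \<delta> powr s < M" using reals_Archimedean2 by blast
    have M0: "0 < real M" using M A \<delta> by (smt (verit) divide_nonneg_nonneg powr_ge_zero)
    obtain F where F: "finite F" "card F = M" "F \<subseteq> Bad" using infinite_arbitrarily_large[OF inf] by blast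
    define k where "k N = (SOME k. bad N k)" for N
    have k: "bad N (k N)" if "N \<in> Bad" for N
      using that someI_ex[of "bad N"] unfolding k_def Bad_def by auto
    \<comment> \<open>With these signs the values of the functional add up instead of
      cancelling.\<close>
    define c where "c N = sgn (\<Phi> (\<lambda>x. k N (W N x)))" for N
    have F1: "F \<subseteq> {1..}" using F by (auto simp: Bad_def)
    have k0: "(\<Sum>u<2 ^ n. k n u) = 0" "\<And>u. u < 2 ^ n \<Longrightarrow> \<bar>k n u\<bar> \<le> 1" "\<delta> < \<bar>\<Phi> (\<lambda>x. k n (W n x))\<bar>" if "n \<in> F" for n
      using k[of n] that F by (auto simp: bad_def)
    have ck0: "(\<Sum>u<2 ^ n. c n * k n u) = 0" if "n \<in> F" for n
      using k0(1)[OF that] by (simp flip: sum_distrib_left)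
    have ck1: "\<bar>c n * k n (W n x)\<bar> \<le> 1" if "n \<in> F" for n x
    proof -
      have "1 \<le> n" using that F1 by auto
      then show ?thesis using k0(2)[OF that W_lt, of x] by (auto simp: c_def abs_mult sgn_if)
    qed
    let ?S = "\<lambda>x. \<Sum>n\<in>F. c n * k n (W n x)"
    interpret X: indep_centered "\<lambda>n x. c n * k n (W n x)" F "\<lambda>n. \<Sum>u<2 ^ n. \<bar>c n * k n u\<bar>"
      using F F1 ck0 by (intro indep_centered_gW) auto
    have Smeas [measurable]: "?S \<in> borel_measurable M01" using partial_meas[OF F1, of "\<lambda>n u. c n * k n u"] .
    have SM: "\<bar>?S x\<bar> \<le> M" for x
    proof -
      have "\<bar>?S x\<bar> \<le> (\<Sum>n\<in>F. 1)" using ck1 by (intro order_trans[OF sum_abs sum_mono]) auto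
      then show ?thesis using F by simp
    qed
    have SL: "?S \<in> Lp t" if "0 < t" for t using SM that by (intro Lp_bounded[where B = M]) auto
    have "(LINT x|M01. \<bar>?S x\<bar> powr 2) \<le> 2 * 2 * (\<Sum>n\<in>F. LINT x|M01. \<bar>c n * k n (W n x)\<bar> powr 2)"
      by (rule X.von_Bahr_Esseen) auto
    also have "\<dots> \<le> 4 * (\<Sum>n\<in>F. 1)"
    proof -
      have "(LINT x|M01. \<bar>c n * k n (W n x)\<bar> powr 2) \<le> 1" if n: "n \<in> F" for n
      proof -
        have "(LINT x|M01. \<bar>c n * k n (W n x)\<bar> powr 2) \<le> (LINT x|M01. 1)"
        proof (rule integral_mono)
          show "integrable M01 (\<lambda>x. \<bar>c n * k n (W n x)\<bar> powr 2)" using X.powr_bdd[OF n, of 2] by simp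
          show "\<bar>c n * k n (W n x)\<bar> powr 2 \<le> 1" for x
            using powr_mono2[of 2 "\<bar>c n * k n (W n x)\<bar>" 1] ck1[OF n, of x] by simp
        qed simp
        then show ?thesis by (simp add: M01.prob_space)
      qed
      then have "(\<Sum>n\<in>F. LINT x|M01. \<bar>c n * k n (W n x)\<bar> powr 2) \<le> (\<Sum>n\<in>F. 1)" by (rule sum_mono)
      then show ?thesis by linarith
    qed
    finally have S2: "(LINT x|M01. \<bar>?S x\<bar> powr 2) \<le> 4 * M" using F by simp
    have "(LINT x|M01. \<bar>?S x\<bar> powr s) \<le> (LINT x|M01. real M powr (s - 2) * \<bar>?S x\<bar> powr 2)"
    proof (rule integral_mono)
      show "integrable M01 (\<lambda>x. \<bar>?S x\<bar> powr s)" using SL[of s] s by auto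
      have "integrable M01 (\<lambda>x. \<bar>?S x\<bar> powr 2)" using LpD(2)[OF SL[of 2]] by simp
      then show "integrable M01 (\<lambda>x. real M powr (s - 2) * \<bar>?S x\<bar> powr 2)" by (intro integrable_mult_right) auto
      fix x
      have "\<bar>?S x\<bar> powr s = \<bar>?S x\<bar> powr (s - 2) * \<bar>?S x\<bar> powr 2" by (simp only: powr_add[symmetric]) simp
      also have "\<dots> \<le> real M powr (s - 2) * \<bar>?S x\<bar> powr 2"
        using s SM[of x] by (intro mult_right_mono powr_mono2) auto
      finally show "\<bar>?S x\<bar> powr s \<le> real M powr (s - 2) * \<bar>?S x\<bar> powr 2" .
    qed
    also have "\<dots> = real M powr (s - 2) * (LINT x|M01. \<bar>?S x\<bar> powr 2)" by (rule integral_mult_right_zero)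
    also have "\<dots> \<le> real M powr (s - 2) * (4 * M)" using S2 by (intro mult_left_mono) auto
    also have "\<dots> = 4 * real M powr (s - 1)" using M0 by (simp add: powr_diff power2_eq_square)
    finally have Ss: "lpnorm s ?S powr s \<le> 4 * real M powr (s - 1)" using s by (simp add: lpnorm_powr)
    have "real M * \<delta> = (\<Sum>n\<in>F. \<delta>)" using F by simp
    also have "\<dots> \<le> (\<Sum>n\<in>F. c n * \<Phi> (\<lambda>x. k n (W n x)))"
      using k0(3) by (intro sum_mono) (auto simp: c_def mult.commute[of "sgn _"] simp flip: abs_sgn intro: less_imp_le)
    also have "\<dots> = \<Phi> ?S" using add[OF F(1) F1 k0(1)] by simp
    also have "\<dots> \<le> A * lpnorm r ?S" using bnd[OF F(1) F1 ck0] by simp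
    also have "\<dots> \<le> A * lpnorm s ?S" using A r s SL by (intro mult_left_mono Lp_mono_exponent(2)) auto
    finally have "(real M * \<delta>) powr s \<le> (A * lpnorm s ?S) powr s" using s M0 \<delta> by (intro powr_mono2) auto
    also have "\<dots> = A powr s * lpnorm s ?S powr s" by (rule powr_mult)
    also have "\<dots> \<le> A powr s * (4 * real M powr (s - 1))" using Ss by (intro mult_left_mono) auto
    finally have "real M powr s * \<delta> powr s \<le> 4 * A powr s * real M powr (s - 1)" by (simp add: powr_mult mult_ac)
    then have "real M * \<delta> powr s * real M powr s \<le> 4 * A powr s * real M powr s"
      using M0 by (simp add: powr_diff field_simps)
    then have "real M * \<delta> powr s \<le> 4 * A powr s" using M0 by (simp add: mult_le_cancel_right)
    then show False using M \<delta> by (simp add: field_simps)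
  qed
  then obtain N1 where N1: "\<And>N. N \<in> Bad \<Longrightarrow> N \<le> N1" by (meson finite_nat_set_iff_bounded_le)
  show ?thesis
  proof (rule eventually_sequentiallyI[of "Suc N1"], intro allI impI)
    fix N and k :: "nat \<Rightarrow> real" assume N: "Suc N1 \<le> N" and k: "(\<Sum>u<2 ^ N. k u) = 0" "\<forall>u<2 ^ N. \<bar>k u\<bar> \<le> 1"
    have "N \<notin> Bad" using N1[of N] N by linarith
    then show "\<bar>\<Phi> (\<lambda>x. k (W N x))\<bar> \<le> \<delta>" using N k by (auto simp: Bad_def bad_def)
  qed
qed

lemma lpnorm_gW_le:
  assumes N: "1 \<le> N" and r: "0 < r" and A: "A \<subseteq> {..<2 ^ N}" and f: "\<And>u. u < 2 ^ N \<Longrightarrow> \<bar>f u\<bar> \<le> indicator A u"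
  shows "lpnorm r (\<lambda>x. f (W N x)) \<le> (card A / 2 ^ N) powr (1 / r)"
proof -
  have "(LINT x|M01. \<bar>f (W N x)\<bar> powr r) \<le> (LINT x|M01. indicator A (W N x))"
  proof (rule integral_mono)
    show "integrable M01 (\<lambda>x. \<bar>f (W N x)\<bar> powr r)" using gW_integrable[OF N, of "\<lambda>u. \<bar>f u\<bar> powr r"] .
    show "integrable M01 (\<lambda>x. indicator A (W N x) :: real)" using gW_integrable[OF N, of "indicator A"] .
    show "\<bar>f (W N x)\<bar> powr r \<le> indicator A (W N x)" for x
      using powr_mono2[of r "\<bar>f (W N x)\<bar>" 1] f[OF W_lt[OF N, of x]] r by (auto simp: indicator_def split: if_splits)
  qed
  also have "\<dots> = (\<Sum>u<2 ^ N. indicator A u) / 2 ^ N" by (rule integral_gW[OF N])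
  also have "(\<Sum>u<2 ^ N. indicator A u :: real) = card A"
    using A by (simp add: sum.If_cases indicator_def Int_absorb1 flip: of_bool_def)
  finally show ?thesis unfolding lpnorm_def using r by (intro powr_mono2) auto
qed

end

context operator_on_copies
begin

definition center :: "nat \<Rightarrow> (nat \<Rightarrow> real) \<Rightarrow> nat \<Rightarrow> real" where
  "center N g u = g u - (\<Sum>u<2 ^ N. g u) / 2 ^ N"

text \<open>Centring the second argument makes the form bilinear on all functions of \<open>W N\<close>, although
  \<open>T\<close> only acts on centred ones.\<close>
definition copy_form :: "nat \<Rightarrow> (nat \<Rightarrow> real) \<Rightarrow> (nat \<Rightarrow> real) \<Rightarrow> real" where
  "copy_form N f g = pair (\<lambda>x. f (W N x)) (T (\<lambda>x. center N g (W N x)))"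

lemma center_sum: "(\<Sum>u<2 ^ N. center N g u) = 0"
  by (simp add: center_def sum_subtractf)

lemma center_id: "(\<Sum>u<2 ^ N. g u) = 0 \<Longrightarrow> center N g = g"
  by (simp add: center_def fun_eq_iff)

lemma center_R: "1 \<le> N \<Longrightarrow> (\<lambda>x. center N g (W N x)) \<in> R"
  by (rule Rspace_gW[OF p _ center_sum])

lemma gW_Lp: "1 \<le> N \<Longrightarrow> 0 < r \<Longrightarrow> (\<lambda>x. g (W N x)) \<in> Lp r"
  using gW_bdd[of N g] by (intro Lp_bounded) auto

text \<open>Centring at most doubles the norm, hence 2 K. A function dominated by the indicator of A
  has L_q norm at most the power 1/q of the measure of A, and 1/p = 1 - 1/q gives the exponent of
  the second argument.\<close>

lemma bilinear_copy_form:
  assumes N: "1 \<le> N"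
  shows "bilinear_form N (copy_form N) (2 * K) (1 / q)"
proof
  fix a b :: real and f f' g g' :: "nat \<Rightarrow> real"
  show "copy_form N (\<lambda>u. a * f u + b * f' u) g = a * copy_form N f g + b * copy_form N f' g"
  proof -
    let ?t = "T (\<lambda>x. center N g (W N x))"
    have t: "?t \<in> Lp p" by (intro T_Lp center_R N)
    have i: "integrable M01 (\<lambda>x. f (W N x) * ?t x)" for f
      by (rule Holder(1)[OF pq(3) p pq(7) gW_Lp[OF N pq(4)] t])
    have "copy_form N (\<lambda>u. a * f u + b * f' u) g = (LINT x|M01. a * (f (W N x) * ?t x) + b * (f' (W N x) * ?t x))"
      unfolding copy_form_def pair_def by (intro Bochner_Integration.integral_cong) (auto simp: algebra_simps)
    then show ?thesis using i[of f] i[of f'] by (simp add: copy_form_def pair_def)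
  qed
  show "copy_form N f (\<lambda>u. a * g u + b * g' u) = a * copy_form N f g + b * copy_form N f g'"
  proof -
    have "(\<lambda>x. center N (\<lambda>u. a * g u + b * g' u) (W N x)) = (\<lambda>x. a * center N g (W N x) + b * center N g' (W N x))"
      by (simp add: center_def fun_eq_iff sum.distrib algebra_simps add_divide_distrib flip: sum_distrib_left)
    then show ?thesis unfolding copy_form_def using pair_T_lincomb[OF gW_Lp[OF N pq(4)] center_R[OF N] center_R[OF N]] by simp
  qed
next
  fix f f' g g' :: "nat \<Rightarrow> real"
  assume f: "\<And>u. u < 2 ^ N \<Longrightarrow> f u = f' u" and g: "\<And>u. u < 2 ^ N \<Longrightarrow> g u = g' u"
  have "(\<lambda>x. f (W N x)) = (\<lambda>x. f' (W N x))" using f[OF W_lt[OF N]] by simp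
  moreover have "(\<Sum>u<2 ^ N. g u) = (\<Sum>u<2 ^ N. g' u)" using g by simp
  then have "(\<lambda>x. center N g (W N x)) = (\<lambda>x. center N g' (W N x))"
    using g[OF W_lt[OF N]] by (simp add: center_def)
  ultimately show "copy_form N f g = copy_form N f' g'" by (simp add: copy_form_def)
next
  fix A A' and f g :: "nat \<Rightarrow> real"
  assume A: "A \<subseteq> {..<2 ^ N}" "A' \<subseteq> {..<2 ^ N}"
    and f: "\<And>u. u < 2 ^ N \<Longrightarrow> \<bar>f u\<bar> \<le> indicator A u" and g: "\<And>u. u < 2 ^ N \<Longrightarrow> \<bar>g u\<bar> \<le> indicator A' u"
  let ?g = "\<lambda>x. g (W N x)" and ?m = "(\<Sum>u<2 ^ N. g u) / 2 ^ N"
  have gL: "?g \<in> Lp p" by (rule gW_Lp[OF N pq(1)])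
  have cL: "(\<lambda>_. ?m) \<in> Lp p" using gW_Lp[OF N pq(1), of "\<lambda>_. ?m"] .
  have "\<bar>?m\<bar> \<le> lpnorm 1 ?g" unfolding integral_gW[OF N, symmetric] lpnorm_one by (rule integral_abs_bound)
  also have "\<dots> \<le> lpnorm p ?g" using pq(2) gL by (intro Lp_mono_exponent(2)) auto
  finally have m: "\<bar>?m\<bar> \<le> lpnorm p ?g" .
  have "lpnorm p (\<lambda>_. ?m) \<le> \<bar>?m\<bar>" using pq(1) by (intro lpnorm_le_bound) auto
  then have "lpnorm p (\<lambda>x. center N g (W N x)) \<le> 2 * lpnorm p ?g"
    unfolding center_def using lpnorm_diff_le[OF pq(2) gL cL] m by linarith
  also have "\<dots> \<le> 2 * (card A' / 2 ^ N) powr (1 / p)" using lpnorm_gW_le[OF N pq(1) A(2) g] by simp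
  finally have c: "lpnorm p (\<lambda>x. center N g (W N x)) \<le> 2 * (card A' / 2 ^ N) powr (1 / p)" .
  have "\<bar>copy_form N f g\<bar> \<le> lpnorm q (\<lambda>x. f (W N x)) * (K * lpnorm p (\<lambda>x. center N g (W N x)))"
    unfolding copy_form_def by (rule pair_T_bound[OF gW_Lp[OF N pq(4)] center_R[OF N]])
  also have "\<dots> \<le> (card A / 2 ^ N) powr (1 / q) * (K * (2 * (card A' / 2 ^ N) powr (1 / p)))"
    using lpnorm_gW_le[OF N pq(4) A(1) f] c K by (intro mult_mono) auto
  also have "1 / p = 1 - 1 / q" using pq(6) by linarith
  finally show "\<bar>copy_form N f g\<bar> \<le> 2 * K * (card A / 2 ^ N) powr (1 / q) * (card A' / 2 ^ N) powr (1 - 1 / q)"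
    by (simp add: mult_ac)
qed (use K pq(3) in auto)

text \<open>\<rho> merges the 2^N atoms of copy N into 2^n groups of equal mass, so that \<rho> of
  \<open>W N\<close> is again uniform. On the Haar functions of this coarser variable T is, up to
  \<delta>, \<mu> times the identity.\<close>

definition good_block :: "nat \<Rightarrow> nat \<Rightarrow> real \<Rightarrow> real \<Rightarrow> (nat \<Rightarrow> nat) \<Rightarrow> bool" where
  "good_block N n \<delta> \<mu> \<rho> \<longleftrightarrow> (\<forall>u<2 ^ N. \<rho> u < 2 ^ n) \<and>
     (\<forall>i<2 ^ n. (\<Sum>u<2 ^ N. of_bool (\<rho> u = i)) / 2 ^ N = 1 / (2::real) ^ n) \<and>
     (\<forall>I\<in>dyadic (n - 1). \<forall>I'\<in>dyadic (n - 1).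
        \<bar>copy_form N (\<lambda>u. dhaar n I (\<rho> u)) (\<lambda>u. dhaar n I' (\<rho> u)) - (if I = I' then \<mu> / 2 ^ fst I else 0)\<bar> \<le> \<delta>)"

text \<open>The constant found by \<open>gamlen_gaudet\<close> is the mean of the 2^m normalised
  diagonal entries of T on level m of copy N, hence in the convex hull. Haar functions have mean 0,
  so centring does not change these entries.\<close>

lemma good_block_exists:
  assumes n: "1 \<le> n" and \<delta>: "0 < \<delta>"
  shows "\<exists>N\<ge>N1. \<exists>\<mu> \<rho>. good_block N n \<delta> \<mu> \<rho> \<and> \<mu> \<in> convex hull (diag_set hW T) \<and> \<bar>\<mu>\<bar> \<le> 2 * K"
proof -
  obtain N0 where N0: "\<forall>N\<ge>N0. \<forall>B. bilinear_form N B (2 * K) (1 / q) \<longrightarrow>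
    (\<exists>m<N. \<exists>\<rho>. (\<forall>u<2 ^ N. \<rho> u < (2::nat) ^ n) \<and>
       (\<forall>i<2 ^ n. (\<Sum>u<2 ^ N. of_bool (\<rho> u = i)) / 2 ^ N = 1 / (2::real) ^ n) \<and>
       (\<forall>I\<in>dyadic (n - 1). \<forall>I'\<in>dyadic (n - 1).
          \<bar>B (\<lambda>u. dhaar n I (\<rho> u)) (\<lambda>u. dhaar n I' (\<rho> u))
            - (if I = I' then (\<Sum>t<2 ^ m. B (dhaar N (m, t)) (dhaar N (m, t))) / 2 ^ fst I else 0)\<bar> \<le> \<delta>))"
    using gamlen_gaudet[of "1 / q" "2 * K" \<delta> n] pq(3) K \<delta> n by auto
  define N where "N = Suc (max N0 N1)"
  have N: "N0 \<le> N" "N1 \<le> N" "1 \<le> N" by (auto simp: N_def)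
  interpret B: bilinear_form N "copy_form N" "2 * K" "1 / q" by (rule bilinear_copy_form[OF N(3)])
  obtain m \<rho> where m: "m < N" and \<rho>: "\<forall>u<2 ^ N. \<rho> u < (2::nat) ^ n"
       "\<forall>i<2 ^ n. (\<Sum>u<2 ^ N. of_bool (\<rho> u = i)) / 2 ^ N = 1 / (2::real) ^ n"
       "\<forall>I\<in>dyadic (n - 1). \<forall>I'\<in>dyadic (n - 1).
          \<bar>copy_form N (\<lambda>u. dhaar n I (\<rho> u)) (\<lambda>u. dhaar n I' (\<rho> u))
            - (if I = I' then (\<Sum>t<2 ^ m. copy_form N (dhaar N (m, t)) (dhaar N (m, t))) / 2 ^ fst I else 0)\<bar> \<le> \<delta>"
    using N0[rule_format, OF N(1) bilinear_copy_form[OF N(3)]] by blast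
  define \<mu> where "\<mu> = (\<Sum>t<2 ^ m. copy_form N (dhaar N (m, t)) (dhaar N (m, t)))"
  have "\<bar>\<mu>\<bar> \<le> 2 * K" using B.diag_avg_le[of m] m by (simp add: B.diag_avg_def \<mu>_def)
  moreover have "\<mu> \<in> convex hull (diag_set hW T)"
  proof -
    have dy: "(m, t) \<in> dyadic (N - 1)" if "t < 2 ^ m" for t using that m by (auto simp: dyadic_def)
    have e: "copy_form N (dhaar N (m, t)) (dhaar N (m, t)) = pair (hW N (m, t)) (T (hW N (m, t)))" if "t < 2 ^ m" for t
      unfolding copy_form_def hW_def[abs_def] using dhaar_sum_zero[OF dy[OF that]] N by (simp add: center_id)
    have "(\<Sum>t<2 ^ m. (1 / 2 ^ m) *\<^sub>R (2 ^ m * pair (hW N (m, t)) (T (hW N (m, t))))) \<in> convex hull (diag_set hW T)"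
    proof (rule convex_sum)
      fix t :: nat assume "t \<in> {..<2 ^ m}"
      then have "(N, (m, t)) \<in> Domega" using dy N by (simp add: Domega_def)
      then have "2 ^ m * pair (hW N (m, t)) (T (hW N (m, t))) \<in> diag_set hW T"
        unfolding diag_set_def by force
      then show "2 ^ m * pair (hW N (m, t)) (T (hW N (m, t))) \<in> convex hull (diag_set hW T)" by (rule hull_inc)
    qed auto
    then show ?thesis using e by (simp add: \<mu>_def)
  qed
  moreover have "good_block N n \<delta> \<mu> \<rho>" using \<rho> by (simp add: good_block_def \<mu>_def)
  ultimately show ?thesis using N by blast
qed

lemma good_block_mono:
  assumes "good_block N n \<delta> \<mu> \<rho>" "\<delta> + \<bar>\<mu> - \<mu>'\<bar> \<le> \<delta>'"
  shows "good_block N n \<delta>' \<mu>' \<rho>"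
proof -
  have "\<bar>copy_form N (\<lambda>u. dhaar n I (\<rho> u)) (\<lambda>u. dhaar n I' (\<rho> u)) - (if I = I' then \<mu>' / 2 ^ fst I else 0)\<bar> \<le> \<delta>'"
    if I: "I \<in> dyadic (n - 1)" "I' \<in> dyadic (n - 1)" for I I'
  proof -
    have 1: "\<bar>copy_form N (\<lambda>u. dhaar n I (\<rho> u)) (\<lambda>u. dhaar n I' (\<rho> u)) - (if I = I' then \<mu> / 2 ^ fst I else 0)\<bar> \<le> \<delta>"
      using assms(1) I by (simp add: good_block_def)
    have "\<bar>\<mu> / 2 ^ fst I - \<mu>' / 2 ^ fst I\<bar> = \<bar>\<mu> - \<mu>'\<bar> / 2 ^ fst I"
      by (simp add: abs_divide flip: diff_divide_distrib)
    also have "\<dots> \<le> \<bar>\<mu> - \<mu>'\<bar> / 1" by (intro divide_left_mono) auto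
    finally show ?thesis using 1 assms(2) by (cases "I = I'") auto
  qed
  then show ?thesis using assms(1) by (simp add: good_block_def)
qed

text \<open>Dropping the last digit of \<rho> merges sibling groups. The Haar functions of the
  coarser system do not see this digit, so their matrix entries are literally the old ones.\<close>

lemma good_block_Suc:
  assumes G: "good_block N (Suc n) \<delta> \<mu> \<rho>" and n: "1 \<le> n"
  shows "good_block N n \<delta> \<mu> (\<lambda>u. \<rho> u div 2)"
proof -
  have "(\<Sum>u<2 ^ N. of_bool (\<rho> u div 2 = i)) / 2 ^ N = 1 / (2::real) ^ n" if i: "i < 2 ^ n" for i
  proof -
    have "of_bool (\<rho> u div 2 = i) = (of_bool (\<rho> u = 2 * i) + of_bool (\<rho> u = 2 * i + 1) :: real)" for u
    proof -
      have "\<rho> u div 2 = i \<longleftrightarrow> \<rho> u = 2 * i \<or> \<rho> u = 2 * i + 1" by presburger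
      then show ?thesis by auto
    qed
    then have "(\<Sum>u<2 ^ N. of_bool (\<rho> u div 2 = i)) / 2 ^ N
      = (\<Sum>u<2 ^ N. of_bool (\<rho> u = 2 * i)) / 2 ^ N + (\<Sum>u<2 ^ N. of_bool (\<rho> u = 2 * i + 1)) / (2 ^ N :: real)"
      by (simp only: sum.distrib add_divide_distrib)
    also have "\<dots> = 1 / 2 ^ Suc n + 1 / 2 ^ Suc n"
    proof -
      have "2 * i < 2 ^ Suc n" "2 * i + 1 < 2 ^ Suc n" using i by auto
      moreover have "\<forall>j<2 ^ Suc n. (\<Sum>u<2 ^ N. of_bool (\<rho> u = j)) / 2 ^ N = 1 / (2::real) ^ Suc n"
        using G unfolding good_block_def by (elim conjE)
      ultimately show ?thesis by (simp only:)
    qed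
    finally show ?thesis by simp
  qed
  moreover have "\<rho> u div 2 < 2 ^ n" if "u < 2 ^ N" for u using G that by (auto simp: good_block_def)
  moreover have "\<bar>copy_form N (\<lambda>u. dhaar n I (\<rho> u div 2)) (\<lambda>u. dhaar n I' (\<rho> u div 2)) - (if I = I' then \<mu> / 2 ^ fst I else 0)\<bar> \<le> \<delta>"
    if I: "I \<in> dyadic (n - 1)" "I' \<in> dyadic (n - 1)" for I I'
  proof -
    have "fst I < n" "fst I' < n" using I n by (auto simp: dyadic_def)
    then have e: "dhaar n I (\<rho> u div 2) = dhaar (Suc n) I (\<rho> u)" "dhaar n I' (\<rho> u div 2) = dhaar (Suc n) I' (\<rho> u)" for u
      by (simp_all add: dhaar_Suc)
    have "I \<in> dyadic (Suc n - 1)" "I' \<in> dyadic (Suc n - 1)" using I by (auto simp: dyadic_def)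
    then show ?thesis using G unfolding e good_block_def by blast
  qed
  ultimately show ?thesis by (simp add: good_block_def)
qed

lemma good_block_restrict:
  assumes "n \<le> n'" "1 \<le> n" "good_block N n' \<delta> \<mu> \<rho>"
  shows "\<exists>\<rho>'. good_block N n \<delta> \<mu> \<rho>'"
  using assms(1,3)
proof (induction n' arbitrary: \<rho> rule: dec_induct)
  case (step m)
  then show ?case using good_block_Suc[of N m \<delta> \<mu> \<rho>] assms(2) by auto
qed blast

text \<open>Blocks of growing size and shrinking error have constants in a compact interval. Large
  blocks restrict to every smaller size, so the limit of one convergent subsequence serves all n.
  The limit lies only in the closure of the convex hull, hence the approximation in the second
  conjunct.\<close>

lemma good_block_limit:
  "\<exists>\<mu>. (\<forall>n\<ge>1. \<forall>\<delta>>0. \<forall>N1. \<exists>N\<ge>N1. \<exists>\<rho>. good_block N n \<delta> \<mu> \<rho>) \<and> (\<forall>e>0. \<exists>lam\<in>convex hull (diag_set hW T). \<bar>\<mu> - lam\<bar> < e)"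
proof -
  have "\<forall>i. \<exists>N \<mu> \<rho>. i \<le> N \<and> good_block N (Suc i) (1 / real (Suc i)) \<mu> \<rho> \<and> \<mu> \<in> convex hull (diag_set hW T) \<and> \<bar>\<mu>\<bar> \<le> 2 * K"
    using good_block_exists by (metis le_add1 plus_1_eq_Suc zero_less_divide_1_iff of_nat_0_less_iff zero_less_Suc)
  then obtain N \<mu> \<rho> where G: "\<And>i. i \<le> N i" "\<And>i. good_block (N i) (Suc i) (1 / real (Suc i)) (\<mu> i) (\<rho> i)"
    "\<And>i. \<mu> i \<in> convex hull (diag_set hW T)" "\<And>i. \<bar>\<mu> i\<bar> \<le> 2 * K" by metis
  have "seq_compact {- (2 * K)..2 * K}" by (rule compact_imp_seq_compact) simp
  moreover have "\<forall>i. \<mu> i \<in> {- (2 * K)..2 * K}" using G(4) by (auto simp: abs_le_iff minus_le_iff)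
  ultimately obtain l s where s: "strict_mono s" "(\<mu> \<circ> s) \<longlonglongrightarrow> l" unfolding seq_compact_def by blast
  have close: "\<exists>i0. \<forall>i\<ge>i0. \<bar>\<mu> (s i) - l\<bar> < e" if "0 < e" for e
    using LIMSEQ_D[OF s(2) that] by simp
  have "\<exists>M\<ge>N1. \<exists>\<rho>. good_block M n \<delta> l \<rho>" if n: "1 \<le> n" and \<delta>: "0 < \<delta>" for n \<delta> N1
  proof -
    obtain i0 where i0: "\<And>i. i0 \<le> i \<Longrightarrow> \<bar>\<mu> (s i) - l\<bar> < \<delta> / 2" using close[of "\<delta> / 2"] \<delta> by auto
    obtain i1 where i1: "1 / real (Suc i1) < \<delta> / 2" using \<delta> by (meson half_gt_zero nat_approx_posE)
    define i where "i = max (max i0 i1) (max n N1)"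
    have i: "i0 \<le> i" "i1 \<le> i" "n \<le> i" "N1 \<le> i" by (auto simp: i_def)
    have si: "i \<le> s i" using seq_suble[OF s(1)] .
    have "1 / real (Suc (s i)) \<le> 1 / real (Suc i1)" using i si by (intro divide_left_mono) auto
    then have "1 / real (Suc (s i)) + \<bar>\<mu> (s i) - l\<bar> \<le> \<delta>" using i1 i0[OF i(1)] by linarith
    then have "good_block (N (s i)) (Suc (s i)) \<delta> l (\<rho> (s i))" by (rule good_block_mono[OF G(2)])
    from good_block_restrict[OF _ n this] obtain \<rho>' where "good_block (N (s i)) n \<delta> l \<rho>'" using i si by fastforce
    moreover have "N1 \<le> N (s i)" using G(1)[of "s i"] si i by linarith
    ultimately show ?thesis by blast
  qed
  moreover have "\<exists>lam\<in>convex hull (diag_set hW T). \<bar>l - lam\<bar> < e" if "0 < e" for e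
    using close[OF that] G(3) by (metis abs_minus_commute order_refl)
  ultimately show ?thesis by blast
qed

lemma good_block_sum:
  assumes "good_block N n \<delta> \<mu> \<rho>"
  shows "(\<Sum>u<2 ^ N. F (\<rho> u)) / 2 ^ N = (\<Sum>i<2 ^ n. F i :: real) / 2 ^ n"
proof -
  have "(\<Sum>u<2 ^ N. F (\<rho> u)) = (\<Sum>u<2 ^ N. \<Sum>i<2 ^ n. F i * of_bool (\<rho> u = i))"
  proof (rule sum.cong)
    fix u :: nat assume "u \<in> {..<2 ^ N}"
    then have "\<rho> u < 2 ^ n" using assms by (simp add: good_block_def)
    then show "F (\<rho> u) = (\<Sum>i<2 ^ n. F i * of_bool (\<rho> u = i))"
      by (subst sum.remove[of _ "\<rho> u"]) (auto intro!: sum.neutral)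
  qed simp
  also have "\<dots> = (\<Sum>i<2 ^ n. F i * (\<Sum>u<2 ^ N. of_bool (\<rho> u = i)))"
    by (subst sum.swap) (simp only: sum_distrib_left)
  finally have "(\<Sum>u<2 ^ N. F (\<rho> u)) / 2 ^ N = (\<Sum>i<2 ^ n. F i * ((\<Sum>u<2 ^ N. of_bool (\<rho> u = i)) / 2 ^ N))"
    by (simp add: sum_divide_distrib[of _ "{..<2 ^ n}"])
  also have "\<dots> = (\<Sum>i<2 ^ n. F i * (1 / 2 ^ n))"
    using assms by (intro sum.cong) (auto simp: good_block_def)
  finally show ?thesis by (simp add: sum_divide_distrib)
qed

lemma good_block_sum_zero:
  assumes "good_block N n \<delta> \<mu> \<rho>" "(\<Sum>i<2 ^ n. F i :: real) = 0"
  shows "(\<Sum>u<2 ^ N. F (\<rho> u)) = 0"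
  using good_block_sum[OF assms(1), of F] assms(2) by simp

text \<open>\<open>functional_small_on_late_copies\<close> is used twice: for g sent to the pairing
  of f with T g, bounded in the L_p norm, and for g sent to its pairing with T f, bounded in the L_q
  norm.\<close>

lemma cross_terms_small:
  assumes f: "f \<in> R" "f \<in> Lp q" and \<delta>: "0 < \<delta>"
  shows "\<forall>\<^sub>F N in sequentially. \<forall>k. (\<Sum>u<2 ^ N. k u) = 0 \<longrightarrow> (\<forall>u<2 ^ N. \<bar>k u\<bar> \<le> 1) \<longrightarrow>
     \<bar>pair f (T (\<lambda>x. k (W N x)))\<bar> \<le> \<delta> \<and> \<bar>pair (\<lambda>x. k (W N x)) (T f)\<bar> \<le> \<delta>"
proof -
  have "\<forall>\<^sub>F N in sequentially. \<forall>k. (\<Sum>u<2 ^ N. k u) = 0 \<longrightarrow> (\<forall>u<2 ^ N. \<bar>k u\<bar> \<le> 1) \<longrightarrow> \<bar>pair f (T (\<lambda>x. k (W N x)))\<bar> \<le> \<delta>"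
  proof (rule functional_small_on_late_copies[of p "lpnorm q f * K"])
    fix F :: "nat set" and c and k :: "nat \<Rightarrow> nat \<Rightarrow> real" assume F: "finite F" "F \<subseteq> {1..}" and k: "\<And>n. n \<in> F \<Longrightarrow> (\<Sum>u<2 ^ n. k n u) = 0"
    have kR: "(\<lambda>x. k n (W n x)) \<in> R" if "n \<in> F" for n using that k F by (intro Rspace_gW[OF p]) auto
    show "pair f (T (\<lambda>x. \<Sum>n\<in>F. c n * k n (W n x))) = (\<Sum>n\<in>F. c n * pair f (T (\<lambda>x. k n (W n x))))"
      using F kR by (intro pair_T_sum f(2))
    have "(\<lambda>x. \<Sum>n\<in>F. k n (W n x)) \<in> R" using Rspace_sum[OF p, of F "\<lambda>n x. k n (W n x)" "\<lambda>_. 1"] kR by simp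
    then show "\<bar>pair f (T (\<lambda>x. \<Sum>n\<in>F. k n (W n x)))\<bar> \<le> lpnorm q f * K * lpnorm p (\<lambda>x. \<Sum>n\<in>F. k n (W n x))"
      using pair_T_bound[OF f(2)] by (simp add: mult.assoc)
  qed (use pq(2) K \<delta> in auto)
  moreover have "\<forall>\<^sub>F N in sequentially. \<forall>k. (\<Sum>u<2 ^ N. k u) = 0 \<longrightarrow> (\<forall>u<2 ^ N. \<bar>k u\<bar> \<le> 1) \<longrightarrow> \<bar>pair (\<lambda>x. k (W N x)) (T f)\<bar> \<le> \<delta>"
  proof (rule functional_small_on_late_copies[of q "lpnorm p (T f)" \<delta> "\<lambda>g. pair g (T f)"])
    fix F :: "nat set" and c and k :: "nat \<Rightarrow> nat \<Rightarrow> real" assume F: "finite F" "F \<subseteq> {1..}"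
    have "integrable M01 (T f)" by (rule Lp_integrable[OF pq(2) T_Lp[OF f(1)]])
    then have i: "integrable M01 (\<lambda>x. c n * (T f x * k n (W n x)))" if "n \<in> F" for n
      using mult_gW_integrable[of n "T f" "k n"] that F by auto
    have "pair (\<lambda>x. \<Sum>n\<in>F. c n * k n (W n x)) (T f) = (LINT x|M01. (\<Sum>n\<in>F. c n * (T f x * k n (W n x))))"
      unfolding pair_def sum_distrib_right by (simp only: mult_ac)
    also have "\<dots> = (\<Sum>n\<in>F. LINT x|M01. c n * (T f x * k n (W n x)))"
      using i by (rule Bochner_Integration.integral_sum)
    finally show "pair (\<lambda>x. \<Sum>n\<in>F. c n * k n (W n x)) (T f) = (\<Sum>n\<in>F. c n * pair (\<lambda>x. k n (W n x)) (T f))"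
      by (simp add: pair_def mult.commute)
    show "\<bar>pair (\<lambda>x. \<Sum>n\<in>F. k n (W n x)) (T f)\<bar> \<le> lpnorm p (T f) * lpnorm q (\<lambda>x. \<Sum>n\<in>F. k n (W n x))"
      using pair_le_lpnorm[OF p pq(3,6) partial_Lp[OF F(2) pq(4)] T_Lp[OF f(1)], of k] by (simp add: mult.commute)
  qed (use pq(5) \<delta> in auto)
  ultimately show ?thesis by eventually_elim blast
qed

definition block_haar :: "nat \<Rightarrow> nat \<times> (nat \<Rightarrow> nat) \<Rightarrow> nat \<times> nat \<Rightarrow> real \<Rightarrow> real" where
  "block_haar n r I x = dhaar n I (snd r (W (fst r) x))"

text \<open>At stage n only finitely many block Haar functions precede, so all late copies are
  almost orthogonal to them through T, in both orders. The tolerance is set without reference to the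
  partner n' < n; 64^n = 8^(2n) exceeds 8^(n+n') for each of them.\<close>

lemma select_copies:
  assumes \<theta>: "0 < \<theta>" and G: "\<And>n \<delta> N1. 1 \<le> n \<Longrightarrow> 0 < \<delta> \<Longrightarrow> \<exists>N\<ge>N1. \<exists>\<rho>. good_block N n \<delta> \<mu> \<rho>"
  shows "\<exists>f. \<forall>n\<ge>1. 1 \<le> fst (f n) \<and> good_block (fst (f n)) n (\<theta> / 64 ^ n) \<mu> (snd (f n)) \<and>
     (\<forall>n'. 1 \<le> n' \<and> n' < n \<longrightarrow> fst (f n') < fst (f n) \<and> (\<forall>I\<in>dyadic (n - 1). \<forall>I'\<in>dyadic (n' - 1).
        \<bar>pair (block_haar n (f n) I) (T (block_haar n' (f n') I'))\<bar> \<le> \<theta> / 64 ^ n \<and> \<bar>pair (block_haar n' (f n') I') (T (block_haar n (f n) I))\<bar> \<le> \<theta> / 64 ^ n))"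
proof -
  \<comment> \<open>Admissibility of the choice r at stage n given the earlier choices. It is
    vacuous at n = 0, as copies are numbered from 1.\<close>
  define P where "P f n r \<longleftrightarrow> (1 \<le> n \<longrightarrow> 1 \<le> fst r \<and> good_block (fst r) n (\<theta> / 64 ^ n) \<mu> (snd r) \<and>
     (\<forall>n'. 1 \<le> n' \<and> n' < n \<longrightarrow> fst (f n') < fst r \<and> (\<forall>I\<in>dyadic (n - 1). \<forall>I'\<in>dyadic (n' - 1).
        \<bar>pair (block_haar n r I) (T (block_haar n' (f n') I'))\<bar> \<le> \<theta> / 64 ^ n \<and> \<bar>pair (block_haar n' (f n') I') (T (block_haar n r I))\<bar> \<le> \<theta> / 64 ^ n)))"
    for f :: "nat \<Rightarrow> nat \<times> (nat \<Rightarrow> nat)" and n r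
  have "\<exists>f. \<forall>n. P f n (f n)"
  proof (rule dependent_wf_choice[OF wf_less_than])
    show "P f n r = P g n r" if "\<And>z. (z, n) \<in> less_than \<Longrightarrow> f z = g z" for f g n r
    proof -
      have "f z = g z" if "z < n" for z using \<open>\<And>z. (z, n) \<in> less_than \<Longrightarrow> f z = g z\<close>[of z] that by simp
      then show ?thesis unfolding P_def by (simp cong: conj_cong)
    qed
    fix n f assume IH: "\<And>n'. (n', n) \<in> less_than \<Longrightarrow> P f n' (f n')"
    show "\<exists>r. P f n r"
    proof (cases "1 \<le> n")
      case False
      then show ?thesis by (simp add: P_def)
    next
      case n: True
      let ?X = "Sigma {1..<n} (\<lambda>n'. dyadic (n' - 1))"
      define \<delta> where "\<delta> = \<theta> / 64 ^ n"
      have \<delta>: "0 < \<delta>" using \<theta> by (simp add: \<delta>_def)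
      have "\<forall>\<^sub>F N in sequentially. \<forall>\<iota>\<in>?X. \<forall>k. (\<Sum>u<2 ^ N. k u) = 0 \<longrightarrow> (\<forall>u<2 ^ N. \<bar>k u\<bar> \<le> 1) \<longrightarrow>
         \<bar>pair (block_haar (fst \<iota>) (f (fst \<iota>)) (snd \<iota>)) (T (\<lambda>x. k (W N x)))\<bar> \<le> \<delta> \<and> \<bar>pair (\<lambda>x. k (W N x)) (T (block_haar (fst \<iota>) (f (fst \<iota>)) (snd \<iota>)))\<bar> \<le> \<delta>"
      proof (rule eventually_ball_finite, simp, rule ballI)
        fix \<iota> assume "\<iota> \<in> ?X"
        then have \<iota>: "1 \<le> fst \<iota>" "fst \<iota> < n" "snd \<iota> \<in> dyadic (fst \<iota> - 1)" by auto
        have "P f (fst \<iota>) (f (fst \<iota>))" using IH[of "fst \<iota>"] \<iota> by simp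
        then have g: "1 \<le> fst (f (fst \<iota>))" "good_block (fst (f (fst \<iota>))) (fst \<iota>) (\<theta> / 64 ^ fst \<iota>) \<mu> (snd (f (fst \<iota>)))"
          using \<iota> unfolding P_def by blast+
        have "(\<Sum>u<2 ^ fst (f (fst \<iota>)). dhaar (fst \<iota>) (snd \<iota>) (snd (f (fst \<iota>)) u)) = 0"
          using \<iota> by (intro good_block_sum_zero[OF g(2)] dhaar_sum_zero) auto
        then have "block_haar (fst \<iota>) (f (fst \<iota>)) (snd \<iota>) \<in> R"
          unfolding block_haar_def[abs_def] by (rule Rspace_gW[OF p g(1)])
        moreover have "block_haar (fst \<iota>) (f (fst \<iota>)) (snd \<iota>) \<in> Lp q"
          unfolding block_haar_def[abs_def] using gW_Lp[OF g(1) pq(4), of "\<lambda>u. dhaar (fst \<iota>) (snd \<iota>) (snd (f (fst \<iota>)) u)"] .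
        ultimately show "\<forall>\<^sub>F N in sequentially. \<forall>k. (\<Sum>u<2 ^ N. k u) = 0 \<longrightarrow> (\<forall>u<2 ^ N. \<bar>k u\<bar> \<le> 1) \<longrightarrow>
         \<bar>pair (block_haar (fst \<iota>) (f (fst \<iota>)) (snd \<iota>)) (T (\<lambda>x. k (W N x)))\<bar> \<le> \<delta> \<and> \<bar>pair (\<lambda>x. k (W N x)) (T (block_haar (fst \<iota>) (f (fst \<iota>)) (snd \<iota>)))\<bar> \<le> \<delta>"
          by (rule cross_terms_small[OF _ _ \<delta>])
      qed
      then obtain N1 where N1: "\<And>N \<iota> k. N1 \<le> N \<Longrightarrow> \<iota> \<in> ?X \<Longrightarrow> (\<Sum>u<2 ^ N. k u) = 0 \<Longrightarrow> (\<forall>u<2 ^ N. \<bar>k u\<bar> \<le> 1) \<Longrightarrow>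
         \<bar>pair (block_haar (fst \<iota>) (f (fst \<iota>)) (snd \<iota>)) (T (\<lambda>x. k (W N x)))\<bar> \<le> \<delta> \<and> \<bar>pair (\<lambda>x. k (W N x)) (T (block_haar (fst \<iota>) (f (fst \<iota>)) (snd \<iota>)))\<bar> \<le> \<delta>"
        unfolding eventually_sequentially by blast
      \<comment> \<open>Beyond the threshold for the cross terms and beyond every copy number
        already used, so that the numbers increase strictly.\<close>
      define N2 where "N2 = Suc (N1 + (\<Sum>n'<n. fst (f n')))"
      obtain N \<rho> where N: "N2 \<le> N" "good_block N n \<delta> \<mu> \<rho>" using G[OF n \<delta>] by blast
      have "fst (f n') < N" if "n' < n" for n'
        using member_le_sum[of n' "{..<n}" "\<lambda>n'. fst (f n')"] that N(1) by (auto simp: N2_def)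
      moreover have "\<bar>pair (block_haar n (N, \<rho>) I) (T (block_haar n' (f n') I'))\<bar> \<le> \<delta> \<and> \<bar>pair (block_haar n' (f n') I') (T (block_haar n (N, \<rho>) I))\<bar> \<le> \<delta>"
        if "1 \<le> n'" "n' < n" "I \<in> dyadic (n - 1)" "I' \<in> dyadic (n' - 1)" for n' I I'
      proof -
        have "(\<Sum>u<2 ^ N. dhaar n I (\<rho> u)) = 0"
          using that n by (intro good_block_sum_zero[OF N(2)] dhaar_sum_zero) auto
        then show ?thesis
          using N1[of N "(n', I')" "\<lambda>u. dhaar n I (\<rho> u)"] that N(1) dhaar_abs_le by (auto simp: N2_def block_haar_def[abs_def])
      qed
      ultimately have "P f n (N, \<rho>)" using N by (auto simp: P_def \<delta>_def N2_def)
      then show ?thesis by blast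
    qed
  qed
  then show ?thesis unfolding P_def by blast
qed

text \<open>Grouping the atoms of the selected copies gives a new system V: the groups have equal
  mass, and distinct copy numbers preserve independence. Entries within one copy are controlled by
  \<open>good_block\<close>, those between copies by the selection. The error is \<theta> =
  \<epsilon>/4 plus the distance, below \<epsilon>/4, from \<mu> to the hull point.\<close>

lemma orth_factor_exists:
  assumes \<epsilon>: "0 < \<epsilon>"
  shows "\<exists>lam0\<in>convex hull (diag_set hW T). orth_factor p R R T (\<lambda>y x. lam0 * y x) \<epsilon>"
proof -
  obtain \<mu> where \<mu>: "\<And>n \<delta> N1. 1 \<le> n \<Longrightarrow> 0 < \<delta> \<Longrightarrow> \<exists>N\<ge>N1. \<exists>\<rho>. good_block N n \<delta> \<mu> \<rho>"
    "\<And>e. 0 < e \<Longrightarrow> \<exists>lam\<in>convex hull (diag_set hW T). \<bar>\<mu> - lam\<bar> < e"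
    using good_block_limit by blast
  define \<theta> where "\<theta> = \<epsilon> / 4"
  have \<theta>: "0 < \<theta>" using \<epsilon> by (simp add: \<theta>_def)
  obtain lam0 where lam0: "lam0 \<in> convex hull (diag_set hW T)" "\<bar>\<mu> - lam0\<bar> < \<epsilon> / 4" using \<mu>(2)[of "\<epsilon> / 4"] \<epsilon> by auto
  obtain f where f: "\<And>n. 1 \<le> n \<Longrightarrow> 1 \<le> fst (f n) \<and> good_block (fst (f n)) n (\<theta> / 64 ^ n) \<mu> (snd (f n)) \<and>
     (\<forall>n'. 1 \<le> n' \<and> n' < n \<longrightarrow> fst (f n') < fst (f n) \<and> (\<forall>I\<in>dyadic (n - 1). \<forall>I'\<in>dyadic (n' - 1).
        \<bar>pair (block_haar n (f n) I) (T (block_haar n' (f n') I'))\<bar> \<le> \<theta> / 64 ^ n \<and> \<bar>pair (block_haar n' (f n') I') (T (block_haar n (f n) I))\<bar> \<le> \<theta> / 64 ^ n))"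
    using select_copies[OF \<theta> \<mu>(1)] by blast
  have f1: "1 \<le> fst (f n)" and fG: "good_block (fst (f n)) n (\<theta> / 64 ^ n) \<mu> (snd (f n))" if "1 \<le> n" for n
    using f[OF that] by auto
  have mono: "fst (f n') < fst (f n)" if "1 \<le> n'" "n' < n" for n n' using f[of n] that by auto
  have cross: "\<bar>pair (block_haar n (f n) I) (T (block_haar n' (f n') I'))\<bar> \<le> \<theta> / 64 ^ n" "\<bar>pair (block_haar n' (f n') I') (T (block_haar n (f n) I))\<bar> \<le> \<theta> / 64 ^ n"
    if "1 \<le> n'" "n' < n" "I \<in> dyadic (n - 1)" "I' \<in> dyadic (n' - 1)" for n n' I I'
  proof -
    have "1 \<le> n" using that by simp
    then show "\<bar>pair (block_haar n (f n) I) (T (block_haar n' (f n') I'))\<bar> \<le> \<theta> / 64 ^ n" "\<bar>pair (block_haar n' (f n') I') (T (block_haar n (f n) I))\<bar> \<le> \<theta> / 64 ^ n"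
      using f[of n] that by blast+
  qed
  define V where "V n x = snd (f n) (W (fst (f n)) x)" for n x
  have V: "copies V"
  proof
    show "V n x < 2 ^ n" if "1 \<le> n" for n x
      using fG[OF that] W_lt[OF f1[OF that], of x] by (simp add: V_def good_block_def)
    show "V n \<in> measurable M01 (count_space UNIV)" if "1 \<le> n" for n
      unfolding V_def[abs_def] by (rule measurable_compose[OF W_meas[OF f1[OF that]]]) simp
    show "measure M01 {x \<in> space M01. V n x = u} = 1 / 2 ^ n" if n: "1 \<le> n" and u: "u < 2 ^ n" for n u
    proof -
      have "measure M01 {x \<in> space M01. V n x = u} = (LINT x|M01. indicator {x \<in> space M01. V n x = u} x)"
        by (auto intro!: arg_cong[where f = "measure M01"])
      also have "\<dots> = (LINT x|M01. of_bool (snd (f n) (W (fst (f n)) x) = u))"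
        by (intro Bochner_Integration.integral_cong) (auto simp: indicator_def V_def)
      also have "\<dots> = (\<Sum>w<2 ^ fst (f n). of_bool (snd (f n) w = u)) / 2 ^ fst (f n)"
        using integral_gW[OF f1[OF n], of "\<lambda>w. of_bool (snd (f n) w = u)"] .
      also have "\<dots> = 1 / 2 ^ n" using fG[OF n] u by (simp add: good_block_def)
      finally show ?thesis .
    qed
    have inj: "inj_on (\<lambda>n. fst (f n)) {1..}"
    proof (rule linorder_inj_onI)
      show "fst (f x) \<noteq> fst (f y)" if "x < y" "x \<in> {1..}" "y \<in> {1..}" for x y using mono[of x y] that by auto
    qed auto
    have "M01.indep_vars (\<lambda>_. count_space UNIV) W ((\<lambda>n. fst (f n)) ` {1..})"
      by (rule M01.indep_vars_subset[OF W_indep]) (use f1 in auto)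
    then have "M01.indep_vars (\<lambda>_. count_space UNIV) (\<lambda>n. W (fst (f n))) {1..}"
      by (rule M01.indep_vars_reindex_inj[OF _ inj])
    then show "M01.indep_vars (\<lambda>_. count_space UNIV) V {1..}"
      unfolding V_def[abs_def] by (rule M01.indep_vars_compose2) simp
  qed
  interpret V: copies V by (rule V)
  have hV: "V.hW n I = block_haar n (f n) I" for n I by (simp add: V.hW_def[abs_def] block_haar_def[abs_def] V_def)
  have "orth_factor p R R T (\<lambda>y x. lam0 * y x) \<epsilon>"
  proof (rule orth_factor_of_copies[OF V])
    show "(\<lambda>x. k (V n x)) \<in> R" if n: "1 \<le> n" and k: "(\<Sum>u<2 ^ n. k u) = 0" for n k
      unfolding V_def using good_block_sum_zero[OF fG[OF n], of k] k f1[OF n] by (intro Rspace_gW[OF p, of _ "\<lambda>u. k (snd (f n) u)"]) auto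
    show "\<theta> + \<bar>\<mu> - lam0\<bar> < \<epsilon>" using lam0 \<epsilon> unfolding \<theta>_def by linarith
    have pw: "(64::real) ^ n = 8 ^ (n + n)" for n by (simp add: power_add flip: power_mult_distrib)
    have le: "\<theta> / 64 ^ n \<le> \<theta> / 8 ^ (n + n')" if "n' \<le> n" for n n'
      unfolding pw using \<theta> that by (intro divide_left_mono power_increasing) auto
    fix n I n' I' assume n: "1 \<le> n" "I \<in> dyadic (n - 1)" and n': "1 \<le> n'" "I' \<in> dyadic (n' - 1)"
    consider "n = n'" | "n' < n" | "n < n'" by linarith
    then show "\<bar>pair (V.hW n I) (T (V.hW n' I')) - (if n = n' \<and> I = I' then \<mu> / 2 ^ fst I else 0)\<bar> \<le> \<theta> / 8 ^ (n + n')"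
    proof cases
      case 1
      have "(\<Sum>u<2 ^ fst (f n). dhaar n I' (snd (f n) u)) = 0"
        using n n' 1 by (intro good_block_sum_zero[OF fG] dhaar_sum_zero) auto
      then have "copy_form (fst (f n)) (\<lambda>u. dhaar n I (snd (f n) u)) (\<lambda>u. dhaar n I' (snd (f n) u)) = pair (V.hW n I) (T (V.hW n' I'))"
        unfolding copy_form_def hV using 1 by (simp add: center_id block_haar_def[abs_def])
      moreover have "\<bar>copy_form (fst (f n)) (\<lambda>u. dhaar n I (snd (f n) u)) (\<lambda>u. dhaar n I' (snd (f n) u)) - (if I = I' then \<mu> / 2 ^ fst I else 0)\<bar> \<le> \<theta> / 64 ^ n"
        using fG[OF n(1)] n n' 1 unfolding good_block_def by blast
      ultimately show ?thesis using 1 by (simp add: pw)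
    next
      case 2
      then show ?thesis using cross(1)[OF n'(1) 2 n(2) n'(2)] le[of n' n] by (simp add: hV)
    next
      case 3
      then show ?thesis using cross(2)[OF n(1) 3 n'(2) n(2)] le[of n n'] by (simp add: hV add.commute)
    qed
  qed (use \<theta> in auto)
  then show ?thesis using lam0(1) by blast
qed

end

section \<open>From the given family to uniform copies\<close>

lemma nat_floor_div:
  fixes x :: real
  assumes "0 \<le> x" "m \<le> n"
  shows "nat \<lfloor>2 ^ n * x\<rfloor> div 2 ^ (n - m) = nat \<lfloor>2 ^ m * x\<rfloor>"
proof -
  have e: "(2::real) ^ n = 2 ^ m * 2 ^ (n - m)" using assms by (simp flip: power_add)
  have "\<lfloor>2 ^ n * x / real_of_int (2 ^ (n - m))\<rfloor> = \<lfloor>2 ^ n * x\<rfloor> div 2 ^ (n - m)"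
    by (rule floor_divide_real_eq_div) simp
  moreover have "2 ^ n * x / real_of_int (2 ^ (n - m)) = 2 ^ m * x" unfolding e by simp
  ultimately have "nat \<lfloor>2 ^ m * x\<rfloor> = nat (\<lfloor>2 ^ n * x\<rfloor> div 2 ^ (n - m))" by simp
  also have "\<dots> = nat \<lfloor>2 ^ n * x\<rfloor> div nat (2 ^ (n - m))" using assms by (intro nat_div_distrib) auto
  finally show ?thesis by (simp add: nat_power_eq)
qed

lemma haar_eq_dhaar:
  assumes n: "1 \<le> n" and I: "I \<in> dyadic (n - 1)" and x: "0 \<le> x"
  shows "haar I x = dhaar n I (nat \<lfloor>2 ^ n * x\<rfloor>)"
proof -
  obtain k i where Ik: "I = (k, i)" by (cases I)
  then have k: "k < n" "Suc k \<le> n" using I n by (auto simp: dyadic_def)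
  \<comment> \<open>The interval of level k + 1 that contains x; the left half of I is number 2 i on
    that level and the right half number 2 i + 1.\<close>
  define v where "v = nat \<lfloor>2 ^ Suc k * x\<rfloor>"
  have v: "real v \<le> 2 ^ Suc k * x" "2 ^ Suc k * x < real v + 1" using x by (auto simp: v_def)
  have d1: "nat \<lfloor>2 ^ n * x\<rfloor> div 2 ^ (n - k - 1) = v" using nat_floor_div[OF x k(2)] by (simp add: v_def)
  have d2: "nat \<lfloor>2 ^ n * x\<rfloor> div 2 ^ (n - k) = v div 2" using div_pow2_Suc[OF k(1), of "nat \<lfloor>2 ^ n * x\<rfloor>"] d1 by simp
  have A: "x \<in> {real i / 2 ^ k ..< (real i + 1/2) / 2 ^ k} \<longleftrightarrow> v = 2 * i"
  proof -
    have "x \<in> {real i / 2 ^ k ..< (real i + 1/2) / 2 ^ k} \<longleftrightarrow> real (2 * i) \<le> 2 ^ Suc k * x \<and> 2 ^ Suc k * x < real (2 * i) + 1"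
      by (auto simp: field_simps)
    also have "\<dots> \<longleftrightarrow> v = 2 * i" using v by (auto simp del: of_nat_mult)
    finally show ?thesis .
  qed
  have B: "x \<in> {(real i + 1/2) / 2 ^ k ..< (real i + 1) / 2 ^ k} \<longleftrightarrow> v = 2 * i + 1"
  proof -
    have "x \<in> {(real i + 1/2) / 2 ^ k ..< (real i + 1) / 2 ^ k} \<longleftrightarrow> real (2 * i + 1) \<le> 2 ^ Suc k * x \<and> 2 ^ Suc k * x < real (2 * i + 1) + 1"
      by (auto simp: field_simps)
    also have "\<dots> \<longleftrightarrow> v = 2 * i + 1" using v by (auto simp del: of_nat_mult of_nat_add of_nat_Suc)
    finally show ?thesis .
  qed
  have "haar I x = of_bool (v = 2 * i) - of_bool (v = 2 * i + 1)"
    unfolding haar_def Let_def Ik fst_conv snd_conv indicator_def A B ..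
  also have "\<dots> = dhaar n I (nat \<lfloor>2 ^ n * x\<rfloor>)"
    unfolding dhaar_def Ik fst_conv snd_conv d1 d2 by auto
  finally show ?thesis .
qed

text \<open>Reads off the binary digits of the position from the signs of the Haar functions.\<close>
definition haar_pos :: "nat \<Rightarrow> (nat \<times> nat \<Rightarrow> real) \<Rightarrow> nat" where
  "haar_pos n v = nat \<lfloor>\<Sum>I\<in>dyadic (n - 1). if v I = -1 then 2 ^ (n - 1 - fst I) else 0 :: real\<rfloor> mod 2 ^ n"

lemma sum_bits: "(\<Sum>j<n. if odd (u div 2 ^ j) then 2 ^ j else 0) = u mod (2::nat) ^ n"
proof (induction n)
  case (Suc n)
  have "u mod 2 ^ Suc n = 2 ^ n * (u div 2 ^ n mod 2) + u mod 2 ^ n"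
    using mod_mult2_eq[of u "2 ^ n" 2] by (simp add: mult.commute)
  then show ?case using Suc by (auto simp: odd_iff_mod_2_eq_one)
qed simp

text \<open>On each level exactly one interval contains u, and its Haar function is -1 there iff the
  next binary digit of u is 1. The sum therefore collects the digits of u with their place
  values.\<close>

lemma haar_pos_dhaar:
  assumes n: "1 \<le> n" and u: "u < 2 ^ n" and v: "\<And>I. I \<in> dyadic (n - 1) \<Longrightarrow> v I = dhaar n I u"
  shows "haar_pos n v = u"
proof -
  have "(\<Sum>I\<in>dyadic (n - 1). if v I = -1 then 2 ^ (n - 1 - fst I) else 0 :: real)
    = (\<Sum>I\<in>dyadic (n - 1). if dhaar n I u = -1 then 2 ^ (n - 1 - fst I) else 0)"
    by (intro sum.cong) (auto simp: v)
  also have "\<dots> = (\<Sum>k\<le>n - 1. \<Sum>i<2 ^ k. if dhaar n (k, i) u = -1 then 2 ^ (n - 1 - k) else 0)"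
    unfolding dyadic_eq_Sigma by (subst sum.Sigma) (auto simp: case_prod_beta)
  also have "\<dots> = (\<Sum>k<n. if odd (u div 2 ^ (n - Suc k)) then 2 ^ (n - Suc k) else 0)"
  proof (rule sum.cong)
    show "{..n - 1} = {..<n}" using n by auto
    fix k assume "k \<in> {..<n}"
    then have k: "k < n" by simp
    have "(\<Sum>i<2 ^ k. if dhaar n (k, i) u = -1 then 2 ^ (n - 1 - k) else 0 :: real)
      = (\<Sum>i<2 ^ k. if i = u div 2 ^ (n - k) then (if odd (u div 2 ^ (n - Suc k)) then 2 ^ (n - Suc k) else 0) else 0)"
      by (intro sum.cong) (auto simp: dhaar_def)
    then show "(\<Sum>i<2 ^ k. if dhaar n (k, i) u = -1 then 2 ^ (n - 1 - k) else 0 :: real)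
      = (if odd (u div 2 ^ (n - Suc k)) then 2 ^ (n - Suc k) else 0)"
      using div_pow2_less[OF u, of k] k by simp
  qed
  also have "\<dots> = (\<Sum>j<n. if odd (u div 2 ^ j) then 2 ^ j else 0)"
    by (rule sum.nat_diff_reindex)
  also have "\<dots> = real (\<Sum>j<n. if odd (u div 2 ^ j) then 2 ^ j else 0)"
    by (simp only: of_nat_sum) (intro sum.cong, auto)
  also have "\<dots> = real u" unfolding sum_bits using u by simp
  finally show ?thesis using u by (simp add: haar_pos_def)
qed

lemma haar_pos_measurable:
  "haar_pos n \<in> measurable (PiM (dyadic (n - 1)) (\<lambda>_. borel)) (count_space UNIV)"
proof -
  have [measurable]: "(\<lambda>v :: nat \<times> nat \<Rightarrow> real. \<Sum>I\<in>dyadic (n - 1). if v I = -1 then 2 ^ (n - 1 - fst I) else 0 :: real) \<in> borel_measurable (PiM (dyadic (n - 1)) (\<lambda>_. borel))"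
  proof (rule borel_measurable_sum)
    fix I assume I: "I \<in> dyadic (n - 1)"
    have "(\<lambda>t::real. if t = -1 then 2 ^ (n - 1 - fst I) else 0 :: real) \<in> borel_measurable borel" by measurable
    from measurable_compose[OF measurable_component_singleton[OF I, of "\<lambda>_. borel"] this]
    show "(\<lambda>v :: nat \<times> nat \<Rightarrow> real. if v I = -1 then 2 ^ (n - 1 - fst I) else 0 :: real) \<in> borel_measurable (PiM (dyadic (n - 1)) (\<lambda>_. borel))" .
  qed
  have "(\<lambda>v :: nat \<times> nat \<Rightarrow> real. \<lfloor>\<Sum>I\<in>dyadic (n - 1). if v I = -1 then 2 ^ (n - 1 - fst I) else 0 :: real\<rfloor>)
     \<in> measurable (PiM (dyadic (n - 1)) (\<lambda>_. borel)) (count_space UNIV)" by measurable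
  from measurable_compose[OF this, of "\<lambda>z. nat z mod 2 ^ n" "count_space UNIV"] show ?thesis
    by (simp add: haar_pos_def[abs_def])
qed

text \<open>The dyadic intervals are half-open while the measure lives on the closed interval. At
  the endpoint 1 all Haar functions vanish, so they determine no position there.\<close>

lemma AE_M01_less_1: "AE x in M01. 0 \<le> x \<and> x < 1"
proof -
  have "AE x in lborel. x \<noteq> (1::real)" by (rule AE_lborel_singleton)
  then have "AE x in lebesgue. x \<noteq> (1::real)" by (rule AE_completion)
  then have "AE x in lebesgue. x \<in> {0..1::real} \<longrightarrow> 0 \<le> x \<and> x < 1" by eventually_elim auto
  then show ?thesis unfolding M01_def by (subst AE_restrict_space_iff) auto
qed

lemma borel_M01: "f \<in> borel_measurable borel \<Longrightarrow> f \<in> borel_measurable M01"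
  unfolding M01_def by (intro measurable_restrict_space1 measurable_completion) simp

lemma haar_measurable: "haar I \<in> borel_measurable M01"
  unfolding haar_def[abs_def] Let_def by (intro borel_M01) measurable

definition haar_vec :: "nat \<Rightarrow> real \<Rightarrow> nat \<times> nat \<Rightarrow> real" where
  "haar_vec n x = (\<lambda>I\<in>dyadic (n - 1). haar I x)"

lemma haar_vec_measurable: "haar_vec n \<in> measurable M01 (PiM (dyadic (n - 1)) (\<lambda>_. borel))"
  unfolding haar_vec_def[abs_def] by (intro measurable_restrict haar_measurable)

lemma haar_pos_haar_vec:
  assumes "1 \<le> n" "0 \<le> x" "x < 1"
  shows "haar_pos n (haar_vec n x) = nat \<lfloor>2 ^ n * x\<rfloor>"
    and "I \<in> dyadic (n - 1) \<Longrightarrow> haar_vec n x I = dhaar n I (haar_pos n (haar_vec n x))"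
proof -
  have "nat \<lfloor>2 ^ n * x\<rfloor> < 2 ^ n"
  proof -
    have "2 ^ n * x < real (2 ^ n)" using assms by simp
    then have "\<lfloor>2 ^ n * x\<rfloor> < int (2 ^ n)" by (simp only: floor_less_iff of_int_of_nat_eq)
    then show ?thesis by (simp add: nat_less_iff)
  qed
  then show 1: "haar_pos n (haar_vec n x) = nat \<lfloor>2 ^ n * x\<rfloor>"
    using assms by (intro haar_pos_dhaar) (auto simp: haar_vec_def haar_eq_dhaar)
  show "haar_vec n x I = dhaar n I (haar_pos n (haar_vec n x))" if "I \<in> dyadic (n - 1)"
    unfolding 1 using assms that by (simp add: haar_vec_def haar_eq_dhaar)
qed

lemma prob_haar_pos:
  assumes n: "1 \<le> n" and u: "u < 2 ^ n"
  shows "measure M01 {x \<in> space M01. haar_pos n (haar_vec n x) = u} = 1 / 2 ^ n"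
proof -
  let ?J = "{real u / 2 ^ n ..< (real u + 1) / 2 ^ n}"
  have u1: "real u + 1 \<le> 2 ^ n"
  proof -
    have "real (Suc u) \<le> real (2 ^ n)" using u by (intro of_nat_mono) simp
    then show ?thesis by simp
  qed
  have sub: "?J \<subseteq> {0..1}"
  proof
    fix x assume x: "x \<in> ?J"
    have "0 \<le> real u / 2 ^ n" by simp
    moreover have "(real u + 1) / 2 ^ n \<le> 1" using u1 by simp
    moreover have "real u / 2 ^ n \<le> x" "x < (real u + 1) / 2 ^ n" using x by auto
    ultimately show "x \<in> {0..1}" unfolding atLeastAtMost_iff by linarith
  qed
  have Jm: "?J \<in> sets M01" unfolding M01_def sets_restrict_space using sub by (intro image_eqI[of _ _ ?J]) auto
  have Am: "{x \<in> space M01. haar_pos n (haar_vec n x) = u} \<in> sets M01"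
    using measurable_sets[OF measurable_compose[OF haar_vec_measurable haar_pos_measurable], of "{u}" n]
    by (simp add: vimage_def Int_def conj_commute)
  have "measure M01 {x \<in> space M01. haar_pos n (haar_vec n x) = u} = measure M01 ?J"
  proof (rule M01.finite_measure_eq_AE[OF _ Am Jm])
    show "AE x in M01. x \<in> {x \<in> space M01. haar_pos n (haar_vec n x) = u} \<longleftrightarrow> x \<in> ?J"
      using AE_M01_less_1 AE_space
    proof eventually_elim
      case (elim x)
      then have "x \<in> {x \<in> space M01. haar_pos n (haar_vec n x) = u} \<longleftrightarrow> nat \<lfloor>2 ^ n * x\<rfloor> = u"
        using haar_pos_haar_vec(1)[OF n] by auto
      also have "\<dots> \<longleftrightarrow> \<lfloor>2 ^ n * x\<rfloor> = int u" using elim by (auto simp: nat_eq_iff)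
      also have "\<dots> \<longleftrightarrow> x \<in> ?J" by (auto simp: floor_eq_iff field_simps)
      finally show ?case .
    qed
  qed
  also have "measure M01 ?J = measure lebesgue ?J" unfolding M01_def using sub by (intro measure_restrict_space) auto
  also have "\<dots> = measure lborel ?J" by (rule measure_completion) simp
  also have "\<dots> = 1 / 2 ^ n" by (simp add: measure_def divide_right_mono flip: diff_divide_distrib)
  finally show ?thesis .
qed

text \<open>That every coordinate I is the Haar function of the decoded position is a measurable
  property of the vector of values. It holds almost surely for the true Haar functions, and equality
  of joint laws carries it over to h. Uniformity of the position is carried over in the same way,
  while independence comes from that of the vectors.\<close>

lemma admissible_copies:
  assumes h: "admissible_family h"
  defines "U \<equiv> (\<lambda>n x. haar_pos n (\<lambda>I\<in>dyadic (n - 1). h n I x))"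
  shows "copies U"
    and "\<And>n I. (n, I) \<in> Domega \<Longrightarrow> h n I \<in> borel_measurable M01"
    and "\<And>n I. (n, I) \<in> Domega \<Longrightarrow> eqae (h n I) (copies.hW U n I)"
proof -
  define hv where "hv n x = (\<lambda>I\<in>dyadic (n - 1). h n I x)" for n x
  have U: "U n x = haar_pos n (hv n x)" for n x by (simp add: U_def hv_def)
  have ind: "M01.indep_vars (\<lambda>n. PiM (dyadic (n - 1)) (\<lambda>_. borel)) hv {1..}"
    using h unfolding admissible_family_def hv_def[abs_def] by blast
  have dist: "distr M01 (PiM (dyadic (n - 1)) (\<lambda>_. borel)) (hv n) = distr M01 (PiM (dyadic (n - 1)) (\<lambda>_. borel)) (haar_vec n)"
    if "1 \<le> n" for n
    using h that unfolding admissible_family_def hv_def[abs_def] haar_vec_def[abs_def] by blast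
  have hvm: "hv n \<in> measurable M01 (PiM (dyadic (n - 1)) (\<lambda>_. borel))" if "1 \<le> n" for n
    using ind that by (auto simp: M01.indep_vars_def)
  show cop: "copies U"
  proof
    \<comment> \<open>The reduction mod 2^n in \<open>haar_pos\<close> ensures this everywhere, also
      where h takes values that no Haar vector has.\<close>
    show "U n x < 2 ^ n" if "1 \<le> n" for n x by (simp add: U haar_pos_def)
    show Um: "U n \<in> measurable M01 (count_space UNIV)" if "1 \<le> n" for n
      unfolding U[abs_def] by (rule measurable_compose[OF hvm[OF that] haar_pos_measurable])
    show "M01.indep_vars (\<lambda>_. count_space UNIV) U {1..}"
      unfolding U[abs_def] by (rule M01.indep_vars_compose2[OF ind haar_pos_measurable])
    fix n u :: nat assume n: "1 \<le> n" and u: "u < 2 ^ n"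
    let ?P = "PiM (dyadic (n - 1)) (\<lambda>_. borel :: real measure)"
    let ?A = "{v \<in> space ?P. haar_pos n v = u}"
    have Am: "?A \<in> sets ?P"
      using measurable_sets[OF haar_pos_measurable, of "{u}" n] by (simp add: vimage_def Int_def conj_commute)
    have tr: "measure (distr M01 ?P g) ?A = measure M01 {x \<in> space M01. haar_pos n (g x) = u}" if "g \<in> measurable M01 ?P" for g
      using that Am measurable_space[OF that] by (subst measure_distr) (auto intro!: arg_cong[where f = "measure M01"])
    show "measure M01 {x \<in> space M01. U n x = u} = 1 / 2 ^ n"
      using tr[OF hvm[OF n]] tr[OF haar_vec_measurable] dist[OF n] prob_haar_pos[OF n u] by (simp add: U)
  qed
  interpret U: copies U by (rule cop)
  fix n I assume "(n, I) \<in> Domega"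
  then have n: "1 \<le> n" and I: "I \<in> dyadic (n - 1)" by (auto simp: Domega_def)
  let ?P = "PiM (dyadic (n - 1)) (\<lambda>_. borel :: real measure)"
  have comp: "(\<lambda>v. v I) \<in> borel_measurable ?P" using measurable_component_singleton[OF I, of "\<lambda>_. borel"] .
  show "h n I \<in> borel_measurable M01"
    using measurable_compose[OF hvm[OF n] comp] I by (simp add: hv_def)
  have [measurable]: "(\<lambda>v. dhaar n I (haar_pos n v)) \<in> borel_measurable ?P"
    by (rule measurable_compose[OF haar_pos_measurable]) simp
  note [measurable] = comp
  have Q: "{v \<in> space ?P. v I = dhaar n I (haar_pos n v)} \<in> sets ?P" by measurable
  have "AE x in M01. haar_vec n x I = dhaar n I (haar_pos n (haar_vec n x))"
    using AE_M01_less_1 by eventually_elim (auto intro: haar_pos_haar_vec(2)[OF n _ _ I])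
  then have "AE v in distr M01 ?P (haar_vec n). v I = dhaar n I (haar_pos n v)"
    by (subst AE_distr_iff[OF haar_vec_measurable Q])
  then have "AE v in distr M01 ?P (hv n). v I = dhaar n I (haar_pos n v)" unfolding dist[OF n] .
  then have "AE x in M01. hv n x I = dhaar n I (haar_pos n (hv n x))"
    by (subst (asm) AE_distr_iff[OF hvm[OF n] Q])
  then show "eqae (h n I) (U.hW n I)"
    using I by (simp add: eqae_def U.hW_def U hv_def)
qed

lemma Rspace_mono_eqae:
  assumes m: "\<And>n I. (n, I) \<in> Domega \<Longrightarrow> h n I \<in> borel_measurable M01" "\<And>n I. (n, I) \<in> Domega \<Longrightarrow> h' n I \<in> borel_measurable M01"
    and eq: "\<And>n I. (n, I) \<in> Domega \<Longrightarrow> eqae (h n I) (h' n I)"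
  shows "Rspace p h \<subseteq> Rspace p h'"
proof
  fix f assume f: "f \<in> Rspace p h"
  then have fL: "f \<in> Lp p" by (simp add: Rspace_def lp_closure_def)
  have "\<exists>g\<in>{(\<lambda>x. \<Sum>\<iota>\<in>F. c \<iota> * h' (fst \<iota>) (snd \<iota>) x) | F c. finite F \<and> F \<subseteq> Domega}. lpnorm p (\<lambda>x. f x - g x) < e"
    if "0 < e" for e
  proof -
    obtain F c where F: "finite F" "F \<subseteq> Domega" and l: "lpnorm p (\<lambda>x. f x - (\<Sum>\<iota>\<in>F. c \<iota> * h (fst \<iota>) (snd \<iota>) x)) < e"
      using f \<open>0 < e\<close> unfolding Rspace_def lp_closure_def by blast
    have D: "(fst \<iota>, snd \<iota>) \<in> Domega" if "\<iota> \<in> F" for \<iota> using F that by auto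
    have "AE x in M01. \<forall>\<iota>\<in>F. h (fst \<iota>) (snd \<iota>) x = h' (fst \<iota>) (snd \<iota>) x"
      using F(1) eq[OF D] by (intro AE_finite_allI) (auto simp: eqae_def)
    then have "eqae (\<lambda>x. f x - (\<Sum>\<iota>\<in>F. c \<iota> * h (fst \<iota>) (snd \<iota>) x)) (\<lambda>x. f x - (\<Sum>\<iota>\<in>F. c \<iota> * h' (fst \<iota>) (snd \<iota>) x))"
      unfolding eqae_def by eventually_elim simp
    then have "lpnorm p (\<lambda>x. f x - (\<Sum>\<iota>\<in>F. c \<iota> * h (fst \<iota>) (snd \<iota>) x)) = lpnorm p (\<lambda>x. f x - (\<Sum>\<iota>\<in>F. c \<iota> * h' (fst \<iota>) (snd \<iota>) x))"
      using m D fL by (intro lpnorm_eqae borel_measurable_diff borel_measurable_sum borel_measurable_times) auto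
    then have "lpnorm p (\<lambda>x. f x - (\<Sum>\<iota>\<in>F. c \<iota> * h' (fst \<iota>) (snd \<iota>) x)) < e" using l by simp
    then show ?thesis
      using F by (intro bexI[of _ "\<lambda>x. \<Sum>\<iota>\<in>F. c \<iota> * h' (fst \<iota>) (snd \<iota>) x"]) blast+
  qed
  then show "f \<in> Rspace p h'" using fL unfolding Rspace_def lp_closure_def by blast
qed

lemma lp_closure_eqae:
  assumes "f \<in> lp_closure p A" "A \<subseteq> borel_measurable M01" "eqae f g" "g \<in> borel_measurable M01"
  shows "g \<in> lp_closure p A"
proof -
  have fL: "f \<in> Lp p" using assms(1) by (simp add: lp_closure_def)
  have gL: "g \<in> Lp p" by (rule Lp_eqae[OF assms(3) fL assms(4)])
  have "lpnorm p (\<lambda>x. f x - k x) = lpnorm p (\<lambda>x. g x - k x)" if "k \<in> A" for k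
  proof (rule lpnorm_eqae)
    show "eqae (\<lambda>x. f x - k x) (\<lambda>x. g x - k x)" using assms(3) by (auto simp: eqae_def)
  qed (use fL assms that in \<open>auto intro!: borel_measurable_diff\<close>)
  then show ?thesis using assms(1) gL unfolding lp_closure_def by force
qed

theorem mainTheorem13:
  fixes p :: real and \<epsilon> :: real
    and h :: "nat \<Rightarrow> nat \<times> nat \<Rightarrow> real \<Rightarrow> real"
    and T :: "(real \<Rightarrow> real) \<Rightarrow> (real \<Rightarrow> real)"
  assumes "1 < p"
    and "admissible_family h"
    and "bounded_op_on p (Rspace p h) T"
    and "\<epsilon> > 0"
  shows "\<exists>lam0 \<in> convex hull (diag_set h T).
           orth_factor p (Rspace p h) (Rspace p h) T (\<lambda>y x. lam0 * y x) \<epsilon>"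
proof -
  define U where "U = (\<lambda>n x. haar_pos n (\<lambda>I\<in>dyadic (n - 1). h n I x))"
  interpret U: copies U unfolding U_def by (rule admissible_copies(1)[OF assms(2)])
  have hm: "h n I \<in> borel_measurable M01" and heq: "eqae (h n I) (U.hW n I)" if "(n, I) \<in> Domega" for n I
    using admissible_copies(2,3)[OF assms(2) that] by (auto simp: U_def)
  have Um: "U.hW n I \<in> borel_measurable M01" if "(n, I) \<in> Domega" for n I
    using that by (intro U.hW_meas) (auto simp: Domega_def)
  \<comment> \<open>\<open>lp_closure\<close> contains with a function every measurable function
    equal to it almost everywhere, so the two spaces coincide as sets of functions.\<close>
  have Req: "Rspace p h = Rspace p U.hW"
    by (intro subset_antisym Rspace_mono_eqae hm Um heq eqae_sym)
  have T: "bounded_op_on p (Rspace p U.hW) T" using assms(3) unfolding Req .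
  then obtain C where C: "\<And>f. f \<in> Rspace p U.hW \<Longrightarrow> lpnorm p (T f) \<le> C * lpnorm p f"
    unfolding bounded_op_on_def by blast
  have TK: "lpnorm p (T f) \<le> max C 0 * lpnorm p f" if "f \<in> Rspace p U.hW" for f
    using C[OF that] by (rule order_trans) (intro mult_right_mono, auto)
  interpret U: operator_on_copies U p "p / (p - 1)" "max C 0" T
    using T assms(1) TK by unfold_locales (auto simp: bounded_op_on_def)
  \<comment> \<open>T acts on functions, and h differs from the Haar functions of U on null sets.
    The difference has norm 0, so linearity and boundedness make the images under T equal almost
    everywhere, and the diagonal entries agree.\<close>
  have diag: "pair (h n I) (T (h n I)) = pair (U.hW n I) (T (U.hW n I))" if D: "(n, I) \<in> Domega" for n I
  proof -
    have nI: "1 \<le> n" "I \<in> dyadic (n - 1)" using D by (auto simp: Domega_def)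
    have "(\<lambda>x. dhaar n I (U n x)) \<in> U.R"
      using nI by (intro U.Rspace_gW[OF assms(1)] dhaar_sum_zero) auto
    moreover have "U.hW n I = (\<lambda>x. dhaar n I (U n x))" by (simp add: fun_eq_iff U.hW_def)
    ultimately have R1: "U.hW n I \<in> U.R" by (simp only:)
    have R2: "h n I \<in> U.R"
      unfolding Rspace_def
    proof (rule lp_closure_eqae[OF _ _ eqae_sym[OF heq[OF D]] hm[OF D]])
      show "U.hW n I \<in> lp_closure p {(\<lambda>x. \<Sum>\<iota>\<in>F. c \<iota> * U.hW (fst \<iota>) (snd \<iota>) x) | F c. finite F \<and> F \<subseteq> Domega}"
        using R1 unfolding Rspace_def .
      show "{(\<lambda>x. \<Sum>\<iota>\<in>F. c \<iota> * U.hW (fst \<iota>) (snd \<iota>) x) | F c. finite F \<and> F \<subseteq> Domega} \<subseteq> borel_measurable M01"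
        using Um by (auto intro!: borel_measurable_sum borel_measurable_times)
    qed
    have R3: "(\<lambda>x. h n I x - U.hW n I x) \<in> U.R" using U.Rspace_lincomb[OF assms(1) R2 R1, of 1 "-1"] by simp
    have p0: "0 < p" using assms(1) by simp
    have "lpnorm p (T (\<lambda>x. h n I x - U.hW n I x)) \<le> max C 0 * lpnorm p (\<lambda>x. h n I x - U.hW n I x)"
      by (rule TK[OF R3])
    also have "lpnorm p (\<lambda>x. h n I x - U.hW n I x) = 0"
      using eqae_iff_lpnorm_diff[OF p0 U.R_Lp[OF R2] U.R_Lp[OF R1]] heq[OF D] by simp
    finally have "lpnorm p (T (\<lambda>x. h n I x - U.hW n I x)) = 0"
      using lpnorm_nonneg[of p "T (\<lambda>x. h n I x - U.hW n I x)"] by simp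
    then have T0: "eqae (T (\<lambda>x. h n I x - U.hW n I x)) (\<lambda>x. 0)" using lpnorm_eq_0_iff[OF p0 U.T_Lp[OF R3]] by simp
    have "eqae (T (\<lambda>x. 1 * h n I x + (-1) * U.hW n I x)) (\<lambda>x. 1 * T (h n I) x + (-1) * T (U.hW n I) x)"
      using U.T_lin R1 R2 unfolding lin_on_def by blast
    then have "eqae (T (\<lambda>x. h n I x - U.hW n I x)) (\<lambda>x. T (h n I) x - T (U.hW n I) x)" by simp
    with T0 have Teq: "eqae (T (h n I)) (T (U.hW n I))" unfolding eqae_def by eventually_elim simp
    have m: "T (h n I) \<in> borel_measurable M01" "T (U.hW n I) \<in> borel_measurable M01"
      using U.T_Lp[OF R1] U.T_Lp[OF R2] by auto
    show ?thesis
      using pair_eqae(2)[OF heq[OF D] hm[OF D] Um[OF D] m(1)] pair_eqae(1)[OF Teq m Um[OF D]] by simp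
  qed
  have "diag_set h T = diag_set U.hW T"
    unfolding diag_set_def using diag by (intro Collect_cong) (metis (no_types, lifting))
  then show ?thesis using U.orth_factor_exists[OF assms(4)] unfolding Req by simp
qed

end
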